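(* Let $G$ be a reductive algebraic group over an algebraically closed field $\mathbb{K}$ of characteristic $p>0$. For each $r,s\in\mathbb{N}$, the map $\Xi_s:\mathrm{Dist}(G)\to\mathrm{Dist}(G)$ induces a Hopf algebra homomorphism $\Upsilon_{r,s}:U^{[r]}(G)\rightarrow U^{[r-s]}(G)$.
   Context: $\mathbb{N}=\{0,1,2,\dots\}$. With $I_1=\{f\in\mathbb{K}[G]: f(1)=0\}$, $\mathrm{Dist}_k(G)$ is the space of linear maps $\mu:\mathbb{K}[G]\to\mathbb{K}$ with $\mu(I_1^{k+1})=0$, $\mathrm{Dist}_k^{+}(G)=\{\mu\in\mathrm{Dist}_k(G):\mu(1)=0\}$ (so $\mathrm{Dist}_0^+(G)=0$), and $\mathrm{Dist}(G)=\bigcup_{k\ge 0}\mathrm{Dist}_k(G)$ is a cocommutative Hopf algebra with product $\mu\rho=(\mu\otimes\rho)\circ\Delta$; each $\mathrm{Dist}_k(G)$ is a subcoalgebra stable under the antipode. $U^{[r]}(G)=T(\mathrm{Dist}^+_{p^{r+1}-1}(G))/Q$, where $T$ is the tensor algebra and $Q$ is the two-sided ideal generated by the relations (i) $x\otimes y=xy$ for $x\in\mathrm{Dist}^+_i(G)$, $y\in\mathrm{Dist}^+_j(G)$ with $i+j<p^{r+1}$; (ii) $x\otimes y-y\otimes x=[x,y]$ for $x\in\mathrm{Dist}^+_i(G)$, $y\in\mathrm{Dist}^+_j(G)$ with $i+j\le p^{r+1}$ (right-hand sides computed in $\mathrm{Dist}(G)$). It is a Hopf algebra whose comultiplication, counit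 and antipode are those induced from the coalgebra $\mathrm{Dist}_{p^{r+1}-1}(G)=\mathbb{K}\oplus\mathrm{Dist}^+_{p^{r+1}-1}(G)$ and the antipode of $\mathrm{Dist}(G)$. For a negative index $m$ (which occurs as $m=r-s$ when $s>r$), the same definition is read with $\mathrm{Dist}^+_{p^{m+1}-1}(G)=0$, so that $U^{[m]}(G)=\mathbb{K}$. Geometric Frobenius: a reductive group is defined over $\mathbb{F}_p$; fix such a form, so $\mathbb{K}[G]=\mathbb{F}_p[G]\otimes_{\mathbb{F}_p}\mathbb{K}$. $F_g^s:G\to G$ is the endomorphism corresponding to the $\mathbb{K}$-Hopf algebra endomorphism of $\mathbb{K}[G]$ given by $f\otimes a\mapsto f^{p^s}\otimes a$ ($f\in\mathbb{F}_p[G]$, $a\in\mathbb{K}$). $\Xi_s:\mathrm{Dist}(G)\to\mathrm{Dist}(G)$ is the resulting Hopf algebra homomorphism, $\Xi_s(\delta)(f\otimes a)=\delta(f^{p^s}\otimes a)$. "Induces" means: $\Xi_s$ maps $\mathrm{Dist}^+_{p^{r+1}-1}(G)$ into $\mathrm{Dist}^+_{p^{r-s+1}-1}(G)$, and $\Upsilon_{r,s}$ is the algebra homomorphism sending the class of $\delta$ to the class of $\Xi_s(\delta)$ for all $\delta\in\mathrm{Dist}^+_{p^{r+1}-1}(G)$. *)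

theory Defs
  imports
    "HOL-Algebra.Module"
    "HOL-Algebra.QuotRing"
    "HOL-Algebra.Ideal_Product"
    "HOL-Algebra.Generated_Rings"
    "HOL-Library.Poly_Mapping"
    "HOL-Computational_Algebra.Polynomial"
    "HOL-Analysis.Abstract_Topology"
begin

section \<open>Algebras over a field, tensor products and tensor algebras\<close>

definition base_field :: "('k::field, 'k) module" where
  "base_field = \<lparr>carrier = UNIV, monoid.mult = (*), one = 1, ring.zero = 0, ring.add = (+), module.smult = (*)\<rparr>"

definition k_algebra :: "('k::field, 'a, 'm) module_scheme \<Rightarrow> bool" where
  "k_algebra A \<longleftrightarrow> ring A \<and> module base_field A \<and>
     (\<forall>c. \<forall>a\<in>carrier A. \<forall>b\<in>carrier A.
        (c \<odot>\<^bsub>A\<^esub> a) \<otimes>\<^bsub>A\<^esub> b = c \<odot>\<^bsub>A\<^esub> (a \<otimes>\<^bsub>A\<^esub> b) \<and>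
        a \<otimes>\<^bsub>A\<^esub> (c \<odot>\<^bsub>A\<^esub> b) = c \<odot>\<^bsub>A\<^esub> (a \<otimes>\<^bsub>A\<^esub> b))"

definition linear_maps ::
  "('k::field, 'a, 'm) module_scheme \<Rightarrow> ('k, 'b, 'n) module_scheme \<Rightarrow> ('a \<Rightarrow> 'b) set" where
  "linear_maps M N = {f \<in> carrier M \<rightarrow> carrier N.
     (\<forall>x\<in>carrier M. \<forall>y\<in>carrier M. f (x \<oplus>\<^bsub>M\<^esub> y) = f x \<oplus>\<^bsub>N\<^esub> f y) \<and>
     (\<forall>c. \<forall>x\<in>carrier M. f (c \<odot>\<^bsub>M\<^esub> x) = c \<odot>\<^bsub>N\<^esub> f x)}"

definition algebra_homs ::
  "('k::field, 'a, 'm) module_scheme \<Rightarrow> ('k, 'b, 'n) module_scheme \<Rightarrow> ('a \<Rightarrow> 'b) set" where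
  "algebra_homs A B = ring_hom A B \<inter> linear_maps A B"

definition opposite_algebra :: "('k, 'a, 'm) module_scheme \<Rightarrow> ('k, 'a, 'm) module_scheme" where
  "opposite_algebra A = A\<lparr>monoid.mult := (\<lambda>a b. b \<otimes>\<^bsub>A\<^esub> a)\<rparr>"

definition quotient_algebra ::
  "('k, 'a, 'm) module_scheme \<Rightarrow> 'a set \<Rightarrow> ('k, 'a set) module" where
  "quotient_algebra A I =
     ring.extend (A Quot I) (module.fields (\<lambda>c X. \<Union>x\<in>X. I +>\<^bsub>A\<^esub> (c \<odot>\<^bsub>A\<^esub> x)))"

text \<open>The value of a map on a coset, for maps that are constant on cosets.\<close>

definition quotient_lift :: "('a \<Rightarrow> 'b) \<Rightarrow> 'a set \<Rightarrow> 'b" where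
  "quotient_lift f X = the_elem (f ` X)"

text \<open>The free module on the carrier of \<open>P\<close> with coefficients in \<open>R\<close>, with the product extending
  the one of \<open>P\<close> bilinearly.  The scalars \<open>R\<close> are a subring of the field \<open>'k\<close>.\<close>

definition monoid_algebra ::
  "('k::field, 'r) ring_scheme \<Rightarrow> ('a, 'm) monoid_scheme \<Rightarrow> ('k, 'a \<Rightarrow>\<^sub>0 'k) module" where
  "monoid_algebra R P =
     \<lparr>carrier = {t. Poly_Mapping.keys t \<subseteq> carrier P \<and> range (Poly_Mapping.lookup t) \<subseteq> carrier R},
      monoid.mult = (\<lambda>s t. \<Sum>u\<in>Poly_Mapping.keys s. \<Sum>v\<in>Poly_Mapping.keys t.
                Poly_Mapping.single (u \<otimes>\<^bsub>P\<^esub> v) (Poly_Mapping.lookup s u * Poly_Mapping.lookup t v)),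
      one = Poly_Mapping.single \<one>\<^bsub>P\<^esub> 1,
      ring.zero = 0,
      ring.add = (+),
      module.smult = (\<lambda>c. Poly_Mapping.map ((*) c))\<rparr>"

definition linear_extension ::
  "('k::field, 'b, 'm) module_scheme \<Rightarrow> ('a \<Rightarrow> 'b) \<Rightarrow> ('a \<Rightarrow>\<^sub>0 'k) \<Rightarrow> 'b" where
  "linear_extension N \<phi> t =
     (\<Oplus>\<^bsub>N\<^esub>w\<in>Poly_Mapping.keys t. Poly_Mapping.lookup t w \<odot>\<^bsub>N\<^esub> \<phi> w)"

text \<open>The tensor product over \<open>R\<close> is the free module on pairs modulo the bilinear relations.  The
  multiplication of the record is \<open>(a \<otimes> b)(c \<otimes> d) = ac \<otimes> bd\<close>; it is meaningful only if \<open>M\<close> and \<open>N\<close>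
  are algebras.\<close>

definition bilinear_relators ::
  "('k::field, 'r) ring_scheme \<Rightarrow> ('k, 'a, 'm) module_scheme \<Rightarrow> ('k, 'b, 'n) module_scheme
     \<Rightarrow> ('a \<times> 'b \<Rightarrow>\<^sub>0 'k) set" where
  "bilinear_relators R M N =
     {Poly_Mapping.single (x \<oplus>\<^bsub>M\<^esub> x', y) 1 - Poly_Mapping.single (x, y) 1
        - Poly_Mapping.single (x', y) 1 | x x' y.
        x \<in> carrier M \<and> x' \<in> carrier M \<and> y \<in> carrier N} \<union>
     {Poly_Mapping.single (x, y \<oplus>\<^bsub>N\<^esub> y') 1 - Poly_Mapping.single (x, y) 1
        - Poly_Mapping.single (x, y') 1 | x y y'.
        x \<in> carrier M \<and> y \<in> carrier N \<and> y' \<in> carrier N} \<union>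
     {Poly_Mapping.single (c \<odot>\<^bsub>M\<^esub> x, y) 1 - Poly_Mapping.single (x, y) c | c x y.
        c \<in> carrier R \<and> x \<in> carrier M \<and> y \<in> carrier N} \<union>
     {Poly_Mapping.single (x, c \<odot>\<^bsub>N\<^esub> y) 1 - Poly_Mapping.single (x, y) c | c x y.
        c \<in> carrier R \<and> x \<in> carrier M \<and> y \<in> carrier N}"

definition bilinear_submodule ::
  "('k::field, 'r) ring_scheme \<Rightarrow> ('k, 'a, 'm) module_scheme \<Rightarrow> ('k, 'b, 'n) module_scheme
     \<Rightarrow> ('a \<times> 'b \<Rightarrow>\<^sub>0 'k) set" where
  "bilinear_submodule R M N =
     \<Inter>{H. submodule H R (monoid_algebra R (M \<times>\<times> N)) \<and> bilinear_relators R M N \<subseteq> H}"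

definition tensor_product ::
  "('k::field, 'r) ring_scheme \<Rightarrow> ('k, 'a, 'm) module_scheme \<Rightarrow> ('k, 'b, 'n) module_scheme
     \<Rightarrow> ('k, ('a \<times> 'b \<Rightarrow>\<^sub>0 'k) set) module" where
  "tensor_product R M N =
     quotient_algebra (monoid_algebra R (M \<times>\<times> N)) (bilinear_submodule R M N)"

definition pure_tensor ::
  "('k::field, 'r) ring_scheme \<Rightarrow> ('k, 'a, 'm) module_scheme \<Rightarrow> ('k, 'b, 'n) module_scheme
     \<Rightarrow> 'a \<Rightarrow> 'b \<Rightarrow> ('a \<times> 'b \<Rightarrow>\<^sub>0 'k) set" where
  "pure_tensor R M N x y =
     bilinear_submodule R M N +>\<^bsub>monoid_algebra R (M \<times>\<times> N)\<^esub> Poly_Mapping.single (x, y) 1"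

text \<open>The linear map \<open>M \<otimes> N \<rightarrow> L\<close> induced by a bilinear map \<open>b\<close>.\<close>

definition tensor_lift ::
  "('k::field, 'c, 'l) module_scheme \<Rightarrow> ('a \<Rightarrow> 'b \<Rightarrow> 'c) \<Rightarrow> ('a \<times> 'b \<Rightarrow>\<^sub>0 'k) set \<Rightarrow> 'c" where
  "tensor_lift L b = quotient_lift (linear_extension L (\<lambda>(x, y). b x y))"

text \<open>\<open>f \<otimes> g\<close> as a map into \<open>M' \<otimes> N'\<close>.\<close>

definition tensor_map ::
  "('k::field, 'c, 'm) module_scheme \<Rightarrow> ('k, 'd, 'n) module_scheme \<Rightarrow> ('a \<Rightarrow> 'c) \<Rightarrow> ('b \<Rightarrow> 'd)
     \<Rightarrow> ('a \<times> 'b \<Rightarrow>\<^sub>0 'k) set \<Rightarrow> ('c \<times> 'd \<Rightarrow>\<^sub>0 'k) set" where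
  "tensor_map M' N' f g =
     tensor_lift (tensor_product base_field M' N')
       (\<lambda>x y. pure_tensor base_field M' N' (f x) (g y))"

text \<open>The associativity isomorphism \<open>(M \<otimes> N) \<otimes> L \<rightarrow> M \<otimes> (N \<otimes> L)\<close>.\<close>

definition tensor_assoc ::
  "('k::field, 'a, 'm) module_scheme \<Rightarrow> ('k, 'b, 'n) module_scheme \<Rightarrow> ('k, 'c, 'l) module_scheme
     \<Rightarrow> (('a \<times> 'b \<Rightarrow>\<^sub>0 'k) set \<times> 'c \<Rightarrow>\<^sub>0 'k) set \<Rightarrow> ('a \<times> ('b \<times> 'c \<Rightarrow>\<^sub>0 'k) set \<Rightarrow>\<^sub>0 'k) set" where
  "tensor_assoc M N L =
     (let NL = tensor_product base_field N L; T = tensor_product base_field M NL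
      in tensor_lift T (\<lambda>z l. tensor_lift T
           (\<lambda>x y. pure_tensor base_field M NL x (pure_tensor base_field N L y l)) z))"

text \<open>For spaces of functions \<open>M \<subseteq> X \<rightarrow> 'k\<close> and \<open>N \<subseteq> Y \<rightarrow> 'k\<close>, the function on \<open>X \<times> Y\<close> given by an
  element of \<open>M \<otimes> N\<close>.\<close>

definition tensor_value ::
  "(('x \<Rightarrow> 'k::field) \<times> ('y \<Rightarrow> 'k) \<Rightarrow>\<^sub>0 'k) set \<Rightarrow> 'x \<Rightarrow> 'y \<Rightarrow> 'k" where
  "tensor_value Z x y = tensor_lift base_field (\<lambda>a b. a x * b y) Z"

text \<open>The tensor algebra is the free algebra on (words in) the elements of \<open>V\<close> modulo linearity;
  its part of degree \<open>n\<close> is the free module on \<open>n\<close>-tuples modulo the multilinear relations.\<close>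

definition word_monoid :: "'a set \<Rightarrow> 'a list monoid" where
  "word_monoid X = \<lparr>carrier = lists X, monoid.mult = (@), one = []\<rparr>"

definition linearity_relators ::
  "('k::field, 'a, 'm) module_scheme \<Rightarrow> ('a list \<Rightarrow>\<^sub>0 'k) set" where
  "linearity_relators V =
     {Poly_Mapping.single [x \<oplus>\<^bsub>V\<^esub> y] 1 - Poly_Mapping.single [x] 1 - Poly_Mapping.single [y] 1
        | x y. x \<in> carrier V \<and> y \<in> carrier V} \<union>
     {Poly_Mapping.single [c \<odot>\<^bsub>V\<^esub> x] 1 - Poly_Mapping.single [x] c | c x. x \<in> carrier V}"

definition free_algebra ::
  "('k::field, 'a, 'm) module_scheme \<Rightarrow> ('k, 'a list \<Rightarrow>\<^sub>0 'k) module" where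
  "free_algebra V = monoid_algebra base_field (word_monoid (carrier V))"

definition linearity_ideal ::
  "('k::field, 'a, 'm) module_scheme \<Rightarrow> ('a list \<Rightarrow>\<^sub>0 'k) set" where
  "linearity_ideal V = genideal (free_algebra V) (linearity_relators V)"

definition tensor_algebra ::
  "('k::field, 'a, 'm) module_scheme \<Rightarrow> ('k, ('a list \<Rightarrow>\<^sub>0 'k) set) module" where
  "tensor_algebra V = quotient_algebra (free_algebra V) (linearity_ideal V)"

definition tensor_algebra_incl ::
  "('k::field, 'a, 'm) module_scheme \<Rightarrow> 'a \<Rightarrow> ('a list \<Rightarrow>\<^sub>0 'k) set" where
  "tensor_algebra_incl V x = linearity_ideal V +>\<^bsub>free_algebra V\<^esub> Poly_Mapping.single [x] 1"

text \<open>The algebra homomorphism from the tensor algebra to \<open>B\<close> extending the linear map \<open>\<phi>\<close>.\<close>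

definition tensor_algebra_lift ::
  "('k::field, 'b, 'm) module_scheme \<Rightarrow> ('a \<Rightarrow> 'b) \<Rightarrow> ('a list \<Rightarrow>\<^sub>0 'k) set \<Rightarrow> 'b" where
  "tensor_algebra_lift B \<phi> =
     quotient_lift (linear_extension B (\<lambda>w. foldr (\<lambda>x b. \<phi> x \<otimes>\<^bsub>B\<^esub> b) w \<one>\<^bsub>B\<^esub>))"


section \<open>Hopf algebras\<close>

record (overloaded) ('k, 'a) hopf = "('k::zero, 'a) module" +
  comult :: "'a \<Rightarrow> ('a \<times> 'a \<Rightarrow>\<^sub>0 'k) set"
  counit :: "'a \<Rightarrow> 'k"
  antipode :: "'a \<Rightarrow> 'a"

definition hopf_algebra :: "('k::field, 'a, 'm) hopf_scheme \<Rightarrow> bool" where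
  "hopf_algebra H \<longleftrightarrow>
     k_algebra H \<and>
     comult H \<in> algebra_homs H (tensor_product base_field H H) \<and>
     counit H \<in> algebra_homs H base_field \<and>
     antipode H \<in> linear_maps H H \<and>
     (\<forall>h\<in>carrier H.
        tensor_assoc H H H
            (tensor_map (tensor_product base_field H H) H (comult H) id (comult H h))
          = tensor_map H (tensor_product base_field H H) id (comult H) (comult H h) \<and>
        tensor_lift H (\<lambda>a b. counit H a \<odot>\<^bsub>H\<^esub> b) (comult H h) = h \<and>
        tensor_lift H (\<lambda>a b. counit H b \<odot>\<^bsub>H\<^esub> a) (comult H h) = h \<and>
        tensor_lift H (\<lambda>a b. antipode H a \<otimes>\<^bsub>H\<^esub> b) (comult H h) = counit H h \<odot>\<^bsub>H\<^esub> \<one>\<^bsub>H\<^esub> \<and>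
        tensor_lift H (\<lambda>a b. a \<otimes>\<^bsub>H\<^esub> antipode H b) (comult H h) = counit H h \<odot>\<^bsub>H\<^esub> \<one>\<^bsub>H\<^esub>)"

definition hopf_algebra_hom ::
  "('k::field, 'a, 'm) hopf_scheme \<Rightarrow> ('k, 'b, 'n) hopf_scheme \<Rightarrow> ('a \<Rightarrow> 'b) \<Rightarrow> bool" where
  "hopf_algebra_hom H H' f \<longleftrightarrow>
     hopf_algebra H \<and> hopf_algebra H' \<and> f \<in> algebra_homs H H' \<and>
     (\<forall>h\<in>carrier H.
        comult H' (f h) = tensor_map H' H' f f (comult H h) \<and>
        counit H' (f h) = counit H h \<and>
        antipode H' (f h) = f (antipode H h))"


section \<open>Affine algebraic groups\<close>

definition function_algebra :: "'x set \<Rightarrow> ('k::field, 'x \<Rightarrow> 'k) module" where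
  "function_algebra X =
     \<lparr>carrier = X \<rightarrow>\<^sub>E UNIV,
      monoid.mult = (\<lambda>f g. \<lambda>x\<in>X. f x * g x),
      one = (\<lambda>x\<in>X. 1),
      ring.zero = (\<lambda>x\<in>X. 0),
      ring.add = (\<lambda>f g. \<lambda>x\<in>X. f x + g x),
      module.smult = (\<lambda>c f. \<lambda>x\<in>X. c * f x)\<rparr>"

text \<open>A group together with the set of its regular functions.\<close>

record ('g, 'k) alg_group = "'g monoid" +
  regular :: "('g \<Rightarrow> 'k) set"

definition coord_ring :: "('g, 'k::field) alg_group \<Rightarrow> ('k, 'g \<Rightarrow> 'k) module" where
  "coord_ring G = (function_algebra (carrier G))\<lparr>carrier := regular G\<rparr>"

text \<open>An affine variety is a set \<open>X\<close> with a finitely generated algebra of functions on it such that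
  the points of \<open>X\<close> are exactly the algebra homomorphisms from this algebra to the (algebraically
  closed) base field.  An affine algebraic group is a group on an affine variety whose
  multiplication and inversion are morphisms.\<close>

definition affine_algebraic_group :: "('g, 'k::field) alg_group \<Rightarrow> bool" where
  "affine_algebraic_group G \<longleftrightarrow>
     group G \<and>
     (\<exists>S. finite S \<and> S \<subseteq> carrier (function_algebra (carrier G)) \<and>
        regular G = generate_ring (function_algebra (carrier G))
          (S \<union> range (\<lambda>c. \<lambda>x\<in>carrier G. c))) \<and>
     (\<forall>\<phi>\<in>algebra_homs (coord_ring G) base_field.
        \<exists>!g. g \<in> carrier G \<and> (\<forall>f\<in>regular G. \<phi> f = f g)) \<and>
     (\<forall>f\<in>regular G. \<exists>Z\<in>carrier (tensor_product base_field (coord_ring G) (coord_ring G)).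
        \<forall>x\<in>carrier G. \<forall>y\<in>carrier G. tensor_value Z x y = f (x \<otimes>\<^bsub>G\<^esub> y)) \<and>
     (\<forall>f\<in>regular G. (\<lambda>x\<in>carrier G. f (inv\<^bsub>G\<^esub> x)) \<in> regular G)"

definition zariski_topology :: "('g, 'k::field) alg_group \<Rightarrow> 'g topology" where
  "zariski_topology G =
     topology (\<lambda>U. \<exists>S\<subseteq>regular G. U = {x \<in> carrier G. \<exists>f\<in>S. f x \<noteq> 0})"

lemma istopology_zariski:
  assumes "affine_algebraic_group G"
  shows "istopology (\<lambda>U. \<exists>S\<subseteq>regular G. U = {x \<in> carrier G. \<exists>f\<in>S. f x \<noteq> 0})"
  unfolding istopology_def
proof (intro conjI allI impI)
  fix U V
  assume "\<exists>S\<subseteq>regular G. U = {x \<in> carrier G. \<exists>f\<in>S. f x \<noteq> 0}"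
    and "\<exists>S\<subseteq>regular G. V = {x \<in> carrier G. \<exists>f\<in>S. f x \<noteq> 0}"
  then obtain S T where S: "S \<subseteq> regular G" "U = {x \<in> carrier G. \<exists>f\<in>S. f x \<noteq> 0}"
    and T: "T \<subseteq> regular G" "V = {x \<in> carrier G. \<exists>f\<in>T. f x \<noteq> 0}" by blast
  have mult: "(\<lambda>x\<in>carrier G. f x * g x) \<in> regular G" if "f \<in> regular G" "g \<in> regular G" for f g
    using assms that generate_ring.eng_mult[of f "function_algebra (carrier G)" _ g]
    unfolding affine_algebraic_group_def by (auto simp: function_algebra_def)
  let ?P = "(\<lambda>(f, g). \<lambda>x\<in>carrier G. f x * g x) ` (S \<times> T)"
  have "?P \<subseteq> regular G" using mult S(1) T(1) by auto
  moreover have "U \<inter> V = {x \<in> carrier G. \<exists>f\<in>?P. f x \<noteq> 0}" by (auto simp: S(2) T(2))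
  ultimately show "\<exists>S\<subseteq>regular G. U \<inter> V = {x \<in> carrier G. \<exists>f\<in>S. f x \<noteq> 0}" by blast
next
  fix \<U>
  assume U: "\<forall>U\<in>\<U>. \<exists>S\<subseteq>regular G. U = {x \<in> carrier G. \<exists>f\<in>S. f x \<noteq> 0}"
  let ?S = "{f \<in> regular G. \<forall>x\<in>carrier G. f x \<noteq> 0 \<longrightarrow> x \<in> \<Union>\<U>}"
  have "x \<in> carrier G \<and> (\<exists>f\<in>?S. f x \<noteq> 0)" if V: "V \<in> \<U>" "x \<in> V" for x V
  proof -
    obtain S where S: "S \<subseteq> regular G" "V = {x \<in> carrier G. \<exists>f\<in>S. f x \<noteq> 0}"
      using bspec[OF U V(1)] by (elim exE conjE)
    from V(2) obtain f where f: "f \<in> S" "f x \<noteq> 0" "x \<in> carrier G" unfolding S(2) by auto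
    have "y \<in> V" if "y \<in> carrier G" "f y \<noteq> 0" for y
      using that f(1) unfolding S(2) by auto
    then have "f \<in> ?S" using f(1) S(1) V(1) by auto
    then show ?thesis using f(2,3) by auto
  qed
  then have "\<Union>\<U> = {x \<in> carrier G. \<exists>f\<in>?S. f x \<noteq> 0}" by (intro equalityI subsetI) auto
  then show "\<exists>S\<subseteq>regular G. \<Union>\<U> = {x \<in> carrier G. \<exists>f\<in>S. f x \<noteq> 0}"
    by (intro exI[of _ ?S] conjI) auto
qed

text \<open>An element is unipotent if right translation by it is locally unipotent on the coordinate
  ring.\<close>

definition unipotent_element :: "('g, 'k::field) alg_group \<Rightarrow> 'g \<Rightarrow> bool" where
  "unipotent_element G g \<longleftrightarrow> g \<in> carrier G \<and>
     (\<forall>f\<in>regular G. \<exists>n. ((\<lambda>h. \<lambda>x\<in>carrier G. h (x \<otimes>\<^bsub>G\<^esub> g) - h x) ^^ n) f = (\<lambda>x\<in>carrier G. 0))"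

text \<open>The largest closed connected normal unipotent subgroup, given as the union of all of them.\<close>

definition unipotent_radical :: "('g, 'k::field) alg_group \<Rightarrow> 'g set" where
  "unipotent_radical G =
     \<Union>{H. H \<lhd> G \<and> closedin (zariski_topology G) H \<and> connectedin (zariski_topology G) H \<and>
           (\<forall>h\<in>H. unipotent_element G h)}"

definition reductive_group :: "('g, 'k::field) alg_group \<Rightarrow> bool" where
  "reductive_group G \<longleftrightarrow> affine_algebraic_group G \<and> unipotent_radical G = {\<one>\<^bsub>G\<^esub>}"


section \<open>Forms over the prime field and the geometric Frobenius\<close>

definition prime_field :: "('k::field, 'k) module" where
  "prime_field = base_field\<lparr>carrier := range of_int\<rparr>"

definition form_ring :: "('g, 'k::field) alg_group \<Rightarrow> ('g \<Rightarrow> 'k) set \<Rightarrow> ('k, 'g \<Rightarrow> 'k) module" where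
  "form_ring G A\<^sub>0 = (function_algebra (carrier G))\<lparr>carrier := A\<^sub>0\<rparr>"

text \<open>The map \<open>f \<otimes> a \<mapsto> a f\<close> on \<open>A\<^sub>0 \<otimes> K\<close>, the tensor product being taken over the prime field.\<close>

definition base_change_map ::
  "('g, 'k::field) alg_group \<Rightarrow> (('g \<Rightarrow> 'k) \<times> 'k \<Rightarrow>\<^sub>0 'k) set \<Rightarrow> 'g \<Rightarrow> 'k" where
  "base_change_map G = tensor_lift (coord_ring G) (\<lambda>f a. a \<odot>\<^bsub>coord_ring G\<^esub> f)"

text \<open>\<open>A\<^sub>0\<close> is the coordinate ring of a form of \<open>G\<close>, as an algebraic group, over the prime field.  A
  subring is automatically an algebra over the prime field.\<close>

definition prime_field_form :: "('g, 'k::field) alg_group \<Rightarrow> ('g \<Rightarrow> 'k) set \<Rightarrow> bool" where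
  "prime_field_form G A\<^sub>0 \<longleftrightarrow>
     A\<^sub>0 \<subseteq> regular G \<and> subring A\<^sub>0 (coord_ring G) \<and>
     bij_betw (base_change_map G)
       (carrier (tensor_product prime_field (form_ring G A\<^sub>0) base_field)) (regular G) \<and>
     (\<forall>f\<in>A\<^sub>0. \<exists>Z\<in>carrier (tensor_product prime_field (form_ring G A\<^sub>0) (form_ring G A\<^sub>0)).
        \<forall>x\<in>carrier G. \<forall>y\<in>carrier G. tensor_value Z x y = f (x \<otimes>\<^bsub>G\<^esub> y)) \<and>
     (\<forall>f\<in>A\<^sub>0. f \<one>\<^bsub>G\<^esub> \<in> carrier prime_field) \<and>
     (\<forall>f\<in>A\<^sub>0. (\<lambda>x\<in>carrier G. f (inv\<^bsub>G\<^esub> x)) \<in> A\<^sub>0)"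

text \<open>The endomorphism \<open>f \<otimes> a \<mapsto> f^(p^s) \<otimes> a\<close> of the coordinate ring.\<close>

definition frobenius_comorphism ::
  "nat \<Rightarrow> ('g, 'k::field) alg_group \<Rightarrow> ('g \<Rightarrow> 'k) set \<Rightarrow> nat \<Rightarrow> ('g \<Rightarrow> 'k) \<Rightarrow> 'g \<Rightarrow> 'k" where
  "frobenius_comorphism p G A\<^sub>0 s h =
     tensor_lift (coord_ring G) (\<lambda>f a. a \<odot>\<^bsub>coord_ring G\<^esub> (f [^]\<^bsub>coord_ring G\<^esub> (p ^ s)))
       (inv_into (carrier (tensor_product prime_field (form_ring G A\<^sub>0) base_field))
          (base_change_map G) h)"


section \<open>Distributions\<close>

definition ideal_power :: "('a, 'r) ring_scheme \<Rightarrow> 'a set \<Rightarrow> nat \<Rightarrow> 'a set" where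
  "ideal_power R I n = ((\<lambda>J. ideal_prod R J I) ^^ n) (carrier R)"

definition augmentation_ideal :: "('g, 'k::field) alg_group \<Rightarrow> ('g \<Rightarrow> 'k) set" where
  "augmentation_ideal G = {f \<in> regular G. f \<one>\<^bsub>G\<^esub> = 0}"

definition Dist :: "('g, 'k::field) alg_group \<Rightarrow> nat \<Rightarrow> (('g \<Rightarrow> 'k) \<Rightarrow> 'k) set" where
  "Dist G k =
     {\<mu> \<in> linear_maps (coord_ring G) base_field \<inter> extensional (regular G).
        \<forall>f\<in>ideal_power (coord_ring G) (augmentation_ideal G) (k + 1). \<mu> f = 0}"

definition Dist_plus :: "('g, 'k::field) alg_group \<Rightarrow> nat \<Rightarrow> (('g \<Rightarrow> 'k) \<Rightarrow> 'k) set" where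
  "Dist_plus G k = {\<mu> \<in> Dist G k. \<mu> \<one>\<^bsub>coord_ring G\<^esub> = 0}"

definition coord_comult ::
  "('g, 'k::field) alg_group \<Rightarrow> ('g \<Rightarrow> 'k) \<Rightarrow> (('g \<Rightarrow> 'k) \<times> ('g \<Rightarrow> 'k) \<Rightarrow>\<^sub>0 'k) set" where
  "coord_comult G f =
     (THE Z. Z \<in> carrier (tensor_product base_field (coord_ring G) (coord_ring G)) \<and>
        (\<forall>x\<in>carrier G. \<forall>y\<in>carrier G. tensor_value Z x y = f (x \<otimes>\<^bsub>G\<^esub> y)))"

definition Dist_algebra :: "('g, 'k::field) alg_group \<Rightarrow> ('k, ('g \<Rightarrow> 'k) \<Rightarrow> 'k) module" where
  "Dist_algebra G = (function_algebra (regular G))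
     \<lparr>carrier := (\<Union>k. Dist G k),
      monoid.mult := (\<lambda>\<mu> \<rho>. \<lambda>f\<in>regular G. tensor_lift base_field (\<lambda>a b. \<mu> a * \<rho> b) (coord_comult G f)),
      one := (\<lambda>f\<in>regular G. f \<one>\<^bsub>G\<^esub>)\<rparr>"

definition Dist_module :: "('g, 'k::field) alg_group \<Rightarrow> nat \<Rightarrow> ('k, ('g \<Rightarrow> 'k) \<Rightarrow> 'k) module" where
  "Dist_module G k = (Dist_algebra G)\<lparr>carrier := Dist G k\<rparr>"

definition Dist_plus_module :: "('g, 'k::field) alg_group \<Rightarrow> nat \<Rightarrow> ('k, ('g \<Rightarrow> 'k) \<Rightarrow> 'k) module" where
  "Dist_plus_module G k = (Dist_algebra G)\<lparr>carrier := Dist_plus G k\<rparr>"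

text \<open>The comultiplication of the subcoalgebra of distributions of order at most \<open>k\<close>: it is dual to
  the multiplication of functions.\<close>

definition Dist_comult ::
  "('g, 'k::field) alg_group \<Rightarrow> nat \<Rightarrow> (('g \<Rightarrow> 'k) \<Rightarrow> 'k)
     \<Rightarrow> ((('g \<Rightarrow> 'k) \<Rightarrow> 'k) \<times> (('g \<Rightarrow> 'k) \<Rightarrow> 'k) \<Rightarrow>\<^sub>0 'k) set" where
  "Dist_comult G k \<mu> =
     (THE Z. Z \<in> carrier (tensor_product base_field (Dist_module G k) (Dist_module G k)) \<and>
        (\<forall>f\<in>regular G. \<forall>g\<in>regular G. tensor_value Z f g = \<mu> (f \<otimes>\<^bsub>coord_ring G\<^esub> g)))"

definition Dist_antipode ::
  "('g, 'k::field) alg_group \<Rightarrow> (('g \<Rightarrow> 'k) \<Rightarrow> 'k) \<Rightarrow> ('g \<Rightarrow> 'k) \<Rightarrow> 'k" where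
  "Dist_antipode G \<mu> = (\<lambda>f\<in>regular G. \<mu> (\<lambda>x\<in>carrier G. f (inv\<^bsub>G\<^esub> x)))"

definition Xi ::
  "nat \<Rightarrow> ('g, 'k::field) alg_group \<Rightarrow> ('g \<Rightarrow> 'k) set \<Rightarrow> nat
     \<Rightarrow> (('g \<Rightarrow> 'k) \<Rightarrow> 'k) \<Rightarrow> ('g \<Rightarrow> 'k) \<Rightarrow> 'k" where
  "Xi p G A\<^sub>0 s \<delta> = (\<lambda>h\<in>regular G. \<delta> (frobenius_comorphism p G A\<^sub>0 s h))"


section \<open>The higher universal enveloping algebras\<close>

text \<open>The number \<open>p\<^bsup>m+1\<^esup> - 1\<close>, to be read as \<open>0\<close> if \<open>m\<close> is negative.\<close>

definition top_order :: "nat \<Rightarrow> int \<Rightarrow> nat" where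
  "top_order p m = p ^ nat (m + 1) - 1"

abbreviation U_generators ::
  "nat \<Rightarrow> ('g, 'k::field) alg_group \<Rightarrow> int \<Rightarrow> ('k, ('g \<Rightarrow> 'k) \<Rightarrow> 'k) module" where
  "U_generators p G m \<equiv> Dist_plus_module G (top_order p m)"

definition U_relators ::
  "nat \<Rightarrow> ('g, 'k::field) alg_group \<Rightarrow> int \<Rightarrow> ((('g \<Rightarrow> 'k) \<Rightarrow> 'k) list \<Rightarrow>\<^sub>0 'k) set set" where
  "U_relators p G m =
     (let T = tensor_algebra (U_generators p G m);
          \<iota> = tensor_algebra_incl (U_generators p G m);
          D = Dist_algebra G;
          q = p ^ nat (m + 1)
      in {(\<iota> x \<otimes>\<^bsub>T\<^esub> \<iota> y) \<ominus>\<^bsub>T\<^esub> \<iota> (x \<otimes>\<^bsub>D\<^esub> y) | x y i j.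
            x \<in> Dist_plus G i \<and> y \<in> Dist_plus G j \<and> i + j < q} \<union>
         {((\<iota> x \<otimes>\<^bsub>T\<^esub> \<iota> y) \<ominus>\<^bsub>T\<^esub> (\<iota> y \<otimes>\<^bsub>T\<^esub> \<iota> x)) \<ominus>\<^bsub>T\<^esub> \<iota> ((x \<otimes>\<^bsub>D\<^esub> y) \<ominus>\<^bsub>D\<^esub> (y \<otimes>\<^bsub>D\<^esub> x)) | x y i j.
            x \<in> Dist_plus G i \<and> y \<in> Dist_plus G j \<and> i < q \<and> j < q \<and> i + j \<le> q})"

definition U_ideal ::
  "nat \<Rightarrow> ('g, 'k::field) alg_group \<Rightarrow> int \<Rightarrow> ((('g \<Rightarrow> 'k) \<Rightarrow> 'k) list \<Rightarrow>\<^sub>0 'k) set set" where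
  "U_ideal p G m = genideal (tensor_algebra (U_generators p G m)) (U_relators p G m)"

definition U_algebra ::
  "nat \<Rightarrow> ('g, 'k::field) alg_group \<Rightarrow> int
     \<Rightarrow> ('k, ((('g \<Rightarrow> 'k) \<Rightarrow> 'k) list \<Rightarrow>\<^sub>0 'k) set set) module" where
  "U_algebra p G m = quotient_algebra (tensor_algebra (U_generators p G m)) (U_ideal p G m)"

definition U_class ::
  "nat \<Rightarrow> ('g, 'k::field) alg_group \<Rightarrow> int
     \<Rightarrow> (('g \<Rightarrow> 'k) \<Rightarrow> 'k) \<Rightarrow> ((('g \<Rightarrow> 'k) \<Rightarrow> 'k) list \<Rightarrow>\<^sub>0 'k) set set" where
  "U_class p G m \<delta> =
     U_ideal p G m +>\<^bsub>tensor_algebra (U_generators p G m)\<^esub> tensor_algebra_incl (U_generators p G m) \<delta>"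

text \<open>The linear map from all distributions of order at most \<open>p\<^bsup>m+1\<^esup> - 1\<close> that sends the unit (the
  evaluation at the identity of \<open>G\<close>) to \<open>1\<close> and extends \<^const>\<open>U_class\<close>.\<close>

definition Dist_to_U ::
  "nat \<Rightarrow> ('g, 'k::field) alg_group \<Rightarrow> int
     \<Rightarrow> (('g \<Rightarrow> 'k) \<Rightarrow> 'k) \<Rightarrow> ((('g \<Rightarrow> 'k) \<Rightarrow> 'k) list \<Rightarrow>\<^sub>0 'k) set set" where
  "Dist_to_U p G m \<mu> =
     (let U = U_algebra p G m; D = Dist_algebra G; c = \<mu> \<one>\<^bsub>coord_ring G\<^esub>
      in (c \<odot>\<^bsub>U\<^esub> \<one>\<^bsub>U\<^esub>) \<oplus>\<^bsub>U\<^esub> U_class p G m (\<mu> \<ominus>\<^bsub>D\<^esub> (c \<odot>\<^bsub>D\<^esub> \<one>\<^bsub>D\<^esub>)))"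

definition U_hopf ::
  "nat \<Rightarrow> ('g, 'k::field) alg_group \<Rightarrow> int
     \<Rightarrow> ('k, ((('g \<Rightarrow> 'k) \<Rightarrow> 'k) list \<Rightarrow>\<^sub>0 'k) set set) hopf" where
  "U_hopf p G m =
     (let U = U_algebra p G m
      in module.extend U (hopf.fields
           (quotient_lift (tensor_algebra_lift (tensor_product base_field U U)
              (\<lambda>x. tensor_map U U (Dist_to_U p G m) (Dist_to_U p G m)
                     (Dist_comult G (top_order p m) x))))
           (quotient_lift (tensor_algebra_lift base_field (\<lambda>x. x \<one>\<^bsub>coord_ring G\<^esub>)))
           (quotient_lift (tensor_algebra_lift (opposite_algebra U)
              (\<lambda>x. U_class p G m (Dist_antipode G x))))))"

text \<open>\<open>\<Upsilon>\<close> is the algebra homomorphism given on classes of generators by \<open>\<Xi>\<close>.\<close>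

definition induced_by ::
  "((('g \<Rightarrow> 'k::field) \<Rightarrow> 'k) \<Rightarrow> ('g \<Rightarrow> 'k) \<Rightarrow> 'k) \<Rightarrow> nat \<Rightarrow> ('g, 'k) alg_group \<Rightarrow> int \<Rightarrow> int
     \<Rightarrow> (((('g \<Rightarrow> 'k) \<Rightarrow> 'k) list \<Rightarrow>\<^sub>0 'k) set set \<Rightarrow> ((('g \<Rightarrow> 'k) \<Rightarrow> 'k) list \<Rightarrow>\<^sub>0 'k) set set) \<Rightarrow> bool" where
  "induced_by \<Xi> p G m m' \<Upsilon> \<longleftrightarrow>
     \<Upsilon> \<in> algebra_homs (U_algebra p G m) (U_algebra p G m') \<and>
     (\<forall>\<delta>\<in>Dist_plus G (top_order p m). \<Upsilon> (U_class p G m \<delta>) = U_class p G m' (\<Xi> \<delta>))"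

end

theory Submission
  imports Defs "HOL-Computational_Algebra.Primes"
begin

text \<open>The algebra \<open>U\<^sup>[\<^sup>m\<^sup>](G)\<close> is given by generators and relations. A
  homomorphism from it is therefore determined by its values on the classes of the generating
  distributions, and it exists as soon as the prescribed values satisfy the relations
  (\<open>U_hom_eq\<close>, \<open>U_lift\<close>). The structure maps of the Hopf algebra and the
  homomorphism \<open>\<Upsilon>\<close> all arise in this way. What has to be understood is the
  behaviour of the orders of distributions, because the relations are restricted by them.

  Let \<open>I\<close> be the augmentation ideal and \<open>N = p\<^sup>m\<^sup>+\<^sup>1 - 1\<close>.
  The function \<open>g(uv) - g(u) - g(v) + g(1)\<close> on the square of the group belongs to
  \<open>I \<otimes> I\<close>. Hence the comultiplication of functions respects the filtration by
  the powers of \<open>I\<close>, and it is symmetric up to terms of higher order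
  (\<open>comult_filtered\<close>). Dually, a product of distributions of orders \<open>i\<close>
  and \<open>j\<close> has order \<open>i + j\<close>, and their commutator has order
  \<open>i + j - 1\<close> (\<open>conv_Dist\<close>, \<open>commutator_Dist\<close>). As the
  coordinate ring is finitely generated, the powers of \<open>I\<close> have finite codimension;
  with a dual system adapted to the filtration, the comultiplication of a distribution of order
  \<open>i\<close> is written as a sum of tensors whose two orders add up to at most
  \<open>i\<close> (\<open>comult_rep_exists\<close>).

  With these facts the relations are seen to be compatible with the comultiplication. For a product
  relation, the components in both slots can be multiplied as distributions
  (\<open>comult_mult\<close>). For a commutator with \<open>i + j = N + 1\<close> this fails only
  for components whose whole order sits in one slot; the other slot then contains scalars, and the
  commutator relation applies in the first one (\<open>comult_bracket\<close>). The resulting tensor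
  of distributions is the comultiplication of the commutator, because tensors of distributions are
  determined by their values on pairs of functions (\<open>separates_tensor\<close>). The axioms of
  a Hopf algebra are checked on generators, where they are those of the distributions
  (\<open>U_hopf_algebra\<close>).

  The Frobenius comorphism is an algebra endomorphism that commutes with comultiplication and
  inversion, since these are defined over the prime field. It raises \<open>f - f(1)\<close> to the
  power \<open>p\<^sup>s\<close> if \<open>f\<close> is defined over the prime field, and so it maps
  \<open>I\<^sup>n\<close> into the power of \<open>I\<close> with exponent
  \<open>n p\<^sup>s\<close> (\<open>phi_J\<close>). Consequently \<open>\<Xi>\<close> divides
  orders by \<open>p\<^sup>s\<close>, rounding down (\<open>Xi_Dist_div\<close>), and this turns the
  order conditions of the relations for \<open>r\<close> into those for \<open>r - s\<close>
  (\<open>order_div\<close>). As \<open>\<Xi>\<close> respects products, comultiplications and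
  antipodes of distributions, the classes of the \<open>\<Xi>(x)\<close> satisfy the relations, and
  the resulting homomorphism respects the Hopf structure because it does so on generators.\<close>

section \<open>Vector spaces, quotients and linear extension\<close>

lemma base_field_simps [simp]:
  "carrier base_field = UNIV" "monoid.mult base_field = (*)" "one base_field = 1"
  "ring.zero base_field = 0" "ring.add base_field = (+)" "module.smult base_field = (*)"
  by (simp_all add: base_field_def)

text \<open>Subrings of the ground field. Most tensor products are taken over the field itself, those
  in the definition of a form over its prime field.\<close>

locale scalars =
  fixes R :: "('k::field, 'k) module"
  assumes ops [simp]: "monoid.mult R = (*)" "one R = 1" "ring.zero R = 0" "ring.add R = (+)"
    and closed [simp]: "0 \<in> carrier R" "1 \<in> carrier R"
      "a \<in> carrier R \<Longrightarrow> b \<in> carrier R \<Longrightarrow> a + b \<in> carrier R"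
      "a \<in> carrier R \<Longrightarrow> b \<in> carrier R \<Longrightarrow> a * b \<in> carrier R"
      "a \<in> carrier R \<Longrightarrow> - a \<in> carrier R"
begin

lemma cring_R: "cring R"
proof (intro cringI abelian_groupI comm_monoidI)
  fix x assume "x \<in> carrier R"
  then show "\<exists>y\<in>carrier R. y \<oplus>\<^bsub>R\<^esub> x = \<zero>\<^bsub>R\<^esub>" by (intro bexI[of _ "- x"]) auto
qed (auto simp: algebra_simps)

end

lemma scalars_base_field: "scalars base_field"
  by unfold_locales auto

lemma scalars_prime_field: "scalars prime_field"
proof (unfold_locales, simp_all add: prime_field_def)
  have "0 = (of_int 0 :: 'a)" "1 = (of_int 1 :: 'a)" by simp_all
  then show "0 \<in> range (of_int :: int \<Rightarrow> 'a)" "1 \<in> range (of_int :: int \<Rightarrow> 'a)" by blast+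
next
  fix a b :: 'a assume "a \<in> range of_int" "b \<in> range of_int"
  then obtain m n where "a = of_int m" "b = of_int n" by blast
  then have "a + b = of_int (m + n)" "a * b = of_int (m * n)" by simp_all
  then show "a + b \<in> range of_int" "a * b \<in> range of_int" by blast+
next
  fix a :: 'a assume "a \<in> range of_int"
  then obtain m where "a = of_int m" by blast
  then have "- a = of_int (- m)" by simp
  then show "- a \<in> range of_int" by blast
qed

abbreviation vspace :: "('k::field, 'a, 'm) module_scheme \<Rightarrow> bool" where
  "vspace M \<equiv> module base_field M"

lemma vspace_abelian_group: "vspace M \<Longrightarrow> abelian_group M"
  by (simp add: module_def)

lemma vspace_simps:
  assumes "vspace M"
  shows "x \<in> carrier M \<Longrightarrow> c \<odot>\<^bsub>M\<^esub> x \<in> carrier M"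
    and "x \<in> carrier M \<Longrightarrow> (a + b) \<odot>\<^bsub>M\<^esub> x = a \<odot>\<^bsub>M\<^esub> x \<oplus>\<^bsub>M\<^esub> b \<odot>\<^bsub>M\<^esub> x"
    and "x \<in> carrier M \<Longrightarrow> y \<in> carrier M \<Longrightarrow> a \<odot>\<^bsub>M\<^esub> (x \<oplus>\<^bsub>M\<^esub> y) = a \<odot>\<^bsub>M\<^esub> x \<oplus>\<^bsub>M\<^esub> a \<odot>\<^bsub>M\<^esub> y"
    and "x \<in> carrier M \<Longrightarrow> (a * b) \<odot>\<^bsub>M\<^esub> x = a \<odot>\<^bsub>M\<^esub> (b \<odot>\<^bsub>M\<^esub> x)"
    and "x \<in> carrier M \<Longrightarrow> 1 \<odot>\<^bsub>M\<^esub> x = x"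
    and "x \<in> carrier M \<Longrightarrow> 0 \<odot>\<^bsub>M\<^esub> x = \<zero>\<^bsub>M\<^esub>"
    and "c \<odot>\<^bsub>M\<^esub> \<zero>\<^bsub>M\<^esub> = \<zero>\<^bsub>M\<^esub>"
proof -
  interpret module base_field M by fact
  show "x \<in> carrier M \<Longrightarrow> c \<odot>\<^bsub>M\<^esub> x \<in> carrier M" using smult_closed by simp
  show "x \<in> carrier M \<Longrightarrow> (a + b) \<odot>\<^bsub>M\<^esub> x = a \<odot>\<^bsub>M\<^esub> x \<oplus>\<^bsub>M\<^esub> b \<odot>\<^bsub>M\<^esub> x" using smult_l_distr by simp
  show "x \<in> carrier M \<Longrightarrow> y \<in> carrier M \<Longrightarrow> a \<odot>\<^bsub>M\<^esub> (x \<oplus>\<^bsub>M\<^esub> y) = a \<odot>\<^bsub>M\<^esub> x \<oplus>\<^bsub>M\<^esub> a \<odot>\<^bsub>M\<^esub> y"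
    using smult_r_distr by simp
  show "x \<in> carrier M \<Longrightarrow> (a * b) \<odot>\<^bsub>M\<^esub> x = a \<odot>\<^bsub>M\<^esub> (b \<odot>\<^bsub>M\<^esub> x)" using smult_assoc1 by simp
  show "x \<in> carrier M \<Longrightarrow> 1 \<odot>\<^bsub>M\<^esub> x = x" using smult_one by simp
  show "x \<in> carrier M \<Longrightarrow> 0 \<odot>\<^bsub>M\<^esub> x = \<zero>\<^bsub>M\<^esub>" using smult_l_null by simp
  show "c \<odot>\<^bsub>M\<^esub> \<zero>\<^bsub>M\<^esub> = \<zero>\<^bsub>M\<^esub>" using smult_r_null by simp
qed

lemma vspace_minus:
  assumes "vspace M" "x \<in> carrier M"
  shows "\<ominus>\<^bsub>M\<^esub> x = (- 1) \<odot>\<^bsub>M\<^esub> x"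
proof -
  interpret module base_field M by fact
  have "(- 1) \<odot>\<^bsub>M\<^esub> x \<oplus>\<^bsub>M\<^esub> x = (- 1 + 1) \<odot>\<^bsub>M\<^esub> x"
    using vspace_simps(2,5)[OF assms(1), OF assms(2)] assms(2) by metis
  also have "\<dots> = \<zero>\<^bsub>M\<^esub>" using vspace_simps(6)[OF assms] by simp
  finally show ?thesis using assms(2) vspace_simps(1)[OF assms] by (metis M.minus_equality)
qed

lemma vspace_add_simps:
  assumes "vspace M"
  shows "x \<in> carrier M \<Longrightarrow> y \<in> carrier M \<Longrightarrow> x \<oplus>\<^bsub>M\<^esub> y \<in> carrier M"
    and "\<zero>\<^bsub>M\<^esub> \<in> carrier M"
    and "x \<in> carrier M \<Longrightarrow> x \<oplus>\<^bsub>M\<^esub> \<zero>\<^bsub>M\<^esub> = x"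
    and "x \<in> carrier M \<Longrightarrow> \<zero>\<^bsub>M\<^esub> \<oplus>\<^bsub>M\<^esub> x = x"
    and "x \<in> carrier M \<Longrightarrow> \<ominus>\<^bsub>M\<^esub> x \<in> carrier M"
    and "x \<in> carrier M \<Longrightarrow> y \<in> carrier M \<Longrightarrow> x \<ominus>\<^bsub>M\<^esub> y \<in> carrier M"
    and "x \<in> carrier M \<Longrightarrow> y \<in> carrier M \<Longrightarrow> z \<in> carrier M \<Longrightarrow>
      (x \<oplus>\<^bsub>M\<^esub> y) \<oplus>\<^bsub>M\<^esub> z = x \<oplus>\<^bsub>M\<^esub> (y \<oplus>\<^bsub>M\<^esub> z)"
    and "x \<in> carrier M \<Longrightarrow> y \<in> carrier M \<Longrightarrow> x \<oplus>\<^bsub>M\<^esub> y = y \<oplus>\<^bsub>M\<^esub> x"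
    and "x \<in> carrier M \<Longrightarrow> x \<ominus>\<^bsub>M\<^esub> x = \<zero>\<^bsub>M\<^esub>"
proof -
  interpret abelian_group M using assms by (rule vspace_abelian_group)
  show "x \<in> carrier M \<Longrightarrow> y \<in> carrier M \<Longrightarrow> x \<oplus>\<^bsub>M\<^esub> y \<in> carrier M"
    "\<zero>\<^bsub>M\<^esub> \<in> carrier M"
    "x \<in> carrier M \<Longrightarrow> x \<oplus>\<^bsub>M\<^esub> \<zero>\<^bsub>M\<^esub> = x"
    "x \<in> carrier M \<Longrightarrow> \<zero>\<^bsub>M\<^esub> \<oplus>\<^bsub>M\<^esub> x = x"
    "x \<in> carrier M \<Longrightarrow> \<ominus>\<^bsub>M\<^esub> x \<in> carrier M"
    "x \<in> carrier M \<Longrightarrow> y \<in> carrier M \<Longrightarrow> x \<ominus>\<^bsub>M\<^esub> y \<in> carrier M"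
    "x \<in> carrier M \<Longrightarrow> x \<ominus>\<^bsub>M\<^esub> x = \<zero>\<^bsub>M\<^esub>" by (simp_all add: r_neg minus_eq)
  show "x \<in> carrier M \<Longrightarrow> y \<in> carrier M \<Longrightarrow> z \<in> carrier M \<Longrightarrow>
      (x \<oplus>\<^bsub>M\<^esub> y) \<oplus>\<^bsub>M\<^esub> z = x \<oplus>\<^bsub>M\<^esub> (y \<oplus>\<^bsub>M\<^esub> z)"
    by (rule a_assoc)
  show "x \<in> carrier M \<Longrightarrow> y \<in> carrier M \<Longrightarrow> x \<oplus>\<^bsub>M\<^esub> y = y \<oplus>\<^bsub>M\<^esub> x" by (rule a_comm)
qed

lemma vspace_base_field: "vspace base_field"
  using scalars.cring_R[OF scalars_base_field]
  by (intro moduleI) (auto simp: algebra_simps cring_def ring_def)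

lemma base_field_minus [simp]: "\<ominus>\<^bsub>base_field\<^esub> x = - x" "x \<ominus>\<^bsub>base_field\<^esub> y = x - y"
  using vspace_minus[OF vspace_base_field] by (simp_all add: a_minus_def)

subsection \<open>Linear maps\<close>

lemma linear_mapsI:
  assumes "\<And>x. x \<in> carrier M \<Longrightarrow> f x \<in> carrier N"
    and "\<And>x y. x \<in> carrier M \<Longrightarrow> y \<in> carrier M \<Longrightarrow> f (x \<oplus>\<^bsub>M\<^esub> y) = f x \<oplus>\<^bsub>N\<^esub> f y"
    and "\<And>c x. x \<in> carrier M \<Longrightarrow> f (c \<odot>\<^bsub>M\<^esub> x) = c \<odot>\<^bsub>N\<^esub> f x"
  shows "f \<in> linear_maps M N"
  using assms by (simp add: linear_maps_def)

lemma linear_mapsD: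
  assumes "f \<in> linear_maps M N"
  shows "x \<in> carrier M \<Longrightarrow> f x \<in> carrier N"
    and "x \<in> carrier M \<Longrightarrow> y \<in> carrier M \<Longrightarrow> f (x \<oplus>\<^bsub>M\<^esub> y) = f x \<oplus>\<^bsub>N\<^esub> f y"
    and "x \<in> carrier M \<Longrightarrow> f (c \<odot>\<^bsub>M\<^esub> x) = c \<odot>\<^bsub>N\<^esub> f x"
  using assms by (auto simp: linear_maps_def)

lemma linear_map_zero:
  assumes "f \<in> linear_maps M N" "vspace M" "vspace N"
  shows "f \<zero>\<^bsub>M\<^esub> = \<zero>\<^bsub>N\<^esub>"
proof -
  have "f (0 \<odot>\<^bsub>M\<^esub> \<zero>\<^bsub>M\<^esub>) = 0 \<odot>\<^bsub>N\<^esub> f \<zero>\<^bsub>M\<^esub>"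
    using assms linear_mapsD(3) vspace_add_simps(2) by metis
  then show ?thesis
    using vspace_simps(6,7)[OF assms(2)] vspace_simps(6)[OF assms(3)] linear_mapsD(1)[OF assms(1)]
      vspace_add_simps(2)[OF assms(2)] by simp
qed

lemma linear_map_minus:
  assumes "f \<in> linear_maps M N" "vspace M" "vspace N" "x \<in> carrier M" "y \<in> carrier M"
  shows "f (x \<ominus>\<^bsub>M\<^esub> y) = f x \<ominus>\<^bsub>N\<^esub> f y"
  using assms(4,5) linear_mapsD[OF assms(1)] vspace_simps(1)[OF assms(2)]
  by (simp add: a_minus_def vspace_minus[OF assms(2)] vspace_minus[OF assms(3)])

lemma linear_map_comp:
  "f \<in> linear_maps M N \<Longrightarrow> g \<in> linear_maps N L \<Longrightarrow> (\<lambda>x. g (f x)) \<in> linear_maps M L"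
  by (intro linear_mapsI) (auto simp: linear_mapsD)

subsection \<open>Quotients and algebras\<close>

locale module_quotient = module R M
  for R :: "('k::field, 'k) module" and M :: "('k, 'a, 'm) module_scheme" +
  fixes H assumes sub: "submodule H R M"
begin

sublocale abelian_subgroup H M
  using sub by (intro abelian_subgroupI3 additive_subgroupI abelian_group_axioms)
    (simp_all add: submodule_def)

lemma quotient_carrier: "carrier (quotient_algebra M H) = (\<lambda>x. H +>\<^bsub>M\<^esub> x) ` carrier M"
  by (auto simp: quotient_algebra_def ring.defs module.defs FactRing_simps)

lemma quotient_zero: "\<zero>\<^bsub>quotient_algebra M H\<^esub> = H +>\<^bsub>M\<^esub> \<zero>\<^bsub>M\<^esub>"
  using a_coset_add_zero[OF a_subset]
  by (simp add: quotient_algebra_def ring.defs module.defs FactRing_simps)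

lemma quotient_add:
  "x \<in> carrier M \<Longrightarrow> y \<in> carrier M \<Longrightarrow>
    (H +>\<^bsub>M\<^esub> x) \<oplus>\<^bsub>quotient_algebra M H\<^esub> (H +>\<^bsub>M\<^esub> y) = H +>\<^bsub>M\<^esub> (x \<oplus>\<^bsub>M\<^esub> y)"
  by (simp add: quotient_algebra_def ring.defs module.defs FactRing_simps a_rcos_sum)

lemma quotient_eq_iff:
  "x \<in> carrier M \<Longrightarrow> y \<in> carrier M \<Longrightarrow> H +>\<^bsub>M\<^esub> x = H +>\<^bsub>M\<^esub> y \<longleftrightarrow> x \<ominus>\<^bsub>M\<^esub> y \<in> H"
  unfolding a_minus_def a_rcos_module[of y x, symmetric]
  using a_repr_independence'[of x y] a_rcos_self[of x] by auto

lemma mem_coset: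
  assumes "x \<in> carrier M" "z \<in> H +>\<^bsub>M\<^esub> x"
  shows "z \<in> carrier M" "H +>\<^bsub>M\<^esub> z = H +>\<^bsub>M\<^esub> x"
  using a_elemrcos_carrier[OF assms] a_repr_independence'[OF assms(2,1)] by simp_all

lemma quotient_smult:
  assumes "c \<in> carrier R" "x \<in> carrier M"
  shows "c \<odot>\<^bsub>quotient_algebra M H\<^esub> (H +>\<^bsub>M\<^esub> x) = H +>\<^bsub>M\<^esub> (c \<odot>\<^bsub>M\<^esub> x)"
proof -
  have "H +>\<^bsub>M\<^esub> (c \<odot>\<^bsub>M\<^esub> z) = H +>\<^bsub>M\<^esub> (c \<odot>\<^bsub>M\<^esub> x)" if "z \<in> H +>\<^bsub>M\<^esub> x" for z
  proof -
    have z: "z \<in> carrier M" "z \<ominus>\<^bsub>M\<^esub> x \<in> H"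
      using mem_coset[OF assms(2) that] quotient_eq_iff assms(2) by auto
    have "c \<odot>\<^bsub>M\<^esub> z \<ominus>\<^bsub>M\<^esub> c \<odot>\<^bsub>M\<^esub> x = c \<odot>\<^bsub>M\<^esub> (z \<ominus>\<^bsub>M\<^esub> x)"
      using z assms smult_r_distr smult_r_minus by (simp add: a_minus_def)
    also have "\<dots> \<in> H" using submodule.smult_closed[OF sub] assms z by simp
    finally show ?thesis using quotient_eq_iff z assms by simp
  qed
  moreover have "x \<in> H +>\<^bsub>M\<^esub> x" using assms a_rcos_self by simp
  ultimately have "(\<Union>z\<in>H +>\<^bsub>M\<^esub> x. H +>\<^bsub>M\<^esub> (c \<odot>\<^bsub>M\<^esub> z)) = H +>\<^bsub>M\<^esub> (c \<odot>\<^bsub>M\<^esub> x)" by blast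
  then show ?thesis by (simp add: quotient_algebra_def ring.defs module.defs)
qed

lemma quotient_module: "module R (quotient_algebra M H)"
proof (intro moduleI)
  show "cring R" by (rule is_cring)
  show "abelian_group (quotient_algebra M H)"
  proof (intro abelian_groupI)
    fix x assume "x \<in> carrier (quotient_algebra M H)"
    then obtain a where "x = H +>\<^bsub>M\<^esub> a" "a \<in> carrier M" by (auto simp: quotient_carrier)
    then show "\<exists>y\<in>carrier (quotient_algebra M H).
        y \<oplus>\<^bsub>quotient_algebra M H\<^esub> x = \<zero>\<^bsub>quotient_algebra M H\<^esub>"
      by (intro bexI[of _ "H +>\<^bsub>M\<^esub> (\<ominus>\<^bsub>M\<^esub> a)"])
        (auto simp: quotient_carrier quotient_add quotient_zero l_neg)
  qed (auto simp: quotient_carrier quotient_add quotient_zero a_ac)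
qed (auto simp: quotient_carrier quotient_add quotient_smult smult_l_distr smult_r_distr smult_assoc1)

end

text \<open>An additive map that vanishes on \<open>H\<close> is constant on the cosets of
  \<open>H\<close>, so that its image of a coset is a singleton.\<close>

lemma quotient_lift_coset:
  assumes "module_quotient R M H" "abelian_group L"
    and "\<And>x. x \<in> carrier M \<Longrightarrow> f x \<in> carrier L"
    and "\<And>x y. x \<in> carrier M \<Longrightarrow> y \<in> carrier M \<Longrightarrow> f (x \<oplus>\<^bsub>M\<^esub> y) = f x \<oplus>\<^bsub>L\<^esub> f y"
    and "\<And>h. h \<in> H \<Longrightarrow> f h = \<zero>\<^bsub>L\<^esub>" and x: "x \<in> carrier M"
  shows "quotient_lift f (H +>\<^bsub>M\<^esub> x) = f x"
proof -
  interpret module_quotient R M H by fact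
  interpret L: abelian_group L by fact
  have "f z = f x" if "z \<in> H +>\<^bsub>M\<^esub> x" for z
  proof -
    from that obtain h where "h \<in> H" "z = h \<oplus>\<^bsub>M\<^esub> x" by (auto simp: a_r_coset_def')
    then show ?thesis using assms x a_Hcarr by simp
  qed
  moreover have "x \<in> H +>\<^bsub>M\<^esub> x" using x a_rcos_self by simp
  ultimately have "f ` (H +>\<^bsub>M\<^esub> x) = {f x}" by blast
  then show ?thesis by (simp add: quotient_lift_def)
qed

lemma k_algebraD:
  assumes "k_algebra A"
  shows "ring A" "vspace A" "Group.monoid A" "abelian_group A"
    and "a \<in> carrier A \<Longrightarrow> b \<in> carrier A \<Longrightarrow> (c \<odot>\<^bsub>A\<^esub> a) \<otimes>\<^bsub>A\<^esub> b = c \<odot>\<^bsub>A\<^esub> (a \<otimes>\<^bsub>A\<^esub> b)"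
    and "a \<in> carrier A \<Longrightarrow> b \<in> carrier A \<Longrightarrow> a \<otimes>\<^bsub>A\<^esub> (c \<odot>\<^bsub>A\<^esub> b) = c \<odot>\<^bsub>A\<^esub> (a \<otimes>\<^bsub>A\<^esub> b)"
    and "a \<in> carrier A \<Longrightarrow> b \<in> carrier A \<Longrightarrow> a \<otimes>\<^bsub>A\<^esub> b \<in> carrier A"
    and "\<one>\<^bsub>A\<^esub> \<in> carrier A"
    and "a \<in> carrier A \<Longrightarrow> \<one>\<^bsub>A\<^esub> \<otimes>\<^bsub>A\<^esub> a = a"
    and "a \<in> carrier A \<Longrightarrow> a \<otimes>\<^bsub>A\<^esub> \<one>\<^bsub>A\<^esub> = a"
    and "a \<in> carrier A \<Longrightarrow> b \<in> carrier A \<Longrightarrow> d \<in> carrier A \<Longrightarrow>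
      (a \<otimes>\<^bsub>A\<^esub> b) \<otimes>\<^bsub>A\<^esub> d = a \<otimes>\<^bsub>A\<^esub> (b \<otimes>\<^bsub>A\<^esub> d)"
    and "a \<in> carrier A \<Longrightarrow> b \<in> carrier A \<Longrightarrow> d \<in> carrier A \<Longrightarrow>
      (a \<oplus>\<^bsub>A\<^esub> b) \<otimes>\<^bsub>A\<^esub> d = (a \<otimes>\<^bsub>A\<^esub> d) \<oplus>\<^bsub>A\<^esub> (b \<otimes>\<^bsub>A\<^esub> d)"
    and "a \<in> carrier A \<Longrightarrow> b \<in> carrier A \<Longrightarrow> d \<in> carrier A \<Longrightarrow>
      d \<otimes>\<^bsub>A\<^esub> (a \<oplus>\<^bsub>A\<^esub> b) = (d \<otimes>\<^bsub>A\<^esub> a) \<oplus>\<^bsub>A\<^esub> (d \<otimes>\<^bsub>A\<^esub> b)"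
    and "a \<in> carrier A \<Longrightarrow> \<zero>\<^bsub>A\<^esub> \<otimes>\<^bsub>A\<^esub> a = \<zero>\<^bsub>A\<^esub>"
    and "a \<in> carrier A \<Longrightarrow> a \<otimes>\<^bsub>A\<^esub> \<zero>\<^bsub>A\<^esub> = \<zero>\<^bsub>A\<^esub>"
proof -
  show R: "ring A" and "vspace A"
    "a \<in> carrier A \<Longrightarrow> b \<in> carrier A \<Longrightarrow> (c \<odot>\<^bsub>A\<^esub> a) \<otimes>\<^bsub>A\<^esub> b = c \<odot>\<^bsub>A\<^esub> (a \<otimes>\<^bsub>A\<^esub> b)"
    "a \<in> carrier A \<Longrightarrow> b \<in> carrier A \<Longrightarrow> a \<otimes>\<^bsub>A\<^esub> (c \<odot>\<^bsub>A\<^esub> b) = c \<odot>\<^bsub>A\<^esub> (a \<otimes>\<^bsub>A\<^esub> b)"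
    using assms by (auto simp: k_algebra_def)
  interpret ring A by (rule R)
  show "Group.monoid A" "abelian_group A" by unfold_locales
  show "a \<in> carrier A \<Longrightarrow> b \<in> carrier A \<Longrightarrow> a \<otimes>\<^bsub>A\<^esub> b \<in> carrier A"
    "\<one>\<^bsub>A\<^esub> \<in> carrier A"
    "a \<in> carrier A \<Longrightarrow> \<one>\<^bsub>A\<^esub> \<otimes>\<^bsub>A\<^esub> a = a"
    "a \<in> carrier A \<Longrightarrow> a \<otimes>\<^bsub>A\<^esub> \<one>\<^bsub>A\<^esub> = a"
    "a \<in> carrier A \<Longrightarrow> b \<in> carrier A \<Longrightarrow> d \<in> carrier A \<Longrightarrow>
      (a \<otimes>\<^bsub>A\<^esub> b) \<otimes>\<^bsub>A\<^esub> d = a \<otimes>\<^bsub>A\<^esub> (b \<otimes>\<^bsub>A\<^esub> d)"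
    "a \<in> carrier A \<Longrightarrow> b \<in> carrier A \<Longrightarrow> d \<in> carrier A \<Longrightarrow>
      (a \<oplus>\<^bsub>A\<^esub> b) \<otimes>\<^bsub>A\<^esub> d = (a \<otimes>\<^bsub>A\<^esub> d) \<oplus>\<^bsub>A\<^esub> (b \<otimes>\<^bsub>A\<^esub> d)"
    "a \<in> carrier A \<Longrightarrow> b \<in> carrier A \<Longrightarrow> d \<in> carrier A \<Longrightarrow>
      d \<otimes>\<^bsub>A\<^esub> (a \<oplus>\<^bsub>A\<^esub> b) = (d \<otimes>\<^bsub>A\<^esub> a) \<oplus>\<^bsub>A\<^esub> (d \<otimes>\<^bsub>A\<^esub> b)"
    "a \<in> carrier A \<Longrightarrow> \<zero>\<^bsub>A\<^esub> \<otimes>\<^bsub>A\<^esub> a = \<zero>\<^bsub>A\<^esub>"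
    "a \<in> carrier A \<Longrightarrow> a \<otimes>\<^bsub>A\<^esub> \<zero>\<^bsub>A\<^esub> = \<zero>\<^bsub>A\<^esub>"
    by (simp_all add: m_assoc l_distr r_distr)
qed

lemma k_algebraI:
  assumes "vspace A" "Group.monoid A"
    and "\<And>a b d. a \<in> carrier A \<Longrightarrow> b \<in> carrier A \<Longrightarrow> d \<in> carrier A \<Longrightarrow>
      (a \<oplus>\<^bsub>A\<^esub> b) \<otimes>\<^bsub>A\<^esub> d = (a \<otimes>\<^bsub>A\<^esub> d) \<oplus>\<^bsub>A\<^esub> (b \<otimes>\<^bsub>A\<^esub> d)"
    and "\<And>a b d. a \<in> carrier A \<Longrightarrow> b \<in> carrier A \<Longrightarrow> d \<in> carrier A \<Longrightarrow>
      d \<otimes>\<^bsub>A\<^esub> (a \<oplus>\<^bsub>A\<^esub> b) = (d \<otimes>\<^bsub>A\<^esub> a) \<oplus>\<^bsub>A\<^esub> (d \<otimes>\<^bsub>A\<^esub> b)"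
    and "\<And>a b c. a \<in> carrier A \<Longrightarrow> b \<in> carrier A \<Longrightarrow>
      (c \<odot>\<^bsub>A\<^esub> a) \<otimes>\<^bsub>A\<^esub> b = c \<odot>\<^bsub>A\<^esub> (a \<otimes>\<^bsub>A\<^esub> b)"
    and "\<And>a b c. a \<in> carrier A \<Longrightarrow> b \<in> carrier A \<Longrightarrow>
      a \<otimes>\<^bsub>A\<^esub> (c \<odot>\<^bsub>A\<^esub> b) = c \<odot>\<^bsub>A\<^esub> (a \<otimes>\<^bsub>A\<^esub> b)"
  shows "k_algebra A"
  unfolding k_algebra_def using assms vspace_abelian_group[OF assms(1)] by (auto intro!: ringI)

lemma k_algebra_base_field: "k_algebra base_field"
  by (intro k_algebraI vspace_base_field monoidI) (auto simp: algebra_simps)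

lemma k_algebra_opposite:
  assumes "k_algebra A"
  shows "k_algebra (opposite_algebra A)"
proof (intro k_algebraI)
  interpret A: module base_field A using k_algebraD(2)[OF assms] .
  interpret O: abelian_group "opposite_algebra A"
  proof (intro abelian_groupI)
    fix x assume "x \<in> carrier (opposite_algebra A)"
    then show "\<exists>y\<in>carrier (opposite_algebra A).
        y \<oplus>\<^bsub>opposite_algebra A\<^esub> x = \<zero>\<^bsub>opposite_algebra A\<^esub>"
      by (intro bexI[of _ "\<ominus>\<^bsub>A\<^esub> x"]) (auto simp: opposite_algebra_def A.l_neg)
  qed (auto simp: opposite_algebra_def A.a_ac)
  show "vspace (opposite_algebra A)"
    using A.smult_l_distr A.smult_r_distr A.smult_assoc1 A.smult_one A.smult_closed
    by (intro moduleI A.is_cring O.abelian_group_axioms) (simp_all add: opposite_algebra_def)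
  show "Group.monoid (opposite_algebra A)"
    by (intro monoidI) (auto simp: opposite_algebra_def k_algebraD[OF assms])
qed (auto simp: opposite_algebra_def k_algebraD[OF assms])

lemma algebra_homsI:
  assumes "f \<in> linear_maps A B"
    and "\<And>x y. x \<in> carrier A \<Longrightarrow> y \<in> carrier A \<Longrightarrow> f (x \<otimes>\<^bsub>A\<^esub> y) = f x \<otimes>\<^bsub>B\<^esub> f y"
    and "f \<one>\<^bsub>A\<^esub> = \<one>\<^bsub>B\<^esub>"
  shows "f \<in> algebra_homs A B"
  using assms by (auto simp: algebra_homs_def intro!: ring_hom_memI dest: linear_mapsD)

lemma algebra_homsD:
  assumes "f \<in> algebra_homs A B"
  shows "f \<in> linear_maps A B"
    and "x \<in> carrier A \<Longrightarrow> y \<in> carrier A \<Longrightarrow> f (x \<otimes>\<^bsub>A\<^esub> y) = f x \<otimes>\<^bsub>B\<^esub> f y"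
    and "f \<one>\<^bsub>A\<^esub> = \<one>\<^bsub>B\<^esub>"
  using assms by (auto simp: algebra_homs_def ring_hom_mult ring_hom_one)

lemma algebra_hom_comp:
  assumes "f \<in> algebra_homs A B" "g \<in> algebra_homs B C"
  shows "(\<lambda>x. g (f x)) \<in> algebra_homs A C"
  using algebra_homsD[OF assms(1)] algebra_homsD[OF assms(2)] linear_mapsD(1)[of f A B]
  by (intro algebra_homsI linear_map_comp[of f A B g C]) auto

text \<open>Scalars act through multiples of the unit, so that ideals are subspaces.\<close>

lemma ideal_module_quotient:
  assumes A: "k_algebra A" and I: "ideal I A"
  shows "module_quotient base_field A I"
proof -
  interpret module base_field A using k_algebraD(2)[OF A] .
  interpret I: ideal I A by fact
  have "c \<odot>\<^bsub>A\<^esub> x \<in> I" if "x \<in> I" for c x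
  proof -
    have "c \<odot>\<^bsub>A\<^esub> x = (c \<odot>\<^bsub>A\<^esub> \<one>\<^bsub>A\<^esub>) \<otimes>\<^bsub>A\<^esub> x" using that k_algebraD[OF A] by (simp add: I.Icarr)
    then show ?thesis using I.I_l_closed[OF that, of "c \<odot>\<^bsub>A\<^esub> \<one>\<^bsub>A\<^esub>"] k_algebraD(8)[OF A] by simp
  qed
  then have "submodule I base_field A"
    using I.a_subgroup by (auto simp: submodule_def submodule_axioms_def)
  then show ?thesis
    by (intro module_quotient.intro module_axioms module_quotient_axioms.intro)
qed

lemma quotient_algebra_mult:
  assumes "k_algebra A" "ideal I A" "x \<in> carrier A" "y \<in> carrier A"
  shows "(I +>\<^bsub>A\<^esub> x) \<otimes>\<^bsub>quotient_algebra A I\<^esub> (I +>\<^bsub>A\<^esub> y) = I +>\<^bsub>A\<^esub> (x \<otimes>\<^bsub>A\<^esub> y)"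
  using ideal.rcoset_mult_add[OF assms(2-4)]
  by (simp add: quotient_algebra_def ring.defs module.defs FactRing_simps)

lemma quotient_algebra_one: "\<one>\<^bsub>quotient_algebra A I\<^esub> = I +>\<^bsub>A\<^esub> \<one>\<^bsub>A\<^esub>"
  by (simp add: quotient_algebra_def ring.defs module.defs FactRing_simps)

lemma k_algebra_quotient:
  assumes A: "k_algebra A" and I: "ideal I A"
  shows "k_algebra (quotient_algebra A I)"
proof -
  interpret module_quotient base_field A I by (rule ideal_module_quotient[OF assms])
  note simps = quotient_carrier quotient_add quotient_smult quotient_algebra_mult[OF assms]
    quotient_algebra_one k_algebraD[OF A] vspace_simps[OF k_algebraD(2)[OF A]]
  show ?thesis
  proof (intro k_algebraI)
    show "vspace (quotient_algebra A I)" by (rule quotient_module)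
    show "Group.monoid (quotient_algebra A I)" by (intro monoidI) (auto simp: simps)
  qed (auto simp: simps)
qed

lemma quotient_class_hom:
  assumes A: "k_algebra A" and I: "ideal I A"
  shows "(\<lambda>x. I +>\<^bsub>A\<^esub> x) \<in> algebra_homs A (quotient_algebra A I)"
proof -
  interpret module_quotient base_field A I by (rule ideal_module_quotient[OF assms])
  show ?thesis
    by (intro algebra_homsI linear_mapsI)
      (auto simp: quotient_carrier quotient_add quotient_smult quotient_algebra_mult[OF assms]
        quotient_algebra_one)
qed

text \<open>The kernel of a homomorphism is an ideal, so that it contains an ideal as soon as it
  contains its generators.\<close>

lemma genideal_quotient_lift:
  assumes A: "k_algebra A" and B: "k_algebra B" and S: "S \<subseteq> carrier A"
    and f: "f \<in> algebra_homs A B" and fS: "\<And>s. s \<in> S \<Longrightarrow> f s = \<zero>\<^bsub>B\<^esub>"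
  shows "quotient_lift f \<in> algebra_homs (quotient_algebra A (genideal A S)) B"
    and "x \<in> carrier A \<Longrightarrow> quotient_lift f (genideal A S +>\<^bsub>A\<^esub> x) = f x"
proof -
  let ?I = "genideal A S"
  have rA: "ring A" and rB: "ring B" using A B k_algebraD by auto
  have I: "ideal ?I A" using rA S by (rule ring.genideal_ideal)
  interpret module_quotient base_field A ?I by (rule ideal_module_quotient[OF A I])
  have "ring_hom_ring A B f"
    using f rA rB by (intro ring_hom_ringI2) (auto simp: algebra_homs_def)
  then have "ideal (a_kernel A B f) A" by (rule ring_hom_ring.kernel_is_ideal)
  moreover have "S \<subseteq> a_kernel A B f" using S fS by (auto simp: a_kernel_def')
  ultimately have "?I \<subseteq> a_kernel A B f" by (rule ring.genideal_minimal[OF rA])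
  then have *: "\<And>h. h \<in> ?I \<Longrightarrow> f h = \<zero>\<^bsub>B\<^esub>" by (auto simp: a_kernel_def')
  note lin = linear_mapsD[OF algebra_homsD(1)[OF f]]
  have L: "quotient_lift f (?I +>\<^bsub>A\<^esub> x) = f x" if "x \<in> carrier A" for x
    using module_quotient_axioms k_algebraD(4)[OF B] lin(1,2) * that
    by (rule quotient_lift_coset)
  then show "x \<in> carrier A \<Longrightarrow> quotient_lift f (?I +>\<^bsub>A\<^esub> x) = f x" .
  show "quotient_lift f \<in> algebra_homs (quotient_algebra A ?I) B"
    by (intro algebra_homsI linear_mapsI)
      (auto simp: quotient_carrier quotient_add quotient_smult quotient_algebra_mult[OF A I]
        quotient_algebra_one L lin k_algebraD[OF A] vspace_simps[OF k_algebraD(2)[OF A]]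
        algebra_homsD[OF f])
qed

subsection \<open>Monoid algebras\<close>

lemma lookup_map_mult [simp]:
  "Poly_Mapping.lookup (Poly_Mapping.map ((*) c) t) w = c * Poly_Mapping.lookup (t :: 'a \<Rightarrow>\<^sub>0 'k::field) w"
  by (simp add: Poly_Mapping.map.rep_eq when_def)

lemma map_mult_simps:
  fixes t :: "'a \<Rightarrow>\<^sub>0 'k::field"
  shows "Poly_Mapping.map ((*) c) (Poly_Mapping.single w a) = Poly_Mapping.single w (c * a)"
    and "Poly_Mapping.map ((*) c) (s + t) = Poly_Mapping.map ((*) c) s + Poly_Mapping.map ((*) c) t"
    and "Poly_Mapping.map ((*) c) (0 :: 'a \<Rightarrow>\<^sub>0 'k) = 0"
    and "Poly_Mapping.map ((*) (a + b)) t = Poly_Mapping.map ((*) a) t + Poly_Mapping.map ((*) b) t"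
    and "Poly_Mapping.map ((*) (a * b)) t = Poly_Mapping.map ((*) a) (Poly_Mapping.map ((*) b) t)"
    and "Poly_Mapping.map ((*) 1) t = t"
  by (auto intro!: poly_mapping_eqI simp: lookup_add lookup_single when_def algebra_simps)

lemma monoid_algebra_simps [simp]:
  "ring.add (monoid_algebra R P) = (+)" "ring.zero (monoid_algebra R P) = 0"
  "module.smult (monoid_algebra R P) c = Poly_Mapping.map ((*) c)"
  "one (monoid_algebra R P) = Poly_Mapping.single \<one>\<^bsub>P\<^esub> 1"
  by (simp_all add: monoid_algebra_def)

lemma monoid_algebra_mult_superset:
  assumes "finite A" "finite B" "Poly_Mapping.keys s \<subseteq> A" "Poly_Mapping.keys t \<subseteq> B"
  shows "s \<otimes>\<^bsub>monoid_algebra R P\<^esub> t = (\<Sum>u\<in>A. \<Sum>v\<in>B.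
    Poly_Mapping.single (u \<otimes>\<^bsub>P\<^esub> v) (Poly_Mapping.lookup s u * Poly_Mapping.lookup t v))"
proof -
  have "s \<otimes>\<^bsub>monoid_algebra R P\<^esub> t = (\<Sum>u\<in>Poly_Mapping.keys s. \<Sum>v\<in>B.
      Poly_Mapping.single (u \<otimes>\<^bsub>P\<^esub> v) (Poly_Mapping.lookup s u * Poly_Mapping.lookup t v))"
    using assms by (simp add: monoid_algebra_def)
      (intro sum.cong refl sum.mono_neutral_left, auto simp: in_keys_iff)
  also have "\<dots> = (\<Sum>u\<in>A. \<Sum>v\<in>B.
      Poly_Mapping.single (u \<otimes>\<^bsub>P\<^esub> v) (Poly_Mapping.lookup s u * Poly_Mapping.lookup t v))"
    using assms by (intro sum.mono_neutral_left) (auto simp: in_keys_iff)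
  finally show ?thesis .
qed

lemma monoid_algebra_mult_add:
  "(s + s') \<otimes>\<^bsub>monoid_algebra R P\<^esub> t = s \<otimes>\<^bsub>monoid_algebra R P\<^esub> t + s' \<otimes>\<^bsub>monoid_algebra R P\<^esub> t"
  "t \<otimes>\<^bsub>monoid_algebra R P\<^esub> (s + s') = t \<otimes>\<^bsub>monoid_algebra R P\<^esub> s + t \<otimes>\<^bsub>monoid_algebra R P\<^esub> s'"
proof -
  let ?A = "Poly_Mapping.keys s \<union> Poly_Mapping.keys s'"
  note * = monoid_algebra_mult_superset[where A = ?A and B = "Poly_Mapping.keys t" and R = R and P = P]
    monoid_algebra_mult_superset[where B = ?A and A = "Poly_Mapping.keys t" and R = R and P = P]
  show "(s + s') \<otimes>\<^bsub>monoid_algebra R P\<^esub> t = s \<otimes>\<^bsub>monoid_algebra R P\<^esub> t + s' \<otimes>\<^bsub>monoid_algebra R P\<^esub> t"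
    using keys_add[of s s']
    by (simp add: *(1) lookup_add distrib_right single_add sum.distrib)
  show "t \<otimes>\<^bsub>monoid_algebra R P\<^esub> (s + s') = t \<otimes>\<^bsub>monoid_algebra R P\<^esub> s + t \<otimes>\<^bsub>monoid_algebra R P\<^esub> s'"
    using keys_add[of s s']
    by (simp add: *(2) lookup_add distrib_left single_add sum.distrib)
qed

lemma monoid_algebra_mult_single:
  "Poly_Mapping.single u a \<otimes>\<^bsub>monoid_algebra R P\<^esub> Poly_Mapping.single v b
    = Poly_Mapping.single (u \<otimes>\<^bsub>P\<^esub> v) (a * b)"
  "0 \<otimes>\<^bsub>monoid_algebra R P\<^esub> t = 0" "t \<otimes>\<^bsub>monoid_algebra R P\<^esub> 0 = 0"
  by (auto simp: monoid_algebra_def)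

context scalars
begin

lemma monoid_algebra_carrier:
  "t \<in> carrier (monoid_algebra R P) \<longleftrightarrow>
    (\<forall>w. Poly_Mapping.lookup t w \<in> carrier R \<and> (Poly_Mapping.lookup t w \<noteq> 0 \<longrightarrow> w \<in> carrier P))"
  by (auto simp: monoid_algebra_def in_keys_iff)

lemma monoid_algebra_module: "module R (monoid_algebra R P)"
proof (intro moduleI cring_R abelian_groupI)
  fix x assume "x \<in> carrier (monoid_algebra R P)"
  then show "\<exists>y\<in>carrier (monoid_algebra R P).
      y \<oplus>\<^bsub>monoid_algebra R P\<^esub> x = \<zero>\<^bsub>monoid_algebra R P\<^esub>"
    by (intro bexI[of _ "- x"]) (auto simp: monoid_algebra_carrier)
next
  fix x y assume "x \<in> carrier (monoid_algebra R P)" "y \<in> carrier (monoid_algebra R P)"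
  then show "x \<oplus>\<^bsub>monoid_algebra R P\<^esub> y \<in> carrier (monoid_algebra R P)"
    by (auto simp: monoid_algebra_carrier lookup_add) (metis add.right_neutral)
qed (auto simp: monoid_algebra_carrier map_mult_simps add_ac)

lemma monoid_algebra_minus:
  "x \<in> carrier (monoid_algebra R P) \<Longrightarrow> y \<in> carrier (monoid_algebra R P) \<Longrightarrow>
    x \<ominus>\<^bsub>monoid_algebra R P\<^esub> y = x - y"
proof -
  assume *: "x \<in> carrier (monoid_algebra R P)" "y \<in> carrier (monoid_algebra R P)"
  interpret module R "monoid_algebra R P" by (rule monoid_algebra_module)
  have "- y \<in> carrier (monoid_algebra R P)" using * by (auto simp: monoid_algebra_carrier)
  then have "\<ominus>\<^bsub>monoid_algebra R P\<^esub> y = - y" using * by (intro M.minus_equality) auto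
  then show ?thesis by (simp add: a_minus_def)
qed

lemma single_in_carrier:
  "w \<in> carrier P \<Longrightarrow> c \<in> carrier R \<Longrightarrow> Poly_Mapping.single w c \<in> carrier (monoid_algebra R P)"
  by (auto simp: monoid_algebra_carrier lookup_single when_def)

lemma monoid_algebra_induct [consumes 1, case_names zero single add]:
  assumes t: "t \<in> carrier (monoid_algebra R P)"
    and "Q 0" and "\<And>w c. w \<in> carrier P \<Longrightarrow> c \<in> carrier R \<Longrightarrow> Q (Poly_Mapping.single w c)"
    and "\<And>s t. s \<in> carrier (monoid_algebra R P) \<Longrightarrow> t \<in> carrier (monoid_algebra R P) \<Longrightarrow>
      Q s \<Longrightarrow> Q t \<Longrightarrow> Q (s + t)"
  shows "Q t"
proof -
  interpret module R "monoid_algebra R P" by (rule monoid_algebra_module)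
  have t_eq: "t = (\<Sum>k\<in>Poly_Mapping.keys t. Poly_Mapping.single k (Poly_Mapping.lookup t k))"
    by (auto intro!: poly_mapping_eqI simp: lookup_sum lookup_single when_def in_keys_iff)
  have "(\<Sum>k\<in>K. Poly_Mapping.single k (Poly_Mapping.lookup t k)) \<in> carrier (monoid_algebra R P) \<and>
      Q (\<Sum>k\<in>K. Poly_Mapping.single k (Poly_Mapping.lookup t k))"
    if "finite K" "K \<subseteq> Poly_Mapping.keys t" for K
    using that
  proof (induction K rule: finite_induct)
    case empty
    show ?case using assms(2) M.zero_closed by simp
  next
    case (insert k K)
    have *: "k \<in> carrier P" "Poly_Mapping.lookup t k \<in> carrier R"
      using insert.prems t by (auto simp: monoid_algebra_carrier in_keys_iff)
    note s = single_in_carrier[OF *]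
    show ?case using insert assms(4)[OF s] assms(3)[OF *] M.add.m_closed[OF s] by simp
  qed
  from this[of "Poly_Mapping.keys t"] t_eq show ?thesis by simp
qed

end

text \<open>All laws are linear in every argument and can therefore be checked on multiples of basis
  elements.\<close>

lemma k_algebra_monoid_algebra:
  fixes P :: "('a, 'm) monoid_scheme"
  assumes "Group.monoid P"
  shows "k_algebra (monoid_algebra (base_field :: ('k::field, 'k) module) P)"
proof -
  interpret P: Group.monoid P by fact
  interpret scalars "base_field :: ('k, 'k) module" by (rule scalars_base_field)
  let ?A = "monoid_algebra (base_field :: ('k, 'k) module) P"
  interpret module base_field ?A by (rule monoid_algebra_module)
  have add: "s + t \<in> carrier ?A" if "s \<in> carrier ?A" "t \<in> carrier ?A" for s t
    using M.add.m_closed that by simp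
  note sm = monoid_algebra_mult_add monoid_algebra_mult_single map_mult_simps
  have cl: "x \<otimes>\<^bsub>?A\<^esub> y \<in> carrier ?A" if "x \<in> carrier ?A" "y \<in> carrier ?A" for x y
    using that(1)
  proof (induction rule: monoid_algebra_induct)
    case (single u a)
    from that(2) show ?case
      by (induction rule: monoid_algebra_induct)
        (use M.zero_closed single in \<open>auto simp: sm add single_in_carrier\<close>)
  qed (use M.zero_closed in \<open>auto simp: sm add\<close>)
  have assoc: "x \<otimes>\<^bsub>?A\<^esub> y \<otimes>\<^bsub>?A\<^esub> z = x \<otimes>\<^bsub>?A\<^esub> (y \<otimes>\<^bsub>?A\<^esub> z)"
    if "x \<in> carrier ?A" "y \<in> carrier ?A" "z \<in> carrier ?A" for x y z
    using that(1)
  proof (induction rule: monoid_algebra_induct)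
    case u: (single u a)
    from that(2) show ?case
    proof (induction rule: monoid_algebra_induct)
      case v: (single v b)
      from that(3) show ?case
        by (induction rule: monoid_algebra_induct) (use u v in \<open>auto simp: sm P.m_assoc mult.assoc\<close>)
    qed (auto simp: sm)
  qed (auto simp: sm)
  have one: "\<one>\<^bsub>?A\<^esub> \<otimes>\<^bsub>?A\<^esub> x = x \<and> x \<otimes>\<^bsub>?A\<^esub> \<one>\<^bsub>?A\<^esub> = x" if "x \<in> carrier ?A" for x
    using that by (induction rule: monoid_algebra_induct) (auto simp: sm)
  have smult: "(c \<odot>\<^bsub>?A\<^esub> x) \<otimes>\<^bsub>?A\<^esub> y = c \<odot>\<^bsub>?A\<^esub> (x \<otimes>\<^bsub>?A\<^esub> y) \<and>
      x \<otimes>\<^bsub>?A\<^esub> (c \<odot>\<^bsub>?A\<^esub> y) = c \<odot>\<^bsub>?A\<^esub> (x \<otimes>\<^bsub>?A\<^esub> y)"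
    if "x \<in> carrier ?A" "y \<in> carrier ?A" for c x y
    using that(1)
  proof (induction rule: monoid_algebra_induct)
    case (single u a)
    from that(2) show ?case
      by (induction rule: monoid_algebra_induct) (auto simp: sm ac_simps)
  qed (auto simp: sm)
  show ?thesis
  proof (intro k_algebraI)
    show "vspace ?A" by unfold_locales
    show "Group.monoid ?A"
      by (intro monoidI) (use cl assoc one in \<open>auto simp: single_in_carrier\<close>)
  qed (use smult in \<open>auto simp: sm\<close>)
qed

text \<open>Further indices contribute only zero summands; in this way the extensions of several
  elements are sums over one common index set.\<close>

lemma linear_extension_superset:
  assumes N: "vspace N" and "finite K" "Poly_Mapping.keys t \<subseteq> K"
    and "\<And>w. w \<in> K \<Longrightarrow> \<phi> w \<in> carrier N"
  shows "linear_extension N \<phi> t = (\<Oplus>\<^bsub>N\<^esub>w\<in>K. Poly_Mapping.lookup t w \<odot>\<^bsub>N\<^esub> \<phi> w)"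
proof -
  interpret abelian_group N using vspace_abelian_group[OF N] .
  show ?thesis unfolding linear_extension_def using assms
    by (intro add.finprod_mono_neutral_cong_left)
      (auto simp: in_keys_iff vspace_simps[OF N])
qed

context scalars
begin

lemma monoid_algebra_keys: "t \<in> carrier (monoid_algebra R P) \<Longrightarrow> Poly_Mapping.keys t \<subseteq> carrier P"
  by (simp add: monoid_algebra_def)

lemma linear_extension_simps:
  assumes N: "vspace N" and phi: "\<And>w. w \<in> carrier P \<Longrightarrow> \<phi> w \<in> carrier N"
  shows "t \<in> carrier (monoid_algebra R P) \<Longrightarrow> linear_extension N \<phi> t \<in> carrier N"
    and "s \<in> carrier (monoid_algebra R P) \<Longrightarrow> t \<in> carrier (monoid_algebra R P) \<Longrightarrow>
      linear_extension N \<phi> (s + t) = linear_extension N \<phi> s \<oplus>\<^bsub>N\<^esub> linear_extension N \<phi> t"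
    and "w \<in> carrier P \<Longrightarrow> linear_extension N \<phi> (Poly_Mapping.single w c) = c \<odot>\<^bsub>N\<^esub> \<phi> w"
    and "linear_extension N \<phi> 0 = \<zero>\<^bsub>N\<^esub>"
proof -
  interpret abelian_group N using vspace_abelian_group[OF N] .
  note vs = vspace_simps[OF N]
  show "linear_extension N \<phi> t \<in> carrier N" if "t \<in> carrier (monoid_algebra R P)"
    unfolding linear_extension_def using monoid_algebra_keys[OF that] phi
    by (intro finsum_closed) (auto simp: vs)
  show "linear_extension N \<phi> (s + t) = linear_extension N \<phi> s \<oplus>\<^bsub>N\<^esub> linear_extension N \<phi> t"
    if s: "s \<in> carrier (monoid_algebra R P)" and t: "t \<in> carrier (monoid_algebra R P)"
  proof -
    let ?K = "Poly_Mapping.keys s \<union> Poly_Mapping.keys t"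
    have K: "\<phi> w \<in> carrier N" if "w \<in> ?K" for w
      using that phi monoid_algebra_keys[OF s] monoid_algebra_keys[OF t] by auto
    have "linear_extension N \<phi> (s + t)
        = (\<Oplus>\<^bsub>N\<^esub>w\<in>?K. Poly_Mapping.lookup s w \<odot>\<^bsub>N\<^esub> \<phi> w \<oplus>\<^bsub>N\<^esub> Poly_Mapping.lookup t w \<odot>\<^bsub>N\<^esub> \<phi> w)"
      by (subst linear_extension_superset[OF N, where K = ?K], use keys_add[of s t] K in auto)
        (rule finsum_cong', use K in \<open>auto simp: lookup_add vs\<close>)
    also have "\<dots> = (\<Oplus>\<^bsub>N\<^esub>w\<in>?K. Poly_Mapping.lookup s w \<odot>\<^bsub>N\<^esub> \<phi> w)
        \<oplus>\<^bsub>N\<^esub> (\<Oplus>\<^bsub>N\<^esub>w\<in>?K. Poly_Mapping.lookup t w \<odot>\<^bsub>N\<^esub> \<phi> w)"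
      by (rule finsum_addf) (use K in \<open>auto simp: vs\<close>)
    also have "\<dots> = linear_extension N \<phi> s \<oplus>\<^bsub>N\<^esub> linear_extension N \<phi> t"
      using linear_extension_superset[OF N, where K = ?K and t = s and \<phi> = \<phi>]
        linear_extension_superset[OF N, where K = ?K and t = t and \<phi> = \<phi>] K by simp
    finally show ?thesis .
  qed
  show "linear_extension N \<phi> 0 = \<zero>\<^bsub>N\<^esub>" by (simp add: linear_extension_def)
  show "linear_extension N \<phi> (Poly_Mapping.single w c) = c \<odot>\<^bsub>N\<^esub> \<phi> w" if "w \<in> carrier P"
    using linear_extension_superset[OF N, of "{w}" "Poly_Mapping.single w c" \<phi>] phi[OF that]
    by (simp add: vs)
qed

end

lemma linear_extension_linear:
  fixes N :: "('k::field, 'b, 'm) module_scheme"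
  assumes N: "vspace N" and phi: "\<And>w. w \<in> carrier P \<Longrightarrow> \<phi> w \<in> carrier N"
  shows "linear_extension N \<phi> \<in> linear_maps (monoid_algebra base_field P) N"
proof (rule linear_mapsI)
  interpret scalars "base_field :: ('k, 'k) module" by (rule scalars_base_field)
  interpret module base_field "monoid_algebra (base_field :: ('k, 'k) module) P"
    by (rule monoid_algebra_module)
  note le = linear_extension_simps[OF N, of P \<phi>, OF phi]
  fix x :: "_ \<Rightarrow>\<^sub>0 'k" assume x: "x \<in> carrier (monoid_algebra base_field P)"
  show "linear_extension N \<phi> x \<in> carrier N" using x le by simp
  show "linear_extension N \<phi> (x \<oplus>\<^bsub>monoid_algebra base_field P\<^esub> y)
      = linear_extension N \<phi> x \<oplus>\<^bsub>N\<^esub> linear_extension N \<phi> y"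
    if "y \<in> carrier (monoid_algebra base_field P)" for y
    using x that le by simp
  show "linear_extension N \<phi> (c \<odot>\<^bsub>monoid_algebra base_field P\<^esub> x)
      = c \<odot>\<^bsub>N\<^esub> linear_extension N \<phi> x" for c
    using x
  proof (induction rule: monoid_algebra_induct)
    case (add s t)
    then show ?case using smult_closed[of c] by (simp add: map_mult_simps le vspace_simps[OF N])
  qed (auto simp: map_mult_simps le vspace_simps[OF N] phi)
qed

lemma linear_extension_algebra_hom:
  fixes B :: "('k::field, 'b, 'm) module_scheme"
  assumes P: "Group.monoid P" and B: "k_algebra B"
    and phi: "\<And>w. w \<in> carrier P \<Longrightarrow> \<phi> w \<in> carrier B" "\<phi> \<one>\<^bsub>P\<^esub> = \<one>\<^bsub>B\<^esub>"
      "\<And>u v. u \<in> carrier P \<Longrightarrow> v \<in> carrier P \<Longrightarrow> \<phi> (u \<otimes>\<^bsub>P\<^esub> v) = \<phi> u \<otimes>\<^bsub>B\<^esub> \<phi> v"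
  shows "linear_extension B \<phi> \<in> algebra_homs (monoid_algebra base_field P) B"
proof -
  interpret P: Group.monoid P by fact
  interpret scalars "base_field :: ('k, 'k) module" by (rule scalars_base_field)
  let ?A = "monoid_algebra (base_field :: ('k, 'k) module) P"
  have A: "k_algebra ?A" by (rule k_algebra_monoid_algebra[OF P])
  have vB: "vspace B" by (rule k_algebraD(2)[OF B])
  note le = linear_extension_simps[OF vB, of P \<phi>, OF phi(1)]
  note simps = le monoid_algebra_mult_add monoid_algebra_mult_single k_algebraD[OF B] k_algebraD(7)[OF A]
  show ?thesis
  proof (intro algebra_homsI linear_extension_linear vB phi)
    show "linear_extension B \<phi> (x \<otimes>\<^bsub>?A\<^esub> y) = linear_extension B \<phi> x \<otimes>\<^bsub>B\<^esub> linear_extension B \<phi> y"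
      if "x \<in> carrier ?A" "y \<in> carrier ?A" for x y
      using that(1)
    proof (induction rule: monoid_algebra_induct)
      case u: (single u a)
      from that(2) show ?case
        by (induction rule: monoid_algebra_induct)
          (use u in \<open>auto simp: simps phi vspace_simps[OF vB] single_in_carrier mult.commute\<close>)
    qed (use that in \<open>auto simp: simps\<close>)
    show "linear_extension B \<phi> \<one>\<^bsub>?A\<^esub> = \<one>\<^bsub>B\<^esub>"
      by (simp add: le phi vspace_simps[OF vB] k_algebraD[OF B])
  qed
qed

section \<open>Tensor products\<close>

text \<open>All that the construction of a tensor product over \<open>R\<close> requires of its
  factors. It includes forms over the prime field, which are not closed under the scalars of
  \<open>'k\<close>.\<close>

definition scalar_closed :: "('k::field, 'k) module \<Rightarrow> ('k, 'a, 'm) module_scheme \<Rightarrow> bool" where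
  "scalar_closed R M \<longleftrightarrow> (\<forall>x\<in>carrier M. \<forall>y\<in>carrier M. x \<oplus>\<^bsub>M\<^esub> y \<in> carrier M) \<and>
     (\<forall>c\<in>carrier R. \<forall>x\<in>carrier M. c \<odot>\<^bsub>M\<^esub> x \<in> carrier M)"

definition bilinear_over :: "('k::field, 'k) module \<Rightarrow> ('k, 'a, 'm) module_scheme \<Rightarrow>
    ('k, 'b, 'n) module_scheme \<Rightarrow> ('k, 'c, 'l) module_scheme \<Rightarrow> ('a \<Rightarrow> 'b \<Rightarrow> 'c) \<Rightarrow> bool" where
  "bilinear_over R M N L b \<longleftrightarrow>
     (\<forall>x\<in>carrier M. \<forall>y\<in>carrier N. b x y \<in> carrier L) \<and>
     (\<forall>x\<in>carrier M. \<forall>x'\<in>carrier M. \<forall>y\<in>carrier N. b (x \<oplus>\<^bsub>M\<^esub> x') y = b x y \<oplus>\<^bsub>L\<^esub> b x' y) \<and>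
     (\<forall>x\<in>carrier M. \<forall>y\<in>carrier N. \<forall>y'\<in>carrier N. b x (y \<oplus>\<^bsub>N\<^esub> y') = b x y \<oplus>\<^bsub>L\<^esub> b x y') \<and>
     (\<forall>c\<in>carrier R. \<forall>x\<in>carrier M. \<forall>y\<in>carrier N. b (c \<odot>\<^bsub>M\<^esub> x) y = c \<odot>\<^bsub>L\<^esub> b x y) \<and>
     (\<forall>c\<in>carrier R. \<forall>x\<in>carrier M. \<forall>y\<in>carrier N. b x (c \<odot>\<^bsub>N\<^esub> y) = c \<odot>\<^bsub>L\<^esub> b x y)"

lemma scalar_closed_vspace: "vspace M \<Longrightarrow> scalar_closed base_field M"
  by (auto simp: scalar_closed_def vspace_simps vspace_add_simps)

lemma bilinear_overI:
  assumes "\<And>x y. x \<in> carrier M \<Longrightarrow> y \<in> carrier N \<Longrightarrow> b x y \<in> carrier L"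
    and "\<And>x x' y. x \<in> carrier M \<Longrightarrow> x' \<in> carrier M \<Longrightarrow> y \<in> carrier N \<Longrightarrow>
      b (x \<oplus>\<^bsub>M\<^esub> x') y = b x y \<oplus>\<^bsub>L\<^esub> b x' y"
    and "\<And>x y y'. x \<in> carrier M \<Longrightarrow> y \<in> carrier N \<Longrightarrow> y' \<in> carrier N \<Longrightarrow>
      b x (y \<oplus>\<^bsub>N\<^esub> y') = b x y \<oplus>\<^bsub>L\<^esub> b x y'"
    and "\<And>c x y. c \<in> carrier R \<Longrightarrow> x \<in> carrier M \<Longrightarrow> y \<in> carrier N \<Longrightarrow> b (c \<odot>\<^bsub>M\<^esub> x) y = c \<odot>\<^bsub>L\<^esub> b x y"
    and "\<And>c x y. c \<in> carrier R \<Longrightarrow> x \<in> carrier M \<Longrightarrow> y \<in> carrier N \<Longrightarrow> b x (c \<odot>\<^bsub>N\<^esub> y) = c \<odot>\<^bsub>L\<^esub> b x y"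
  shows "bilinear_over R M N L b"
  using assms unfolding bilinear_over_def by blast

lemma bilinear_overD:
  assumes "bilinear_over R M N L b"
  shows "x \<in> carrier M \<Longrightarrow> y \<in> carrier N \<Longrightarrow> b x y \<in> carrier L"
    and "x \<in> carrier M \<Longrightarrow> x' \<in> carrier M \<Longrightarrow> y \<in> carrier N \<Longrightarrow>
      b (x \<oplus>\<^bsub>M\<^esub> x') y = b x y \<oplus>\<^bsub>L\<^esub> b x' y"
    and "x \<in> carrier M \<Longrightarrow> y \<in> carrier N \<Longrightarrow> y' \<in> carrier N \<Longrightarrow>
      b x (y \<oplus>\<^bsub>N\<^esub> y') = b x y \<oplus>\<^bsub>L\<^esub> b x y'"
    and "c \<in> carrier R \<Longrightarrow> x \<in> carrier M \<Longrightarrow> y \<in> carrier N \<Longrightarrow> b (c \<odot>\<^bsub>M\<^esub> x) y = c \<odot>\<^bsub>L\<^esub> b x y"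
    and "c \<in> carrier R \<Longrightarrow> x \<in> carrier M \<Longrightarrow> y \<in> carrier N \<Longrightarrow> b x (c \<odot>\<^bsub>N\<^esub> y) = c \<odot>\<^bsub>L\<^esub> b x y"
  using assms unfolding bilinear_over_def by blast+

lemma DirProd_carrier: "carrier (M \<times>\<times> N) = carrier M \<times> carrier N"
  by (simp add: DirProd_def)

lemma DirProd_mult: "(a, b) \<otimes>\<^bsub>M \<times>\<times> N\<^esub> (c, d) = (a \<otimes>\<^bsub>M\<^esub> c, b \<otimes>\<^bsub>N\<^esub> d)"
  by (simp add: DirProd_def)

lemma monoid_algebra_mult_diff:
  "(s - s') \<otimes>\<^bsub>monoid_algebra R P\<^esub> t = s \<otimes>\<^bsub>monoid_algebra R P\<^esub> t - s' \<otimes>\<^bsub>monoid_algebra R P\<^esub> t"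
  "t \<otimes>\<^bsub>monoid_algebra R P\<^esub> (s - s') = t \<otimes>\<^bsub>monoid_algebra R P\<^esub> s - t \<otimes>\<^bsub>monoid_algebra R P\<^esub> s'"
  using monoid_algebra_mult_add(1)[where s = "s - s'" and s' = s' and t = t and R = R and P = P]
    monoid_algebra_mult_add(2)[where s = "s - s'" and s' = s' and t = t and R = R and P = P]
  by simp_all

context scalars
begin

lemma submoduleI_scalars:
  assumes "module R M" "H \<subseteq> carrier M" "\<zero>\<^bsub>M\<^esub> \<in> H"
    and "\<And>x y. x \<in> H \<Longrightarrow> y \<in> H \<Longrightarrow> x \<oplus>\<^bsub>M\<^esub> y \<in> H"
    and "\<And>c x. c \<in> carrier R \<Longrightarrow> x \<in> H \<Longrightarrow> c \<odot>\<^bsub>M\<^esub> x \<in> H"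
  shows "submodule H R M"
proof -
  interpret module R M by fact
  have "\<ominus>\<^bsub>M\<^esub> x \<in> H" if "x \<in> H" for x
  proof -
    have "\<ominus>\<^bsub>M\<^esub> x = (\<ominus>\<^bsub>R\<^esub> \<one>\<^bsub>R\<^esub>) \<odot>\<^bsub>M\<^esub> x"
      using smult_l_minus[of "\<one>\<^bsub>R\<^esub>" x] that assms(2) smult_one by auto
    also have "\<dots> \<in> H" using that by (intro assms(5)) auto
    finally show ?thesis .
  qed
  then show ?thesis using assms by (intro submoduleI) auto
qed

lemma bilinear_relators_carrier:
  assumes "scalar_closed R M" "scalar_closed R N"
  shows "bilinear_relators R M N \<subseteq> carrier (monoid_algebra R (M \<times>\<times> N))"
proof -
  interpret F: module R "monoid_algebra R (M \<times>\<times> N)" by (rule monoid_algebra_module)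
  have *: "s - t \<in> carrier (monoid_algebra R (M \<times>\<times> N))"
    if "s \<in> carrier (monoid_algebra R (M \<times>\<times> N))" "t \<in> carrier (monoid_algebra R (M \<times>\<times> N))" for s t
    using F.M.minus_closed[OF that] monoid_algebra_minus[OF that] by simp
  show ?thesis using assms
    by (auto simp: bilinear_relators_def DirProd_carrier scalar_closed_def intro!: * single_in_carrier)
qed

lemma bilinear_submodule_minimal:
  "submodule H R (monoid_algebra R (M \<times>\<times> N)) \<Longrightarrow> bilinear_relators R M N \<subseteq> H \<Longrightarrow>
    bilinear_submodule R M N \<subseteq> H"
  by (auto simp: bilinear_submodule_def)

lemma bilinear_relators_submodule: "bilinear_relators R M N \<subseteq> bilinear_submodule R M N"
  by (auto simp: bilinear_submodule_def)

lemma tensor_quotient: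
  assumes "scalar_closed R M" "scalar_closed R N"
  shows "module_quotient R (monoid_algebra R (M \<times>\<times> N)) (bilinear_submodule R M N)"
proof (intro module_quotient.intro module_quotient_axioms.intro monoid_algebra_module
    submoduleI_scalars)
  let ?F = "monoid_algebra R (M \<times>\<times> N)"
  interpret F: module R ?F by (rule monoid_algebra_module)
  have c: "submodule (carrier ?F) R ?F" by (rule F.carrier_is_submodule)
  show "bilinear_submodule R M N \<subseteq> carrier ?F"
    by (rule bilinear_submodule_minimal[OF c bilinear_relators_carrier[OF assms]])
  show "\<zero>\<^bsub>?F\<^esub> \<in> bilinear_submodule R M N"
    by (auto simp: bilinear_submodule_def submodule_def dest: subgroup.one_closed)
  show "x \<oplus>\<^bsub>?F\<^esub> y \<in> bilinear_submodule R M N"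
    if "x \<in> bilinear_submodule R M N" "y \<in> bilinear_submodule R M N" for x y
    unfolding bilinear_submodule_def
  proof (rule InterI)
    fix H assume H: "H \<in> {H. submodule H R ?F \<and> bilinear_relators R M N \<subseteq> H}"
    then have "x \<in> H" "y \<in> H" using that by (auto simp: bilinear_submodule_def)
    then show "x \<oplus>\<^bsub>?F\<^esub> y \<in> H" using H F.submoduleE(5) by blast
  qed
  show "c \<odot>\<^bsub>?F\<^esub> x \<in> bilinear_submodule R M N"
    if "c \<in> carrier R" "x \<in> bilinear_submodule R M N" for c x
    unfolding bilinear_submodule_def
  proof (rule InterI)
    fix H assume H: "H \<in> {H. submodule H R ?F \<and> bilinear_relators R M N \<subseteq> H}"
    then have "x \<in> H" using that by (auto simp: bilinear_submodule_def)
    then show "c \<odot>\<^bsub>?F\<^esub> x \<in> H" using H that(1) submodule.smult_closed[of H R ?F c x] by simp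
  qed
qed

end

locale tensor = scalars R for R :: "('k::field, 'k) module" +
  fixes M :: "('k, 'a, 'm) module_scheme" and N :: "('k, 'b, 'n) module_scheme"
  assumes M: "scalar_closed R M" and N: "scalar_closed R N"
begin

abbreviation "F \<equiv> monoid_algebra R (M \<times>\<times> N)"
abbreviation "B \<equiv> bilinear_submodule R M N"
abbreviation "T \<equiv> tensor_product R M N"

sublocale Q: module_quotient R F B by (rule tensor_quotient[OF M N])

lemma single_carrier [simp]:
  "x \<in> carrier M \<Longrightarrow> y \<in> carrier N \<Longrightarrow> c \<in> carrier R \<Longrightarrow> Poly_Mapping.single (x, y) c \<in> carrier F"
  by (simp add: single_in_carrier DirProd_carrier)

lemma F_closed [simp]:
  "s \<in> carrier F \<Longrightarrow> t \<in> carrier F \<Longrightarrow> s + t \<in> carrier F"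
  "s \<in> carrier F \<Longrightarrow> t \<in> carrier F \<Longrightarrow> s - t \<in> carrier F"
  "c \<in> carrier R \<Longrightarrow> t \<in> carrier F \<Longrightarrow> Poly_Mapping.map ((*) c) t \<in> carrier F"
  using Q.M.a_closed[of s t] Q.M.minus_closed[of s t] Q.smult_closed[of c t]
  by (simp_all add: monoid_algebra_minus)

lemma class_eq: "s \<in> carrier F \<Longrightarrow> t \<in> carrier F \<Longrightarrow> s - t \<in> B \<Longrightarrow> B +>\<^bsub>F\<^esub> s = B +>\<^bsub>F\<^esub> t"
  by (simp add: Q.quotient_eq_iff monoid_algebra_minus)

lemma T_module: "module R T"
  unfolding tensor_product_def by (rule Q.quotient_module)

lemma pure_closed: "x \<in> carrier M \<Longrightarrow> y \<in> carrier N \<Longrightarrow> pure_tensor R M N x y \<in> carrier T"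
  by (simp add: tensor_product_def Q.quotient_carrier pure_tensor_def)

lemma pure_bilinear: "bilinear_over R M N T (pure_tensor R M N)"
proof (rule bilinear_overI)
  note [simp] = M[unfolded scalar_closed_def, THEN conjunct1, rule_format]
    M[unfolded scalar_closed_def, THEN conjunct2, rule_format]
    N[unfolded scalar_closed_def, THEN conjunct1, rule_format]
    N[unfolded scalar_closed_def, THEN conjunct2, rule_format]
  note simps = tensor_product_def pure_tensor_def Q.quotient_add Q.quotient_smult map_mult_simps
  note R = subsetD[OF bilinear_relators_submodule]
  show "pure_tensor R M N x y \<in> carrier T" if "x \<in> carrier M" "y \<in> carrier N" for x y
    using that by (rule pure_closed)
  show "pure_tensor R M N (x \<oplus>\<^bsub>M\<^esub> x') y = pure_tensor R M N x y \<oplus>\<^bsub>T\<^esub> pure_tensor R M N x' y"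
    if "x \<in> carrier M" "x' \<in> carrier M" "y \<in> carrier N" for x x' y
    using that
    by (simp add: simps, intro class_eq R)
      (auto simp: diff_diff_eq[symmetric] bilinear_relators_def)
  show "pure_tensor R M N x (y \<oplus>\<^bsub>N\<^esub> y') = pure_tensor R M N x y \<oplus>\<^bsub>T\<^esub> pure_tensor R M N x y'"
    if "x \<in> carrier M" "y \<in> carrier N" "y' \<in> carrier N" for x y y'
    using that
    by (simp add: simps, intro class_eq R)
      (auto simp: diff_diff_eq[symmetric] bilinear_relators_def)
  show "pure_tensor R M N (c \<odot>\<^bsub>M\<^esub> x) y = c \<odot>\<^bsub>T\<^esub> pure_tensor R M N x y"
    if "c \<in> carrier R" "x \<in> carrier M" "y \<in> carrier N" for c x y
    using that by (simp add: simps, intro class_eq R) (auto simp: bilinear_relators_def)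
  show "pure_tensor R M N x (c \<odot>\<^bsub>N\<^esub> y) = c \<odot>\<^bsub>T\<^esub> pure_tensor R M N x y"
    if "c \<in> carrier R" "x \<in> carrier M" "y \<in> carrier N" for c x y
    using that by (simp add: simps, intro class_eq R) (auto simp: bilinear_relators_def)
qed

text \<open>Scalar multiples of pure tensors need no case of their own, because scalars can be moved
  into the first factor.\<close>

lemma tensor_induct [consumes 1, case_names zero pure add]:
  assumes "z \<in> carrier T" and zero: "Q \<zero>\<^bsub>T\<^esub>"
    and pure: "\<And>x y. x \<in> carrier M \<Longrightarrow> y \<in> carrier N \<Longrightarrow> Q (pure_tensor R M N x y)"
    and add: "\<And>u v. u \<in> carrier T \<Longrightarrow> v \<in> carrier T \<Longrightarrow> Q u \<Longrightarrow> Q v \<Longrightarrow> Q (u \<oplus>\<^bsub>T\<^esub> v)"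
  shows "Q z"
proof -
  have "Q (B +>\<^bsub>F\<^esub> t)" if "t \<in> carrier F" for t
    using that
  proof (induction rule: monoid_algebra_induct)
    case zero
    show ?case using assms(2) by (simp add: tensor_product_def Q.quotient_zero)
  next
    case (single w c)
    obtain x y where w: "w = (x, y)" "x \<in> carrier M" "y \<in> carrier N"
      using single by (auto simp: DirProd_carrier)
    have "Poly_Mapping.single (c \<odot>\<^bsub>M\<^esub> x, y) 1 - Poly_Mapping.single (x, y) c \<in> B"
      using w single by (intro subsetD[OF bilinear_relators_submodule])
        (unfold bilinear_relators_def, blast)
    then have "B +>\<^bsub>F\<^esub> Poly_Mapping.single (x, y) c = pure_tensor R M N (c \<odot>\<^bsub>M\<^esub> x) y"
      using w single M unfolding pure_tensor_def
      by (intro class_eq[symmetric]) (auto simp: scalar_closed_def)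
    then show ?case using w single pure M by (auto simp: scalar_closed_def)
  next
    case (add s t)
    then show ?case
      using assms(4)[of "B +>\<^bsub>F\<^esub> s" "B +>\<^bsub>F\<^esub> t"]
      by (simp add: tensor_product_def Q.quotient_carrier Q.quotient_add)
  qed
  then show ?thesis using assms(1) by (auto simp: tensor_product_def Q.quotient_carrier)
qed

text \<open>The relators express bilinearity, so that the linear extension of a bilinear map vanishes
  on them. The target is a vector space over the whole field even if \<open>R\<close> is smaller;
  the base change of a form is of this kind.\<close>

lemma tensor_lift_simps:
  assumes L: "vspace L" and b: "bilinear_over R M N L b"
  shows "z \<in> carrier T \<Longrightarrow> tensor_lift L b z \<in> carrier L"
    and "u \<in> carrier T \<Longrightarrow> v \<in> carrier T \<Longrightarrow>
      tensor_lift L b (u \<oplus>\<^bsub>T\<^esub> v) = tensor_lift L b u \<oplus>\<^bsub>L\<^esub> tensor_lift L b v"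
    and "x \<in> carrier M \<Longrightarrow> y \<in> carrier N \<Longrightarrow> tensor_lift L b (pure_tensor R M N x y) = b x y"
    and "c \<in> carrier R \<Longrightarrow> z \<in> carrier T \<Longrightarrow> tensor_lift L b (c \<odot>\<^bsub>T\<^esub> z) = c \<odot>\<^bsub>L\<^esub> tensor_lift L b z"
    and "tensor_lift L b \<zero>\<^bsub>T\<^esub> = \<zero>\<^bsub>L\<^esub>"
proof -
  interpret L: abelian_group L by (rule vspace_abelian_group[OF L])
  let ?f = "linear_extension L (\<lambda>(x, y). b x y)"
  note bD = bilinear_overD[OF b]
  have phi: "(\<lambda>(x, y). b x y) w \<in> carrier L" if "w \<in> carrier (M \<times>\<times> N)" for w
    using that bD(1) by (auto simp: DirProd_carrier)
  note le0 = linear_extension_simps[OF L, of "M \<times>\<times> N" "\<lambda>(x, y). b x y", OF phi]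
  have le: "t \<in> carrier F \<Longrightarrow> ?f t \<in> carrier L"
    "s \<in> carrier F \<Longrightarrow> t \<in> carrier F \<Longrightarrow> ?f (s + t) = ?f s \<oplus>\<^bsub>L\<^esub> ?f t"
    "w \<in> carrier (M \<times>\<times> N) \<Longrightarrow> ?f (Poly_Mapping.single w c) = c \<odot>\<^bsub>L\<^esub> (case w of (x, y) \<Rightarrow> b x y)"
    "?f 0 = \<zero>\<^bsub>L\<^esub>" for s t w c
    by (rule le0; assumption)+
  have sub: "t \<in> carrier F \<Longrightarrow> t \<in> carrier (monoid_algebra base_field (M \<times>\<times> N))" for t
    by (auto simp: monoid_algebra_def)
  have smult: "?f (Poly_Mapping.map ((*) c) t) = c \<odot>\<^bsub>L\<^esub> ?f t" if "t \<in> carrier F" for c t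
    using linear_mapsD(3)[OF linear_extension_linear[OF L, of "M \<times>\<times> N" "\<lambda>(x, y). b x y", OF phi] sub[OF that]]
    by simp
  have diff: "?f (s - t) = ?f s \<ominus>\<^bsub>L\<^esub> ?f t" if "s \<in> carrier F" "t \<in> carrier F" for s t
  proof -
    have "?f s = ?f (s - t) \<oplus>\<^bsub>L\<^esub> ?f t" using le(2)[of "s - t" t] that by simp
    then show ?thesis using le(1)[of s] le(1)[of t] le(1)[of "s - t"] that
      by (simp add: a_minus_def L.a_assoc L.r_neg)
  qed
  have sg: "?f (Poly_Mapping.single (x, y) c) = c \<odot>\<^bsub>L\<^esub> b x y" if "x \<in> carrier M" "y \<in> carrier N" for x y c
    using le(3)[of "(x, y)" c] that by (simp add: DirProd_carrier)
  have neg: "p \<oplus>\<^bsub>L\<^esub> q \<ominus>\<^bsub>L\<^esub> p \<ominus>\<^bsub>L\<^esub> q = \<zero>\<^bsub>L\<^esub>"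
    if "p \<in> carrier L" "q \<in> carrier L" for p q
    using that vspace_add_simps(9)[OF L, of "p \<oplus>\<^bsub>L\<^esub> q"] vspace_add_simps(9)[OF L, of p]
    by (simp_all add: a_minus_def L.minus_add L.a_assoc)
  have sub_ker: "B \<subseteq> {t \<in> carrier F. ?f t = \<zero>\<^bsub>L\<^esub>}"
  proof (intro bilinear_submodule_minimal submoduleI_scalars monoid_algebra_module)
    show "bilinear_relators R M N \<subseteq> {t \<in> carrier F. ?f t = \<zero>\<^bsub>L\<^esub>}"
      using M N bilinear_relators_carrier[OF M N]
      by (auto simp: bilinear_relators_def scalar_closed_def diff sg bD vspace_simps[OF L] neg vspace_add_simps(9)[OF L])
    show "\<zero>\<^bsub>F\<^esub> \<in> {t \<in> carrier F. ?f t = \<zero>\<^bsub>L\<^esub>}" using Q.M.zero_closed le(4) by simp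
    show "x \<oplus>\<^bsub>F\<^esub> y \<in> {t \<in> carrier F. ?f t = \<zero>\<^bsub>L\<^esub>}"
      if "x \<in> {t \<in> carrier F. ?f t = \<zero>\<^bsub>L\<^esub>}" "y \<in> {t \<in> carrier F. ?f t = \<zero>\<^bsub>L\<^esub>}" for x y
      using that le(2)[of x y] by simp
  qed (auto simp: smult vspace_simps[OF L])
  have ql: "tensor_lift L b (B +>\<^bsub>F\<^esub> t) = ?f t" if "t \<in> carrier F" for t
    unfolding tensor_lift_def using Q.module_quotient_axioms L.abelian_group_axioms
    by (rule quotient_lift_coset[OF _ _ _ _ _ that]) (use le sub_ker in auto)
  show "z \<in> carrier T \<Longrightarrow> tensor_lift L b z \<in> carrier L"
    by (auto simp: tensor_product_def Q.quotient_carrier ql le)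
  show "tensor_lift L b (u \<oplus>\<^bsub>T\<^esub> v) = tensor_lift L b u \<oplus>\<^bsub>L\<^esub> tensor_lift L b v"
    if "u \<in> carrier T" "v \<in> carrier T"
    using that by (auto simp: tensor_product_def Q.quotient_carrier Q.quotient_add ql le)
  show "tensor_lift L b (pure_tensor R M N x y) = b x y" if "x \<in> carrier M" "y \<in> carrier N"
    using that by (simp add: pure_tensor_def ql sg bD vspace_simps[OF L])
  show "tensor_lift L b (c \<odot>\<^bsub>T\<^esub> z) = c \<odot>\<^bsub>L\<^esub> tensor_lift L b z" if "c \<in> carrier R" "z \<in> carrier T"
    using that by (auto simp: tensor_product_def Q.quotient_carrier Q.quotient_smult ql smult)
  show "tensor_lift L b \<zero>\<^bsub>T\<^esub> = \<zero>\<^bsub>L\<^esub>"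
    using ql[of 0] Q.M.zero_closed by (simp add: tensor_product_def Q.quotient_zero le)
qed

end

abbreviation tprod (infixr "\<otimes>\<^sub>k" 72) where "M \<otimes>\<^sub>k N \<equiv> tensor_product base_field M N"
abbreviation "pure \<equiv> pure_tensor base_field"
abbreviation "bilinear \<equiv> bilinear_over base_field"

lemma tensor_base: "vspace M \<Longrightarrow> vspace N \<Longrightarrow> tensor base_field M N"
  by (simp add: tensor_def tensor_axioms_def scalars_base_field scalar_closed_vspace)

lemma tensor_vspace: "vspace M \<Longrightarrow> vspace N \<Longrightarrow> vspace (M \<otimes>\<^sub>k N)"
  using tensor.T_module tensor_base by blast

lemma pure_simps:
  assumes "vspace M" "vspace N"
  shows "x \<in> carrier M \<Longrightarrow> y \<in> carrier N \<Longrightarrow> pure M N x y \<in> carrier (M \<otimes>\<^sub>k N)"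
    and "x \<in> carrier M \<Longrightarrow> x' \<in> carrier M \<Longrightarrow> y \<in> carrier N \<Longrightarrow>
      pure M N (x \<oplus>\<^bsub>M\<^esub> x') y = pure M N x y \<oplus>\<^bsub>M \<otimes>\<^sub>k N\<^esub> pure M N x' y"
    and "x \<in> carrier M \<Longrightarrow> y \<in> carrier N \<Longrightarrow> y' \<in> carrier N \<Longrightarrow>
      pure M N x (y \<oplus>\<^bsub>N\<^esub> y') = pure M N x y \<oplus>\<^bsub>M \<otimes>\<^sub>k N\<^esub> pure M N x y'"
    and "x \<in> carrier M \<Longrightarrow> y \<in> carrier N \<Longrightarrow> pure M N (c \<odot>\<^bsub>M\<^esub> x) y = c \<odot>\<^bsub>M \<otimes>\<^sub>k N\<^esub> pure M N x y"
    and "x \<in> carrier M \<Longrightarrow> y \<in> carrier N \<Longrightarrow> pure M N x (c \<odot>\<^bsub>N\<^esub> y) = c \<odot>\<^bsub>M \<otimes>\<^sub>k N\<^esub> pure M N x y"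
  using bilinear_overD[OF tensor.pure_bilinear[OF tensor_base[OF assms]]] by auto

lemma pure_zero:
  assumes "vspace M" "vspace N"
  shows "y \<in> carrier N \<Longrightarrow> pure M N \<zero>\<^bsub>M\<^esub> y = \<zero>\<^bsub>M \<otimes>\<^sub>k N\<^esub>"
    and "x \<in> carrier M \<Longrightarrow> pure M N x \<zero>\<^bsub>N\<^esub> = \<zero>\<^bsub>M \<otimes>\<^sub>k N\<^esub>"
proof -
  note z = vspace_add_simps(2)[OF assms(1)] vspace_add_simps(2)[OF assms(2)]
  show "pure M N \<zero>\<^bsub>M\<^esub> y = \<zero>\<^bsub>M \<otimes>\<^sub>k N\<^esub>" if "y \<in> carrier N"
    using pure_simps(4)[OF assms z(1) that, of 0] pure_simps(1)[OF assms z(1) that]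
    by (simp add: vspace_simps(6)[OF tensor_vspace[OF assms]] vspace_simps(7)[OF assms(1)])
  show "pure M N x \<zero>\<^bsub>N\<^esub> = \<zero>\<^bsub>M \<otimes>\<^sub>k N\<^esub>" if "x \<in> carrier M"
    using pure_simps(5)[OF assms that z(2), of 0] pure_simps(1)[OF assms that z(2)]
    by (simp add: vspace_simps(6)[OF tensor_vspace[OF assms]] vspace_simps(7)[OF assms(2)])
qed

lemma tensor_inducts [consumes 3, case_names zero pure add]:
  assumes "vspace M" "vspace N" "z \<in> carrier (M \<otimes>\<^sub>k N)" and "Q \<zero>\<^bsub>M \<otimes>\<^sub>k N\<^esub>"
    and "\<And>x y. x \<in> carrier M \<Longrightarrow> y \<in> carrier N \<Longrightarrow> Q (pure M N x y)"
    and "\<And>u v. u \<in> carrier (M \<otimes>\<^sub>k N) \<Longrightarrow> v \<in> carrier (M \<otimes>\<^sub>k N) \<Longrightarrow> Q u \<Longrightarrow> Q v \<Longrightarrow>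
      Q (u \<oplus>\<^bsub>M \<otimes>\<^sub>k N\<^esub> v)"
  shows "Q z"
  using tensor.tensor_induct[OF tensor_base[OF assms(1,2)], of z Q] assms(3-6) by blast

lemma tensor_lift_linear:
  assumes "vspace M" "vspace N" "vspace L" "bilinear M N L b"
  shows "tensor_lift L b \<in> linear_maps (M \<otimes>\<^sub>k N) L"
  using tensor.tensor_lift_simps[OF tensor_base[OF assms(1,2)] assms(3,4)] by (intro linear_mapsI) auto

lemma tensor_lift_pure:
  assumes "vspace M" "vspace N" "vspace L" "bilinear M N L b" "x \<in> carrier M" "y \<in> carrier N"
  shows "tensor_lift L b (pure M N x y) = b x y"
  using tensor.tensor_lift_simps(3)[OF tensor_base[OF assms(1,2)] assms(3,4)] assms by auto

lemma tensor_ext: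
  assumes M: "vspace M" and N: "vspace N" and L: "vspace L"
    and f: "f \<in> linear_maps (M \<otimes>\<^sub>k N) L" and g: "g \<in> linear_maps (M \<otimes>\<^sub>k N) L"
    and eq: "\<And>x y. x \<in> carrier M \<Longrightarrow> y \<in> carrier N \<Longrightarrow> f (pure M N x y) = g (pure M N x y)"
    and z: "z \<in> carrier (M \<otimes>\<^sub>k N)"
  shows "f z = g z"
  using M N z
proof (induction rule: tensor_inducts)
  case zero
  show ?case using linear_map_zero[OF f] linear_map_zero[OF g] tensor_vspace[OF M N] L by simp
next
  case (pure x y)
  then show ?case by (rule eq)
next
  case (add u v)
  then show ?case using linear_mapsD(2)[OF f] linear_mapsD(2)[OF g] by simp
qed

lemma linear_map_add:
  assumes "vspace N" "f \<in> linear_maps M N" "g \<in> linear_maps M N"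
  shows "(\<lambda>x. f x \<oplus>\<^bsub>N\<^esub> g x) \<in> linear_maps M N"
proof -
  interpret abelian_group N by (rule vspace_abelian_group[OF assms(1)])
  show ?thesis
    using linear_mapsD[OF assms(2)] linear_mapsD[OF assms(3)]
    by (intro linear_mapsI) (auto simp: vspace_simps[OF assms(1)] a_ac)
qed

lemma linear_map_smult:
  assumes "vspace N" "f \<in> linear_maps M N"
  shows "(\<lambda>x. c \<odot>\<^bsub>N\<^esub> f x) \<in> linear_maps M N"
  using linear_mapsD[OF assms(2)]
  by (intro linear_mapsI)
    (auto simp: vspace_simps(1-3)[OF assms(1)] vspace_simps(4)[OF assms(1), symmetric] mult.commute)

lemma bilinearI:
  assumes "\<And>y. y \<in> carrier N \<Longrightarrow> (\<lambda>x. b x y) \<in> linear_maps M L"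
    and "\<And>x. x \<in> carrier M \<Longrightarrow> (\<lambda>y. b x y) \<in> linear_maps N L"
  shows "bilinear M N L b"
  using linear_mapsD[OF assms(1)] linear_mapsD[OF assms(2)] by (intro bilinear_overI) auto

lemma bilinear_linear:
  assumes "bilinear M N L b"
  shows "y \<in> carrier N \<Longrightarrow> (\<lambda>x. b x y) \<in> linear_maps M L"
    and "x \<in> carrier M \<Longrightarrow> (\<lambda>y. b x y) \<in> linear_maps N L"
  using bilinear_overD[OF assms] by (auto intro!: linear_mapsI)

lemma bilinear_compose:
  assumes "bilinear M' N' L b" "f \<in> linear_maps M M'" "g \<in> linear_maps N N'" "h \<in> linear_maps L L'"
  shows "bilinear M N L' (\<lambda>x y. h (b (f x) (g y)))"
proof (rule bilinearI)
  show "(\<lambda>x. h (b (f x) (g y))) \<in> linear_maps M L'" if "y \<in> carrier N" for y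
    using linear_map_comp[OF linear_map_comp[OF assms(2)
          bilinear_linear(1)[OF assms(1) linear_mapsD(1)[OF assms(3) that]]] assms(4)] .
  show "(\<lambda>y. h (b (f x) (g y))) \<in> linear_maps N L'" if "x \<in> carrier M" for x
    using linear_map_comp[OF linear_map_comp[OF assms(3)
          bilinear_linear(2)[OF assms(1) linear_mapsD(1)[OF assms(2) that]]] assms(4)] .
qed

lemma linear_map_id: "(\<lambda>x. x) \<in> linear_maps M M" "id \<in> linear_maps M M"
  by (auto intro!: linear_mapsI)

lemma pure_bilinear: "vspace M \<Longrightarrow> vspace N \<Longrightarrow> bilinear M N (M \<otimes>\<^sub>k N) (pure M N)"
  using tensor.pure_bilinear tensor_base by blast

lemma algebra_mult_bilinear: "k_algebra A \<Longrightarrow> bilinear A A A (\<lambda>x y. x \<otimes>\<^bsub>A\<^esub> y)"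
  by (intro bilinear_overI) (auto simp: k_algebraD)

lemma smult_bilinear: "vspace M \<Longrightarrow> bilinear base_field M M (\<lambda>c x. c \<odot>\<^bsub>M\<^esub> x)"
  by (intro bilinear_overI)
    (auto simp: vspace_simps(1-3) vspace_simps(4)[symmetric] mult.commute)

text \<open>A trilinear map, lifted in its first two arguments, becomes bilinear in the tensor and
  the third argument. This is what makes the associativity isomorphism well defined.\<close>

lemma tensor_lift_parametric:
  assumes M: "vspace M" and N: "vspace N" and P: "vspace P" and L: "vspace L"
    and b: "\<And>w. w \<in> carrier P \<Longrightarrow> bilinear M N L (\<lambda>x y. b x y w)"
    and lin: "\<And>x y. x \<in> carrier M \<Longrightarrow> y \<in> carrier N \<Longrightarrow> (\<lambda>w. b x y w) \<in> linear_maps P L"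
  shows "bilinear (M \<otimes>\<^sub>k N) P L (\<lambda>z w. tensor_lift L (\<lambda>x y. b x y w) z)"
proof (rule bilinearI)
  show "(\<lambda>z. tensor_lift L (\<lambda>x y. b x y w) z) \<in> linear_maps (M \<otimes>\<^sub>k N) L" if "w \<in> carrier P" for w
    by (rule tensor_lift_linear[OF M N L b[OF that]])
  fix z assume z: "z \<in> carrier (M \<otimes>\<^sub>k N)"
  note tl = tensor_lift_linear[OF M N L b] and tp = tensor_lift_pure[OF M N L b]
  show "(\<lambda>w. tensor_lift L (\<lambda>x y. b x y w) z) \<in> linear_maps P L"
  proof (rule linear_mapsI)
    fix w assume w: "w \<in> carrier P"
    show "tensor_lift L (\<lambda>x y. b x y w) z \<in> carrier L" using linear_mapsD(1)[OF tl[OF w] z] .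
    show "tensor_lift L (\<lambda>x y. b x y (w \<oplus>\<^bsub>P\<^esub> w')) z
        = tensor_lift L (\<lambda>x y. b x y w) z \<oplus>\<^bsub>L\<^esub> tensor_lift L (\<lambda>x y. b x y w') z"
      if w': "w' \<in> carrier P" for w'
      using w w' vspace_add_simps(1)[OF P] linear_mapsD(2)[OF lin]
      by (intro tensor_ext[OF M N L tl linear_map_add[OF L tl tl] _ z]) (simp_all add: tp)
    show "tensor_lift L (\<lambda>x y. b x y (c \<odot>\<^bsub>P\<^esub> w)) z = c \<odot>\<^bsub>L\<^esub> tensor_lift L (\<lambda>x y. b x y w) z" for c
      using w vspace_simps(1)[OF P] linear_mapsD(3)[OF lin]
      by (intro tensor_ext[OF M N L tl linear_map_smult[OF L tl] _ z]) (simp_all add: tp)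
  qed
qed

subsection \<open>Tensor products of maps and of algebras\<close>

lemma tensor_map_linear:
  assumes "vspace M" "vspace N" "vspace M'" "vspace N'" "f \<in> linear_maps M M'" "g \<in> linear_maps N N'"
  shows "tensor_map M' N' f g \<in> linear_maps (M \<otimes>\<^sub>k N) (M' \<otimes>\<^sub>k N')"
    and "x \<in> carrier M \<Longrightarrow> y \<in> carrier N \<Longrightarrow>
      tensor_map M' N' f g (pure M N x y) = pure M' N' (f x) (g y)"
proof -
  have b: "bilinear M N (M' \<otimes>\<^sub>k N') (\<lambda>x y. pure M' N' (f x) (g y))"
    using bilinear_compose[OF pure_bilinear[OF assms(3,4)] assms(5,6) linear_map_id(1)] .
  show "tensor_map M' N' f g \<in> linear_maps (M \<otimes>\<^sub>k N) (M' \<otimes>\<^sub>k N')"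
    unfolding tensor_map_def using tensor_lift_linear[OF assms(1,2) tensor_vspace[OF assms(3,4)] b] .
  show "tensor_map M' N' f g (pure M N x y) = pure M' N' (f x) (g y)"
    if "x \<in> carrier M" "y \<in> carrier N"
    unfolding tensor_map_def using tensor_lift_pure[OF assms(1,2) tensor_vspace[OF assms(3,4)] b that] .
qed

context
  fixes A :: "('k::field, 'a, 'm) module_scheme" and B :: "('k, 'b, 'n) module_scheme"
  assumes A: "k_algebra A" and B: "k_algebra B"
begin

interpretation tensor base_field A B
  using tensor_base k_algebraD(2)[OF A] k_algebraD(2)[OF B] by blast

lemma pair_algebra: "k_algebra (monoid_algebra (base_field :: ('k, 'k) module) (A \<times>\<times> B))"
  using k_algebra_monoid_algebra DirProd_monoid k_algebraD(3)[OF A] k_algebraD(3)[OF B] by blast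

text \<open>Multiplying a bilinear relator by a pair gives a multiple of a bilinear relator.\<close>

lemma bilinear_submodule_ideal:
  "ideal (bilinear_submodule base_field A B) (monoid_algebra (base_field :: ('k, 'k) module) (A \<times>\<times> B))"
proof -
  let ?F = "monoid_algebra (base_field :: ('k, 'k) module) (A \<times>\<times> B)"
  let ?B = "bilinear_submodule (base_field :: ('k, 'k) module) A B"
  note vA = vspace_simps[OF k_algebraD(2)[OF A]] and vB = vspace_simps[OF k_algebraD(2)[OF B]]
  note aA = vspace_add_simps[OF k_algebraD(2)[OF A]] and aB = vspace_add_simps[OF k_algebraD(2)[OF B]]
  note mA = k_algebraD[OF A] and mB = k_algebraD[OF B]
  have mapd: "Poly_Mapping.map ((*) c) (s - t) = Poly_Mapping.map ((*) c) s - Poly_Mapping.map ((*) c) t"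
    for c :: 'k and s t :: "'a \<times> 'b \<Rightarrow>\<^sub>0 'k"
    by (auto intro!: poly_mapping_eqI simp: lookup_minus right_diff_distrib)
  have sm: "Poly_Mapping.map ((*) c) t \<in> ?B" if "t \<in> bilinear_relators base_field A B" for t and c :: 'k
    using submodule.smult_closed[OF Q.sub, of c t] subsetD[OF bilinear_relators_submodule that] by simp
  have r1: "Poly_Mapping.single (x \<oplus>\<^bsub>A\<^esub> x', y) c - Poly_Mapping.single (x, y) c - Poly_Mapping.single (x', y) c \<in> ?B"
    if "x \<in> carrier A" "x' \<in> carrier A" "y \<in> carrier B" for x x' y and c :: 'k
  proof -
    have "Poly_Mapping.single (x \<oplus>\<^bsub>A\<^esub> x', y) 1 - Poly_Mapping.single (x, y) 1 - Poly_Mapping.single (x', y) 1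
        \<in> bilinear_relators base_field A B"
      using that unfolding bilinear_relators_def by blast
    from sm[OF this, of c] show ?thesis by (simp add: mapd map_mult_simps)
  qed
  have r2: "Poly_Mapping.single (x, y \<oplus>\<^bsub>B\<^esub> y') c - Poly_Mapping.single (x, y) c - Poly_Mapping.single (x, y') c \<in> ?B"
    if "x \<in> carrier A" "y' \<in> carrier B" "y \<in> carrier B" for x y' y and c :: 'k
  proof -
    have "Poly_Mapping.single (x, y \<oplus>\<^bsub>B\<^esub> y') 1 - Poly_Mapping.single (x, y) 1 - Poly_Mapping.single (x, y') 1
        \<in> bilinear_relators base_field A B"
      using that unfolding bilinear_relators_def by blast
    from sm[OF this, of c] show ?thesis by (simp add: mapd map_mult_simps)
  qed
  have r3: "Poly_Mapping.single (d \<odot>\<^bsub>A\<^esub> x, y) c - Poly_Mapping.single (x, y) (c * d) \<in> ?B"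
    if "x \<in> carrier A" "y \<in> carrier B" for x y and c d :: 'k
  proof -
    have "Poly_Mapping.single (d \<odot>\<^bsub>A\<^esub> x, y) 1 - Poly_Mapping.single (x, y) d \<in> bilinear_relators base_field A B"
      using that unfolding bilinear_relators_def by auto
    from sm[OF this, of c] show ?thesis by (simp add: mapd map_mult_simps)
  qed
  have r4: "Poly_Mapping.single (x, d \<odot>\<^bsub>B\<^esub> y) c - Poly_Mapping.single (x, y) (c * d) \<in> ?B"
    if "x \<in> carrier A" "y \<in> carrier B" for x y and c d :: 'k
  proof -
    have "Poly_Mapping.single (x, d \<odot>\<^bsub>B\<^esub> y) 1 - Poly_Mapping.single (x, y) d \<in> bilinear_relators base_field A B"
      using that unfolding bilinear_relators_def by auto
    from sm[OF this, of c] show ?thesis by (simp add: mapd map_mult_simps)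
  qed
  have B_add: "s + t \<in> ?B" if "s \<in> ?B" "t \<in> ?B" for s t
    using Q.a_closed[OF that] by simp
  have B_zero: "0 \<in> ?B" using Q.zero_closed by simp
  have B_sm: "Poly_Mapping.map ((*) c) t \<in> ?B" if "t \<in> ?B" for c t
    using submodule.smult_closed[OF Q.sub, of c t] that by simp
  have single: "Poly_Mapping.single (u, v) c \<otimes>\<^bsub>?F\<^esub> t \<in> ?B \<and> t \<otimes>\<^bsub>?F\<^esub> Poly_Mapping.single (u, v) c \<in> ?B"
    if uv: "u \<in> carrier A" "v \<in> carrier B" and t: "t \<in> ?B" for u v c t
  proof -
    let ?H = "{t \<in> carrier ?F. Poly_Mapping.single (u, v) c \<otimes>\<^bsub>?F\<^esub> t \<in> ?B \<and> t \<otimes>\<^bsub>?F\<^esub> Poly_Mapping.single (u, v) c \<in> ?B}"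
    have s: "Poly_Mapping.single (u, v) c \<in> carrier ?F" using uv by simp
    have "?B \<subseteq> ?H"
    proof (intro bilinear_submodule_minimal submoduleI_scalars monoid_algebra_module)
      show "bilinear_relators base_field A B \<subseteq> ?H"
        using bilinear_relators_carrier[OF M N] uv
        by (auto simp: bilinear_relators_def monoid_algebra_mult_diff monoid_algebra_mult_single
            DirProd_mult mA mB r1 r2 r3 r4) (use r3[where c = c] r4[where c = c] in \<open>simp_all add: mA mB vA(1) vB(1) mult.commute\<close>)
      show "\<zero>\<^bsub>?F\<^esub> \<in> ?H"
        using B_zero Q.M.zero_closed by (simp add: monoid_algebra_mult_single)
      show "x \<oplus>\<^bsub>?F\<^esub> y \<in> ?H" if "x \<in> ?H" "y \<in> ?H" for x y
        using that by (simp add: monoid_algebra_mult_add B_add)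
      show "d \<odot>\<^bsub>?F\<^esub> x \<in> ?H" if "d \<in> carrier base_field" "x \<in> ?H" for d x
        using that k_algebraD(5,6)[OF pair_algebra, of _ _ d] s by (simp add: B_sm)
    qed simp
    then show ?thesis using t by auto
  qed
  have "s \<otimes>\<^bsub>?F\<^esub> t \<in> ?B \<and> t \<otimes>\<^bsub>?F\<^esub> s \<in> ?B" if "s \<in> carrier ?F" and t: "t \<in> ?B" for s t
    using that(1)
    by (induction rule: monoid_algebra_induct)
      (auto simp: monoid_algebra_mult_add monoid_algebra_mult_single B_zero B_add DirProd_carrier single t)
  then show ?thesis
    using Q.a_subgroup by (intro idealI k_algebraD(1)[OF pair_algebra]) auto
qed

lemma k_algebra_tensor: "k_algebra (A \<otimes>\<^sub>k B)"
  unfolding tensor_product_def by (rule k_algebra_quotient[OF pair_algebra bilinear_submodule_ideal])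

lemma tensor_mult_pure:
  "a \<in> carrier A \<Longrightarrow> b \<in> carrier B \<Longrightarrow> c \<in> carrier A \<Longrightarrow> d \<in> carrier B \<Longrightarrow>
    pure A B a b \<otimes>\<^bsub>A \<otimes>\<^sub>k B\<^esub> pure A B c d = pure A B (a \<otimes>\<^bsub>A\<^esub> c) (b \<otimes>\<^bsub>B\<^esub> d)"
  unfolding tensor_product_def pure_tensor_def
  by (simp add: quotient_algebra_mult[OF pair_algebra bilinear_submodule_ideal]
      monoid_algebra_mult_single DirProd_mult)

lemma tensor_one: "\<one>\<^bsub>A \<otimes>\<^sub>k B\<^esub> = pure A B \<one>\<^bsub>A\<^esub> \<one>\<^bsub>B\<^esub>"
  by (simp add: tensor_product_def pure_tensor_def quotient_algebra_one)

end

text \<open>Multiplicativity is an identity between bilinear maps, so that pure tensors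
  suffice.\<close>

lemma tensor_algebra_homI:
  assumes A: "k_algebra A" and B: "k_algebra B" and C: "k_algebra C"
    and f: "f \<in> linear_maps (A \<otimes>\<^sub>k B) C"
    and mult: "\<And>a b c d. a \<in> carrier A \<Longrightarrow> b \<in> carrier B \<Longrightarrow> c \<in> carrier A \<Longrightarrow> d \<in> carrier B \<Longrightarrow>
      f (pure A B (a \<otimes>\<^bsub>A\<^esub> c) (b \<otimes>\<^bsub>B\<^esub> d)) = f (pure A B a b) \<otimes>\<^bsub>C\<^esub> f (pure A B c d)"
    and one: "f (pure A B \<one>\<^bsub>A\<^esub> \<one>\<^bsub>B\<^esub>) = \<one>\<^bsub>C\<^esub>"
  shows "f \<in> algebra_homs (A \<otimes>\<^sub>k B) C"
proof (rule algebra_homsI[OF f])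
  let ?T = "A \<otimes>\<^sub>k B"
  have T: "k_algebra ?T" by (rule k_algebra_tensor[OF A B])
  note [simp] = linear_mapsD[OF f] k_algebraD[OF T] k_algebraD[OF C]
    linear_map_zero[OF f k_algebraD(2)[OF T] k_algebraD(2)[OF C]] pure_simps(1)[OF k_algebraD(2)[OF A] k_algebraD(2)[OF B]]
  show "f (x \<otimes>\<^bsub>?T\<^esub> y) = f x \<otimes>\<^bsub>C\<^esub> f y" if x: "x \<in> carrier ?T" and y: "y \<in> carrier ?T" for x y
    using k_algebraD(2)[OF A] k_algebraD(2)[OF B] x
  proof (induction rule: tensor_inducts)
    case ab: (pure a b)
    from k_algebraD(2)[OF A] k_algebraD(2)[OF B] y
    show ?case
      by (induction rule: tensor_inducts) (use ab in \<open>simp_all add: tensor_mult_pure[OF A B] mult\<close>)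
  qed (use y in simp_all)
  show "f \<one>\<^bsub>?T\<^esub> = \<one>\<^bsub>C\<^esub>" by (simp add: tensor_one[OF A B] one)
qed

lemma tensor_map_algebra_hom:
  assumes A: "k_algebra A" and B: "k_algebra B" and C: "k_algebra C" and D: "k_algebra D"
    and f: "f \<in> algebra_homs A C" and g: "g \<in> algebra_homs B D"
  shows "tensor_map C D f g \<in> algebra_homs (A \<otimes>\<^sub>k B) (C \<otimes>\<^sub>k D)"
proof -
  note fl = algebra_homsD(1)[OF f] and gl = algebra_homsD(1)[OF g]
  note tm = tensor_map_linear[OF k_algebraD(2)[OF A] k_algebraD(2)[OF B] k_algebraD(2)[OF C] k_algebraD(2)[OF D] fl gl]
  show ?thesis
    by (intro tensor_algebra_homI A B k_algebra_tensor C D tm)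
      (auto simp: tm k_algebraD[OF A] k_algebraD[OF B] algebra_homsD[OF f] algebra_homsD[OF g]
        tensor_mult_pure[OF C D] tensor_one[OF C D] linear_mapsD(1)[OF fl] linear_mapsD(1)[OF gl])
qed

lemma id_algebra_hom: "id \<in> algebra_homs A A"
  by (intro algebra_homsI linear_map_id) auto

lemma tensor_assoc_linear:
  assumes M: "vspace M" and N: "vspace N" and L: "vspace L"
  shows "tensor_assoc M N L \<in> linear_maps ((M \<otimes>\<^sub>k N) \<otimes>\<^sub>k L) (M \<otimes>\<^sub>k (N \<otimes>\<^sub>k L))"
    and "x \<in> carrier M \<Longrightarrow> y \<in> carrier N \<Longrightarrow> l \<in> carrier L \<Longrightarrow>
      tensor_assoc M N L (pure (M \<otimes>\<^sub>k N) L (pure M N x y) l)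
        = pure M (N \<otimes>\<^sub>k L) x (pure N L y l)"
proof -
  let ?T = "M \<otimes>\<^sub>k (N \<otimes>\<^sub>k L)"
  note NL = tensor_vspace[OF N L] and MN = tensor_vspace[OF M N]
  note T = tensor_vspace[OF M NL]
  have b1: "bilinear M N ?T (\<lambda>x y. pure M (N \<otimes>\<^sub>k L) x (pure N L y l))" if "l \<in> carrier L" for l
    using bilinear_compose[OF pure_bilinear[OF M NL] linear_map_id(1)
        bilinear_linear(1)[OF pure_bilinear[OF N L] that] linear_map_id(1)] .
  have b2: "(\<lambda>l. pure M (N \<otimes>\<^sub>k L) x (pure N L y l)) \<in> linear_maps L ?T"
    if "x \<in> carrier M" "y \<in> carrier N" for x y
    using linear_map_comp[OF bilinear_linear(2)[OF pure_bilinear[OF N L] that(2)]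
        bilinear_linear(2)[OF pure_bilinear[OF M NL] that(1)]] .
  have b: "bilinear (M \<otimes>\<^sub>k N) L ?T
      (\<lambda>z l. tensor_lift ?T (\<lambda>x y. pure M (N \<otimes>\<^sub>k L) x (pure N L y l)) z)"
    by (rule tensor_lift_parametric[OF M N L T b1 b2])
  have eq: "tensor_assoc M N L
      = tensor_lift ?T (\<lambda>z l. tensor_lift ?T (\<lambda>x y. pure M (N \<otimes>\<^sub>k L) x (pure N L y l)) z)"
    by (simp add: tensor_assoc_def Let_def)
  show "tensor_assoc M N L \<in> linear_maps ((M \<otimes>\<^sub>k N) \<otimes>\<^sub>k L) ?T"
    unfolding eq by (rule tensor_lift_linear[OF MN L T b])
  show "tensor_assoc M N L (pure (M \<otimes>\<^sub>k N) L (pure M N x y) l) = pure M (N \<otimes>\<^sub>k L) x (pure N L y l)"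
    if "x \<in> carrier M" "y \<in> carrier N" "l \<in> carrier L"
    unfolding eq using that pure_simps(1)[OF M N]
    by (simp add: tensor_lift_pure[OF MN L T b] tensor_lift_pure[OF M N T b1])
qed

lemma tensor_assoc_algebra_hom:
  assumes A: "k_algebra A" and B: "k_algebra B" and C: "k_algebra C"
  shows "tensor_assoc A B C \<in> algebra_homs ((A \<otimes>\<^sub>k B) \<otimes>\<^sub>k C) (A \<otimes>\<^sub>k (B \<otimes>\<^sub>k C))"
proof -
  let ?T = "A \<otimes>\<^sub>k (B \<otimes>\<^sub>k C)"
  note AB = k_algebra_tensor[OF A B] and BC = k_algebra_tensor[OF B C]
  note T = k_algebra_tensor[OF A BC] and S = k_algebra_tensor[OF AB C]
  note vA = k_algebraD(2)[OF A] and vB = k_algebraD(2)[OF B] and vC = k_algebraD(2)[OF C]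
  note vT = k_algebraD(2)[OF T] and vAB = k_algebraD(2)[OF AB]
  let ?f = "tensor_assoc A B C"
  note f = tensor_assoc_linear[OF vA vB vC]
  have mult: "?f (pure (A \<otimes>\<^sub>k B) C (z \<otimes>\<^bsub>A \<otimes>\<^sub>k B\<^esub> w) (c \<otimes>\<^bsub>C\<^esub> d))
      = ?f (pure (A \<otimes>\<^sub>k B) C z c) \<otimes>\<^bsub>?T\<^esub> ?f (pure (A \<otimes>\<^sub>k B) C w d)"
    if "z \<in> carrier (A \<otimes>\<^sub>k B)" and cd: "c \<in> carrier C" "d \<in> carrier C" and w: "w \<in> carrier (A \<otimes>\<^sub>k B)"
    for z w c d
  proof -
    have cd': "c \<otimes>\<^bsub>C\<^esub> d \<in> carrier C" using cd by (simp add: k_algebraD[OF C])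
    note [simp] = linear_mapsD[OF f(1)] linear_map_zero[OF f(1) k_algebraD(2)[OF S] vT] pure_simps(1)[OF vA vB]
      pure_simps(1)[OF vB vC] pure_simps(1)[OF vA k_algebraD(2)[OF BC]] k_algebraD[OF A] k_algebraD[OF B] k_algebraD[OF C] k_algebraD[OF AB] k_algebraD[OF T] cd cd'
      pure_simps[OF vAB vC] pure_zero[OF vAB vC] f(2) tensor_mult_pure[OF A B] tensor_mult_pure[OF A BC]
      tensor_mult_pure[OF B C]
    from vA vB that(1) show ?thesis
    proof (induction rule: tensor_inducts)
      case ab: (pure a b)
      from vA vB w show ?case
        by (induction rule: tensor_inducts) (use ab in simp_all)
    qed (use w in simp_all)
  qed
  show ?thesis
    by (intro tensor_algebra_homI AB C T f mult)
      (simp_all add: tensor_one[OF A B] f k_algebraD[OF A] k_algebraD[OF B] k_algebraD[OF C]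
        tensor_one[OF A BC] tensor_one[OF B C])
qed

subsection \<open>Separating evaluations\<close>

text \<open>Lists of pairs represent tensors, so that a tensor can be treated by induction on the
  number of its terms.\<close>

definition tensor_sum :: "('k::field, 'a, 'm) module_scheme \<Rightarrow> ('k, 'b, 'n) module_scheme \<Rightarrow>
    ('a \<times> 'b) list \<Rightarrow> ('a \<times> 'b \<Rightarrow>\<^sub>0 'k) set" where
  "tensor_sum M N L = foldr (\<lambda>(a, b) z. pure M N a b \<oplus>\<^bsub>M \<otimes>\<^sub>k N\<^esub> z) L \<zero>\<^bsub>M \<otimes>\<^sub>k N\<^esub>"

lemma tensor_sum_simps [simp]:
  "tensor_sum M N [] = \<zero>\<^bsub>M \<otimes>\<^sub>k N\<^esub>"
  "tensor_sum M N ((a, b) # L) = pure M N a b \<oplus>\<^bsub>M \<otimes>\<^sub>k N\<^esub> tensor_sum M N L"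
  by (simp_all add: tensor_sum_def)

lemma tensor_sum_closed:
  assumes "vspace M" "vspace N" "set L \<subseteq> carrier M \<times> carrier N"
  shows "tensor_sum M N L \<in> carrier (M \<otimes>\<^sub>k N)"
  using assms(3)
  by (induction L)
    (auto simp: pure_simps[OF assms(1,2)] vspace_add_simps[OF tensor_vspace[OF assms(1,2)]])

lemma tensor_sum_append:
  assumes "vspace M" "vspace N" "set L \<subseteq> carrier M \<times> carrier N" "set L' \<subseteq> carrier M \<times> carrier N"
  shows "tensor_sum M N (L @ L') = tensor_sum M N L \<oplus>\<^bsub>M \<otimes>\<^sub>k N\<^esub> tensor_sum M N L'"
  using assms(3)
  by (induction L)
    (auto simp: pure_simps[OF assms(1,2)] vspace_add_simps(1-7)[OF tensor_vspace[OF assms(1,2)]]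
      tensor_sum_closed[OF assms(1,2)] assms(4))

lemma tensor_as_sum:
  assumes M: "vspace M" and N: "vspace N" and z: "z \<in> carrier (M \<otimes>\<^sub>k N)"
  obtains L where "set L \<subseteq> carrier M \<times> carrier N" "z = tensor_sum M N L"
proof -
  have "\<exists>L. set L \<subseteq> carrier M \<times> carrier N \<and> z = tensor_sum M N L"
    using M N z
  proof (induction rule: tensor_inducts)
    case zero
    show ?case by (intro exI[of _ "[]"]) simp
  next
    case (pure x y)
    then show ?case
      by (intro exI[of _ "[(x, y)]"])
        (simp add: vspace_add_simps[OF tensor_vspace[OF M N]] pure_simps[OF M N])
  next
    case (add u v)
    then obtain L L' where "set L \<subseteq> carrier M \<times> carrier N" "u = tensor_sum M N L"
      "set L' \<subseteq> carrier M \<times> carrier N" "v = tensor_sum M N L'" by auto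
    then show ?case
      by (intro exI[of _ "L @ L'"]) (simp add: tensor_sum_append[OF M N])
  qed
  then show ?thesis using that by blast
qed

lemma linear_map_tensor_sum:
  assumes M: "vspace M" and N: "vspace N" and f: "f \<in> linear_maps (M \<otimes>\<^sub>k N) base_field"
    and L: "set L \<subseteq> carrier M \<times> carrier N"
  shows "f (tensor_sum M N L) = (\<Sum>(a, b)\<leftarrow>L. f (pure M N a b))"
  using L
proof (induction L)
  case Nil
  show ?case using linear_map_zero[OF f tensor_vspace[OF M N] vspace_base_field] by simp
next
  case (Cons ab L)
  then show ?case
    using linear_mapsD(2)[OF f pure_simps(1)[OF M N] tensor_sum_closed[OF M N]] by (cases ab) auto
qed

text \<open>The elements of \<open>M\<close> are determined by their values \<open>e a x\<close>.
  Regular functions are separated by the points of the group and distributions by the regular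
  functions. As this passes to tensor products, identities between tensors of functions or of
  distributions become identities between values.\<close>

definition separates :: "('a \<Rightarrow> 'x \<Rightarrow> 'k::field) \<Rightarrow> 'x set \<Rightarrow> ('k, 'a, 'm) module_scheme \<Rightarrow> bool" where
  "separates e X M \<longleftrightarrow> (\<forall>x\<in>X. (\<lambda>a. e a x) \<in> linear_maps M base_field) \<and>
     (\<forall>a\<in>carrier M. (\<forall>x\<in>X. e a x = 0) \<longrightarrow> a = \<zero>\<^bsub>M\<^esub>)"

lemma separatesD:
  assumes "separates e X M"
  shows "x \<in> X \<Longrightarrow> (\<lambda>a. e a x) \<in> linear_maps M base_field"
    and "a \<in> carrier M \<Longrightarrow> (\<And>x. x \<in> X \<Longrightarrow> e a x = 0) \<Longrightarrow> a = \<zero>\<^bsub>M\<^esub>"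
  using assms unfolding separates_def by blast+

lemma separates_eq:
  assumes "vspace M" "separates e X M" "a \<in> carrier M" "b \<in> carrier M" "\<And>x. x \<in> X \<Longrightarrow> e a x = e b x"
  shows "a = b"
proof -
  interpret abelian_group M by (rule vspace_abelian_group[OF assms(1)])
  have "a \<ominus>\<^bsub>M\<^esub> b = \<zero>\<^bsub>M\<^esub>"
    using assms(3-5) linear_map_minus[OF separatesD(1)[OF assms(2)] assms(1) vspace_base_field]
    by (intro separatesD(2)[OF assms(2)]) simp_all
  then have "(a \<ominus>\<^bsub>M\<^esub> b) \<oplus>\<^bsub>M\<^esub> b = b" using assms(4) by simp
  then show ?thesis using assms(3,4) by (simp add: a_minus_def a_assoc l_neg)
qed

lemma mult_bilinear_base: "bilinear base_field base_field base_field (*)"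
  by (intro bilinear_overI) (auto simp: algebra_simps)

lemma evaluation_bilinear:
  assumes "f \<in> linear_maps M base_field" "g \<in> linear_maps N base_field"
  shows "bilinear M N base_field (\<lambda>a b. f a * g b)"
  using bilinear_compose[OF mult_bilinear_base assms linear_map_id(1)] .

text \<open>A term \<open>x \<otimes> s\<close> whose second entry is a combination of the second
  entries of the other terms can be distributed over them, which shortens the list by one. Linear
  functionals are applied to \<open>s\<close> in order to recognise it.\<close>

lemma tensor_sum_absorb:
  assumes M: "vspace M" and N: "vspace N" and x: "x \<in> carrier N"
    and L: "set L \<subseteq> carrier N \<times> carrier M"
  shows "\<exists>s\<in>carrier M. (\<forall>f\<in>linear_maps M base_field. f s = (\<Sum>(a, b)\<leftarrow>L. c a * f b)) \<and>
    pure N M x s \<oplus>\<^bsub>N \<otimes>\<^sub>k M\<^esub> tensor_sum N M L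
      = tensor_sum N M (map (\<lambda>(a, b). (a \<oplus>\<^bsub>N\<^esub> c a \<odot>\<^bsub>N\<^esub> x, b)) L)"
  using L
proof (induction L)
  case Nil
  show ?case
    by (intro bexI[of _ "\<zero>\<^bsub>M\<^esub>"] conjI ballI)
      (simp_all add: linear_map_zero[OF _ M vspace_base_field] pure_zero[OF N M] x
        vspace_add_simps(2,3)[OF tensor_vspace[OF N M]] vspace_add_simps(2)[OF M])
next
  case (Cons ab L)
  obtain a b where ab: "ab = (a, b)" by (cases ab)
  have a: "a \<in> carrier N" and b: "b \<in> carrier M" and LN: "set L \<subseteq> carrier N \<times> carrier M"
    using Cons.prems by (auto simp: ab)
  from Cons.IH[OF LN] obtain s where s: "s \<in> carrier M"
    and sf: "\<And>f. f \<in> linear_maps M base_field \<Longrightarrow> f s = (\<Sum>(a, b)\<leftarrow>L. c a * f b)"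
    and sT: "pure N M x s \<oplus>\<^bsub>N \<otimes>\<^sub>k M\<^esub> tensor_sum N M L
        = tensor_sum N M (map (\<lambda>(a, b). (a \<oplus>\<^bsub>N\<^esub> c a \<odot>\<^bsub>N\<^esub> x, b)) L)" by auto
  interpret T: abelian_group "N \<otimes>\<^sub>k M" by (rule vspace_abelian_group[OF tensor_vspace[OF N M]])
  note cl = pure_simps(1)[OF N M] tensor_sum_closed[OF N M LN] vspace_simps(1)[OF N]
    vspace_simps(1)[OF M] a b x s vspace_simps(1)[OF tensor_vspace[OF N M]]
  show ?case
  proof (intro bexI[of _ "c a \<odot>\<^bsub>M\<^esub> b \<oplus>\<^bsub>M\<^esub> s"] conjI ballI)
    show "f (c a \<odot>\<^bsub>M\<^esub> b \<oplus>\<^bsub>M\<^esub> s) = (\<Sum>(a, b)\<leftarrow>ab # L. c a * f b)"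
      if "f \<in> linear_maps M base_field" for f
      using linear_mapsD[OF that] s sf[OF that] b by (simp add: ab vspace_simps(1)[OF M])
    have "pure N M x (c a \<odot>\<^bsub>M\<^esub> b \<oplus>\<^bsub>M\<^esub> s) \<oplus>\<^bsub>N \<otimes>\<^sub>k M\<^esub> tensor_sum N M (ab # L)
        = (pure N M a b \<oplus>\<^bsub>N \<otimes>\<^sub>k M\<^esub> c a \<odot>\<^bsub>N \<otimes>\<^sub>k M\<^esub> pure N M x b) \<oplus>\<^bsub>N \<otimes>\<^sub>k M\<^esub>
          (pure N M x s \<oplus>\<^bsub>N \<otimes>\<^sub>k M\<^esub> tensor_sum N M L)"
      using cl by (simp add: ab pure_simps(2-)[OF N M] T.a_ac)
    then show "pure N M x (c a \<odot>\<^bsub>M\<^esub> b \<oplus>\<^bsub>M\<^esub> s) \<oplus>\<^bsub>N \<otimes>\<^sub>k M\<^esub> tensor_sum N M (ab # L)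
        = tensor_sum N M (map (\<lambda>(a, b). (a \<oplus>\<^bsub>N\<^esub> c a \<odot>\<^bsub>N\<^esub> x, b)) (ab # L))"
      using cl by (simp add: ab pure_simps(2-)[OF N M] sT)
  qed (use s b in \<open>auto simp: vspace_simps[OF M] vspace_add_simps[OF M]\<close>)
qed

text \<open>Suppose that a list of terms has only zero values. Evaluating the first factor at a point
  where the leading first entry does not vanish expresses the leading second entry through the other
  second entries, so that the leading term can be absorbed and the list becomes shorter.\<close>

lemma separates_tensor:
  assumes M: "vspace M" and N: "vspace N" and eM: "separates e X M" and eN: "separates e' Y N"
  shows "separates (\<lambda>Z (x, y). tensor_lift base_field (\<lambda>a b. e a x * e' b y) Z) (X \<times> Y) (M \<otimes>\<^sub>k N)"
proof -
  have b: "bilinear M N base_field (\<lambda>a b. e a x * e' b y)" if "x \<in> X" "y \<in> Y" for x y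
    using evaluation_bilinear[OF separatesD(1)[OF eM that(1)] separatesD(1)[OF eN that(2)]] .
  note lin = tensor_lift_linear[OF M N vspace_base_field b]
  note lp = tensor_lift_pure[OF M N vspace_base_field b]
  have val: "tensor_lift base_field (\<lambda>a b. e a x * e' b y) (tensor_sum M N L) = (\<Sum>(a, b)\<leftarrow>L. e a x * e' b y)"
    if "x \<in> X" "y \<in> Y" "set L \<subseteq> carrier M \<times> carrier N" for x y L
  proof -
    have "map (\<lambda>(a, b). tensor_lift base_field (\<lambda>a b. e a x * e' b y) (pure M N a b)) L
        = map (\<lambda>(a, b). e a x * e' b y) L"
      using that(3) lp[OF that(1,2)] by (intro map_cong refl) auto
    then show ?thesis unfolding linear_map_tensor_sum[OF M N lin[OF that(1,2)] that(3)]
      by (rule arg_cong)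
  qed
  have zero: "tensor_sum M N L = \<zero>\<^bsub>M \<otimes>\<^sub>k N\<^esub>"
    if "set L \<subseteq> carrier M \<times> carrier N"
      "\<And>x y. x \<in> X \<Longrightarrow> y \<in> Y \<Longrightarrow> (\<Sum>(a, b)\<leftarrow>L. e a x * e' b y) = 0" for L
    using that
  proof (induction "length L" arbitrary: L)
    case 0
    then show ?case by simp
  next
    case (Suc n)
    obtain a b L' where L: "L = (a, b) # L'" and n: "length L' = n"
      using Suc.hyps(2) by (cases L) auto
    have ab: "a \<in> carrier M" "b \<in> carrier N" and L': "set L' \<subseteq> carrier M \<times> carrier N"
      using Suc.prems(1) L by auto
    show ?case
    proof (cases "\<forall>x\<in>X. e a x = 0")
      case True
      then have a: "a = \<zero>\<^bsub>M\<^esub>" using separatesD(2)[OF eM ab(1)] by simp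
      have "tensor_sum M N L' = \<zero>\<^bsub>M \<otimes>\<^sub>k N\<^esub>"
        using Suc.prems(2) True by (intro Suc.hyps(1) L' n[symmetric]) (auto simp: L)
      then show ?thesis using a ab
        by (simp add: L pure_zero[OF M N] vspace_add_simps[OF tensor_vspace[OF M N]])
    next
      case False
      then obtain x0 where x0: "x0 \<in> X" "e a x0 \<noteq> 0" by blast
      (* the values at x0 and an arbitrary point say that b is the sum of the c a' times b' over the
         other terms (a', b') *)
      define c where "c a' = - e a' x0 / e a x0" for a'
      from tensor_sum_absorb[OF N M ab(1) L', of c] obtain s where s: "s \<in> carrier N"
        "\<And>f. f \<in> linear_maps N base_field \<Longrightarrow> f s = (\<Sum>(a, b)\<leftarrow>L'. c a * f b)"
        and sT: "pure M N a s \<oplus>\<^bsub>M \<otimes>\<^sub>k N\<^esub> tensor_sum M N L'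
          = tensor_sum M N (map (\<lambda>(a', b). (a' \<oplus>\<^bsub>M\<^esub> c a' \<odot>\<^bsub>M\<^esub> a, b)) L')" by auto
      have "b = s"
      proof (rule separates_eq[OF N eN ab(2) s(1)])
        fix y assume y: "y \<in> Y"
        have "(\<Sum>(a', b')\<leftarrow>L'. c a' * e' b' y) = - (\<Sum>(a', b')\<leftarrow>L'. e a' x0 * e' b' y) / e a x0"
          by (induction L') (auto simp: c_def add_divide_distrib diff_divide_distrib)
        also have "\<dots> = e' b y" using Suc.prems(2)[OF x0(1) y] x0(2)
          by (simp add: L field_simps neg_eq_iff_add_eq_0 add.commute)
        finally show "e' b y = e' s y" using s(2)[OF separatesD(1)[OF eN y]] by simp
      qed
      define L'' where "L'' = map (\<lambda>(a', b). (a' \<oplus>\<^bsub>M\<^esub> c a' \<odot>\<^bsub>M\<^esub> a, b)) L'"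
      have L'': "set L'' \<subseteq> carrier M \<times> carrier N"
        using L' ab(1) by (auto simp: L''_def vspace_simps[OF M] vspace_add_simps[OF M])
      have eq: "tensor_sum M N L = tensor_sum M N L''" using sT \<open>b = s\<close> by (simp add: L L''_def)
      have "tensor_sum M N L'' = \<zero>\<^bsub>M \<otimes>\<^sub>k N\<^esub>"
      proof (rule Suc.hyps(1)[OF _ L''])
        show "n = length L''" using n by (simp add: L''_def)
        fix x y assume "x \<in> X" "y \<in> Y"
        then show "(\<Sum>(a, b)\<leftarrow>L''. e a x * e' b y) = 0"
          using val[OF _ _ L''] val[OF _ _ Suc.prems(1)] Suc.prems(2) eq by metis
      qed
      then show ?thesis using eq by simp
    qed
  qed
  show ?thesis unfolding separates_def
  proof (intro conjI ballI impI)
    fix xy assume "xy \<in> X \<times> Y"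
    then show "(\<lambda>Z. case xy of (x, y) \<Rightarrow> tensor_lift base_field (\<lambda>a b. e a x * e' b y) Z)
        \<in> linear_maps (M \<otimes>\<^sub>k N) base_field"
      using lin by auto
  next
    fix Z assume Z: "Z \<in> carrier (M \<otimes>\<^sub>k N)"
      "\<forall>xy\<in>X \<times> Y. (case xy of (x, y) \<Rightarrow> tensor_lift base_field (\<lambda>a b. e a x * e' b y) Z) = 0"
    obtain L where L: "set L \<subseteq> carrier M \<times> carrier N" "Z = tensor_sum M N L"
      using tensor_as_sum[OF M N Z(1)] .
    show "Z = \<zero>\<^bsub>M \<otimes>\<^sub>k N\<^esub>" unfolding L(2)
      using Z(2) val[OF _ _ L(1)] L(2) by (intro zero L(1)) auto
  qed
qed

section \<open>The tensor algebra\<close>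

lemma word_monoid_simps [simp]:
  "carrier (word_monoid X) = lists X" "u \<otimes>\<^bsub>word_monoid X\<^esub> v = u @ v" "\<one>\<^bsub>word_monoid X\<^esub> = []"
  by (simp_all add: word_monoid_def)

lemma word_monoid_monoid: "Group.monoid (word_monoid X)"
  by (intro monoidI) auto

context
  fixes V :: "('k::field, 'a, 'm) module_scheme"
  assumes V: "vspace V"
begin

interpretation scalars "base_field :: ('k, 'k) module" by (rule scalars_base_field)

lemma free_algebra_k_algebra: "k_algebra (free_algebra V)"
  unfolding free_algebra_def by (rule k_algebra_monoid_algebra[OF word_monoid_monoid])

lemma free_algebra_letter:
  "x \<in> carrier V \<Longrightarrow> Poly_Mapping.single [x] c \<in> carrier (free_algebra V)"
  unfolding free_algebra_def by (rule single_in_carrier) auto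

lemma free_algebra_minus:
  "s \<in> carrier (free_algebra V) \<Longrightarrow> t \<in> carrier (free_algebra V) \<Longrightarrow>
    s \<ominus>\<^bsub>free_algebra V\<^esub> t = s - t \<and> s - t \<in> carrier (free_algebra V)"
  using vspace_add_simps(6)[OF k_algebraD(2)[OF free_algebra_k_algebra], of s t]
  unfolding free_algebra_def by (simp add: monoid_algebra_minus)

lemma linearity_relators_carrier: "linearity_relators V \<subseteq> carrier (free_algebra V)"
  unfolding linearity_relators_def
  by (auto intro!: free_algebra_minus[THEN conjunct2] free_algebra_letter
      simp: vspace_simps[OF V] vspace_add_simps[OF V])

lemma linearity_ideal_ideal: "ideal (linearity_ideal V) (free_algebra V)"
  unfolding linearity_ideal_def
  by (rule ring.genideal_ideal[OF k_algebraD(1)[OF free_algebra_k_algebra] linearity_relators_carrier])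

lemma tensor_algebra_k_algebra: "k_algebra (tensor_algebra V)"
  unfolding tensor_algebra_def
  by (rule k_algebra_quotient[OF free_algebra_k_algebra linearity_ideal_ideal])

interpretation Q: module_quotient base_field "free_algebra V" "linearity_ideal V"
  by (rule ideal_module_quotient[OF free_algebra_k_algebra linearity_ideal_ideal])

lemma tensor_algebra_incl_linear: "tensor_algebra_incl V \<in> linear_maps V (tensor_algebra V)"
proof (rule linear_mapsI)
  note R = ring.genideal_self[OF k_algebraD(1)[OF free_algebra_k_algebra] linearity_relators_carrier]
  note [simp] = free_algebra_letter vspace_simps(1)[OF V] vspace_add_simps(1)[OF V]
  have eqI: "linearity_ideal V +>\<^bsub>free_algebra V\<^esub> s = linearity_ideal V +>\<^bsub>free_algebra V\<^esub> t"
    if "s \<in> carrier (free_algebra V)" "t \<in> carrier (free_algebra V)" "s - t \<in> linearity_relators V" for s t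
    unfolding Q.quotient_eq_iff[OF that(1,2)]
    using that R by (auto simp: free_algebra_minus linearity_ideal_def)
  have add: "s \<oplus>\<^bsub>free_algebra V\<^esub> t = s + t" and sm: "c \<odot>\<^bsub>free_algebra V\<^esub> s = Poly_Mapping.map ((*) c) s"
    for s t c by (simp_all add: free_algebra_def)
  have cl: "s + t \<in> carrier (free_algebra V)"
    if "s \<in> carrier (free_algebra V)" "t \<in> carrier (free_algebra V)" for s t
    using vspace_add_simps(1)[OF k_algebraD(2)[OF free_algebra_k_algebra] that] by (simp add: add)
  fix x assume x: "x \<in> carrier V"
  show "tensor_algebra_incl V x \<in> carrier (tensor_algebra V)"
    using x by (simp add: tensor_algebra_incl_def tensor_algebra_def Q.quotient_carrier)
  show "tensor_algebra_incl V (x \<oplus>\<^bsub>V\<^esub> y)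
      = tensor_algebra_incl V x \<oplus>\<^bsub>tensor_algebra V\<^esub> tensor_algebra_incl V y" if y: "y \<in> carrier V" for y
    unfolding tensor_algebra_incl_def tensor_algebra_def using x y
    by (subst Q.quotient_add, simp, simp, intro eqI, simp, simp add: add cl)
      (auto simp: linearity_relators_def add diff_diff_eq[symmetric])
  show "tensor_algebra_incl V (c \<odot>\<^bsub>V\<^esub> x) = c \<odot>\<^bsub>tensor_algebra V\<^esub> tensor_algebra_incl V x" for c
    unfolding tensor_algebra_incl_def tensor_algebra_def using x
    by (subst Q.quotient_smult, simp, simp, intro eqI, simp, simp add: sm map_mult_simps)
      (auto simp: linearity_relators_def sm map_mult_simps)
qed

lemma tensor_algebra_induct [consumes 1, case_names one letter smult add]:
  assumes "z \<in> carrier (tensor_algebra V)"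
    and "Q \<one>\<^bsub>tensor_algebra V\<^esub>"
    and "\<And>x z. x \<in> carrier V \<Longrightarrow> z \<in> carrier (tensor_algebra V) \<Longrightarrow> Q z \<Longrightarrow>
      Q (tensor_algebra_incl V x \<otimes>\<^bsub>tensor_algebra V\<^esub> z)"
    and "\<And>c z. z \<in> carrier (tensor_algebra V) \<Longrightarrow> Q z \<Longrightarrow> Q (c \<odot>\<^bsub>tensor_algebra V\<^esub> z)"
    and "\<And>y z. y \<in> carrier (tensor_algebra V) \<Longrightarrow> z \<in> carrier (tensor_algebra V) \<Longrightarrow> Q y \<Longrightarrow> Q z \<Longrightarrow>
      Q (y \<oplus>\<^bsub>tensor_algebra V\<^esub> z)"
  shows "Q z"
proof -
  let ?cl = "\<lambda>t. linearity_ideal V +>\<^bsub>free_algebra V\<^esub> t"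
  have clT: "?cl t \<in> carrier (tensor_algebra V)" if "t \<in> carrier (free_algebra V)" for t
    using that by (simp add: tensor_algebra_def Q.quotient_carrier)
  have sc: "Poly_Mapping.single w c \<in> carrier (free_algebra V)" if "w \<in> lists (carrier V)" for w c
    using that unfolding free_algebra_def by (intro single_in_carrier) auto
  have word: "Q (?cl (Poly_Mapping.single w 1))" if "w \<in> lists (carrier V)" for w
    using that
  proof (induction w)
    case Nil
    show ?case using assms(2) by (simp add: tensor_algebra_def quotient_algebra_one free_algebra_def)
  next
    case (Cons x w)
    have "?cl (Poly_Mapping.single (x # w) 1)
        = tensor_algebra_incl V x \<otimes>\<^bsub>tensor_algebra V\<^esub> ?cl (Poly_Mapping.single w 1)"
      using Cons unfolding tensor_algebra_incl_def tensor_algebra_def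
      by (subst quotient_algebra_mult[OF free_algebra_k_algebra linearity_ideal_ideal])
        (simp_all add: sc, simp add: free_algebra_def monoid_algebra_mult_single)
    then show ?case using Cons assms(3) clT sc by simp
  qed
  have "Q (?cl t)" if "t \<in> carrier (free_algebra V)" for t
    using that[unfolded free_algebra_def]
  proof (induction rule: monoid_algebra_induct)
    case zero
    have "?cl 0 = (0 :: 'k) \<odot>\<^bsub>tensor_algebra V\<^esub> \<one>\<^bsub>tensor_algebra V\<^esub>"
      using vspace_simps(6)[OF k_algebraD(2)[OF tensor_algebra_k_algebra]]
        k_algebraD(8)[OF tensor_algebra_k_algebra]
      by (simp add: tensor_algebra_def Q.quotient_zero) (simp add: free_algebra_def)
    then show ?case using assms(2,4) k_algebraD(8)[OF tensor_algebra_k_algebra] by simp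
  next
    case (single w c)
    have "?cl (Poly_Mapping.single w c) = c \<odot>\<^bsub>tensor_algebra V\<^esub> ?cl (Poly_Mapping.single w 1)"
      using single unfolding tensor_algebra_def
      by (subst Q.quotient_smult) (simp_all add: sc, simp add: free_algebra_def map_mult_simps)
    then show ?case using single word assms(4) clT sc by simp
  next
    case (add s t)
    have "?cl (s + t) = ?cl s \<oplus>\<^bsub>tensor_algebra V\<^esub> ?cl t"
      using add(1,2)[folded free_algebra_def] unfolding tensor_algebra_def
      by (subst Q.quotient_add) (simp_all, simp add: free_algebra_def)
    then show ?case using add assms(5) clT by (simp add: free_algebra_def)
  qed
  then show ?thesis using assms(1) by (auto simp: tensor_algebra_def Q.quotient_carrier)
qed

lemma tensor_algebra_lift_hom:
  assumes B: "k_algebra B" and phi: "\<phi> \<in> linear_maps V B"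
  shows "tensor_algebra_lift B \<phi> \<in> algebra_homs (tensor_algebra V) B"
    and "x \<in> carrier V \<Longrightarrow> tensor_algebra_lift B \<phi> (tensor_algebra_incl V x) = \<phi> x"
proof -
  let ?chi = "\<lambda>w. foldr (\<lambda>x b. \<phi> x \<otimes>\<^bsub>B\<^esub> b) w \<one>\<^bsub>B\<^esub>"
  let ?f = "linear_extension B ?chi"
  note mB = k_algebraD[OF B] and lin = linear_mapsD[OF phi]
  have chi: "?chi w \<in> carrier B" if "w \<in> lists (carrier V)" for w
    using that by (induction w) (auto simp: mB lin)
  have chi_mult: "?chi (u @ v) = ?chi u \<otimes>\<^bsub>B\<^esub> ?chi v" if "u \<in> lists (carrier V)" "v \<in> lists (carrier V)" for u v
    using that(1)
  proof (induction u)
    case Nil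
    then show ?case using chi[OF that(2)] by (simp add: mB)
  next
    case (Cons a u)
    then have "?chi u \<in> carrier B" "\<phi> a \<in> carrier B" using chi lin by auto
    then show ?case using Cons chi[OF that(2)] by (simp add: mB)
  qed
  have f: "?f \<in> algebra_homs (free_algebra V) B"
    unfolding free_algebra_def
    using chi chi_mult by (intro linear_extension_algebra_hom word_monoid_monoid B) auto
  have letter: "?f (Poly_Mapping.single [x] c) = c \<odot>\<^bsub>B\<^esub> \<phi> x" if "x \<in> carrier V" for x c
    using linear_extension_simps(3)[OF mB(2), of "word_monoid (carrier V)" ?chi "[x]" c] chi that
    by (simp add: mB lin)
  note diff = linear_map_minus[OF algebra_homsD(1)[OF f] k_algebraD(2)[OF free_algebra_k_algebra] mB(2)]
  interpret B: abelian_group B by (rule mB(4))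
  have neg: "p \<oplus>\<^bsub>B\<^esub> q \<ominus>\<^bsub>B\<^esub> p \<ominus>\<^bsub>B\<^esub> q = \<zero>\<^bsub>B\<^esub>" if "p \<in> carrier B" "q \<in> carrier B" for p q
    using that vspace_add_simps(9)[OF mB(2), of "p \<oplus>\<^bsub>B\<^esub> q"]
    by (simp_all add: a_minus_def B.minus_add B.a_assoc)
  have rel: "?f s = \<zero>\<^bsub>B\<^esub>" if "s \<in> linearity_relators V" for s
    using that unfolding linearity_relators_def
  proof (elim UnE CollectE exE conjE)
    fix x y assume *: "x \<in> carrier V" "y \<in> carrier V"
      and s: "s = Poly_Mapping.single [x \<oplus>\<^bsub>V\<^esub> y] 1 - Poly_Mapping.single [x] 1 - Poly_Mapping.single [y] 1"
    have xy: "x \<oplus>\<^bsub>V\<^esub> y \<in> carrier V" using * by (simp add: vspace_add_simps[OF V])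
    have "s = (Poly_Mapping.single [x \<oplus>\<^bsub>V\<^esub> y] 1 \<ominus>\<^bsub>free_algebra V\<^esub> Poly_Mapping.single [x] 1)
        \<ominus>\<^bsub>free_algebra V\<^esub> Poly_Mapping.single [y] 1"
      using free_algebra_minus * xy by (simp add: s free_algebra_letter)
    show ?thesis unfolding \<open>s = _ \<ominus>\<^bsub>free_algebra V\<^esub> _\<close> using * xy
      by (simp add: diff free_algebra_letter letter lin vspace_simps[OF mB(2)] neg
          vspace_add_simps(6)[OF k_algebraD(2)[OF free_algebra_k_algebra]])
  next
    fix c x assume *: "x \<in> carrier V"
      and s: "s = Poly_Mapping.single [c \<odot>\<^bsub>V\<^esub> x] 1 - Poly_Mapping.single [x] c"
    have cx: "c \<odot>\<^bsub>V\<^esub> x \<in> carrier V" using * by (simp add: vspace_simps[OF V])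
    have "s = Poly_Mapping.single [c \<odot>\<^bsub>V\<^esub> x] 1 \<ominus>\<^bsub>free_algebra V\<^esub> Poly_Mapping.single [x] c"
      using free_algebra_minus * cx by (simp add: s free_algebra_letter)
    show ?thesis unfolding \<open>s = _ \<ominus>\<^bsub>free_algebra V\<^esub> _\<close> using * cx
      by (simp add: diff free_algebra_letter letter lin vspace_simps[OF mB(2)] vspace_add_simps(9)[OF mB(2)])
  qed
  have L: "quotient_lift ?f \<in> algebra_homs (tensor_algebra V) B"
    unfolding tensor_algebra_def linearity_ideal_def
    by (rule genideal_quotient_lift(1)[OF free_algebra_k_algebra B linearity_relators_carrier f])
      (rule rel)
  have L2: "quotient_lift ?f (linearity_ideal V +>\<^bsub>free_algebra V\<^esub> t) = ?f t"
    if "t \<in> carrier (free_algebra V)" for t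
    unfolding linearity_ideal_def
    by (rule genideal_quotient_lift(2)[OF free_algebra_k_algebra B linearity_relators_carrier f _ that])
      (rule rel)
  show "tensor_algebra_lift B \<phi> \<in> algebra_homs (tensor_algebra V) B"
    unfolding tensor_algebra_lift_def by (rule L)
  show "tensor_algebra_lift B \<phi> (tensor_algebra_incl V x) = \<phi> x" if "x \<in> carrier V"
    unfolding tensor_algebra_lift_def tensor_algebra_incl_def L2[OF free_algebra_letter[OF that]]
    using letter[OF that] that by (simp add: vspace_simps[OF mB(2)] lin)
qed

end

section \<open>The coordinate ring and the powers of the augmentation ideal\<close>

text \<open>Functions on the group and functionals on the coordinate ring are restricted to their
  domains. They are evaluated only at points that are known to belong to the domain, so that no case
  distinctions arise.\<close>

declare restrict_apply [simp del] restrict_apply' [simp]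

lemma function_algebra_simps [simp]:
  "carrier (function_algebra X) = X \<rightarrow>\<^sub>E UNIV"
  "f \<otimes>\<^bsub>function_algebra X\<^esub> g = (\<lambda>x\<in>X. f x * g x)" "\<one>\<^bsub>function_algebra X\<^esub> = (\<lambda>x\<in>X. 1)"
  "\<zero>\<^bsub>function_algebra X\<^esub> = (\<lambda>x\<in>X. 0)" "f \<oplus>\<^bsub>function_algebra X\<^esub> g = (\<lambda>x\<in>X. f x + g x)"
  "c \<odot>\<^bsub>function_algebra X\<^esub> f = (\<lambda>x\<in>X. c * f x)"
  by (simp_all add: function_algebra_def)

lemma function_space_vspace:
  fixes M :: "('k::field, 'x \<Rightarrow> 'k, 'm) module_scheme"
  assumes ext: "carrier M \<subseteq> extensional X"
    and ops: "\<And>f g. f \<oplus>\<^bsub>M\<^esub> g = (\<lambda>x\<in>X. f x + g x)" "\<zero>\<^bsub>M\<^esub> = (\<lambda>x\<in>X. 0)"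
      "\<And>c f. c \<odot>\<^bsub>M\<^esub> f = (\<lambda>x\<in>X. c * f x)"
    and closed: "(\<lambda>x\<in>X. 0) \<in> carrier M"
      "\<And>f g. f \<in> carrier M \<Longrightarrow> g \<in> carrier M \<Longrightarrow> (\<lambda>x\<in>X. f x + g x) \<in> carrier M"
      "\<And>c f. f \<in> carrier M \<Longrightarrow> (\<lambda>x\<in>X. c * f x) \<in> carrier M"
  shows "vspace M" "separates (\<lambda>f x. f x) X M"
proof -
  have eqI: "f = g" if "f \<in> extensional X" "g \<in> extensional X" "\<And>x. x \<in> X \<Longrightarrow> f x = g x" for f g :: "'x \<Rightarrow> 'k"
    using that by (rule extensionalityI)
  have ab: "abelian_group M"
  proof (intro abelian_groupI)
    fix f assume "f \<in> carrier M"
    then show "\<exists>g\<in>carrier M. g \<oplus>\<^bsub>M\<^esub> f = \<zero>\<^bsub>M\<^esub>"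
      using closed(3)[of f "- 1"] by (intro bexI[of _ "\<lambda>x\<in>X. - 1 * f x"]) (auto simp: ops cong: restrict_cong)
  qed (use ext in \<open>auto simp: ops closed algebra_simps intro!: eqI cong: restrict_cong\<close>)
  show V: "vspace M"
    using ext scalars.cring_R[OF scalars_base_field]
    by (intro moduleI ab) (auto simp: ops closed algebra_simps intro!: eqI)
  show "separates (\<lambda>f x. f x) X M"
    unfolding separates_def
    using ext by (auto intro!: linear_mapsI eqI simp: ops)
qed

lemma function_algebra_k_algebra: "k_algebra (function_algebra X)"
  by (intro k_algebraI monoidI function_space_vspace[where X = X])
    (auto intro!: extensionalityI[of _ X] simp: PiE_def algebra_simps)

lemma coord_ring_simps [simp]:
  "carrier (coord_ring G) = regular G"
  "f \<otimes>\<^bsub>coord_ring G\<^esub> g = (\<lambda>x\<in>carrier G. f x * g x)" "\<one>\<^bsub>coord_ring G\<^esub> = (\<lambda>x\<in>carrier G. 1)"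
  "\<zero>\<^bsub>coord_ring G\<^esub> = (\<lambda>x\<in>carrier G. 0)" "f \<oplus>\<^bsub>coord_ring G\<^esub> g = (\<lambda>x\<in>carrier G. f x + g x)"
  "c \<odot>\<^bsub>coord_ring G\<^esub> f = (\<lambda>x\<in>carrier G. c * f x)"
  by (simp_all add: coord_ring_def)

locale affine_group =
  fixes G :: "('g, 'k::field) alg_group"
  assumes affine: "affine_algebraic_group G"
begin

abbreviation "X \<equiv> carrier G"
abbreviation "A \<equiv> regular G"
abbreviation "C \<equiv> coord_ring G"

lemma group_G: "group G"
  using affine by (simp add: affine_algebraic_group_def)

sublocale group G by (rule group_G)

lemma regular_generated:
  obtains S where "finite S" "S \<subseteq> X \<rightarrow>\<^sub>E UNIV"
    "A = generate_ring (function_algebra X) (S \<union> range (\<lambda>c. \<lambda>x\<in>X. c))"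
  using affine by (auto simp: affine_algebraic_group_def)

lemma A_ext: "f \<in> A \<Longrightarrow> f \<in> extensional X"
proof -
  assume f: "f \<in> A"
  obtain S where S: "S \<subseteq> X \<rightarrow>\<^sub>E UNIV" "A = generate_ring (function_algebra X) (S \<union> range (\<lambda>c. \<lambda>x\<in>X. c))"
    by (rule regular_generated)
  have "S \<union> range (\<lambda>c. \<lambda>x\<in>X. c) \<subseteq> carrier (function_algebra X)" using S(1) by (auto simp: restrict_apply)
  then have "f \<in> carrier (function_algebra X)"
    using ring.generate_ring_in_carrier[OF k_algebraD(1)[OF function_algebra_k_algebra]] f
    unfolding S(2) by blast
  then show ?thesis by (simp add: PiE_def)
qed

lemma A_closed [simp]:
  "(\<lambda>x\<in>X. c) \<in> A"
  "f \<in> A \<Longrightarrow> g \<in> A \<Longrightarrow> (\<lambda>x\<in>X. f x + g x) \<in> A"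
  "f \<in> A \<Longrightarrow> g \<in> A \<Longrightarrow> (\<lambda>x\<in>X. f x * g x) \<in> A"
  "f \<in> A \<Longrightarrow> (\<lambda>x\<in>X. c * f x) \<in> A"
proof -
  obtain S where S: "A = generate_ring (function_algebra X) (S \<union> range (\<lambda>c. \<lambda>x\<in>X. c))"
    by (rule regular_generated)
  show const: "(\<lambda>x\<in>X. c) \<in> A" for c unfolding S by (intro generate_ring.incl) auto
  show "f \<in> A \<Longrightarrow> g \<in> A \<Longrightarrow> (\<lambda>x\<in>X. f x + g x) \<in> A"
    using generate_ring.eng_add[of f "function_algebra X" _ g] unfolding S by simp
  show mult: "f \<in> A \<Longrightarrow> g \<in> A \<Longrightarrow> (\<lambda>x\<in>X. f x * g x) \<in> A" for f g
    using generate_ring.eng_mult[of f "function_algebra X" _ g] unfolding S by simp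
  show "f \<in> A \<Longrightarrow> (\<lambda>x\<in>X. c * f x) \<in> A"
    using mult[OF const[of c], of f] by (simp cong: restrict_cong)
qed

lemma A_diff [simp]: "f \<in> A \<Longrightarrow> g \<in> A \<Longrightarrow> (\<lambda>x\<in>X. f x - g x) \<in> A"
  using A_closed(2)[OF _ A_closed(4)[of g "- 1"], of f] by (simp cong: restrict_cong)

lemma A_lin: "f \<in> A \<Longrightarrow> g \<in> A \<Longrightarrow> (\<lambda>x\<in>X. f x + c * g x) \<in> A"
  using A_closed(2)[OF _ A_closed(4)[of g c], of f] by (simp cong: restrict_cong)

lemma C_vspace: "vspace C" and C_separates: "separates (\<lambda>f x. f x) X C"
  using A_ext by (auto intro!: function_space_vspace)

lemma A_restrict: "f \<in> A \<Longrightarrow> (\<lambda>x\<in>X. f x) = f"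
  by (simp add: A_ext extensional_restrict)

lemma A_eq_restrict: "f \<in> A \<Longrightarrow> (\<And>x. x \<in> X \<Longrightarrow> f x = g x) \<Longrightarrow> (\<lambda>x\<in>X. g x) = f"
  using A_ext by (intro extensionalityI[of _ X]) auto

lemma A_inv: "f \<in> A \<Longrightarrow> (\<lambda>x\<in>X. f (inv\<^bsub>G\<^esub> x)) \<in> A"
  using affine by (simp add: affine_algebraic_group_def)

text \<open>The powers of the augmentation ideal, starting with the whole coordinate ring.\<close>

definition J :: "nat \<Rightarrow> ('g \<Rightarrow> 'k) set" where
  "J n = ideal_power C (augmentation_ideal G) n"

lemma J_0 [simp]: "J 0 = A"
  by (simp add: J_def ideal_power_def)

lemma J_Suc: "J (Suc n) = ideal_prod C (J n) (augmentation_ideal G)"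
  by (simp add: J_def ideal_power_def)

lemma J_Suc_induct [consumes 1, case_names mult add]:
  assumes "f \<in> J (Suc n)"
    and "\<And>a b. a \<in> J n \<Longrightarrow> b \<in> A \<Longrightarrow> b \<one>\<^bsub>G\<^esub> = 0 \<Longrightarrow> P (\<lambda>x\<in>X. a x * b x)"
    and "\<And>f g. f \<in> J (Suc n) \<Longrightarrow> g \<in> J (Suc n) \<Longrightarrow> P f \<Longrightarrow> P g \<Longrightarrow> P (\<lambda>x\<in>X. f x + g x)"
  shows "P f"
  using assms(1) unfolding J_Suc
proof (induction rule: ideal_prod.induct)
  case (prod i j)
  then show ?case using assms(2)[of i j] by (auto simp: augmentation_ideal_def)
next
  case (sum s t)
  then show ?case using assms(3)[of s t] by (simp add: J_Suc)
qed

lemma J_closed: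
  "J n \<subseteq> A"
  "(\<lambda>x\<in>X. 0) \<in> J n"
  "f \<in> J n \<Longrightarrow> g \<in> J n \<Longrightarrow> (\<lambda>x\<in>X. f x + g x) \<in> J n"
  "f \<in> J n \<Longrightarrow> h \<in> A \<Longrightarrow> (\<lambda>x\<in>X. h x * f x) \<in> J n"
proof (induction n arbitrary: f g h)
  case 0
  { case 1 show ?case by simp next case 2 show ?case by simp next case 3 then show ?case by simp
  next case 4 then show ?case by simp }
next
  case (Suc n)
  { case 1
    show ?case
    proof
      fix f assume "f \<in> J (Suc n)"
      then show "f \<in> A" using Suc(1) by (induction rule: J_Suc_induct) auto
    qed
  next
    case 2
    have "(\<lambda>x\<in>X. 0) \<otimes>\<^bsub>C\<^esub> (\<lambda>x\<in>X. 0) \<in> J (Suc n)"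
      unfolding J_Suc using Suc(2) by (intro ideal_prod.prod) (auto simp: augmentation_ideal_def)
    then show ?case by (simp cong: restrict_cong)
  next
    case 3
    then show ?case using ideal_prod.sum[of f C "J n" "augmentation_ideal G" g] by (simp add: J_Suc)
  next
    case (4 f h)
    from 4(1) show ?case
    proof (induction rule: J_Suc_induct)
      case (mult a b)
      have "(\<lambda>x\<in>X. h x * a x) \<otimes>\<^bsub>C\<^esub> b \<in> J (Suc n)"
        unfolding J_Suc using Suc(4) mult 4(2) by (intro ideal_prod.prod) (auto simp: augmentation_ideal_def)
      then show ?case by (simp add: mult.assoc cong: restrict_cong)
    next
      case (add f g)
      have "(\<lambda>x\<in>X. h x * f x) \<oplus>\<^bsub>C\<^esub> (\<lambda>x\<in>X. h x * g x) \<in> J (Suc n)"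
        using add(3,4) unfolding J_Suc by (rule ideal_prod.sum)
      then show ?case by (simp add: distrib_left cong: restrict_cong)
    qed }
qed

lemma J_A: "f \<in> J n \<Longrightarrow> f \<in> A"
  using J_closed(1) by blast

lemma J_smult: "f \<in> J n \<Longrightarrow> (\<lambda>x\<in>X. c * f x) \<in> J n"
  using J_closed(4)[of f n "\<lambda>x\<in>X. c"] by (simp cong: restrict_cong)

lemma J_mult_aug: "a \<in> J n \<Longrightarrow> b \<in> A \<Longrightarrow> b \<one>\<^bsub>G\<^esub> = 0 \<Longrightarrow> (\<lambda>x\<in>X. a x * b x) \<in> J (Suc n)"
  using ideal_prod.prod[of a "J n" b "augmentation_ideal G" C]
  by (simp add: J_Suc augmentation_ideal_def)

lemma J_mult: "a \<in> J n \<Longrightarrow> b \<in> J m \<Longrightarrow> (\<lambda>x\<in>X. a x * b x) \<in> J (n + m)"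
proof (induction m arbitrary: b)
  case 0
  then show ?case using J_closed(4)[of a n b] by (simp add: mult.commute cong: restrict_cong)
next
  case (Suc m)
  from Suc.prems(2) show ?case
  proof (induction rule: J_Suc_induct)
    case (mult c b)
    have "(\<lambda>x\<in>X. (\<lambda>x\<in>X. a x * c x) x * b x) \<in> J (Suc (n + m))"
      using Suc.IH[OF Suc.prems(1) mult(1)] mult by (intro J_mult_aug)
    then show ?case by (simp add: mult.assoc cong: restrict_cong)
  next
    case (add f g)
    then show ?case using J_closed(3)[OF add(3,4)] by (simp add: distrib_left cong: restrict_cong)
  qed
qed

lemma J_Suc_subset: "J (Suc n) \<subseteq> J n"
proof
  fix f assume "f \<in> J (Suc n)"
  then show "f \<in> J n"
  proof (induction rule: J_Suc_induct)
    case (mult a b)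
    then show ?case using J_closed(4)[of a n b] by (simp add: mult.commute cong: restrict_cong)
  qed (rule J_closed)
qed

lemma J_antimono: "m \<le> n \<Longrightarrow> J n \<subseteq> J m"
  by (rule lift_Suc_antimono_le[where f = J, OF J_Suc_subset])

lemma J_1_iff: "f \<in> J (Suc 0) \<longleftrightarrow> f \<in> A \<and> f \<one>\<^bsub>G\<^esub> = 0"
proof
  assume "f \<in> J (Suc 0)"
  then show "f \<in> A \<and> f \<one>\<^bsub>G\<^esub> = 0" by (induction rule: J_Suc_induct) auto
next
  assume f: "f \<in> A \<and> f \<one>\<^bsub>G\<^esub> = 0"
  then show "f \<in> J (Suc 0)" using J_mult_aug[of "\<lambda>x\<in>X. 1" 0 f]
    by (simp add: A_restrict cong: restrict_cong)
qed

lemma dev_in_J: "f \<in> A \<Longrightarrow> (\<lambda>x\<in>X. f x - f \<one>\<^bsub>G\<^esub>) \<in> J (Suc 0)"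
  using A_diff[of f "\<lambda>x\<in>X. f \<one>\<^bsub>G\<^esub>"] by (auto simp: J_1_iff cong: restrict_cong)

subsection \<open>The powers of the augmentation ideal have finite codimension\<close>

definition subspace_A :: "('g \<Rightarrow> 'k) set \<Rightarrow> bool" where
  "subspace_A S \<longleftrightarrow> S \<subseteq> A \<and> (\<lambda>x\<in>X. 0) \<in> S \<and> (\<forall>f\<in>S. \<forall>g\<in>S. (\<lambda>x\<in>X. f x + g x) \<in> S) \<and>
     (\<forall>c. \<forall>f\<in>S. (\<lambda>x\<in>X. c * f x) \<in> S)"

text \<open>The span of a subspace and a list of functions, as a recursion that splits off one
  function at a time.\<close>

fun extend_by :: "('g \<Rightarrow> 'k) set \<Rightarrow> ('g \<Rightarrow> 'k) list \<Rightarrow> ('g \<Rightarrow> 'k) set" where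
  "extend_by W [] = W"
| "extend_by W (b # bs) = {\<lambda>x\<in>X. f x + c * b x | f c. f \<in> extend_by W bs}"

lemma subspace_J: "subspace_A (J n)"
  using J_closed J_smult unfolding subspace_A_def by blast

lemma subspaceD:
  assumes "subspace_A S"
  shows "f \<in> S \<Longrightarrow> f \<in> A" "(\<lambda>x\<in>X. 0) \<in> S"
    "f \<in> S \<Longrightarrow> g \<in> S \<Longrightarrow> (\<lambda>x\<in>X. f x + g x) \<in> S" "f \<in> S \<Longrightarrow> (\<lambda>x\<in>X. c * f x) \<in> S"
    "f \<in> S \<Longrightarrow> g \<in> S \<Longrightarrow> (\<lambda>x\<in>X. f x - g x) \<in> S"
proof -
  show "f \<in> S \<Longrightarrow> f \<in> A" "(\<lambda>x\<in>X. 0) \<in> S"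
    "f \<in> S \<Longrightarrow> g \<in> S \<Longrightarrow> (\<lambda>x\<in>X. f x + g x) \<in> S" "f \<in> S \<Longrightarrow> (\<lambda>x\<in>X. c * f x) \<in> S" for f g c
    using assms by (auto simp: subspace_A_def)
  from this(3)[of f "\<lambda>x\<in>X. - 1 * g x"] this(4)[of g "- 1"]
  show "f \<in> S \<Longrightarrow> g \<in> S \<Longrightarrow> (\<lambda>x\<in>X. f x - g x) \<in> S" by (simp cong: restrict_cong)
qed

lemma extend_by_subspace:
  assumes W: "subspace_A W" and bs: "set bs \<subseteq> A"
  shows "subspace_A (extend_by W bs)"
  using bs
proof (induction bs)
  case (Cons b bs)
  then have E: "subspace_A (extend_by W bs)" and b: "b \<in> A" by auto
  note d = subspaceD[OF E]
  show ?case unfolding subspace_A_def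
  proof (intro conjI subsetI ballI allI)
    fix f assume "f \<in> extend_by W (b # bs)"
    then show "f \<in> A" using d(1) b A_lin by auto
  next
    have "(\<lambda>x\<in>X. 0) = (\<lambda>x\<in>X. (\<lambda>x\<in>X. 0) x + 0 * b x)" by (simp cong: restrict_cong)
    then show "(\<lambda>x\<in>X. 0) \<in> extend_by W (b # bs)" using d(2)
      by (auto intro!: exI[of _ "\<lambda>x\<in>X. 0"] exI[of _ 0] cong: restrict_cong)
  next
    fix f g assume "f \<in> extend_by W (b # bs)" "g \<in> extend_by W (b # bs)"
    then obtain f' c g' c' where *: "f = (\<lambda>x\<in>X. f' x + c * b x)" "f' \<in> extend_by W bs"
      "g = (\<lambda>x\<in>X. g' x + c' * b x)" "g' \<in> extend_by W bs" by auto
    have "(\<lambda>x\<in>X. f x + g x) = (\<lambda>x\<in>X. (\<lambda>x\<in>X. f' x + g' x) x + (c + c') * b x)"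
      by (simp add: * algebra_simps cong: restrict_cong)
    then show "(\<lambda>x\<in>X. f x + g x) \<in> extend_by W (b # bs)" using d(3)[OF *(2,4)] by auto
  next
    fix e f assume "f \<in> extend_by W (b # bs)"
    then obtain f' c where *: "f = (\<lambda>x\<in>X. f' x + c * b x)" "f' \<in> extend_by W bs" by auto
    have "(\<lambda>x\<in>X. e * f x) = (\<lambda>x\<in>X. (\<lambda>x\<in>X. e * f' x) x + (e * c) * b x)"
      by (simp add: * algebra_simps cong: restrict_cong)
    then show "(\<lambda>x\<in>X. e * f x) \<in> extend_by W (b # bs)" using d(4)[OF *(2)] by auto
  qed
qed (use W in simp)

lemma extend_by_contains:
  assumes W: "subspace_A W" and bs: "set bs \<subseteq> A"
  shows "W \<union> set bs \<subseteq> extend_by W bs"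
  using bs
proof (induction bs)
  case (Cons b bs)
  then have E: "subspace_A (extend_by W bs)" and b: "b \<in> A" using extend_by_subspace[OF W] by auto
  have "f \<in> extend_by W (b # bs)" if "f \<in> extend_by W bs" for f
  proof -
    have "f = (\<lambda>x\<in>X. f x + 0 * b x)" using subspaceD(1)[OF E that] by (simp add: A_restrict)
    then show ?thesis using that by (auto intro!: exI[of _ f] exI[of _ 0])
  qed
  moreover have "b \<in> extend_by W (b # bs)"
  proof -
    have "b = (\<lambda>x\<in>X. (\<lambda>x\<in>X. 0) x + 1 * b x)" using b by (simp add: A_restrict cong: restrict_cong)
    then show ?thesis using subspaceD(2)[OF E]
      by (auto intro!: exI[of _ "\<lambda>x\<in>X. 0"] exI[of _ 1])
  qed
  ultimately show ?case using Cons by auto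
qed simp

lemma extend_by_least:
  assumes S: "subspace_A S" and "W \<subseteq> S" and "set bs \<subseteq> S"
  shows "extend_by W bs \<subseteq> S"
  using assms(3)
proof (induction bs)
  case (Cons b bs)
  show ?case
  proof
    fix h assume "h \<in> extend_by W (b # bs)"
    then obtain f c where h: "h = (\<lambda>x\<in>X. f x + c * b x)" "f \<in> extend_by W bs" by auto
    then have "f \<in> S" "b \<in> S" using Cons by auto
    then have "(\<lambda>x\<in>X. f x + (\<lambda>x\<in>X. c * b x) x) \<in> S"
      by (intro subspaceD(3)[OF S] subspaceD(4)[OF S])
    then show "h \<in> S" by (simp add: h cong: restrict_cong)
  qed
qed (use assms(2) in simp)

end

lemma sum_list_zero: "(\<And>l. l \<in> set L \<Longrightarrow> f l = 0) \<Longrightarrow> (\<Sum>l\<leftarrow>L. f l) = (0 :: 'a::monoid_add)"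
  by (induction L) auto

lemma tensor_lift_tensor_sum:
  assumes "vspace M" "vspace N" "bilinear M N base_field b" "set L \<subseteq> carrier M \<times> carrier N"
  shows "tensor_lift base_field b (tensor_sum M N L) = (\<Sum>(x, y)\<leftarrow>L. b x y)"
proof -
  have "map (\<lambda>(x, y). tensor_lift base_field b (pure M N x y)) L = map (\<lambda>(x, y). b x y) L"
    using assms(4) tensor_lift_pure[OF assms(1,2) vspace_base_field assms(3)]
    by (intro map_cong refl) auto
  then show ?thesis
    unfolding linear_map_tensor_sum[OF assms(1,2) tensor_lift_linear[OF assms(1,2) vspace_base_field assms(3)] assms(4)]
    by (rule arg_cong)
qed

lemma tensor_value_tensor_sum:
  assumes "vspace M" "vspace N" "separates (\<lambda>a x. a x) X M" "separates (\<lambda>b y. b y) Y N"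
    and "set L \<subseteq> carrier M \<times> carrier N" "x \<in> X" "y \<in> Y"
  shows "tensor_value (tensor_sum M N L) x y = (\<Sum>(a, b)\<leftarrow>L. a x * b y)"
  unfolding tensor_value_def
  using evaluation_bilinear[OF separatesD(1)[OF assms(3,6)] separatesD(1)[OF assms(4,7)]]
  by (rule tensor_lift_tensor_sum[OF assms(1,2) _ assms(5)])

lemma tensor_value_eqI:
  assumes "vspace M" "vspace N" "separates (\<lambda>a x. a x) X M" "separates (\<lambda>b y. b y) Y N"
    and "Z \<in> carrier (M \<otimes>\<^sub>k N)" "W \<in> carrier (M \<otimes>\<^sub>k N)"
    and "\<And>x y. x \<in> X \<Longrightarrow> y \<in> Y \<Longrightarrow> tensor_value Z x y = tensor_value W x y"
  shows "Z = W"
  by (rule separates_eq[OF tensor_vspace[OF assms(1,2)] separates_tensor[OF assms(1-4)] assms(5,6)])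
    (use assms(7) in \<open>auto simp: tensor_value_def\<close>)

context affine_group
begin

text \<open>The coordinate ring is generated by finitely many functions \<open>f\<close>, and their
  deviations \<open>f - f(1)\<close> generate the augmentation ideal modulo its square: the
  deviation of a product is a combination of the deviations of the factors up to the product of the
  two deviations.\<close>

lemma augmentation_generators:
  "\<exists>bs. set bs \<subseteq> J 1 \<and> J 1 \<subseteq> extend_by (J 2) bs"
proof -
  define dev where "dev f = (\<lambda>x\<in>X. f x - f \<one>\<^bsub>G\<^esub>)" for f :: "'g \<Rightarrow> 'k"
  obtain S where S: "finite S" "A = generate_ring (function_algebra X) (S \<union> range (\<lambda>c. \<lambda>x\<in>X. c))"
    by (rule regular_generated)
  obtain ss where ss: "set ss = S" using finite_list[OF S(1)] by auto
  have SA: "S \<subseteq> A" unfolding S(2) by (auto intro: generate_ring.incl)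
  have devJ: "dev f \<in> J 1" if "f \<in> A" for f
    using dev_in_J[OF that] by (simp add: dev_def)
  define E where "E = extend_by (J 2) (map dev ss)"
  have bs: "set (map dev ss) \<subseteq> J 1" using devJ SA ss by auto
  then have bsA: "set (map dev ss) \<subseteq> A" using J_closed(1) by blast
  have E: "subspace_A E" unfolding E_def by (rule extend_by_subspace[OF subspace_J bsA])
  have E2: "J 2 \<union> set (map dev ss) \<subseteq> E" unfolding E_def by (rule extend_by_contains[OF subspace_J bsA])
  have "dev f \<in> E" if "f \<in> A" for f
    using that unfolding S(2)
  proof (induction rule: generate_ring.induct)
    case one
    have "dev \<one>\<^bsub>function_algebra X\<^esub> = (\<lambda>x\<in>X. 0)" by (simp add: dev_def cong: restrict_cong)
    then show ?case using subspaceD(2)[OF E] by simp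
  next
    case (incl h)
    show ?case
    proof (cases "h \<in> S")
      case True
      then show ?thesis using E2 ss by auto
    next
      case False
      then obtain c where "h = (\<lambda>x\<in>X. c)" using incl by auto
      then have "dev h = (\<lambda>x\<in>X. 0)" by (simp add: dev_def cong: restrict_cong)
      then show ?thesis using subspaceD(2)[OF E] by simp
    qed
  next
    case (a_inv h)
    then have "h \<in> carrier (function_algebra X)" using A_ext by (auto simp: S(2)[symmetric] PiE_def)
    then have "\<ominus>\<^bsub>function_algebra X\<^esub> h = (\<lambda>x\<in>X. - h x)"
      using vspace_minus[OF k_algebraD(2)[OF function_algebra_k_algebra], of h X] by simp
    then have "dev (\<ominus>\<^bsub>function_algebra X\<^esub> h) = (\<lambda>x\<in>X. - 1 * dev h x)"
      by (simp add: dev_def cong: restrict_cong)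
    then show ?case using subspaceD(4)[OF E a_inv(2), of "- 1"] by simp
  next
    case (eng_add h1 h2)
    have "dev (h1 \<oplus>\<^bsub>function_algebra X\<^esub> h2) = (\<lambda>x\<in>X. dev h1 x + dev h2 x)"
      by (simp add: dev_def algebra_simps cong: restrict_cong)
    then show ?case using subspaceD(3)[OF E eng_add(3,4)] by simp
  next
    case (eng_mult h1 h2)
    have "(\<lambda>x\<in>X. dev h1 x * dev h2 x) \<in> J (1 + 1)"
      using eng_mult by (intro J_mult devJ) (simp_all add: S(2))
    then have d2: "(\<lambda>x\<in>X. dev h1 x * dev h2 x) \<in> E" using E2 by (auto simp: numeral_2_eq_2)
    have "dev (h1 \<otimes>\<^bsub>function_algebra X\<^esub> h2) = (\<lambda>x\<in>X. (\<lambda>x\<in>X. dev h1 x * dev h2 x) x +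
        (\<lambda>x\<in>X. (\<lambda>x\<in>X. h1 \<one>\<^bsub>G\<^esub> * dev h2 x) x + (\<lambda>x\<in>X. h2 \<one>\<^bsub>G\<^esub> * dev h1 x) x) x)"
      by (simp add: dev_def algebra_simps cong: restrict_cong)
    then show ?case
      using subspaceD(3)[OF E d2 subspaceD(3)[OF E subspaceD(4)[OF E eng_mult(4)] subspaceD(4)[OF E eng_mult(3)]]]
      by simp
  qed
  moreover have "dev f = f" if "f \<in> J 1" for f
    using that by (simp add: dev_def J_1_iff A_restrict)
  ultimately have "J 1 \<subseteq> E" using J_A by fastforce
  then show ?thesis using bs unfolding E_def by blast
qed

text \<open>Membership of products in \<open>E\<close> can thus be checked for one factor at a time
  on a spanning set.\<close>

lemma subspace_mult:
  assumes E: "subspace_A E" and h: "h \<in> A"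
  shows "subspace_A {a \<in> A. (\<lambda>x\<in>X. a x * h x) \<in> E}"
  unfolding subspace_A_def
proof (intro conjI ballI allI)
  show "(\<lambda>x\<in>X. 0) \<in> {a \<in> A. (\<lambda>x\<in>X. a x * h x) \<in> E}"
    using subspaceD(2)[OF E] by (simp cong: restrict_cong)
  show "(\<lambda>x\<in>X. f x + g x) \<in> {a \<in> A. (\<lambda>x\<in>X. a x * h x) \<in> E}"
    if "f \<in> {a \<in> A. (\<lambda>x\<in>X. a x * h x) \<in> E}" "g \<in> {a \<in> A. (\<lambda>x\<in>X. a x * h x) \<in> E}" for f g
    using that subspaceD(3)[OF E, of "\<lambda>x\<in>X. f x * h x" "\<lambda>x\<in>X. g x * h x"]
    by (simp add: distrib_right cong: restrict_cong)
  show "(\<lambda>x\<in>X. c * f x) \<in> {a \<in> A. (\<lambda>x\<in>X. a x * h x) \<in> E}"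
    if "f \<in> {a \<in> A. (\<lambda>x\<in>X. a x * h x) \<in> E}" for c f
    using that subspaceD(4)[OF E, of "\<lambda>x\<in>X. f x * h x" c]
    by (simp add: mult.assoc cong: restrict_cong)
qed auto

text \<open>Modulo the next power, \<open>J (Suc n)\<close> is spanned by the products of spanning
  sets of \<open>J n\<close> modulo \<open>J (Suc n)\<close> and of \<open>J 1\<close> modulo
  \<open>J 2\<close>.\<close>

lemma J_generators:
  "\<exists>bs. set bs \<subseteq> J n \<and> J n \<subseteq> extend_by (J (Suc n)) bs"
proof (induction n)
  case 0
  have "f \<in> extend_by (J (Suc 0)) [\<lambda>x\<in>X. 1]" if "f \<in> A" for f
  proof -
    have "f = (\<lambda>x\<in>X. (\<lambda>x\<in>X. f x - f \<one>\<^bsub>G\<^esub>) x + f \<one>\<^bsub>G\<^esub> * (\<lambda>x\<in>X. 1) x)"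
      using that by (simp add: A_restrict cong: restrict_cong)
    then show ?thesis using dev_in_J[OF that] by auto
  qed
  then show ?case by (intro exI[of _ "[\<lambda>x\<in>X. 1]"]) auto
next
  case (Suc n)
  then obtain bs where bs: "set bs \<subseteq> J n" "J n \<subseteq> extend_by (J (Suc n)) bs" by blast
  obtain cs where cs: "set cs \<subseteq> J 1" "J 1 \<subseteq> extend_by (J 2) cs" using augmentation_generators by blast
  define ds where "ds = map (\<lambda>(b, c). \<lambda>x\<in>X. b x * c x) (List.product bs cs)"
  define E where "E = extend_by (J (Suc (Suc n))) ds"
  have ds: "set ds \<subseteq> J (Suc n)"
  proof
    fix d assume "d \<in> set ds"
    then obtain b c where "d = (\<lambda>x\<in>X. b x * c x)" "b \<in> J n" "c \<in> J 1"
      using bs(1) cs(1) by (auto simp: ds_def)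
    then show "d \<in> J (Suc n)" using J_mult[of b n c 1] by simp
  qed
  then have dsA: "set ds \<subseteq> A" using J_closed(1) by blast
  have E: "subspace_A E" unfolding E_def by (rule extend_by_subspace[OF subspace_J dsA])
  have Esup: "J (Suc (Suc n)) \<union> set ds \<subseteq> E"
    unfolding E_def by (rule extend_by_contains[OF subspace_J dsA])
  have 1: "(\<lambda>x\<in>X. i x * b x) \<in> E" if b: "b \<in> set bs" and i: "i \<in> J 1" for b i
  proof -
    have bA: "b \<in> J n" using b bs by auto
    have "extend_by (J 2) cs \<subseteq> {i \<in> A. (\<lambda>x\<in>X. i x * b x) \<in> E}"
    proof (intro extend_by_least subspace_mult E J_A[OF bA] subsetI CollectI conjI)
      fix f assume "f \<in> J 2"
      then show "f \<in> A" "(\<lambda>x\<in>X. f x * b x) \<in> E"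
        using J_A J_mult[OF _ bA, of f 2] Esup by (auto simp: numeral_2_eq_2)
    next
      fix c assume c: "c \<in> set cs"
      have "(\<lambda>x\<in>X. b x * c x) \<in> set ds"
        using c b by (auto simp: ds_def intro!: image_eqI[of _ _ "(b, c)"])
      then show "c \<in> A" "(\<lambda>x\<in>X. c x * b x) \<in> E"
        using J_A c cs Esup by (auto simp: mult.commute)
    qed
    then show ?thesis using i cs by blast
  qed
  have 2: "(\<lambda>x\<in>X. a x * i x) \<in> E" if a: "a \<in> J n" and i: "i \<in> J 1" for a i
  proof -
    have "extend_by (J (Suc n)) bs \<subseteq> {a \<in> A. (\<lambda>x\<in>X. a x * i x) \<in> E}"
    proof (intro extend_by_least subspace_mult E J_A[OF i] subsetI CollectI conjI)
      fix f assume "f \<in> J (Suc n)"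
      then show "f \<in> A" "(\<lambda>x\<in>X. f x * i x) \<in> E"
        using J_A J_mult[OF _ i, of f "Suc n"] Esup by auto
    next
      fix b assume b: "b \<in> set bs"
      then show "b \<in> A" "(\<lambda>x\<in>X. b x * i x) \<in> E"
        using J_A bs 1[OF b i] by (auto simp: mult.commute)
    qed
    then show ?thesis using a bs by blast
  qed
  have "f \<in> E" if "f \<in> J (Suc n)" for f
    using that
  proof (induction rule: J_Suc_induct)
    case (mult a b)
    then show ?case by (intro 2) (auto simp: J_1_iff)
  next
    case (add f g)
    then show ?case using subspaceD(3)[OF E] by blast
  qed
  then show ?case using ds unfolding E_def by blast
qed

section \<open>Distributions\<close>

lemma Dist_iff:
  "\<mu> \<in> Dist G k \<longleftrightarrow> \<mu> \<in> linear_maps C base_field \<and> \<mu> \<in> extensional A \<and> (\<forall>f\<in>J (Suc k). \<mu> f = 0)"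
  by (auto simp: Dist_def J_def)

lemma DistD:
  assumes "\<mu> \<in> Dist G k"
  shows "\<mu> \<in> linear_maps C base_field" "\<mu> \<in> extensional A" "f \<in> J (Suc k) \<Longrightarrow> \<mu> f = 0"
  using assms by (auto simp: Dist_iff)

lemma Dist_mono: "k \<le> l \<Longrightarrow> Dist G k \<subseteq> Dist G l"
proof
  fix \<mu> assume "k \<le> l" "\<mu> \<in> Dist G k"
  then show "\<mu> \<in> Dist G l" using J_antimono[of "Suc k" "Suc l"] unfolding Dist_iff by blast
qed

lemma linear_C:
  assumes "\<mu> \<in> linear_maps C base_field"
  shows "f \<in> A \<Longrightarrow> g \<in> A \<Longrightarrow> \<mu> (\<lambda>x\<in>X. f x + g x) = \<mu> f + \<mu> g"
    and "f \<in> A \<Longrightarrow> \<mu> (\<lambda>x\<in>X. c * f x) = c * \<mu> f"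
    and "\<mu> (\<lambda>x\<in>X. 0) = 0"
    and "f \<in> A \<Longrightarrow> g \<in> A \<Longrightarrow> \<mu> (\<lambda>x\<in>X. f x - g x) = \<mu> f - \<mu> g"
proof -
  show add: "f \<in> A \<Longrightarrow> g \<in> A \<Longrightarrow> \<mu> (\<lambda>x\<in>X. f x + g x) = \<mu> f + \<mu> g" for f g
    using linear_mapsD(2)[OF assms, of f g] by simp
  show sm: "f \<in> A \<Longrightarrow> \<mu> (\<lambda>x\<in>X. c * f x) = c * \<mu> f" for f c
    using linear_mapsD(3)[OF assms, of f c] by simp
  show "\<mu> (\<lambda>x\<in>X. 0) = 0" using linear_map_zero[OF assms C_vspace vspace_base_field] by simp
  show "f \<in> A \<Longrightarrow> g \<in> A \<Longrightarrow> \<mu> (\<lambda>x\<in>X. f x - g x) = \<mu> f - \<mu> g"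
    using add[of f "\<lambda>x\<in>X. - 1 * g x"] sm[of g "- 1"] A_closed(4)[of g "- 1"]
    by (simp cong: restrict_cong)
qed

lemma linear_sum_list:
  assumes "\<And>l. l \<in> set L \<Longrightarrow> f l \<in> A"
  shows "(\<lambda>x\<in>X. \<Sum>l\<leftarrow>L. c l * f l x) \<in> A"
    and "\<mu> \<in> linear_maps C base_field \<Longrightarrow> \<mu> (\<lambda>x\<in>X. \<Sum>l\<leftarrow>L. c l * f l x) = (\<Sum>l\<leftarrow>L. c l * \<mu> (f l))"
proof -
  have "(\<lambda>x\<in>X. \<Sum>l\<leftarrow>L. c l * f l x) \<in> A \<and>
      (\<mu> \<in> linear_maps C base_field \<longrightarrow> \<mu> (\<lambda>x\<in>X. \<Sum>l\<leftarrow>L. c l * f l x) = (\<Sum>l\<leftarrow>L. c l * \<mu> (f l)))"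
    using assms
  proof (induction L)
    case Nil
    then show ?case by (simp add: linear_C)
  next
    case (Cons l L)
    let ?g = "\<lambda>x\<in>X. \<Sum>l\<leftarrow>L. c l * f l x"
    have g: "?g \<in> A" and l: "(\<lambda>x\<in>X. c l * f l x) \<in> A" "f l \<in> A" using Cons by auto
    have eq: "(\<lambda>x\<in>X. \<Sum>l\<leftarrow>l # L. c l * f l x) = (\<lambda>x\<in>X. (\<lambda>x\<in>X. c l * f l x) x + ?g x)"
      by (simp cong: restrict_cong)
    show ?case unfolding eq
      using A_closed(2)[OF l(1) g] linear_C(1)[of \<mu>, OF _ l(1) g] linear_C(2)[of \<mu>, OF _ l(2)] Cons by simp
  qed
  then show "(\<lambda>x\<in>X. \<Sum>l\<leftarrow>L. c l * f l x) \<in> A"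
    "\<mu> \<in> linear_maps C base_field \<Longrightarrow> \<mu> (\<lambda>x\<in>X. \<Sum>l\<leftarrow>L. c l * f l x) = (\<Sum>l\<leftarrow>L. c l * \<mu> (f l))" by auto
qed

subsection \<open>Dual systems adapted to the filtration\<close>

text \<open>Modulo \<open>V\<close>, every function is expanded in the functions \<open>g\<close>
  with the functionals \<open>\<mu>\<close> as coordinates. The system is adapted to the filtration:
  if \<open>g\<close> vanishes to order \<open>d\<close> at the identity, then its coordinate is a
  distribution of order \<open>d\<close>.\<close>

definition dual_system :: "nat \<Rightarrow> ('g \<Rightarrow> 'k) set \<Rightarrow> (('g \<Rightarrow> 'k) \<times> (('g \<Rightarrow> 'k) \<Rightarrow> 'k) \<times> nat) list \<Rightarrow> bool" where
  "dual_system i V L \<longleftrightarrow> (\<forall>(g, \<mu>, d)\<in>set L. d \<le> i \<and> g \<in> J d \<and> \<mu> \<in> Dist G d) \<and>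
     (\<forall>f\<in>A. (\<lambda>x\<in>X. f x - (\<Sum>(g, \<mu>, d)\<leftarrow>L. \<mu> f * g x)) \<in> V)"

text \<open>The remainder \<open>r f\<close> of the expansion is a multiple of \<open>b\<close>
  modulo \<open>V\<close>, and the coefficient \<open>\<kappa> f\<close> is unique unless
  \<open>b\<close> belongs to \<open>V\<close>. On \<open>J (Suc i)\<close> the earlier coordinates
  vanish, so that the remainder is the function itself and lies in \<open>V\<close>; hence the new
  coordinate is a distribution of order \<open>i\<close>.\<close>

lemma dual_system_step:
  assumes L: "dual_system i (extend_by V [b]) L" and V: "subspace_A V"
    and JV: "J (Suc i) \<subseteq> V" and b: "b \<in> J i"
  shows "\<exists>L'. dual_system i V L'"
proof (cases "b \<in> V")
  case True
  then have "extend_by V [b] \<subseteq> V" by (intro extend_by_least V) auto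
  then show ?thesis using L unfolding dual_system_def by blast
next
  case False
  have LD: "d \<le> i" "g \<in> J d" "\<mu> \<in> Dist G d" if "(g, \<mu>, d) \<in> set L" for g \<mu> d
    using L that by (auto simp: dual_system_def)
  note V' = subspaceD[OF V] and bA = J_A[OF b]
  define r where "r f = (\<lambda>x\<in>X. f x - (\<Sum>(g, \<mu>, d)\<leftarrow>L. \<mu> f * g x))" for f
  have rA: "r f \<in> A" if f: "f \<in> A" for f
  proof -
    have "(\<lambda>x\<in>X. \<Sum>l\<leftarrow>L. (case l of (g, \<mu>, d) \<Rightarrow> \<mu> f) * (case l of (g, \<mu>, d) \<Rightarrow> g) x) \<in> A"
      by (intro linear_sum_list) (auto intro: J_A dest: LD(2))
    from A_diff[OF f this] show ?thesis
      by (simp add: r_def split_def cong: restrict_cong)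
  qed
  have r_add: "r (\<lambda>x\<in>X. f x + g x) = (\<lambda>x\<in>X. r f x + r g x)" if "f \<in> A" "g \<in> A" for f g
  proof -
    have *: "(\<Sum>(g', \<mu>, d)\<leftarrow>L. \<mu> (\<lambda>x\<in>X. f x + g x) * g' x)
        = (\<Sum>(g', \<mu>, d)\<leftarrow>L. \<mu> f * g' x) + (\<Sum>(g', \<mu>, d)\<leftarrow>L. \<mu> g * g' x)" for x
      unfolding sum_list_addf[symmetric]
      by (intro arg_cong[of _ _ sum_list] map_cong refl)
        (auto simp: distrib_right linear_C(1)[OF DistD(1)[OF LD(3)] that])
    show ?thesis by (simp add: r_def * add_diff_add cong: restrict_cong)
  qed
  have r_smult: "r (\<lambda>x\<in>X. c * f x) = (\<lambda>x\<in>X. c * r f x)" if "f \<in> A" for c f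
  proof -
    have *: "(\<Sum>(g', \<mu>, d)\<leftarrow>L. \<mu> (\<lambda>x\<in>X. c * f x) * g' x) = c * (\<Sum>(g', \<mu>, d)\<leftarrow>L. \<mu> f * g' x)" for x
      unfolding sum_list_const_mult[symmetric]
      by (intro arg_cong[of _ _ sum_list] map_cong refl)
        (auto simp: mult.assoc linear_C(2)[OF DistD(1)[OF LD(3)] that])
    show ?thesis by (simp add: r_def * right_diff_distrib cong: restrict_cong)
  qed
  have ex: "\<exists>c. (\<lambda>x\<in>X. r f x - c * b x) \<in> V" if f: "f \<in> A" for f
  proof -
    have "r f \<in> extend_by V [b]" using L f by (simp add: dual_system_def r_def)
    then obtain v c where v: "v \<in> V" "r f = (\<lambda>x\<in>X. v x + c * b x)" by auto
    then have "(\<lambda>x\<in>X. r f x - c * b x) = v" using V'(1) by (simp add: A_restrict cong: restrict_cong)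
    then show ?thesis using v(1) by (intro exI[of _ c]) simp
  qed
  have uniq: "c = c'" if "(\<lambda>x\<in>X. r f x - c * b x) \<in> V" "(\<lambda>x\<in>X. r f x - c' * b x) \<in> V" for f c c'
  proof (rule ccontr)
    assume ne: "c \<noteq> c'"
    have "(\<lambda>x\<in>X. (1 / (c' - c)) * (\<lambda>x\<in>X. (\<lambda>x\<in>X. r f x - c * b x) x - (\<lambda>x\<in>X. r f x - c' * b x) x) x) \<in> V"
      by (rule V'(4)[OF V'(5)[OF that]])
    also have "(\<lambda>x\<in>X. (1 / (c' - c)) * (\<lambda>x\<in>X. (\<lambda>x\<in>X. r f x - c * b x) x - (\<lambda>x\<in>X. r f x - c' * b x) x) x)
        = (\<lambda>x\<in>X. b x)"
      using ne by (auto simp: divide_simps algebra_simps intro!: restrict_ext)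
    finally show False using False bA by (simp add: A_restrict)
  qed
  define \<kappa> where "\<kappa> = (\<lambda>f\<in>A. SOME c. (\<lambda>x\<in>X. r f x - c * b x) \<in> V)"
  have kappa: "(\<lambda>x\<in>X. r f x - \<kappa> f * b x) \<in> V" if "f \<in> A" for f
    using someI_ex[OF ex[OF that]] that by (simp add: \<kappa>_def)
  have kappa_eq: "\<kappa> f = c" if "f \<in> A" "(\<lambda>x\<in>X. r f x - c * b x) \<in> V" for f c
    using uniq[OF kappa[OF that(1)] that(2)] .
  have "\<kappa> \<in> Dist G i"
    unfolding Dist_iff
  proof (intro conjI ballI linear_mapsI)
    show "\<kappa> \<in> extensional A" by (simp add: \<kappa>_def)
  next
    fix f assume f: "f \<in> J (Suc i)"
    have "(\<Sum>(g, \<mu>, d)\<leftarrow>L. \<mu> f * g x) = 0" for x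
    proof (rule sum_list_zero)
      fix l assume l: "l \<in> set L"
      obtain g \<mu> d where gmd: "l = (g, \<mu>, d)" by (cases l)
      have "\<mu> f = 0"
        using LD[OF l[unfolded gmd]] f J_antimono[of "Suc d" "Suc i"] by (auto intro!: DistD(3)[of \<mu> d])
      then show "(case l of (g, \<mu>, d) \<Rightarrow> \<mu> f * g x) = 0" by (simp add: gmd)
    qed
    then have "r f = f" using J_A[OF f] by (simp add: r_def A_restrict)
    then show "\<kappa> f = 0" using f JV J_A[OF f] by (intro kappa_eq) (auto simp: A_restrict)
  next
    fix f assume "f \<in> carrier C"
    then have f: "f \<in> A" by simp
    show "\<kappa> (f \<oplus>\<^bsub>C\<^esub> g) = \<kappa> f \<oplus>\<^bsub>base_field\<^esub> \<kappa> g" if "g \<in> carrier C" for g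
    proof -
      have g: "g \<in> A" using that by simp
      have "(\<lambda>x\<in>X. r (\<lambda>x\<in>X. f x + g x) x - (\<kappa> f + \<kappa> g) * b x)
          = (\<lambda>x\<in>X. (\<lambda>x\<in>X. r f x - \<kappa> f * b x) x + (\<lambda>x\<in>X. r g x - \<kappa> g * b x) x)"
        by (simp add: r_add[OF f g] algebra_simps cong: restrict_cong)
      also have "\<dots> \<in> V" by (rule V'(3)[OF kappa[OF f] kappa[OF g]])
      finally show ?thesis using f g by (simp add: kappa_eq)
    qed
    show "\<kappa> (c \<odot>\<^bsub>C\<^esub> f) = c \<odot>\<^bsub>base_field\<^esub> \<kappa> f" for c
    proof -
      have "(\<lambda>x\<in>X. r (\<lambda>x\<in>X. c * f x) x - (c * \<kappa> f) * b x)
          = (\<lambda>x\<in>X. c * (\<lambda>x\<in>X. r f x - \<kappa> f * b x) x)"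
        by (simp add: r_smult[OF f] algebra_simps cong: restrict_cong)
      also have "\<dots> \<in> V" by (rule V'(4)[OF kappa[OF f]])
      finally show ?thesis using f by (simp add: kappa_eq)
    qed
  qed simp
  then have "dual_system i V ((b, \<kappa>, i) # L)"
    using LD b kappa unfolding dual_system_def
    by (auto simp: r_def algebra_simps cong: restrict_cong)
  then show ?thesis by blast
qed

text \<open>One descends through the powers of the augmentation ideal, which have finite codimension
  in one another, by splitting off one generator after the other.\<close>

lemma dual_system_exists: "\<exists>L. dual_system n (J (Suc n)) L"
proof -
  have shrink: "\<exists>L'. dual_system i V L'"
    if "dual_system i (extend_by V bs) L" "set bs \<subseteq> J i" and V: "subspace_A V" and JV: "J (Suc i) \<subseteq> V"
    for i V bs L
    using that(1,2)
  proof (induction bs arbitrary: L)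
    case Nil
    then show ?case by auto
  next
    case (Cons b bs)
    then have bsA: "set bs \<subseteq> A" using J_A by auto
    have "J (Suc i) \<subseteq> extend_by V bs" using extend_by_contains[OF V bsA] JV by blast
    moreover have "dual_system i (extend_by (extend_by V bs) [b]) L" using Cons.prems(1) by simp
    moreover have "b \<in> J i" using Cons.prems(2) by simp
    ultimately obtain L' where "dual_system i (extend_by V bs) L'"
      using dual_system_step[OF _ extend_by_subspace[OF V bsA]] by blast
    then show ?case using Cons by auto
  qed
  have next_J: "\<exists>L'. dual_system i (J (Suc i)) L'" if L: "dual_system i (J i) L" for i L
  proof -
    obtain bs where bs: "set bs \<subseteq> J i" "J i \<subseteq> extend_by (J (Suc i)) bs" using J_generators by blast
    then have "dual_system i (extend_by (J (Suc i)) bs) L"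
      using L unfolding dual_system_def by blast
    then show ?thesis using bs(1) subspace_J by (rule shrink) simp
  qed
  show ?thesis
  proof (induction n)
    case 0
    have "dual_system 0 (J 0) []" by (simp add: dual_system_def A_restrict)
    then show ?case by (rule next_J)
  next
    case (Suc n)
    then obtain L where L: "dual_system n (J (Suc n)) L" by blast
    then have "dual_system (Suc n) (J (Suc n)) L" by (fastforce simp: dual_system_def)
    then show ?case by (rule next_J)
  qed
qed

subsection \<open>Functions on the square of the group\<close>

text \<open>Tensors of two regular functions are treated as functions on the square of the group,
  together with an expansion into products.\<close>

definition rep :: "('g \<Rightarrow> 'g \<Rightarrow> 'k) \<Rightarrow> (('g \<Rightarrow> 'k) \<times> ('g \<Rightarrow> 'k)) list \<Rightarrow> bool" where
  "rep F L \<longleftrightarrow> set L \<subseteq> A \<times> A \<and> (\<forall>u\<in>X. \<forall>v\<in>X. F u v = (\<Sum>(a, b)\<leftarrow>L. a u * b v))"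

lemma repD: "rep F L \<Longrightarrow> u \<in> X \<Longrightarrow> v \<in> X \<Longrightarrow> F u v = (\<Sum>(a, b)\<leftarrow>L. a u * b v)"
  by (simp add: rep_def)

lemma rep_carrier: "rep F L \<Longrightarrow> set L \<subseteq> carrier C \<times> carrier C"
  by (simp add: rep_def)

lemma rep_exists:
  assumes "f \<in> A" obtains L where "rep (\<lambda>u v. f (u \<otimes>\<^bsub>G\<^esub> v)) L"
proof -
  obtain Z where Z: "Z \<in> carrier (C \<otimes>\<^sub>k C)" "\<forall>x\<in>X. \<forall>y\<in>X. tensor_value Z x y = f (x \<otimes>\<^bsub>G\<^esub> y)"
    using affine assms by (auto simp: affine_algebraic_group_def)
  obtain L where L: "set L \<subseteq> carrier C \<times> carrier C" "Z = tensor_sum C C L"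
    using tensor_as_sum[OF C_vspace C_vspace Z(1)] .
  then have "rep (\<lambda>u v. f (u \<otimes>\<^bsub>G\<^esub> v)) L"
    using Z(2) tensor_value_tensor_sum[OF C_vspace C_vspace C_separates C_separates L(1)]
    by (auto simp: rep_def)
  then show ?thesis by (rule that)
qed

lemma tensor_sum_rep:
  assumes "rep F L" "rep F L'" shows "tensor_sum C C L = tensor_sum C C L'"
  using tensor_sum_closed[OF C_vspace C_vspace] rep_carrier[OF assms(1)] rep_carrier[OF assms(2)]
  by (intro tensor_value_eqI[OF C_vspace C_vspace C_separates C_separates])
    (simp_all add: tensor_value_tensor_sum[OF C_vspace C_vspace C_separates C_separates]
      repD[OF assms(1), symmetric] repD[OF assms(2), symmetric])

text \<open>Two expansions of one function define the same tensor, because the points of the square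
  of the group separate the tensors.\<close>

lemma pairing_unique:
  assumes "rep F L" "rep F L'" "x \<in> linear_maps C base_field" "y \<in> linear_maps C base_field"
  shows "(\<Sum>(a, b)\<leftarrow>L. x a * y b) = (\<Sum>(a, b)\<leftarrow>L'. x a * y b)"
  using tensor_sum_rep[OF assms(1,2)]
    tensor_lift_tensor_sum[OF C_vspace C_vspace evaluation_bilinear[OF assms(3,4)] rep_carrier[OF assms(1)]]
    tensor_lift_tensor_sum[OF C_vspace C_vspace evaluation_bilinear[OF assms(3,4)] rep_carrier[OF assms(2)]]
  by simp

lemma coord_comult_rep:
  assumes "f \<in> A" "rep (\<lambda>u v. f (u \<otimes>\<^bsub>G\<^esub> v)) L"
  shows "coord_comult G f = tensor_sum C C L"
  unfolding coord_comult_def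
proof (rule the_equality)
  have *: "tensor_sum C C L \<in> carrier (C \<otimes>\<^sub>k C)"
    using tensor_sum_closed[OF C_vspace C_vspace rep_carrier[OF assms(2)]] .
  show **: "tensor_sum C C L \<in> carrier (C \<otimes>\<^sub>k C) \<and>
      (\<forall>x\<in>X. \<forall>y\<in>X. tensor_value (tensor_sum C C L) x y = f (x \<otimes>\<^bsub>G\<^esub> y))"
    using * repD[OF assms(2)]
    by (simp add: tensor_value_tensor_sum[OF C_vspace C_vspace C_separates C_separates rep_carrier[OF assms(2)]])
  fix Z assume "Z \<in> carrier (C \<otimes>\<^sub>k C) \<and> (\<forall>x\<in>X. \<forall>y\<in>X. tensor_value Z x y = f (x \<otimes>\<^bsub>G\<^esub> y))"
  then show "Z = tensor_sum C C L"
    using ** by (intro tensor_value_eqI[OF C_vspace C_vspace C_separates C_separates]) auto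
qed

text \<open>The filtration of the functions on the square of the group by the order of vanishing at
  the identity, that is, by the sums of the products \<open>J s \<otimes> J t\<close> with
  \<open>n \<le> s + t\<close>.\<close>

definition Filt :: "nat \<Rightarrow> ('g \<Rightarrow> 'g \<Rightarrow> 'k) \<Rightarrow> bool" where
  "Filt n F \<longleftrightarrow> (\<exists>L. rep F L \<and> (\<forall>(a, b)\<in>set L. \<exists>s t. n \<le> s + t \<and> a \<in> J s \<and> b \<in> J t))"

lemma FiltE:
  assumes "Filt n F"
  obtains L where "rep F L" "\<And>a b. (a, b) \<in> set L \<Longrightarrow> \<exists>s t. n \<le> s + t \<and> a \<in> J s \<and> b \<in> J t"
  using assms unfolding Filt_def by blast

lemma FiltI:
  assumes "rep F L" "\<And>a b. (a, b) \<in> set L \<Longrightarrow> \<exists>s t. n \<le> s + t \<and> a \<in> J s \<and> b \<in> J t"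
  shows "Filt n F"
  using assms unfolding Filt_def by blast

lemma rep_mem: "rep F L \<Longrightarrow> (a, b) \<in> set L \<Longrightarrow> a \<in> A \<and> b \<in> A"
  by (auto simp: rep_def)

lemma Filt_cong:
  "Filt n F \<Longrightarrow> (\<And>u v. u \<in> X \<Longrightarrow> v \<in> X \<Longrightarrow> F' u v = F u v) \<Longrightarrow> Filt n F'"
  by (auto simp: Filt_def rep_def)

lemma Filt_mono: "Filt n F \<Longrightarrow> m \<le> n \<Longrightarrow> Filt m F"
  unfolding Filt_def by (fastforce intro: order_trans)

lemma Filt_pure: "a \<in> J s \<Longrightarrow> b \<in> J t \<Longrightarrow> n \<le> s + t \<Longrightarrow> Filt n (\<lambda>u v. a u * b v)"
  unfolding Filt_def by (intro exI[of _ "[(a, b)]"]) (auto simp: rep_def dest: J_A)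

lemma Filt_add: "Filt n F \<Longrightarrow> Filt n F' \<Longrightarrow> Filt n (\<lambda>u v. F u v + F' u v)"
proof -
  assume "Filt n F" "Filt n F'"
  then obtain L L' where "rep F L" "\<forall>(a, b)\<in>set L. \<exists>s t. n \<le> s + t \<and> a \<in> J s \<and> b \<in> J t"
    "rep F' L'" "\<forall>(a, b)\<in>set L'. \<exists>s t. n \<le> s + t \<and> a \<in> J s \<and> b \<in> J t" by (auto simp: Filt_def)
  then show ?thesis unfolding Filt_def
    by (intro exI[of _ "L @ L'"]) (auto simp: rep_def)
qed

lemma Filt_swap:
  assumes "Filt n F" shows "Filt n (\<lambda>u v. F v u)"
proof -
  obtain L where L: "rep F L" "\<And>a b. (a, b) \<in> set L \<Longrightarrow> \<exists>s t. n \<le> s + t \<and> a \<in> J s \<and> b \<in> J t"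
    using assms by (rule FiltE) blast
  have "(\<Sum>(a, b)\<leftarrow>map (\<lambda>(a, b). (b, a)) L. a u * b v) = (\<Sum>(a, b)\<leftarrow>L. a v * b u)" for u v
    by (induction L) (auto simp: mult.commute)
  then have "rep (\<lambda>u v. F v u) (map (\<lambda>(a, b). (b, a)) L)" using L(1) by (auto simp: rep_def)
  moreover have "\<exists>s t. n \<le> s + t \<and> a \<in> J s \<and> b \<in> J t"
    if "(a, b) \<in> set (map (\<lambda>(a, b). (b, a)) L)" for a b
  proof -
    have "(b, a) \<in> set L" using that by auto
    then obtain s t where "n \<le> s + t" "b \<in> J s" "a \<in> J t" using L(2) by blast
    then show ?thesis by (intro exI[of _ t] exI[of _ s]) simp
  qed
  ultimately show ?thesis by (rule FiltI)
qed

lemma sum_list_product: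
  "(\<Sum>(p, q)\<leftarrow>List.product L L'. f p * g q) = (\<Sum>p\<leftarrow>L. f p) * (\<Sum>q\<leftarrow>L'. g q :: 'r::comm_semiring_0)"
  by (induction L) (auto simp: distrib_right sum_list_const_mult o_def)

lemma rep_mult:
  assumes "rep F L" "rep F' L'"
  shows "rep (\<lambda>u v. F u v * F' u v)
    (map (\<lambda>((a, b), (c, d)). (\<lambda>x\<in>X. a x * c x, \<lambda>x\<in>X. b x * d x)) (List.product L L'))"
proof -
  have "(\<Sum>(a, b)\<leftarrow>map (\<lambda>((a, b), (c, d)). (\<lambda>x\<in>X. a x * c x, \<lambda>x\<in>X. b x * d x)) (List.product L L'). a u * b v)
      = F u v * F' u v" if "u \<in> X" "v \<in> X" for u v
    unfolding repD[OF assms(1) that] repD[OF assms(2) that]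
    unfolding sum_list_product[symmetric] map_map
    using that by (intro arg_cong[of _ _ sum_list] map_cong refl) (auto simp: ac_simps)
  moreover have "set (map (\<lambda>((a, b), (c, d)). (\<lambda>x\<in>X. a x * c x, \<lambda>x\<in>X. b x * d x)) (List.product L L')) \<subseteq> A \<times> A"
    using rep_mem[OF assms(1)] rep_mem[OF assms(2)] by auto
  ultimately show ?thesis unfolding rep_def by auto
qed

lemma Filt_mult:
  assumes "Filt n F" "Filt m F'" shows "Filt (n + m) (\<lambda>u v. F u v * F' u v)"
proof -
  obtain L where L: "rep F L" "\<And>a b. (a, b) \<in> set L \<Longrightarrow> \<exists>s t. n \<le> s + t \<and> a \<in> J s \<and> b \<in> J t"
    using assms(1) by (rule FiltE) blast
  obtain L' where L': "rep F' L'" "\<And>a b. (a, b) \<in> set L' \<Longrightarrow> \<exists>s t. m \<le> s + t \<and> a \<in> J s \<and> b \<in> J t"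
    using assms(2) by (rule FiltE) blast
  have "\<exists>s t. n + m \<le> s + t \<and> (\<lambda>x\<in>X. a x * c x) \<in> J s \<and> (\<lambda>x\<in>X. b x * d x) \<in> J t"
    if ab: "(a, b) \<in> set L" and cd: "(c, d) \<in> set L'" for a b c d
  proof -
    obtain s t where "n \<le> s + t" "a \<in> J s" "b \<in> J t" using L(2)[OF ab] by blast
    moreover obtain s' t' where "m \<le> s' + t'" "c \<in> J s'" "d \<in> J t'" using L'(2)[OF cd] by blast
    ultimately show ?thesis
      by (intro exI[of _ "s + s'"] exI[of _ "t + t'"]) (auto intro: J_mult)
  qed
  then show ?thesis by (intro FiltI[OF rep_mult[OF L(1) L'(1)]]) auto
qed

lemma Filt_smult: "Filt n F \<Longrightarrow> Filt n (\<lambda>u v. c * F u v)"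
  using Filt_mult[OF Filt_pure[of "\<lambda>x\<in>X. c" 0 "\<lambda>x\<in>X. 1" 0 0], of n F]
  by (auto intro!: Filt_cong[of n "\<lambda>u v. (\<lambda>x\<in>X. c) u * (\<lambda>x\<in>X. 1) v * F u v"])

lemma Filt_diff: "Filt n F \<Longrightarrow> Filt n F' \<Longrightarrow> Filt n (\<lambda>u v. F u v - F' u v)"
  using Filt_add[OF _ Filt_smult[of n F' "- 1"], of F] by simp

text \<open>If \<open>g(uv)\<close> is expanded into products \<open>a(u) b(v)\<close>, then the
  products \<open>(a(u) - a(1)) (b(v) - b(1))\<close> add up to the function in question.\<close>

lemma comult_primitive:
  assumes g: "g \<in> A"
  shows "Filt 2 (\<lambda>u v. g (u \<otimes>\<^bsub>G\<^esub> v) - g u - g v + g \<one>\<^bsub>G\<^esub>)"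
proof -
  obtain L where L: "rep (\<lambda>u v. g (u \<otimes>\<^bsub>G\<^esub> v)) L" by (rule rep_exists[OF g])
  let ?dev = "\<lambda>f. \<lambda>x\<in>X. f x - f \<one>\<^bsub>G\<^esub>"
  let ?L = "map (\<lambda>(a, b). (?dev a, ?dev b)) L"
  have A: "a \<in> A" "b \<in> A" if "(a, b) \<in> set L" for a b using L that by (auto simp: rep_def)
  have "(\<Sum>(a, b)\<leftarrow>?L. a u * b v) = g (u \<otimes>\<^bsub>G\<^esub> v) - g u - g v + g \<one>\<^bsub>G\<^esub>" if uv: "u \<in> X" "v \<in> X" for u v
  proof -
    have "(\<Sum>(a, b)\<leftarrow>?L. a u * b v) = (\<Sum>(a, b)\<leftarrow>L. a u * b v) - (\<Sum>(a, b)\<leftarrow>L. a u * b \<one>\<^bsub>G\<^esub>)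
        - (\<Sum>(a, b)\<leftarrow>L. a \<one>\<^bsub>G\<^esub> * b v) + (\<Sum>(a, b)\<leftarrow>L. a \<one>\<^bsub>G\<^esub> * b \<one>\<^bsub>G\<^esub>)"
      using uv by (induction L) (auto simp: algebra_simps)
    then show ?thesis
      using repD[OF L, symmetric] uv by simp
  qed
  then have "rep (\<lambda>u v. g (u \<otimes>\<^bsub>G\<^esub> v) - g u - g v + g \<one>\<^bsub>G\<^esub>) ?L"
    using A J_A[OF dev_in_J] unfolding rep_def by auto
  moreover have "\<exists>s t. 2 \<le> s + t \<and> a \<in> J s \<and> b \<in> J t" if "(a, b) \<in> set ?L" for a b
    using that A by (intro exI[of _ 1]) (auto intro: dev_in_J)
  ultimately show ?thesis by (rule FiltI)
qed

text \<open>For the augmentation ideal both claims follow from \<open>comult_primitive\<close>, as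
  the terms of order one are symmetric in \<open>u\<close> and \<open>v\<close>. For a product of
  \<open>a\<close> and \<open>b\<close> with values \<open>a\<close>, \<open>b\<close> at
  \<open>uv\<close> and \<open>a'\<close>, \<open>b'\<close> at \<open>vu\<close> one uses
  \<open>a b - a' b' = (a - a') b + a' (b - b')\<close>.\<close>

lemma comult_filtered:
  "f \<in> J n \<Longrightarrow> Filt n (\<lambda>u v. f (u \<otimes>\<^bsub>G\<^esub> v)) \<and> Filt (Suc n) (\<lambda>u v. f (u \<otimes>\<^bsub>G\<^esub> v) - f (v \<otimes>\<^bsub>G\<^esub> u))"
proof (induction n arbitrary: f)
  case (0 f)
  then have f: "f \<in> A" by simp
  obtain L where L: "rep (\<lambda>u v. f (u \<otimes>\<^bsub>G\<^esub> v)) L" by (rule rep_exists[OF f])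
  then have "Filt 0 (\<lambda>u v. f (u \<otimes>\<^bsub>G\<^esub> v))"
    using rep_mem[OF L] by (intro FiltI[OF L]) (auto intro!: exI[of _ 0])
  moreover have "Filt 1 (\<lambda>u v. f (u \<otimes>\<^bsub>G\<^esub> v) - f (v \<otimes>\<^bsub>G\<^esub> u))"
    using Filt_mono[OF Filt_diff[OF comult_primitive[OF f] Filt_swap[OF comult_primitive[OF f]]], of 1]
    by (auto intro: Filt_cong)
  ultimately show ?case by simp
next
  case (Suc n f)
  from Suc.prems show ?case
  proof (induction rule: J_Suc_induct)
    case (mult a b)
    let ?K = "\<lambda>u v. b (u \<otimes>\<^bsub>G\<^esub> v) - b u - b v + b \<one>\<^bsub>G\<^esub>"
    have bJ: "b \<in> J 1" using mult by (simp add: J_1_iff)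
    have K: "Filt 2 ?K" by (rule comult_primitive[OF mult(2)])
    have b1: "Filt 1 (\<lambda>u v. b (u \<otimes>\<^bsub>G\<^esub> v))"
      using Filt_add[OF Filt_mono[OF K, of 1] Filt_add[OF Filt_pure[OF bJ, of "\<lambda>x\<in>X. 1" 0 1] Filt_pure[of "\<lambda>x\<in>X. 1" 0 b 1 1]]]
        bJ mult(3) by (auto intro: Filt_cong)
    have b2: "Filt 2 (\<lambda>u v. b (u \<otimes>\<^bsub>G\<^esub> v) - b (v \<otimes>\<^bsub>G\<^esub> u))"
      using Filt_diff[OF K Filt_swap[OF K]] by (auto intro: Filt_cong)
    note a = Suc.IH[OF mult(1), THEN conjunct1] Suc.IH[OF mult(1), THEN conjunct2]
    have p1: "Filt (Suc n) (\<lambda>u v. a (u \<otimes>\<^bsub>G\<^esub> v) * b (u \<otimes>\<^bsub>G\<^esub> v))"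
      using Filt_mult[OF a(1) b1] by simp
    have p2: "Filt (Suc (Suc n)) (\<lambda>u v. (a (u \<otimes>\<^bsub>G\<^esub> v) - a (v \<otimes>\<^bsub>G\<^esub> u)) * b (u \<otimes>\<^bsub>G\<^esub> v)
        + a (v \<otimes>\<^bsub>G\<^esub> u) * (b (u \<otimes>\<^bsub>G\<^esub> v) - b (v \<otimes>\<^bsub>G\<^esub> u)))"
      using Filt_mult[OF a(2) b1] Filt_mult[OF Filt_swap[OF a(1)] b2]
      by (intro Filt_add) (simp_all add: numeral_2_eq_2)
    show ?case
      by (intro conjI Filt_cong[OF p1] Filt_cong[OF p2]) (simp_all add: algebra_simps)
  next
    case (add f g)
    then have p: "Filt (Suc n) (\<lambda>u v. f (u \<otimes>\<^bsub>G\<^esub> v) + g (u \<otimes>\<^bsub>G\<^esub> v))"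
      "Filt (Suc (Suc n)) (\<lambda>u v. (f (u \<otimes>\<^bsub>G\<^esub> v) - f (v \<otimes>\<^bsub>G\<^esub> u)) + (g (u \<otimes>\<^bsub>G\<^esub> v) - g (v \<otimes>\<^bsub>G\<^esub> u)))"
      by (intro Filt_add; simp)+
    show ?case
      by (intro conjI Filt_cong[OF p(1)] Filt_cong[OF p(2)]) (simp_all add: algebra_simps)
  qed
qed

text \<open>In each term one of the two functions vanishes to an order that is higher than the order
  of the distribution applied to it.\<close>

lemma pairing_Filt:
  assumes x: "x \<in> Dist G i" and y: "y \<in> Dist G j" and L: "rep F L" and F: "Filt (Suc (i + j)) F"
  shows "(\<Sum>(a, b)\<leftarrow>L. x a * y b) = 0"
proof -
  obtain L' where L': "rep F L'" "\<And>a b. (a, b) \<in> set L' \<Longrightarrow> \<exists>s t. Suc (i + j) \<le> s + t \<and> a \<in> J s \<and> b \<in> J t"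
    using F by (rule FiltE) blast
  have "(\<Sum>(a, b)\<leftarrow>L'. x a * y b) = 0"
  proof (rule sum_list_zero)
    fix l assume l: "l \<in> set L'"
    obtain a b where ab: "l = (a, b)" by (cases l)
    obtain s t where st: "Suc (i + j) \<le> s + t" "a \<in> J s" "b \<in> J t" using L'(2) l ab by blast
    show "(case l of (a, b) \<Rightarrow> x a * y b) = 0"
    proof (cases "Suc i \<le> s")
      case True
      then show ?thesis using st J_antimono[of "Suc i" s] DistD(3)[OF x, of a] by (auto simp: ab)
    next
      case False
      then have "Suc j \<le> t" using st by simp
      then show ?thesis using st J_antimono[of "Suc j" t] DistD(3)[OF y, of b] by (auto simp: ab)
    qed
  qed
  then show ?thesis using pairing_unique[OF L L'(1) DistD(1)[OF x] DistD(1)[OF y]] by simp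
qed

end

lemma Dist_algebra_simps [simp]:
  "carrier (Dist_algebra G) = (\<Union>k. Dist G k)"
  "x \<oplus>\<^bsub>Dist_algebra G\<^esub> y = (\<lambda>f\<in>regular G. x f + y f)"
  "\<zero>\<^bsub>Dist_algebra G\<^esub> = (\<lambda>f\<in>regular G. 0)"
  "c \<odot>\<^bsub>Dist_algebra G\<^esub> x = (\<lambda>f\<in>regular G. c * x f)"
  "\<one>\<^bsub>Dist_algebra G\<^esub> = (\<lambda>f\<in>regular G. f \<one>\<^bsub>G\<^esub>)"
  by (simp_all add: Dist_algebra_def function_algebra_def)

lemma Dist_module_simps [simp]:
  "carrier (Dist_module G k) = Dist G k"
  "x \<oplus>\<^bsub>Dist_module G k\<^esub> y = (\<lambda>f\<in>regular G. x f + y f)"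
  "\<zero>\<^bsub>Dist_module G k\<^esub> = (\<lambda>f\<in>regular G. 0)"
  "c \<odot>\<^bsub>Dist_module G k\<^esub> x = (\<lambda>f\<in>regular G. c * x f)"
  by (simp_all add: Dist_module_def Dist_algebra_def function_algebra_def)

lemma Dist_plus_module_simps [simp]:
  "carrier (Dist_plus_module G k) = Dist_plus G k"
  "x \<oplus>\<^bsub>Dist_plus_module G k\<^esub> y = (\<lambda>f\<in>regular G. x f + y f)"
  "\<zero>\<^bsub>Dist_plus_module G k\<^esub> = (\<lambda>f\<in>regular G. 0)"
  "c \<odot>\<^bsub>Dist_plus_module G k\<^esub> x = (\<lambda>f\<in>regular G. c * x f)"
  by (simp_all add: Dist_plus_module_def Dist_algebra_def function_algebra_def)

context affine_group
begin

abbreviation "D \<equiv> Dist_algebra G"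
abbreviation "DM k \<equiv> Dist_module G k"
abbreviation "VM k \<equiv> Dist_plus_module G k"

lemma Dist_closed:
  "(\<lambda>f\<in>A. 0) \<in> Dist G k"
  "x \<in> Dist G k \<Longrightarrow> y \<in> Dist G k \<Longrightarrow> (\<lambda>f\<in>A. x f + y f) \<in> Dist G k"
  "x \<in> Dist G k \<Longrightarrow> (\<lambda>f\<in>A. c * x f) \<in> Dist G k"
  "x \<in> Dist G k \<Longrightarrow> y \<in> Dist G k \<Longrightarrow> (\<lambda>f\<in>A. x f - y f) \<in> Dist G k"
  by (auto simp: Dist_iff linear_C J_A algebra_simps intro!: linear_mapsI)

lemma Dist_plus_iff: "x \<in> Dist_plus G k \<longleftrightarrow> x \<in> Dist G k \<and> x (\<lambda>x\<in>X. 1) = 0"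
  by (simp add: Dist_plus_def)

lemma Dist_ext: "x \<in> Dist G k \<Longrightarrow> x \<in> extensional A"
  by (simp add: Dist_iff)

lemma Dist_union_closed:
  assumes "x \<in> (\<Union>k. Dist G k)" "y \<in> (\<Union>k. Dist G k)"
  obtains k where "x \<in> Dist G k" "y \<in> Dist G k"
proof -
  obtain i j where "x \<in> Dist G i" "y \<in> Dist G j" using assms by auto
  then have "x \<in> Dist G (max i j)" "y \<in> Dist G (max i j)"
    using Dist_mono[of i "max i j"] Dist_mono[of j "max i j"] by auto
  then show ?thesis by (rule that)
qed

lemma D_vspace: "vspace D"
proof (rule function_space_vspace(1)[where X = A])
  show "carrier D \<subseteq> extensional A" by (auto dest: Dist_ext)
  show "(\<lambda>f\<in>A. x f + y f) \<in> carrier D" if "x \<in> carrier D" "y \<in> carrier D" for x y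
    using that Dist_union_closed[of x y] Dist_closed(2)[of x _ y] by (metis Dist_algebra_simps(1) UN_I UNIV_I)
qed (auto intro: Dist_closed)

lemma DM_vspace: "vspace (DM k)" and DM_separates: "separates (\<lambda>x f. x f) A (DM k)"
  using Dist_ext Dist_closed by (auto intro!: function_space_vspace)

lemma VM_vspace: "vspace (VM k)"
  using Dist_ext Dist_closed
  by (intro function_space_vspace(1)[where X = A]) (auto simp: Dist_plus_iff)

lemma D_minus: "x \<in> carrier D \<Longrightarrow> y \<in> carrier D \<Longrightarrow> x \<ominus>\<^bsub>D\<^esub> y = (\<lambda>f\<in>A. x f - y f)"
  by (simp add: a_minus_def vspace_minus[OF D_vspace] cong: restrict_cong)

lemma Dist_eqI:
  "x \<in> extensional A \<Longrightarrow> y \<in> extensional A \<Longrightarrow> (\<And>f. f \<in> A \<Longrightarrow> x f = y f) \<Longrightarrow> x = y"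
  by (rule extensionalityI)

lemma unit_Dist: "(\<lambda>f\<in>A. f \<one>\<^bsub>G\<^esub>) \<in> Dist G k"
proof -
  have "(\<lambda>f\<in>A. f \<one>\<^bsub>G\<^esub>) \<in> Dist G 0"
    by (auto simp: Dist_iff J_1_iff intro!: linear_mapsI)
  then show ?thesis using Dist_mono[of 0 k] by auto
qed

text \<open>The function \<open>f - f(1)\<close> lies in the augmentation ideal, where
  \<open>x\<close> vanishes.\<close>

lemma Dist_0:
  assumes "x \<in> Dist G 0" shows "x = (\<lambda>f\<in>A. x (\<lambda>x\<in>X. 1) * f \<one>\<^bsub>G\<^esub>)"
proof (rule Dist_eqI)
  fix f assume f: "f \<in> A"
  let ?d = "\<lambda>x\<in>X. f x - f \<one>\<^bsub>G\<^esub>"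
  have "x f = x (\<lambda>x\<in>X. ?d x + (\<lambda>x\<in>X. f \<one>\<^bsub>G\<^esub> * (\<lambda>x\<in>X. 1) x) x)"
    using f by (simp add: A_restrict cong: restrict_cong)
  also have "\<dots> = x ?d + f \<one>\<^bsub>G\<^esub> * x (\<lambda>x\<in>X. 1)"
    using linear_C[OF DistD(1)[OF assms]] J_A[OF dev_in_J[OF f]] by (simp del: restrict_apply')
  also have "x ?d = 0" using DistD(3)[OF assms] dev_in_J[OF f] by simp
  finally show "x f = (\<lambda>f\<in>A. x (\<lambda>x\<in>X. 1) * f \<one>\<^bsub>G\<^esub>) f" using f by simp
qed (use assms in \<open>auto dest: Dist_ext\<close>)

lemma Dist_plus_0: "x \<in> Dist_plus G 0 \<Longrightarrow> x = (\<lambda>f\<in>A. 0)"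
  using Dist_0[of x] by (simp add: Dist_plus_iff)

subsection \<open>Convolution\<close>

lemma conv_apply:
  assumes f: "f \<in> A" and L: "rep (\<lambda>u v. f (u \<otimes>\<^bsub>G\<^esub> v)) L"
    and x: "x \<in> linear_maps C base_field" and y: "y \<in> linear_maps C base_field"
  shows "(x \<otimes>\<^bsub>D\<^esub> y) f = (\<Sum>(a, b)\<leftarrow>L. x a * y b)"
  using tensor_lift_tensor_sum[OF C_vspace C_vspace evaluation_bilinear[OF x y] rep_carrier[OF L]] f
  by (simp add: Dist_algebra_def coord_comult_rep[OF f L])

lemma conv_ext: "x \<otimes>\<^bsub>D\<^esub> y \<in> extensional A"
  by (simp add: Dist_algebra_def)

lemma rep_add: "rep F L \<Longrightarrow> rep F' L' \<Longrightarrow> rep (\<lambda>u v. F u v + F' u v) (L @ L')"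
  by (auto simp: rep_def)

lemma rep_smult:
  assumes "rep F L" shows "rep (\<lambda>u v. c * F u v) (map (\<lambda>(a, b). (\<lambda>x\<in>X. c * a x, b)) L)"
proof -
  have "(\<Sum>(a, b)\<leftarrow>map (\<lambda>(a, b). (\<lambda>x\<in>X. c * a x, b)) L. a u * b v) = c * (\<Sum>(a, b)\<leftarrow>L. a u * b v)"
    if "u \<in> X" "v \<in> X" for u v
    using that by (induction L) (auto simp: algebra_simps)
  then show ?thesis using assms rep_mem[OF assms] unfolding rep_def by auto
qed

lemma rep_cong: "rep F L \<Longrightarrow> (\<And>u v. u \<in> X \<Longrightarrow> v \<in> X \<Longrightarrow> F' u v = F u v) \<Longrightarrow> rep F' L"
  by (auto simp: rep_def)

lemma conv_linear:
  assumes x: "x \<in> linear_maps C base_field" and y: "y \<in> linear_maps C base_field"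
  shows "x \<otimes>\<^bsub>D\<^esub> y \<in> linear_maps C base_field"
proof (rule linear_mapsI)
  fix f assume "f \<in> carrier C"
  then have f: "f \<in> A" by simp
  obtain L where L: "rep (\<lambda>u v. f (u \<otimes>\<^bsub>G\<^esub> v)) L" by (rule rep_exists[OF f])
  show "(x \<otimes>\<^bsub>D\<^esub> y) (f \<oplus>\<^bsub>C\<^esub> g) = (x \<otimes>\<^bsub>D\<^esub> y) f \<oplus>\<^bsub>base_field\<^esub> (x \<otimes>\<^bsub>D\<^esub> y) g" if "g \<in> carrier C" for g
  proof -
    have g: "g \<in> A" using that by simp
    obtain L' where L': "rep (\<lambda>u v. g (u \<otimes>\<^bsub>G\<^esub> v)) L'" by (rule rep_exists[OF g])
    have "rep (\<lambda>u v. (\<lambda>x\<in>X. f x + g x) (u \<otimes>\<^bsub>G\<^esub> v)) (L @ L')"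
      by (rule rep_cong[OF rep_add[OF L L']]) simp
    from conv_apply[OF _ this x y] show ?thesis
      using f g by (simp add: conv_apply[OF f L x y] conv_apply[OF g L' x y])
  qed
  show "(x \<otimes>\<^bsub>D\<^esub> y) (c \<odot>\<^bsub>C\<^esub> f) = c \<odot>\<^bsub>base_field\<^esub> (x \<otimes>\<^bsub>D\<^esub> y) f" for c
  proof -
    let ?L = "map (\<lambda>(a, b). (\<lambda>x\<in>X. c * a x, b)) L"
    have "rep (\<lambda>u v. (\<lambda>x\<in>X. c * f x) (u \<otimes>\<^bsub>G\<^esub> v)) ?L"
      by (rule rep_cong[OF rep_smult[OF L]]) simp
    then have "(x \<otimes>\<^bsub>D\<^esub> y) (\<lambda>x\<in>X. c * f x) = (\<Sum>(a, b)\<leftarrow>?L. x a * y b)"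
      using f by (intro conv_apply x y) auto
    also have "\<dots> = c * (\<Sum>(a, b)\<leftarrow>L. x a * y b)"
      unfolding map_map sum_list_const_mult[symmetric]
      using rep_mem[OF L] linear_C(2)[OF x]
      by (intro arg_cong[of _ _ sum_list] map_cong refl) (auto simp: mult.assoc)
    finally show ?thesis by (simp add: conv_apply[OF f L x y])
  qed
qed simp

lemma conv_Dist:
  assumes x: "x \<in> Dist G i" and y: "y \<in> Dist G j"
  shows "x \<otimes>\<^bsub>D\<^esub> y \<in> Dist G (i + j)"
  unfolding Dist_iff
proof (intro conjI conv_linear conv_ext DistD(1)[OF x] DistD(1)[OF y] ballI)
  fix f assume f: "f \<in> J (Suc (i + j))"
  obtain L where L: "rep (\<lambda>u v. f (u \<otimes>\<^bsub>G\<^esub> v)) L" by (rule rep_exists[OF J_A[OF f]])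
  then show "(x \<otimes>\<^bsub>D\<^esub> y) f = 0"
    using pairing_Filt[OF x y L] comult_filtered[OF f] conv_apply[OF J_A[OF f] L DistD(1)[OF x] DistD(1)[OF y]]
    by simp
qed

lemma conv_bilinear:
  assumes x: "x \<in> linear_maps C base_field" and x': "x' \<in> linear_maps C base_field"
    and y: "y \<in> linear_maps C base_field"
  shows "(\<lambda>f\<in>A. x f + x' f) \<otimes>\<^bsub>D\<^esub> y = (\<lambda>f\<in>A. (x \<otimes>\<^bsub>D\<^esub> y) f + (x' \<otimes>\<^bsub>D\<^esub> y) f)"
    and "y \<otimes>\<^bsub>D\<^esub> (\<lambda>f\<in>A. x f + x' f) = (\<lambda>f\<in>A. (y \<otimes>\<^bsub>D\<^esub> x) f + (y \<otimes>\<^bsub>D\<^esub> x') f)"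
    and "(\<lambda>f\<in>A. c * x f) \<otimes>\<^bsub>D\<^esub> y = (\<lambda>f\<in>A. c * (x \<otimes>\<^bsub>D\<^esub> y) f)"
    and "y \<otimes>\<^bsub>D\<^esub> (\<lambda>f\<in>A. c * x f) = (\<lambda>f\<in>A. c * (y \<otimes>\<^bsub>D\<^esub> x) f)"
proof -
  have lin: "(\<lambda>f\<in>A. x f + x' f) \<in> linear_maps C base_field" "(\<lambda>f\<in>A. c * x f) \<in> linear_maps C base_field"
    by (auto simp: linear_C[OF x] linear_C[OF x'] algebra_simps intro!: linear_mapsI)
  have val: "(\<lambda>f\<in>A. g f) a = g a" if "rep F L" "(a, b) \<in> set L \<or> (b, a) \<in> set L" for g :: "('g \<Rightarrow> 'k) \<Rightarrow> 'k" and a b F L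
    using that rep_mem by auto
  show "(\<lambda>f\<in>A. x f + x' f) \<otimes>\<^bsub>D\<^esub> y = (\<lambda>f\<in>A. (x \<otimes>\<^bsub>D\<^esub> y) f + (x' \<otimes>\<^bsub>D\<^esub> y) f)"
  proof (rule Dist_eqI[OF conv_ext])
    fix f assume f: "f \<in> A"
    obtain L where L: "rep (\<lambda>u v. f (u \<otimes>\<^bsub>G\<^esub> v)) L" by (rule rep_exists[OF f])
    have "(\<Sum>(a, b)\<leftarrow>L. (\<lambda>f\<in>A. x f + x' f) a * y b) = (\<Sum>(a, b)\<leftarrow>L. x a * y b) + (\<Sum>(a, b)\<leftarrow>L. x' a * y b)"
      unfolding sum_list_addf[symmetric] using rep_mem[OF L]
      by (intro arg_cong[of _ _ sum_list] map_cong refl) (auto simp: algebra_simps)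
    then show "((\<lambda>f\<in>A. x f + x' f) \<otimes>\<^bsub>D\<^esub> y) f = (\<lambda>f\<in>A. (x \<otimes>\<^bsub>D\<^esub> y) f + (x' \<otimes>\<^bsub>D\<^esub> y) f) f"
      using f by (simp add: conv_apply[OF f L] lin x x' y)
  qed simp
  show "y \<otimes>\<^bsub>D\<^esub> (\<lambda>f\<in>A. x f + x' f) = (\<lambda>f\<in>A. (y \<otimes>\<^bsub>D\<^esub> x) f + (y \<otimes>\<^bsub>D\<^esub> x') f)"
  proof (rule Dist_eqI[OF conv_ext])
    fix f assume f: "f \<in> A"
    obtain L where L: "rep (\<lambda>u v. f (u \<otimes>\<^bsub>G\<^esub> v)) L" by (rule rep_exists[OF f])
    have "(\<Sum>(a, b)\<leftarrow>L. y a * (\<lambda>f\<in>A. x f + x' f) b) = (\<Sum>(a, b)\<leftarrow>L. y a * x b) + (\<Sum>(a, b)\<leftarrow>L. y a * x' b)"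
      unfolding sum_list_addf[symmetric] using rep_mem[OF L]
      by (intro arg_cong[of _ _ sum_list] map_cong refl) (auto simp: algebra_simps)
    then show "(y \<otimes>\<^bsub>D\<^esub> (\<lambda>f\<in>A. x f + x' f)) f = (\<lambda>f\<in>A. (y \<otimes>\<^bsub>D\<^esub> x) f + (y \<otimes>\<^bsub>D\<^esub> x') f) f"
      using f by (simp add: conv_apply[OF f L] lin x x' y)
  qed simp
  show "(\<lambda>f\<in>A. c * x f) \<otimes>\<^bsub>D\<^esub> y = (\<lambda>f\<in>A. c * (x \<otimes>\<^bsub>D\<^esub> y) f)"
  proof (rule Dist_eqI[OF conv_ext])
    fix f assume f: "f \<in> A"
    obtain L where L: "rep (\<lambda>u v. f (u \<otimes>\<^bsub>G\<^esub> v)) L" by (rule rep_exists[OF f])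
    have "(\<Sum>(a, b)\<leftarrow>L. (\<lambda>f\<in>A. c * x f) a * y b) = c * (\<Sum>(a, b)\<leftarrow>L. x a * y b)"
      unfolding sum_list_const_mult[symmetric] using rep_mem[OF L]
      by (intro arg_cong[of _ _ sum_list] map_cong refl) (auto simp: algebra_simps)
    then show "((\<lambda>f\<in>A. c * x f) \<otimes>\<^bsub>D\<^esub> y) f = (\<lambda>f\<in>A. c * (x \<otimes>\<^bsub>D\<^esub> y) f) f"
      using f by (simp add: conv_apply[OF f L] lin x y)
  qed simp
  show "y \<otimes>\<^bsub>D\<^esub> (\<lambda>f\<in>A. c * x f) = (\<lambda>f\<in>A. c * (y \<otimes>\<^bsub>D\<^esub> x) f)"
  proof (rule Dist_eqI[OF conv_ext])
    fix f assume f: "f \<in> A"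
    obtain L where L: "rep (\<lambda>u v. f (u \<otimes>\<^bsub>G\<^esub> v)) L" by (rule rep_exists[OF f])
    have "(\<Sum>(a, b)\<leftarrow>L. y a * (\<lambda>f\<in>A. c * x f) b) = c * (\<Sum>(a, b)\<leftarrow>L. y a * x b)"
      unfolding sum_list_const_mult[symmetric] using rep_mem[OF L]
      by (intro arg_cong[of _ _ sum_list] map_cong refl) (auto simp: algebra_simps)
    then show "(y \<otimes>\<^bsub>D\<^esub> (\<lambda>f\<in>A. c * x f)) f = (\<lambda>f\<in>A. c * (y \<otimes>\<^bsub>D\<^esub> x) f) f"
      using f by (simp add: conv_apply[OF f L] lin x y)
  qed simp
qed

lemma conv_unit:
  assumes x: "x \<in> Dist G k"
  shows "(\<lambda>f\<in>A. f \<one>\<^bsub>G\<^esub>) \<otimes>\<^bsub>D\<^esub> x = x" "x \<otimes>\<^bsub>D\<^esub> (\<lambda>f\<in>A. f \<one>\<^bsub>G\<^esub>) = x"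
proof -
  have u: "(\<lambda>f\<in>A. f \<one>\<^bsub>G\<^esub>) \<in> linear_maps C base_field" using DistD(1)[OF unit_Dist] .
  note xl = DistD(1)[OF x]
  show "(\<lambda>f\<in>A. f \<one>\<^bsub>G\<^esub>) \<otimes>\<^bsub>D\<^esub> x = x"
  proof (rule Dist_eqI[OF conv_ext Dist_ext[OF x]])
    fix f assume f: "f \<in> A"
    obtain L where L: "rep (\<lambda>u v. f (u \<otimes>\<^bsub>G\<^esub> v)) L" by (rule rep_exists[OF f])
    have "((\<lambda>f\<in>A. f \<one>\<^bsub>G\<^esub>) \<otimes>\<^bsub>D\<^esub> x) f = (\<Sum>l\<leftarrow>L. fst l \<one>\<^bsub>G\<^esub> * x (snd l))"
      unfolding conv_apply[OF f L u xl] using rep_mem[OF L]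
      by (intro arg_cong[of _ _ sum_list] map_cong refl) auto
    also have "\<dots> = x (\<lambda>v\<in>X. \<Sum>l\<leftarrow>L. fst l \<one>\<^bsub>G\<^esub> * snd l v)"
      using rep_mem[OF L] by (intro linear_sum_list(2)[symmetric] xl) auto
    also have "(\<lambda>v\<in>X. \<Sum>l\<leftarrow>L. fst l \<one>\<^bsub>G\<^esub> * snd l v) = f"
      using repD[OF L, of "\<one>\<^bsub>G\<^esub>"] by (intro A_eq_restrict[OF f]) (simp add: split_def)
    finally show "((\<lambda>f\<in>A. f \<one>\<^bsub>G\<^esub>) \<otimes>\<^bsub>D\<^esub> x) f = x f" .
  qed
  show "x \<otimes>\<^bsub>D\<^esub> (\<lambda>f\<in>A. f \<one>\<^bsub>G\<^esub>) = x"
  proof (rule Dist_eqI[OF conv_ext Dist_ext[OF x]])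
    fix f assume f: "f \<in> A"
    obtain L where L: "rep (\<lambda>u v. f (u \<otimes>\<^bsub>G\<^esub> v)) L" by (rule rep_exists[OF f])
    have "(x \<otimes>\<^bsub>D\<^esub> (\<lambda>f\<in>A. f \<one>\<^bsub>G\<^esub>)) f = (\<Sum>l\<leftarrow>L. snd l \<one>\<^bsub>G\<^esub> * x (fst l))"
      unfolding conv_apply[OF f L xl u] using rep_mem[OF L]
      by (intro arg_cong[of _ _ sum_list] map_cong refl) auto
    also have "\<dots> = x (\<lambda>v\<in>X. \<Sum>l\<leftarrow>L. snd l \<one>\<^bsub>G\<^esub> * fst l v)"
      using rep_mem[OF L] by (intro linear_sum_list(2)[symmetric] xl) auto
    also have "(\<lambda>v\<in>X. \<Sum>l\<leftarrow>L. snd l \<one>\<^bsub>G\<^esub> * fst l v) = f"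
      using repD[OF L, of _ "\<one>\<^bsub>G\<^esub>"] by (intro A_eq_restrict[OF f]) (simp add: split_def mult.commute)
    finally show "(x \<otimes>\<^bsub>D\<^esub> (\<lambda>f\<in>A. f \<one>\<^bsub>G\<^esub>)) f = x f" .
  qed
qed

lemma conv_one_value:
  assumes "x \<in> linear_maps C base_field" "y \<in> linear_maps C base_field"
  shows "(x \<otimes>\<^bsub>D\<^esub> y) (\<lambda>x\<in>X. 1) = x (\<lambda>x\<in>X. 1) * y (\<lambda>x\<in>X. 1)"
proof -
  have "rep (\<lambda>u v. (\<lambda>x\<in>X. 1) (u \<otimes>\<^bsub>G\<^esub> v)) [(\<lambda>x\<in>X. 1, \<lambda>x\<in>X. 1)]" by (simp add: rep_def)
  from conv_apply[OF _ this assms] show ?thesis by simp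
qed

lemma conv_Dist_plus:
  "x \<in> Dist_plus G i \<Longrightarrow> y \<in> Dist_plus G j \<Longrightarrow> x \<otimes>\<^bsub>D\<^esub> y \<in> Dist_plus G (i + j)"
  using conv_one_value[OF DistD(1)[of x i] DistD(1)[of y j]] by (simp add: Dist_plus_iff conv_Dist)

text \<open>Dually to the symmetry of the leading part of the comultiplication of functions, the
  associated graded algebra of the distributions is commutative.\<close>

lemma commutator_Dist:
  assumes x: "x \<in> Dist G i" and y: "y \<in> Dist G j"
  shows "(\<lambda>f\<in>A. (x \<otimes>\<^bsub>D\<^esub> y) f - (y \<otimes>\<^bsub>D\<^esub> x) f) \<in> Dist G (i + j - 1)"
proof (cases "i + j = 0")
  case True
  then show ?thesis using conv_Dist[OF x y] conv_Dist[OF y x] by (auto intro: Dist_closed)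
next
  case False
  note xl = DistD(1)[OF x] and yl = DistD(1)[OF y]
  have *: "(\<lambda>f\<in>A. (x \<otimes>\<^bsub>D\<^esub> y) f - (y \<otimes>\<^bsub>D\<^esub> x) f) \<in> Dist G (i + j)"
    using conv_Dist[OF x y] conv_Dist[OF y x] by (intro Dist_closed) (simp_all add: add.commute)
  show ?thesis unfolding Dist_iff
  proof (intro conjI DistD(1)[OF *] DistD(2)[OF *] ballI)
    fix f assume "f \<in> J (Suc (i + j - 1))"
    then have f: "f \<in> J (i + j)" using False by simp
    note fA = J_A[OF f]
    obtain L where L: "rep (\<lambda>u v. f (u \<otimes>\<^bsub>G\<^esub> v)) L" by (rule rep_exists[OF fA])
    (* an expansion of - f(vu) *)
    define L' where "L' = map (\<lambda>(a, b). (\<lambda>x\<in>X. - 1 * b x, a)) L"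
    have L'A: "set L' \<subseteq> A \<times> A" using rep_mem[OF L] A_closed(4)[of _ "- 1"] by (auto simp: L'_def)
    have val: "(\<Sum>(a, b)\<leftarrow>L'. a u * b v) = - (\<Sum>(a, b)\<leftarrow>L. a v * b u)" if "u \<in> X" for u v
      unfolding L'_def using that by (induction L) (auto simp: mult.commute)
    have "rep (\<lambda>u v. f (u \<otimes>\<^bsub>G\<^esub> v) - f (v \<otimes>\<^bsub>G\<^esub> u)) (L @ L')"
      using L L'A val by (auto simp: rep_def)
    then have "(\<Sum>(a, b)\<leftarrow>L @ L'. x a * y b) = 0"
      by (rule pairing_Filt[OF x y _ comult_filtered[OF f, THEN conjunct2]])
    moreover have "(\<Sum>(a, b)\<leftarrow>L'. x a * y b) = - (\<Sum>(a, b)\<leftarrow>L. y a * x b)"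
      unfolding L'_def map_map uminus_sum_list_map using rep_mem[OF L] linear_C(2)[OF xl, of _ "- 1"]
      by (intro arg_cong[of _ _ sum_list] map_cong refl) (auto simp: mult.commute)
    ultimately show "(\<lambda>f\<in>A. (x \<otimes>\<^bsub>D\<^esub> y) f - (y \<otimes>\<^bsub>D\<^esub> x) f) f = 0"
      using fA by (simp add: conv_apply[OF fA L] xl yl)
  qed
qed

lemma commutator_Dist_plus:
  assumes "x \<in> Dist_plus G i" "y \<in> Dist_plus G j"
  shows "(\<lambda>f\<in>A. (x \<otimes>\<^bsub>D\<^esub> y) f - (y \<otimes>\<^bsub>D\<^esub> x) f) \<in> Dist_plus G (i + j - 1)"
  using assms commutator_Dist[of x i y j] conv_one_value[OF DistD(1)[of x i] DistD(1)[of y j]]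
    conv_one_value[OF DistD(1)[of y j] DistD(1)[of x i]]
  by (simp add: Dist_plus_iff)

subsection \<open>The antipode\<close>

definition inversion :: "('g \<Rightarrow> 'k) \<Rightarrow> 'g \<Rightarrow> 'k" where
  "inversion f = (\<lambda>x\<in>X. f (inv\<^bsub>G\<^esub> x))"

lemma inversion_A [simp]: "f \<in> A \<Longrightarrow> inversion f \<in> A"
  by (simp add: inversion_def A_inv)

lemma inversion_J: "f \<in> J n \<Longrightarrow> inversion f \<in> J n"
proof (induction n arbitrary: f)
  case (Suc n)
  from Suc.prems show ?case
  proof (induction rule: J_Suc_induct)
    case (mult a b)
    have "(\<lambda>x\<in>X. inversion a x * inversion b x) \<in> J (Suc n)"
      using Suc.IH[OF mult(1)] mult by (intro J_mult_aug) (auto simp: inversion_def A_inv)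
    then show ?case by (simp add: inversion_def cong: restrict_cong)
  next
    case (add f g)
    then show ?case using J_closed(3)[OF add(3,4)] by (simp add: inversion_def cong: restrict_cong)
  qed
qed simp

lemma antipode_eq: "Dist_antipode G x = (\<lambda>f\<in>A. x (inversion f))"
  by (simp add: Dist_antipode_def inversion_def)

lemma antipode_Dist:
  assumes x: "x \<in> Dist G k" shows "Dist_antipode G x \<in> Dist G k"
proof -
  have "inversion (\<lambda>x\<in>X. f x + g x) = (\<lambda>x\<in>X. inversion f x + inversion g x)"
    "inversion (\<lambda>x\<in>X. c * f x) = (\<lambda>x\<in>X. c * inversion f x)" for f g c
    by (simp_all add: inversion_def cong: restrict_cong)
  then show ?thesis
    using linear_C[OF DistD(1)[OF x]] DistD(3)[OF x] inversion_J J_A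
    by (auto simp: Dist_iff antipode_eq intro!: linear_mapsI)
qed

lemma inversion_1: "inversion (\<lambda>x\<in>X. 1) = (\<lambda>x\<in>X. 1)"
  by (simp add: inversion_def cong: restrict_cong)

lemma antipode_Dist_plus: "x \<in> Dist_plus G k \<Longrightarrow> Dist_antipode G x \<in> Dist_plus G k"
  using antipode_Dist[of x k] by (simp add: Dist_plus_iff) (simp add: antipode_eq inversion_1)

text \<open>Inversion reverses products in the group, so that it interchanges the factors in an
  expansion of \<open>f(uv)\<close>.\<close>

lemma antipode_conv:
  assumes x: "x \<in> Dist G i" and y: "y \<in> Dist G j"
  shows "Dist_antipode G (x \<otimes>\<^bsub>D\<^esub> y) = Dist_antipode G y \<otimes>\<^bsub>D\<^esub> Dist_antipode G x"
proof (rule Dist_eqI[OF _ conv_ext])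
  fix f assume f: "f \<in> A"
  obtain L where L: "rep (\<lambda>u v. f (u \<otimes>\<^bsub>G\<^esub> v)) L" by (rule rep_exists[OF f])
  let ?L = "map (\<lambda>(a, b). (inversion b, inversion a)) L"
  have val: "(\<Sum>(a, b)\<leftarrow>?L. a u * b v) = (\<Sum>(a, b)\<leftarrow>L. a (inv\<^bsub>G\<^esub> v) * b (inv\<^bsub>G\<^esub> u))"
    if "u \<in> X" "v \<in> X" for u v
    using that by (induction L) (auto simp: mult.commute inversion_def)
  have "rep (\<lambda>u v. inversion f (u \<otimes>\<^bsub>G\<^esub> v)) ?L"
    using rep_mem[OF L] repD[OF L] val by (auto simp: rep_def inversion_def inv_mult_group intro!: A_inv)
  then have "(x \<otimes>\<^bsub>D\<^esub> y) (inversion f) = (\<Sum>(a, b)\<leftarrow>?L. x a * y b)"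
    using f by (intro conv_apply DistD(1)[OF x] DistD(1)[OF y]) auto
  also have "\<dots> = (\<Sum>(a, b)\<leftarrow>L. Dist_antipode G y a * Dist_antipode G x b)"
    unfolding map_map using rep_mem[OF L]
    by (intro arg_cong[of _ _ sum_list] map_cong refl) (auto simp: antipode_eq mult.commute)
  also have "\<dots> = (Dist_antipode G y \<otimes>\<^bsub>D\<^esub> Dist_antipode G x) f"
    using conv_apply[OF f L DistD(1)[OF antipode_Dist[OF y]] DistD(1)[OF antipode_Dist[OF x]]] by simp
  finally show "Dist_antipode G (x \<otimes>\<^bsub>D\<^esub> y) f = (Dist_antipode G y \<otimes>\<^bsub>D\<^esub> Dist_antipode G x) f"
    using f by (simp add: antipode_eq)
qed (simp add: antipode_eq)

end

lemma sum_list_index: "(\<Sum>x\<leftarrow>xs. f x) = (\<Sum>i<length xs. f (xs ! i))"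
  by (simp add: sum_list_sum_nth atLeast0LessThan)

lemma sum_list_swap:
  "(\<Sum>x\<leftarrow>xs. \<Sum>y\<leftarrow>ys. f x y) = (\<Sum>y\<leftarrow>ys. \<Sum>x\<leftarrow>xs. f x y :: 'r::comm_monoid_add)"
  unfolding sum_list_index by (rule sum.swap)

text \<open>The four-fold interchange of sums behind the compatibility of convolution and
  comultiplication.\<close>

lemma sum_interchange:
  fixes p :: "'l \<Rightarrow> 'r \<Rightarrow> 'k::comm_semiring_0"
  shows "(\<Sum>r\<in>R. \<Sum>s\<in>S. (\<Sum>l\<in>L. p l r * q l s) * (\<Sum>m\<in>M. u m r * v m s))
    = (\<Sum>l\<in>L. \<Sum>m\<in>M. (\<Sum>r\<in>R. p l r * u m r) * (\<Sum>s\<in>S. q l s * v m s))"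
proof -
  let ?t = "\<lambda>l m r s. p l r * q l s * (u m r * v m s)"
  have "(\<Sum>l\<in>L. \<Sum>m\<in>M. (\<Sum>r\<in>R. p l r * u m r) * (\<Sum>s\<in>S. q l s * v m s))
      = (\<Sum>l\<in>L. \<Sum>m\<in>M. \<Sum>r\<in>R. \<Sum>s\<in>S. ?t l m r s)"
    unfolding sum_product by (intro sum.cong refl) (simp add: ac_simps)
  also have "\<dots> = (\<Sum>l\<in>L. \<Sum>r\<in>R. \<Sum>m\<in>M. \<Sum>s\<in>S. ?t l m r s)"
    by (intro sum.cong refl sum.swap)
  also have "\<dots> = (\<Sum>r\<in>R. \<Sum>l\<in>L. \<Sum>m\<in>M. \<Sum>s\<in>S. ?t l m r s)" by (rule sum.swap)
  also have "\<dots> = (\<Sum>r\<in>R. \<Sum>l\<in>L. \<Sum>s\<in>S. \<Sum>m\<in>M. ?t l m r s)"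
    by (intro sum.cong refl sum.swap)
  also have "\<dots> = (\<Sum>r\<in>R. \<Sum>s\<in>S. \<Sum>l\<in>L. \<Sum>m\<in>M. ?t l m r s)"
    by (intro sum.cong refl sum.swap)
  finally show ?thesis unfolding sum_product by simp
qed

context affine_group
begin

subsection \<open>The comultiplication of distributions\<close>

text \<open>An expansion of the comultiplication of \<open>\<mu>\<close>, that is, of the functional
  \<open>\<mu>(f g)\<close> of two functions, in which the orders of the two components add up to at
  most \<open>i\<close>.\<close>

definition comult_rep :: "nat \<Rightarrow> (('g \<Rightarrow> 'k) \<Rightarrow> 'k) \<Rightarrow> ((('g \<Rightarrow> 'k) \<Rightarrow> 'k) \<times> (('g \<Rightarrow> 'k) \<Rightarrow> 'k)) list \<Rightarrow> bool" where
  "comult_rep i \<mu> L \<longleftrightarrow>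
     (\<forall>(x, y)\<in>set L. \<exists>a b. a + b \<le> i \<and> x \<in> Dist G a \<and> y \<in> Dist G b) \<and>
     (\<forall>f\<in>A. \<forall>g\<in>A. \<mu> (\<lambda>x\<in>X. f x * g x) = (\<Sum>(x, y)\<leftarrow>L. x f * y g))"

lemma comult_repD:
  assumes "comult_rep i \<mu> L"
  shows "(x, y) \<in> set L \<Longrightarrow> \<exists>a b. a + b \<le> i \<and> x \<in> Dist G a \<and> y \<in> Dist G b"
    and "f \<in> A \<Longrightarrow> g \<in> A \<Longrightarrow> \<mu> (\<lambda>x\<in>X. f x * g x) = (\<Sum>(x, y)\<leftarrow>L. x f * y g)"
  using assms unfolding comult_rep_def by blast+

lemma comult_rep_mem:
  assumes "comult_rep i \<mu> L" "(x, y) \<in> set L" "i \<le> k"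
  shows "x \<in> Dist G k \<and> y \<in> Dist G k"
proof -
  obtain a b where "a + b \<le> i" "x \<in> Dist G a" "y \<in> Dist G b" using comult_repD(1)[OF assms(1,2)] by blast
  then show ?thesis using assms(3) Dist_mono[of a k] Dist_mono[of b k] by auto
qed

text \<open>Expanding \<open>f\<close> in an adapted dual system gives
  \<open>\<mu>(f g) = (\<Sum> \<nu>(f) \<mu>(h g))\<close>. If \<open>h\<close> vanishes to order
  \<open>d\<close>, then \<open>\<mu>(h g)\<close> is a distribution of order \<open>i - d\<close>
  in \<open>g\<close>, while \<open>\<nu>\<close> has order \<open>d\<close>.\<close>

lemma comult_rep_exists:
  assumes mu: "\<mu> \<in> Dist G i" obtains L where "comult_rep i \<mu> L"
proof -
  obtain L where L: "dual_system i (J (Suc i)) L" using dual_system_exists by blast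
  have LD: "d \<le> i" "g \<in> J d" "\<nu> \<in> Dist G d" if "(g, \<nu>, d) \<in> set L" for g \<nu> d
    using L that by (auto simp: dual_system_def)
  note ml = linear_C[OF DistD(1)[OF mu]]
  let ?m = "\<lambda>g. \<lambda>h\<in>A. \<mu> (\<lambda>x\<in>X. g x * h x)"
  let ?L = "map (\<lambda>(g, \<nu>, d). (\<nu>, ?m g)) L"
  have m: "?m g \<in> Dist G (i - d)" if "d \<le> i" "g \<in> J d" for g d
    unfolding Dist_iff
  proof (intro conjI ballI linear_mapsI)
    note gA = J_A[OF that(2)]
    fix f assume "f \<in> carrier C"
    then have f: "f \<in> A" by simp
    show "?m g (f \<oplus>\<^bsub>C\<^esub> h) = ?m g f \<oplus>\<^bsub>base_field\<^esub> ?m g h" if "h \<in> carrier C" for h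
      using ml(1)[of "\<lambda>x\<in>X. g x * f x" "\<lambda>x\<in>X. g x * h x"] f gA that
      by (simp add: distrib_left cong: restrict_cong)
    show "?m g (c \<odot>\<^bsub>C\<^esub> f) = c \<odot>\<^bsub>base_field\<^esub> ?m g f" for c
      using ml(2)[of "\<lambda>x\<in>X. g x * f x" c] f gA
      by (simp add: ac_simps cong: restrict_cong)
  next
    fix h assume h: "h \<in> J (Suc (i - d))"
    have "(\<lambda>x\<in>X. g x * h x) \<in> J (d + Suc (i - d))" by (rule J_mult[OF that(2) h])
    then show "?m g h = 0" using that DistD(3)[OF mu] J_A[OF h] by simp
  qed simp_all
  have "comult_rep i \<mu> ?L"
    unfolding comult_rep_def
  proof (intro conjI ballI)
    fix xy assume "xy \<in> set ?L"
    then obtain g \<nu> d where *: "(g, \<nu>, d) \<in> set L" "xy = (\<nu>, ?m g)" by auto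
    have "d + (i - d) \<le> i \<and> \<nu> \<in> Dist G d \<and> ?m g \<in> Dist G (i - d)"
      using LD[OF *(1)] m[of d g] by simp
    then show "case xy of (x, y) \<Rightarrow> \<exists>a b. a + b \<le> i \<and> x \<in> Dist G a \<and> y \<in> Dist G b"
      unfolding *(2) prod.case by blast
  next
    fix f g assume f: "f \<in> A" and g: "g \<in> A"
    let ?r = "\<lambda>x\<in>X. f x - (\<Sum>(h, \<nu>, d)\<leftarrow>L. \<nu> f * h x)"
    have r: "?r \<in> J (Suc i)" using L f by (simp add: dual_system_def)
    have S1: "(\<lambda>x\<in>X. \<Sum>l\<leftarrow>L. fst (snd l) f * (\<lambda>x\<in>X. fst l x * g x) x) \<in> A"
      and S2: "\<mu> (\<lambda>x\<in>X. \<Sum>l\<leftarrow>L. fst (snd l) f * (\<lambda>x\<in>X. fst l x * g x) x)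
        = (\<Sum>l\<leftarrow>L. fst (snd l) f * \<mu> (\<lambda>x\<in>X. fst l x * g x))"
      using LD(2) J_A g by (intro linear_sum_list DistD(1)[OF mu]; fastforce)+
    have rg: "(\<lambda>x\<in>X. g x * ?r x) \<in> J (Suc i)" using J_closed(4)[OF r g] .
    have "(\<lambda>x\<in>X. f x * g x) = (\<lambda>x\<in>X. (\<lambda>x\<in>X. g x * ?r x) x +
        (\<lambda>x\<in>X. \<Sum>l\<leftarrow>L. fst (snd l) f * (\<lambda>x\<in>X. fst l x * g x) x) x)"
      by (auto intro!: restrict_ext simp: algebra_simps split_def sum_list_const_mult[symmetric])
    then have "\<mu> (\<lambda>x\<in>X. f x * g x) = \<mu> (\<lambda>x\<in>X. g x * ?r x)
        + \<mu> (\<lambda>x\<in>X. \<Sum>l\<leftarrow>L. fst (snd l) f * (\<lambda>x\<in>X. fst l x * g x) x)"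
      using ml(1)[OF J_A[OF rg] S1] by simp
    also have "\<mu> (\<lambda>x\<in>X. g x * ?r x) = 0" by (rule DistD(3)[OF mu rg])
    finally show "\<mu> (\<lambda>x\<in>X. f x * g x) = (\<Sum>(x, y)\<leftarrow>?L. x f * y g)"
      using g by (simp add: S2 split_def o_def)
  qed
  then show ?thesis by (rule that)
qed

lemma Dist_comult_eqI:
  assumes "Z \<in> carrier (DM k \<otimes>\<^sub>k DM k)"
    and "\<And>f g. f \<in> A \<Longrightarrow> g \<in> A \<Longrightarrow> tensor_value Z f g = \<mu> (\<lambda>x\<in>X. f x * g x)"
  shows "Dist_comult G k \<mu> = Z"
  unfolding Dist_comult_def
proof (rule the_equality)
  show "Z \<in> carrier (DM k \<otimes>\<^sub>k DM k) \<and> (\<forall>f\<in>A. \<forall>g\<in>A. tensor_value Z f g = \<mu> (f \<otimes>\<^bsub>C\<^esub> g))"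
    using assms by simp
  fix W assume "W \<in> carrier (DM k \<otimes>\<^sub>k DM k) \<and> (\<forall>f\<in>A. \<forall>g\<in>A. tensor_value W f g = \<mu> (f \<otimes>\<^bsub>C\<^esub> g))"
  then show "W = Z"
    using assms by (intro tensor_value_eqI[OF DM_vspace DM_vspace DM_separates DM_separates]) auto
qed

lemma Dist_comult_rep:
  assumes "comult_rep i \<mu> L" "i \<le> k"
  shows "Dist_comult G k \<mu> = tensor_sum (DM k) (DM k) L" "set L \<subseteq> Dist G k \<times> Dist G k"
proof -
  show L: "set L \<subseteq> Dist G k \<times> Dist G k" using comult_rep_mem[OF assms(1) _ assms(2)] by auto
  show "Dist_comult G k \<mu> = tensor_sum (DM k) (DM k) L"
    using L comult_repD(2)[OF assms(1)]
    by (intro Dist_comult_eqI tensor_sum_closed DM_vspace)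
      (simp_all add: tensor_value_tensor_sum[OF DM_vspace DM_vspace DM_separates DM_separates])
qed

lemma Dist_comult_spec:
  assumes "\<mu> \<in> Dist G k"
  shows "Dist_comult G k \<mu> \<in> carrier (DM k \<otimes>\<^sub>k DM k)"
    and "f \<in> A \<Longrightarrow> g \<in> A \<Longrightarrow> tensor_value (Dist_comult G k \<mu>) f g = \<mu> (\<lambda>x\<in>X. f x * g x)"
proof -
  obtain L where L: "comult_rep k \<mu> L" by (rule comult_rep_exists[OF assms])
  note D = Dist_comult_rep[OF L order.refl]
  show "Dist_comult G k \<mu> \<in> carrier (DM k \<otimes>\<^sub>k DM k)"
    unfolding D(1) using D(2) by (intro tensor_sum_closed DM_vspace) auto
  show "f \<in> A \<Longrightarrow> g \<in> A \<Longrightarrow> tensor_value (Dist_comult G k \<mu>) f g = \<mu> (\<lambda>x\<in>X. f x * g x)"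
    unfolding D(1) using D(2) comult_repD(2)[OF L]
    by (simp add: tensor_value_tensor_sum[OF DM_vspace DM_vspace DM_separates DM_separates])
qed

lemma DM_evaluation: "f \<in> A \<Longrightarrow> (\<lambda>x. x f) \<in> linear_maps (DM k) base_field"
  using separatesD(1)[OF DM_separates] by simp

lemma tensor_value_linear:
  "f \<in> A \<Longrightarrow> g \<in> A \<Longrightarrow> (\<lambda>Z. tensor_value Z f g) \<in> linear_maps (DM k \<otimes>\<^sub>k DM k) base_field"
  unfolding tensor_value_def
  by (intro tensor_lift_linear DM_vspace vspace_base_field evaluation_bilinear DM_evaluation)

lemma tensor_value_pure:
  "f \<in> A \<Longrightarrow> g \<in> A \<Longrightarrow> x \<in> Dist G k \<Longrightarrow> y \<in> Dist G k \<Longrightarrow>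
    tensor_value (pure (DM k) (DM k) x y) f g = x f * y g"
  unfolding tensor_value_def
  by (subst tensor_lift_pure[OF DM_vspace DM_vspace vspace_base_field evaluation_bilinear[OF DM_evaluation DM_evaluation]])
    auto

lemma Dist_comult_linear: "Dist_comult G k \<in> linear_maps (DM k) (DM k \<otimes>\<^sub>k DM k)"
proof (rule linear_mapsI)
  note vs = tensor_vspace[OF DM_vspace DM_vspace]
  fix x assume "x \<in> carrier (DM k)"
  then have x: "x \<in> Dist G k" by simp
  then show "Dist_comult G k x \<in> carrier (DM k \<otimes>\<^sub>k DM k)" by (rule Dist_comult_spec)
  show "Dist_comult G k (x \<oplus>\<^bsub>DM k\<^esub> y) = Dist_comult G k x \<oplus>\<^bsub>DM k \<otimes>\<^sub>k DM k\<^esub> Dist_comult G k y"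
    if "y \<in> carrier (DM k)" for y
    using that x linear_mapsD(2)[OF tensor_value_linear[where k = k]] Dist_comult_spec
    by (intro Dist_comult_eqI vspace_add_simps(1)[OF vs]) simp_all
  show "Dist_comult G k (c \<odot>\<^bsub>DM k\<^esub> x) = c \<odot>\<^bsub>DM k \<otimes>\<^sub>k DM k\<^esub> Dist_comult G k x" for c
    using x linear_mapsD(3)[OF tensor_value_linear[where k = k]] Dist_comult_spec
    by (intro Dist_comult_eqI vspace_simps(1)[OF vs]) simp_all
qed

lemma Dist_comult_unit:
  "Dist_comult G k (\<lambda>f\<in>A. f \<one>\<^bsub>G\<^esub>) = pure (DM k) (DM k) (\<lambda>f\<in>A. f \<one>\<^bsub>G\<^esub>) (\<lambda>f\<in>A. f \<one>\<^bsub>G\<^esub>)"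
  using unit_Dist by (intro Dist_comult_eqI pure_simps(1)[OF DM_vspace DM_vspace]) (auto simp: tensor_value_pure)

text \<open>On three functions, both sides have the value of \<open>\<mu>\<close> at the product of
  the functions, and triples of functions separate the tensors.\<close>

lemma Dist_comult_coassoc:
  assumes mu: "\<mu> \<in> Dist G k"
  shows "tensor_assoc (DM k) (DM k) (DM k)
      (tensor_map (DM k \<otimes>\<^sub>k DM k) (DM k) (Dist_comult G k) id (Dist_comult G k \<mu>))
    = tensor_map (DM k) (DM k \<otimes>\<^sub>k DM k) id (Dist_comult G k) (Dist_comult G k \<mu>)"
proof -
  let ?M = "DM k" and ?d = "Dist_comult G k"
  let ?MM = "?M \<otimes>\<^sub>k ?M"
  note M = DM_vspace[of k] and MM = tensor_vspace[OF DM_vspace DM_vspace, of k k]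
  note T = tensor_vspace[OF M MM]
  note sep = separates_tensor[OF M M DM_separates DM_separates]
  note sep3 = separates_tensor[OF M MM DM_separates sep]
  note dl = Dist_comult_linear[of k]
  note as = tensor_assoc_linear[OF M M M]
  note l1 = tensor_map_linear[OF M M MM M dl linear_map_id(2)]
    and l2 = tensor_map_linear[OF M M M MM linear_map_id(2) dl]
  note L1 = linear_map_comp[OF l1(1) as(1)]
  have d: "?d \<mu> \<in> carrier ?MM" by (rule Dist_comult_spec[OF mu])
  show ?thesis
  proof (rule separates_eq[OF T sep3 linear_mapsD(1)[OF L1 d] linear_mapsD(1)[OF l2(1) d]])
    fix fgh assume fgh: "fgh \<in> A \<times> (A \<times> A)"
    obtain f g h where e: "fgh = (f, (g, h))" by (cases fgh)
    have f: "f \<in> A" and g: "g \<in> A" and h: "h \<in> A" using fgh by (auto simp: e)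
    let ?E = "\<lambda>W. tensor_lift base_field (\<lambda>a Z. a f * tensor_value Z g h) W"
    have bE: "bilinear ?M ?MM base_field (\<lambda>a Z. a f * tensor_value Z g h)"
      by (rule evaluation_bilinear[OF DM_evaluation[OF f] tensor_value_linear[OF g h]])
    note E = tensor_lift_linear[OF M MM vspace_base_field bE]
    note Ep = tensor_lift_pure[OF M MM vspace_base_field bE]
    have 1: "?E (tensor_map ?M ?MM id ?d Z) = tensor_value Z f (\<lambda>x\<in>X. g x * h x)" if "Z \<in> carrier ?MM" for Z
    proof -
      have gh: "(\<lambda>x\<in>X. g x * h x) \<in> A" using g h by simp
      have p: "?E (tensor_map ?M ?MM id ?d (pure ?M ?M x y)) = tensor_value (pure ?M ?M x y) f (\<lambda>x\<in>X. g x * h x)"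
        if "x \<in> carrier ?M" "y \<in> carrier ?M" for x y
        using that g h f gh Dist_comult_spec[of y k]
        by (simp add: l2(2) Ep tensor_value_pure)
      show ?thesis
        by (rule tensor_ext[OF M M vspace_base_field linear_map_comp[OF l2(1) E] tensor_value_linear[OF f gh] p that])
    qed
    have 2: "?E (tensor_assoc ?M ?M ?M (pure ?MM ?M w b)) = tensor_value w f g * b h"
      if "w \<in> carrier ?MM" "b \<in> Dist G k" for w b
    proof -
      have pl: "(\<lambda>w. pure ?MM ?M w b) \<in> linear_maps ?MM (?MM \<otimes>\<^sub>k ?M)"
        using bilinear_linear(1)[OF pure_bilinear[OF MM M]] that(2) by simp
      have l: "(\<lambda>w. b h * tensor_value w f g) \<in> linear_maps ?MM base_field"
        using linear_map_smult[OF vspace_base_field tensor_value_linear[OF f g]] by simp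
      have p: "?E (tensor_assoc ?M ?M ?M (pure ?MM ?M (pure ?M ?M x y) b)) = b h * tensor_value (pure ?M ?M x y) f g"
        if "x \<in> carrier ?M" "y \<in> carrier ?M" for x y
        using that \<open>b \<in> Dist G k\<close> f g h pure_simps(1)[OF M M] by (simp add: as(2) Ep tensor_value_pure)
      have "?E (tensor_assoc ?M ?M ?M (pure ?MM ?M w b)) = b h * tensor_value w f g"
        by (rule tensor_ext[OF M M vspace_base_field linear_map_comp[OF linear_map_comp[OF pl as(1)] E] l p that(1)])
      then show ?thesis by simp
    qed
    have 3: "?E (tensor_assoc ?M ?M ?M (tensor_map ?MM ?M ?d id Z)) = tensor_value Z (\<lambda>x\<in>X. f x * g x) h"
      if "Z \<in> carrier ?MM" for Z
    proof -
      have fg: "(\<lambda>x\<in>X. f x * g x) \<in> A" using f g by simp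
      have p: "?E (tensor_assoc ?M ?M ?M (tensor_map ?MM ?M ?d id (pure ?M ?M x y)))
          = tensor_value (pure ?M ?M x y) (\<lambda>x\<in>X. f x * g x) h"
        if "x \<in> carrier ?M" "y \<in> carrier ?M" for x y
        using that g h f fg Dist_comult_spec[of x k]
        by (simp add: l1(2) 2 tensor_value_pure)
      show ?thesis
        by (rule tensor_ext[OF M M vspace_base_field linear_map_comp[OF L1 E] tensor_value_linear[OF fg h] p that])
    qed
    show "(\<lambda>Z (x, y). tensor_lift base_field (\<lambda>a b. a x * (case y of (x, y) \<Rightarrow> tensor_lift base_field (\<lambda>a b. a x * b y) b)) Z)
        (tensor_assoc ?M ?M ?M (tensor_map ?MM ?M ?d id (?d \<mu>))) fgh
      = (\<lambda>Z (x, y). tensor_lift base_field (\<lambda>a b. a x * (case y of (x, y) \<Rightarrow> tensor_lift base_field (\<lambda>a b. a x * b y) b)) Z)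
        (tensor_map ?M ?MM id ?d (?d \<mu>)) fgh"
      using 1[OF d] 3[OF d] f g h
      by (simp add: e tensor_value_def[symmetric] Dist_comult_spec[OF mu] mult.assoc cong: restrict_cong)
  qed
qed

text \<open>Dual to the multiplicativity of the comultiplication of functions: expansions of
  \<open>f(uv)\<close> and \<open>g(uv)\<close> multiply to one of \<open>(f g)(uv)\<close>.\<close>

lemma conv_comult:
  assumes x: "x \<in> Dist G i" and y: "y \<in> Dist G j" and L: "comult_rep i x L" and M: "comult_rep j y M"
    and f: "f \<in> A" and g: "g \<in> A"
  shows "(x \<otimes>\<^bsub>D\<^esub> y) (\<lambda>x\<in>X. f x * g x)
    = (\<Sum>(x', x'')\<leftarrow>L. \<Sum>(y', y'')\<leftarrow>M. (x' \<otimes>\<^bsub>D\<^esub> y') f * (x'' \<otimes>\<^bsub>D\<^esub> y'') g)"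
proof -
  obtain R where R: "rep (\<lambda>u v. f (u \<otimes>\<^bsub>G\<^esub> v)) R" by (rule rep_exists[OF f])
  obtain S where S: "rep (\<lambda>u v. g (u \<otimes>\<^bsub>G\<^esub> v)) S" by (rule rep_exists[OF g])
  note RA = rep_mem[OF R] and SA = rep_mem[OF S]
  have "rep (\<lambda>u v. (\<lambda>x\<in>X. f x * g x) (u \<otimes>\<^bsub>G\<^esub> v))
      (map (\<lambda>((a, b), (c, d)). (\<lambda>x\<in>X. a x * c x, \<lambda>x\<in>X. b x * d x)) (List.product R S))"
    by (rule rep_cong[OF rep_mult[OF R S]]) simp
  then have "(x \<otimes>\<^bsub>D\<^esub> y) (\<lambda>x\<in>X. f x * g x) = (\<Sum>(a, b)\<leftarrow>map (\<lambda>((a, b), (c, d)).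
      (\<lambda>x\<in>X. a x * c x, \<lambda>x\<in>X. b x * d x)) (List.product R S). x a * y b)"
    using f g by (intro conv_apply DistD(1)[OF x] DistD(1)[OF y]) auto
  also have "\<dots> = (\<Sum>r\<leftarrow>R. \<Sum>s\<leftarrow>S. x (\<lambda>x\<in>X. fst r x * fst s x) * y (\<lambda>x\<in>X. snd r x * snd s x))"
    by (induction R) (auto simp: o_def split_def)
  also have "\<dots> = (\<Sum>r\<leftarrow>R. \<Sum>s\<leftarrow>S. (\<Sum>l\<leftarrow>L. fst l (fst r) * snd l (fst s)) * (\<Sum>m\<leftarrow>M. fst m (snd r) * snd m (snd s)))"
    using RA SA by (intro arg_cong[of _ _ sum_list] map_cong refl)
      (auto simp: comult_repD(2)[OF L] comult_repD(2)[OF M] split_def)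
  also have "\<dots> = (\<Sum>l\<leftarrow>L. \<Sum>m\<leftarrow>M. (\<Sum>r\<leftarrow>R. fst l (fst r) * fst m (snd r)) * (\<Sum>s\<leftarrow>S. snd l (fst s) * snd m (snd s)))"
    unfolding sum_list_index by (rule sum_interchange)
  also have "\<dots> = (\<Sum>l\<leftarrow>L. \<Sum>m\<leftarrow>M. (fst l \<otimes>\<^bsub>D\<^esub> fst m) f * (snd l \<otimes>\<^bsub>D\<^esub> snd m) g)"
    using comult_rep_mem[OF L _ order.refl] comult_rep_mem[OF M _ order.refl]
    by (intro arg_cong[of _ _ sum_list] map_cong refl)
      (auto simp: conv_apply[OF f R DistD(1)[of _ i] DistD(1)[of _ j]]
        conv_apply[OF g S DistD(1)[of _ i] DistD(1)[of _ j]] split_def)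
  finally show ?thesis by (simp add: split_def)
qed

text \<open>If \<open>f(uv)\<close> is the sum of the products \<open>a(u) b(v)\<close>, then the
  products of \<open>inversion a\<close> and \<open>b\<close> add up to the constant
  \<open>f(1)\<close>.\<close>

lemma antipode_convolution:
  assumes mu: "\<mu> \<in> Dist G i" and L: "comult_rep i \<mu> L" and f: "f \<in> A"
  shows "(\<Sum>(x, y)\<leftarrow>L. (Dist_antipode G x \<otimes>\<^bsub>D\<^esub> y) f) = \<mu> (\<lambda>x\<in>X. 1) * f \<one>\<^bsub>G\<^esub>"
    and "(\<Sum>(x, y)\<leftarrow>L. (x \<otimes>\<^bsub>D\<^esub> Dist_antipode G y) f) = \<mu> (\<lambda>x\<in>X. 1) * f \<one>\<^bsub>G\<^esub>"
proof -
  obtain R where R: "rep (\<lambda>u v. f (u \<otimes>\<^bsub>G\<^esub> v)) R" by (rule rep_exists[OF f])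
  note RA = rep_mem[OF R] and LD = comult_rep_mem[OF L _ order.refl]
  have A2: "fst l \<in> Dist G i" "snd l \<in> Dist G i" if "l \<in> set L" for l
    using LD[of "fst l" "snd l"] that by auto
  have R2: "fst r \<in> A" "snd r \<in> A" if "r \<in> set R" for r
    using RA[of "fst r" "snd r"] that by auto
  have cv: "(Dist_antipode G x \<otimes>\<^bsub>D\<^esub> y) f = (\<Sum>r\<leftarrow>R. x (inversion (fst r)) * y (snd r))"
    "(x \<otimes>\<^bsub>D\<^esub> Dist_antipode G y) f = (\<Sum>r\<leftarrow>R. x (fst r) * y (inversion (snd r)))"
    if "x \<in> Dist G i" "y \<in> Dist G i" for x y
    unfolding conv_apply[OF f R DistD(1)[OF antipode_Dist[OF that(1)]] DistD(1)[OF that(2)]]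
      conv_apply[OF f R DistD(1)[OF that(1)] DistD(1)[OF antipode_Dist[OF that(2)]]]
    using R2 by (intro arg_cong[of _ _ sum_list] map_cong refl; simp add: antipode_eq split_def)+
  have const: "\<mu> (\<lambda>x\<in>X. f \<one>\<^bsub>G\<^esub>) = \<mu> (\<lambda>x\<in>X. 1) * f \<one>\<^bsub>G\<^esub>"
    using linear_C(2)[OF DistD(1)[OF mu], of "\<lambda>x\<in>X. 1" "f \<one>\<^bsub>G\<^esub>"] by (simp add: mult.commute cong: restrict_cong)
  have "(\<Sum>(x, y)\<leftarrow>L. (Dist_antipode G x \<otimes>\<^bsub>D\<^esub> y) f)
      = (\<Sum>l\<leftarrow>L. \<Sum>r\<leftarrow>R. fst l (inversion (fst r)) * snd l (snd r))"
    using A2 by (intro arg_cong[of _ _ sum_list] map_cong refl) (simp add: cv split_def)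
  also have "\<dots> = (\<Sum>r\<leftarrow>R. \<Sum>l\<leftarrow>L. fst l (inversion (fst r)) * snd l (snd r))" by (rule sum_list_swap)
  also have "\<dots> = (\<Sum>r\<leftarrow>R. 1 * \<mu> (\<lambda>x\<in>X. inversion (fst r) x * snd r x))"
    using R2 by (intro arg_cong[of _ _ sum_list] map_cong refl) (simp add: comult_repD(2)[OF L] split_def)
  also have "\<dots> = \<mu> (\<lambda>x\<in>X. \<Sum>r\<leftarrow>R. 1 * (\<lambda>x\<in>X. inversion (fst r) x * snd r x) x)"
    using R2 by (intro linear_sum_list(2)[symmetric] DistD(1)[OF mu]) auto
  also have "(\<lambda>x\<in>X. \<Sum>r\<leftarrow>R. 1 * (\<lambda>x\<in>X. inversion (fst r) x * snd r x) x) = (\<lambda>x\<in>X. f \<one>\<^bsub>G\<^esub>)"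
    using repD[OF R, symmetric] by (intro restrict_ext) (simp add: inversion_def split_def)
  finally show "(\<Sum>(x, y)\<leftarrow>L. (Dist_antipode G x \<otimes>\<^bsub>D\<^esub> y) f) = \<mu> (\<lambda>x\<in>X. 1) * f \<one>\<^bsub>G\<^esub>"
    by (simp add: const)
  have "(\<Sum>(x, y)\<leftarrow>L. (x \<otimes>\<^bsub>D\<^esub> Dist_antipode G y) f)
      = (\<Sum>l\<leftarrow>L. \<Sum>r\<leftarrow>R. fst l (fst r) * snd l (inversion (snd r)))"
    using A2 by (intro arg_cong[of _ _ sum_list] map_cong refl) (simp add: cv split_def)
  also have "\<dots> = (\<Sum>r\<leftarrow>R. \<Sum>l\<leftarrow>L. fst l (fst r) * snd l (inversion (snd r)))" by (rule sum_list_swap)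
  also have "\<dots> = (\<Sum>r\<leftarrow>R. 1 * \<mu> (\<lambda>x\<in>X. fst r x * inversion (snd r) x))"
    using R2 by (intro arg_cong[of _ _ sum_list] map_cong refl) (simp add: comult_repD(2)[OF L] split_def)
  also have "\<dots> = \<mu> (\<lambda>x\<in>X. \<Sum>r\<leftarrow>R. 1 * (\<lambda>x\<in>X. fst r x * inversion (snd r) x) x)"
    using R2 by (intro linear_sum_list(2)[symmetric] DistD(1)[OF mu]) auto
  also have "(\<lambda>x\<in>X. \<Sum>r\<leftarrow>R. 1 * (\<lambda>x\<in>X. fst r x * inversion (snd r) x) x) = (\<lambda>x\<in>X. f \<one>\<^bsub>G\<^esub>)"
    using repD[OF R, symmetric] by (intro restrict_ext) (simp add: inversion_def split_def)
  finally show "(\<Sum>(x, y)\<leftarrow>L. (x \<otimes>\<^bsub>D\<^esub> Dist_antipode G y) f) = \<mu> (\<lambda>x\<in>X. 1) * f \<one>\<^bsub>G\<^esub>"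
    by (simp add: const)
qed

end

section \<open>Higher universal enveloping algebras\<close>

lemma vspace_eqI_minus:
  assumes "vspace M" "x \<in> carrier M" "y \<in> carrier M" "x \<ominus>\<^bsub>M\<^esub> y = \<zero>\<^bsub>M\<^esub>"
  shows "x = y"
proof -
  interpret abelian_group M by (rule vspace_abelian_group[OF assms(1)])
  have "(x \<ominus>\<^bsub>M\<^esub> y) \<oplus>\<^bsub>M\<^esub> y = y" using assms(3,4) by simp
  then show ?thesis using assms(2,3) by (simp add: a_minus_def a_assoc l_neg)
qed

lemma bilinear_minus:
  assumes L: "vspace L" and "bilinear M N L b" "bilinear M N L b'"
  shows "bilinear M N L (\<lambda>x y. b x y \<ominus>\<^bsub>L\<^esub> b' x y)"
proof -
  interpret L: abelian_group L by (rule vspace_abelian_group[OF L])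
  have lin: "(\<lambda>x. f x \<ominus>\<^bsub>L\<^esub> g x) \<in> linear_maps K L"
    if f: "f \<in> linear_maps K L" and g: "g \<in> linear_maps K L" for f g and K :: "('a, 'z, 'w) module_scheme"
  proof (rule linear_mapsI)
    fix x assume x: "x \<in> carrier K"
    then show "f x \<ominus>\<^bsub>L\<^esub> g x \<in> carrier L" using linear_mapsD(1)[OF f] linear_mapsD(1)[OF g] by simp
    show "f (x \<oplus>\<^bsub>K\<^esub> y) \<ominus>\<^bsub>L\<^esub> g (x \<oplus>\<^bsub>K\<^esub> y) = (f x \<ominus>\<^bsub>L\<^esub> g x) \<oplus>\<^bsub>L\<^esub> (f y \<ominus>\<^bsub>L\<^esub> g y)" if "y \<in> carrier K" for y
      using x that linear_mapsD[OF f] linear_mapsD[OF g] by (simp add: a_minus_def L.minus_add L.a_ac)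
    show "f (c \<odot>\<^bsub>K\<^esub> x) \<ominus>\<^bsub>L\<^esub> g (c \<odot>\<^bsub>K\<^esub> x) = c \<odot>\<^bsub>L\<^esub> (f x \<ominus>\<^bsub>L\<^esub> g x)" for c
      using x linear_mapsD[OF f] linear_mapsD[OF g] vspace_simps(1,3)[OF L]
      by (simp add: a_minus_def vspace_minus[OF L] vspace_simps(4)[OF L, symmetric] mult.commute)
  qed
  show ?thesis
    by (intro bilinearI lin bilinear_linear[OF assms(2)] bilinear_linear[OF assms(3)])
qed

locale higher_enveloping = affine_group G for G :: "('g, 'k::field) alg_group" +
  fixes p :: nat and m :: int
  assumes p_pos: "p > 0"
begin

abbreviation "N \<equiv> top_order p m"
abbreviation "V \<equiv> VM N"
abbreviation "T \<equiv> tensor_algebra V"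
abbreviation "\<iota> \<equiv> tensor_algebra_incl V"
abbreviation "U \<equiv> U_algebra p G m"
abbreviation "cls \<equiv> U_class p G m"
abbreviation "\<pi> \<equiv> Dist_to_U p G m"

lemma power_eq: "p ^ nat (m + 1) = Suc N"
  using p_pos by (simp add: top_order_def)

lemma Dist_plus_mono: "x \<in> Dist_plus G i \<Longrightarrow> i \<le> j \<Longrightarrow> x \<in> Dist_plus G j"
  using Dist_mono[of i j] by (auto simp: Dist_plus_iff)

definition bracket :: "(('g \<Rightarrow> 'k) \<Rightarrow> 'k) \<Rightarrow> (('g \<Rightarrow> 'k) \<Rightarrow> 'k) \<Rightarrow> ('g \<Rightarrow> 'k) \<Rightarrow> 'k" where
  "bracket x y = (\<lambda>f\<in>A. (x \<otimes>\<^bsub>D\<^esub> y) f - (y \<otimes>\<^bsub>D\<^esub> x) f)"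

lemma bracket_Dist: "x \<in> Dist G i \<Longrightarrow> y \<in> Dist G j \<Longrightarrow> bracket x y \<in> Dist G (i + j - 1)"
  unfolding bracket_def by (rule commutator_Dist)

lemma bracket_Dist_plus: "x \<in> Dist_plus G i \<Longrightarrow> y \<in> Dist_plus G j \<Longrightarrow> bracket x y \<in> Dist_plus G (i + j - 1)"
  unfolding bracket_def by (rule commutator_Dist_plus)

lemma bracket_minus:
  "x \<in> Dist_plus G i \<Longrightarrow> y \<in> Dist_plus G j \<Longrightarrow> (x \<otimes>\<^bsub>D\<^esub> y) \<ominus>\<^bsub>D\<^esub> (y \<otimes>\<^bsub>D\<^esub> x) = bracket x y"
  unfolding bracket_def using conv_Dist[of x i y j] conv_Dist[of y j x i]
  by (intro D_minus) (auto simp: Dist_plus_iff)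

lemma T_alg: "k_algebra T"
  by (rule tensor_algebra_k_algebra[OF VM_vspace])

lemma iota: "\<iota> \<in> linear_maps V T"
  by (rule tensor_algebra_incl_linear[OF VM_vspace])

lemma U_relators_cases:
  assumes "s \<in> U_relators p G m"
  obtains (prod) x y i j where "x \<in> Dist_plus G i" "y \<in> Dist_plus G j" "i + j \<le> N"
      "s = (\<iota> x \<otimes>\<^bsub>T\<^esub> \<iota> y) \<ominus>\<^bsub>T\<^esub> \<iota> (x \<otimes>\<^bsub>D\<^esub> y)"
  | (comm) x y i j where "x \<in> Dist_plus G i" "y \<in> Dist_plus G j" "i \<le> N" "j \<le> N" "i + j \<le> Suc N"
      "s = ((\<iota> x \<otimes>\<^bsub>T\<^esub> \<iota> y) \<ominus>\<^bsub>T\<^esub> (\<iota> y \<otimes>\<^bsub>T\<^esub> \<iota> x)) \<ominus>\<^bsub>T\<^esub> \<iota> (bracket x y)"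
  using assms unfolding U_relators_def Let_def power_eq
proof (elim UnE CollectE exE conjE)
  fix x y i j
  assume "x \<in> Dist_plus G i" "y \<in> Dist_plus G j" "i + j < Suc N"
    "s = (\<iota> x \<otimes>\<^bsub>T\<^esub> \<iota> y) \<ominus>\<^bsub>T\<^esub> \<iota> (x \<otimes>\<^bsub>D\<^esub> y)"
  then show ?thesis using prod[of x i y j] by simp
next
  fix x y i j
  assume *: "x \<in> Dist_plus G i" "y \<in> Dist_plus G j" "i < Suc N" "j < Suc N" "i + j \<le> Suc N"
    "s = ((\<iota> x \<otimes>\<^bsub>T\<^esub> \<iota> y) \<ominus>\<^bsub>T\<^esub> (\<iota> y \<otimes>\<^bsub>T\<^esub> \<iota> x)) \<ominus>\<^bsub>T\<^esub> \<iota> ((x \<otimes>\<^bsub>D\<^esub> y) \<ominus>\<^bsub>D\<^esub> (y \<otimes>\<^bsub>D\<^esub> x))"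
  then show ?thesis using comm[of x i y j] by (simp add: bracket_minus)
qed

lemma rel_carriers:
  assumes "x \<in> Dist_plus G i" "y \<in> Dist_plus G j"
  shows "i + j \<le> N \<Longrightarrow> x \<in> Dist_plus G N \<and> y \<in> Dist_plus G N \<and> x \<otimes>\<^bsub>D\<^esub> y \<in> Dist_plus G N"
    and "i \<le> N \<Longrightarrow> j \<le> N \<Longrightarrow> i + j \<le> Suc N \<Longrightarrow>
      x \<in> Dist_plus G N \<and> y \<in> Dist_plus G N \<and> bracket x y \<in> Dist_plus G N"
  using assms conv_Dist_plus[OF assms] bracket_Dist_plus[OF assms] by (auto elim!: Dist_plus_mono)

lemma U_relators_carrier: "U_relators p G m \<subseteq> carrier T"
proof
  fix s assume "s \<in> U_relators p G m"
  then show "s \<in> carrier T"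
  proof (cases rule: U_relators_cases)
    case (prod x y i j)
    then show ?thesis using rel_carriers(1)[OF prod(1,2)] linear_mapsD(1)[OF iota]
      by (simp add: k_algebraD[OF T_alg] vspace_add_simps[OF k_algebraD(2)[OF T_alg]])
  next
    case (comm x y i j)
    then show ?thesis using rel_carriers(2)[OF comm(1,2)] linear_mapsD(1)[OF iota]
      by (simp add: k_algebraD[OF T_alg] vspace_add_simps[OF k_algebraD(2)[OF T_alg]])
  qed
qed

lemma U_ideal_ideal: "ideal (U_ideal p G m) T"
  unfolding U_ideal_def by (rule ring.genideal_ideal[OF k_algebraD(1)[OF T_alg] U_relators_carrier])

lemma U_alg: "k_algebra U"
  unfolding U_algebra_def by (rule k_algebra_quotient[OF T_alg U_ideal_ideal])

lemmas U_vspace = k_algebraD(2)[OF U_alg]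

lemma class_hom: "(\<lambda>t. U_ideal p G m +>\<^bsub>T\<^esub> t) \<in> algebra_homs T U"
  unfolding U_algebra_def by (rule quotient_class_hom[OF T_alg U_ideal_ideal])

lemma class_relator: "s \<in> U_relators p G m \<Longrightarrow> U_ideal p G m +>\<^bsub>T\<^esub> s = \<zero>\<^bsub>U\<^esub>"
proof -
  assume s: "s \<in> U_relators p G m"
  interpret Q: module_quotient base_field T "U_ideal p G m" by (rule ideal_module_quotient[OF T_alg U_ideal_ideal])
  have "s \<in> U_ideal p G m"
    using s ring.genideal_self[OF k_algebraD(1)[OF T_alg] U_relators_carrier] unfolding U_ideal_def by blast
  moreover have "s \<ominus>\<^bsub>T\<^esub> \<zero>\<^bsub>T\<^esub> = s"
    using s U_relators_carrier vspace_minus[OF k_algebraD(2)[OF T_alg], of "\<zero>\<^bsub>T\<^esub>"]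
      vspace_simps(7)[OF k_algebraD(2)[OF T_alg]] vspace_add_simps(2,3)[OF k_algebraD(2)[OF T_alg]]
    by (simp add: a_minus_def subset_iff)
  ultimately show ?thesis
    using s U_relators_carrier Q.quotient_eq_iff[of s "\<zero>\<^bsub>T\<^esub>"] by (auto simp: U_algebra_def Q.quotient_zero)
qed

lemma cls_linear: "cls \<in> linear_maps V U"
proof -
  have "cls = (\<lambda>x. U_ideal p G m +>\<^bsub>T\<^esub> \<iota> x)" by (rule ext) (simp add: U_class_def)
  then show ?thesis using linear_map_comp[OF iota algebra_homsD(1)[OF class_hom]] by simp
qed

lemma cls_closed: "x \<in> Dist_plus G N \<Longrightarrow> cls x \<in> carrier U"
  using linear_mapsD(1)[OF cls_linear, of x] by simp

lemma cls_mult: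
  assumes x: "x \<in> Dist_plus G i" and y: "y \<in> Dist_plus G j" and ij: "i + j \<le> N"
  shows "cls x \<otimes>\<^bsub>U\<^esub> cls y = cls (x \<otimes>\<^bsub>D\<^esub> y)"
proof -
  let ?c = "\<lambda>t. U_ideal p G m +>\<^bsub>T\<^esub> t"
  note c = rel_carriers(1)[OF x y ij]
  let ?s = "(\<iota> x \<otimes>\<^bsub>T\<^esub> \<iota> y) \<ominus>\<^bsub>T\<^esub> \<iota> (x \<otimes>\<^bsub>D\<^esub> y)"
  have s: "?s \<in> U_relators p G m"
    unfolding U_relators_def Let_def power_eq using x y ij
    by (intro UnI1 CollectI exI[of _ x] exI[of _ y] exI[of _ i] exI[of _ j]) auto
  have ic: "\<iota> x \<in> carrier T" "\<iota> y \<in> carrier T" "\<iota> (x \<otimes>\<^bsub>D\<^esub> y) \<in> carrier T"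
    using c linear_mapsD(1)[OF iota] by auto
  note ch = linear_map_minus[OF algebra_homsD(1)[OF class_hom] k_algebraD(2)[OF T_alg] U_vspace]
  have "?c ?s = (?c (\<iota> x) \<otimes>\<^bsub>U\<^esub> ?c (\<iota> y)) \<ominus>\<^bsub>U\<^esub> ?c (\<iota> (x \<otimes>\<^bsub>D\<^esub> y))"
    using ic by (simp add: ch k_algebraD[OF T_alg] algebra_homsD(2)[OF class_hom])
  then have z: "(cls x \<otimes>\<^bsub>U\<^esub> cls y) \<ominus>\<^bsub>U\<^esub> cls (x \<otimes>\<^bsub>D\<^esub> y) = \<zero>\<^bsub>U\<^esub>"
    using class_relator[OF s] by (simp add: U_class_def)
  show ?thesis
    by (rule vspace_eqI_minus[OF U_vspace _ _ z]) (use c in \<open>simp_all add: cls_closed k_algebraD(7)[OF U_alg]\<close>)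
qed

lemma cls_bracket:
  assumes x: "x \<in> Dist_plus G i" and y: "y \<in> Dist_plus G j" and ij: "i \<le> N" "j \<le> N" "i + j \<le> Suc N"
  shows "(cls x \<otimes>\<^bsub>U\<^esub> cls y) \<ominus>\<^bsub>U\<^esub> (cls y \<otimes>\<^bsub>U\<^esub> cls x) = cls (bracket x y)"
proof -
  let ?c = "\<lambda>t. U_ideal p G m +>\<^bsub>T\<^esub> t"
  note c = rel_carriers(2)[OF x y ij]
  let ?s = "((\<iota> x \<otimes>\<^bsub>T\<^esub> \<iota> y) \<ominus>\<^bsub>T\<^esub> (\<iota> y \<otimes>\<^bsub>T\<^esub> \<iota> x)) \<ominus>\<^bsub>T\<^esub> \<iota> (bracket x y)"
  have s: "?s \<in> U_relators p G m"
    unfolding U_relators_def Let_def power_eq bracket_minus[OF x y, symmetric] using x y ij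
    by (intro UnI2 CollectI exI[of _ x] exI[of _ y] exI[of _ i] exI[of _ j]) auto
  have ic: "\<iota> x \<in> carrier T" "\<iota> y \<in> carrier T" "\<iota> (bracket x y) \<in> carrier T"
    using c linear_mapsD(1)[OF iota] by auto
  note ch = linear_map_minus[OF algebra_homsD(1)[OF class_hom] k_algebraD(2)[OF T_alg] U_vspace]
  have "?c ?s = ((?c (\<iota> x) \<otimes>\<^bsub>U\<^esub> ?c (\<iota> y)) \<ominus>\<^bsub>U\<^esub> (?c (\<iota> y) \<otimes>\<^bsub>U\<^esub> ?c (\<iota> x))) \<ominus>\<^bsub>U\<^esub> ?c (\<iota> (bracket x y))"
    using ic by (simp add: ch k_algebraD[OF T_alg] algebra_homsD(2)[OF class_hom]
        vspace_add_simps[OF k_algebraD(2)[OF T_alg]])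
  then have z: "((cls x \<otimes>\<^bsub>U\<^esub> cls y) \<ominus>\<^bsub>U\<^esub> (cls y \<otimes>\<^bsub>U\<^esub> cls x)) \<ominus>\<^bsub>U\<^esub> cls (bracket x y) = \<zero>\<^bsub>U\<^esub>"
    using class_relator[OF s] by (simp add: U_class_def)
  show ?thesis
    by (rule vspace_eqI_minus[OF U_vspace _ _ z])
      (use c in \<open>simp_all add: cls_closed k_algebraD(7)[OF U_alg] vspace_add_simps(6)[OF U_vspace]\<close>)
qed

lemma U_induct [consumes 1, case_names one cls smult add]:
  assumes u: "u \<in> carrier U"
    and "Q \<one>\<^bsub>U\<^esub>"
    and "\<And>x z. x \<in> Dist_plus G N \<Longrightarrow> z \<in> carrier U \<Longrightarrow> Q z \<Longrightarrow> Q (cls x \<otimes>\<^bsub>U\<^esub> z)"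
    and "\<And>c z. z \<in> carrier U \<Longrightarrow> Q z \<Longrightarrow> Q (c \<odot>\<^bsub>U\<^esub> z)"
    and "\<And>y z. y \<in> carrier U \<Longrightarrow> z \<in> carrier U \<Longrightarrow> Q y \<Longrightarrow> Q z \<Longrightarrow> Q (y \<oplus>\<^bsub>U\<^esub> z)"
  shows "Q u"
proof -
  interpret QQ: module_quotient base_field T "U_ideal p G m" by (rule ideal_module_quotient[OF T_alg U_ideal_ideal])
  let ?c = "\<lambda>t. U_ideal p G m +>\<^bsub>T\<^esub> t"
  note h = algebra_homsD[OF class_hom] and hl = linear_mapsD[OF algebra_homsD(1)[OF class_hom]]
  have "Q (?c t)" if "t \<in> carrier T" for t
  proof (rule tensor_algebra_induct[OF VM_vspace that])
    show "Q (?c \<one>\<^bsub>T\<^esub>)" using assms(2) h(3) by simp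
  next
    fix x z assume xz: "x \<in> carrier V" "z \<in> carrier T" "Q (?c z)"
    then have "\<iota> x \<in> carrier T" using linear_mapsD(1)[OF iota] by simp
    then have "?c (\<iota> x \<otimes>\<^bsub>T\<^esub> z) = cls x \<otimes>\<^bsub>U\<^esub> ?c z" using xz h(2) by (simp add: U_class_def)
    then show "Q (?c (\<iota> x \<otimes>\<^bsub>T\<^esub> z))" using xz assms(3) hl(1) by simp
  next
    fix c z assume "z \<in> carrier T" "Q (?c z)"
    then show "Q (?c (c \<odot>\<^bsub>T\<^esub> z))" using assms(4) hl by simp
  next
    fix y z assume "y \<in> carrier T" "z \<in> carrier T" "Q (?c y)" "Q (?c z)"
    then show "Q (?c (y \<oplus>\<^bsub>T\<^esub> z))" using assms(5) hl by simp
  qed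
  then show ?thesis using u by (auto simp: U_algebra_def QQ.quotient_carrier)
qed

text \<open>The universal property given by the presentation; the hypotheses say that
  \<open>\<phi>\<close> respects the two kinds of relations. The structure maps of the Hopf algebra
  and the homomorphism induced by the Frobenius are all obtained in this way.\<close>

lemma U_lift:
  assumes B: "k_algebra B" and phi: "\<phi> \<in> linear_maps V B"
    and mult: "\<And>x y i j. x \<in> Dist_plus G i \<Longrightarrow> y \<in> Dist_plus G j \<Longrightarrow> i + j \<le> N \<Longrightarrow>
      \<phi> x \<otimes>\<^bsub>B\<^esub> \<phi> y = \<phi> (x \<otimes>\<^bsub>D\<^esub> y)"
    and comm: "\<And>x y i j. x \<in> Dist_plus G i \<Longrightarrow> y \<in> Dist_plus G j \<Longrightarrow> i \<le> N \<Longrightarrow> j \<le> N \<Longrightarrow> i + j \<le> Suc N \<Longrightarrow>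
      (\<phi> x \<otimes>\<^bsub>B\<^esub> \<phi> y) \<ominus>\<^bsub>B\<^esub> (\<phi> y \<otimes>\<^bsub>B\<^esub> \<phi> x) = \<phi> (bracket x y)"
  shows "quotient_lift (tensor_algebra_lift B \<phi>) \<in> algebra_homs U B"
    and "x \<in> Dist_plus G N \<Longrightarrow> quotient_lift (tensor_algebra_lift B \<phi>) (cls x) = \<phi> x"
proof -
  let ?f = "tensor_algebra_lift B \<phi>"
  note f = tensor_algebra_lift_hom[OF VM_vspace B phi]
  note fl = linear_map_minus[OF algebra_homsD(1)[OF f(1)] k_algebraD(2)[OF T_alg] k_algebraD(2)[OF B]]
  note ic = linear_mapsD(1)[OF iota]
  note pc = linear_mapsD(1)[OF phi]
  have rel: "?f s = \<zero>\<^bsub>B\<^esub>" if "s \<in> U_relators p G m" for s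
    using that
  proof (cases rule: U_relators_cases)
    case (prod x y i j)
    note c = rel_carriers(1)[OF prod(1-3)]
    have "?f s = (\<phi> x \<otimes>\<^bsub>B\<^esub> \<phi> y) \<ominus>\<^bsub>B\<^esub> \<phi> (x \<otimes>\<^bsub>D\<^esub> y)"
      using c ic by (simp add: prod(4) fl k_algebraD[OF T_alg] algebra_homsD(2)[OF f(1)] f(2))
    then show ?thesis using mult[OF prod(1-3)] c pc
      by (simp add: vspace_add_simps(9)[OF k_algebraD(2)[OF B]])
  next
    case (comm x y i j)
    note c = rel_carriers(2)[OF comm(1-5)]
    have "?f s = ((\<phi> x \<otimes>\<^bsub>B\<^esub> \<phi> y) \<ominus>\<^bsub>B\<^esub> (\<phi> y \<otimes>\<^bsub>B\<^esub> \<phi> x)) \<ominus>\<^bsub>B\<^esub> \<phi> (bracket x y)"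
      using c ic by (simp add: comm(6) fl k_algebraD[OF T_alg] algebra_homsD(2)[OF f(1)] f(2)
          vspace_add_simps[OF k_algebraD(2)[OF T_alg]])
    then show ?thesis using assms(4)[OF comm(1-5)] c pc
      by (simp add: vspace_add_simps(9)[OF k_algebraD(2)[OF B]])
  qed
  show "quotient_lift ?f \<in> algebra_homs U B"
    unfolding U_algebra_def U_ideal_def
    by (rule genideal_quotient_lift(1)[OF T_alg B U_relators_carrier f(1)]) (rule rel)
  show "quotient_lift ?f (cls x) = \<phi> x" if x: "x \<in> Dist_plus G N"
  proof -
    have "\<iota> x \<in> carrier T" using ic x by simp
    then have "quotient_lift ?f (cls x) = ?f (\<iota> x)"
      unfolding U_class_def U_ideal_def
      by (rule genideal_quotient_lift(2)[OF T_alg B U_relators_carrier f(1), rotated]) (rule rel)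
    then show ?thesis using f(2) x by simp
  qed
qed

lemma U_hom_eq:
  assumes B: "k_algebra B" and f: "f \<in> algebra_homs U B" and g: "g \<in> algebra_homs U B"
    and eq: "\<And>x. x \<in> Dist_plus G N \<Longrightarrow> f (cls x) = g (cls x)" and u: "u \<in> carrier U"
  shows "f u = g u"
  using u
proof (induction rule: U_induct)
  case one
  show ?case using algebra_homsD(3)[OF f] algebra_homsD(3)[OF g] by simp
next
  case (cls x z)
  then show ?case using algebra_homsD(2)[OF f] algebra_homsD(2)[OF g] eq cls_closed by simp
next
  case (smult c z)
  then show ?case using linear_mapsD(3)[OF algebra_homsD(1)[OF f]] linear_mapsD(3)[OF algebra_homsD(1)[OF g]] by simp
next
  case (add y z)
  then show ?case using linear_mapsD(2)[OF algebra_homsD(1)[OF f]] linear_mapsD(2)[OF algebra_homsD(1)[OF g]] by simp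
qed

subsection \<open>The map from distributions\<close>

text \<open>The projection onto the distributions that vanish at the constants, along the
  unit.\<close>

definition plus_part :: "(('g \<Rightarrow> 'k) \<Rightarrow> 'k) \<Rightarrow> ('g \<Rightarrow> 'k) \<Rightarrow> 'k" where
  "plus_part x = (\<lambda>f\<in>A. x f - x (\<lambda>x\<in>X. 1) * f \<one>\<^bsub>G\<^esub>)"

lemma plus_part_Dist_plus: "x \<in> Dist G k \<Longrightarrow> plus_part x \<in> Dist_plus G k"
proof -
  assume x: "x \<in> Dist G k"
  have "(\<lambda>f\<in>A. x f - (\<lambda>f\<in>A. x (\<lambda>x\<in>X. 1) * (\<lambda>f\<in>A. f \<one>\<^bsub>G\<^esub>) f) f) \<in> Dist G k"
    by (rule Dist_closed(4)[OF x Dist_closed(3)[OF unit_Dist]])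
  then have "plus_part x \<in> Dist G k" by (simp add: plus_part_def cong: restrict_cong)
  then show ?thesis by (simp add: Dist_plus_iff) (simp add: plus_part_def)
qed

lemma pi_eq:
  assumes x: "x \<in> Dist G k"
  shows "\<pi> x = (x (\<lambda>x\<in>X. 1) \<odot>\<^bsub>U\<^esub> \<one>\<^bsub>U\<^esub>) \<oplus>\<^bsub>U\<^esub> cls (plus_part x)"
proof -
  let ?c = "x (\<lambda>x\<in>X. 1)"
  have "(\<lambda>f\<in>A. ?c * (\<lambda>f\<in>A. f \<one>\<^bsub>G\<^esub>) f) \<in> Dist G k" by (rule Dist_closed(3)[OF unit_Dist])
  then have "x \<ominus>\<^bsub>D\<^esub> (?c \<odot>\<^bsub>D\<^esub> \<one>\<^bsub>D\<^esub>) = plus_part x"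
    using x by (subst D_minus) (auto simp: plus_part_def cong: restrict_cong)
  then show ?thesis by (simp add: Dist_to_U_def Let_def)
qed

lemma pi_linear: "\<pi> \<in> linear_maps (DM N) U"
proof (rule linear_mapsI)
  interpret U: abelian_group U by (rule k_algebraD(4)[OF U_alg])
  note us = vspace_simps[OF U_vspace] k_algebraD(8)[OF U_alg] cls_closed plus_part_Dist_plus
  fix x assume "x \<in> carrier (DM N)"
  then have x: "x \<in> Dist G N" by simp
  show "\<pi> x \<in> carrier U" using x by (simp add: pi_eq[OF x] us)
  show "\<pi> (x \<oplus>\<^bsub>DM N\<^esub> y) = \<pi> x \<oplus>\<^bsub>U\<^esub> \<pi> y" if "y \<in> carrier (DM N)" for y
  proof -
    have y: "y \<in> Dist G N" using that by simp
    have "plus_part (\<lambda>f\<in>A. x f + y f) = plus_part x \<oplus>\<^bsub>V\<^esub> plus_part y"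
      by (simp add: plus_part_def algebra_simps cong: restrict_cong)
    then have "cls (plus_part (\<lambda>f\<in>A. x f + y f)) = cls (plus_part x) \<oplus>\<^bsub>U\<^esub> cls (plus_part y)"
      using linear_mapsD(2)[OF cls_linear] x y plus_part_Dist_plus by simp
    then show ?thesis using x y
      by (simp add: pi_eq[OF x] pi_eq[OF y] pi_eq[OF Dist_closed(2)[OF x y]] us U.a_ac)
  qed
  show "\<pi> (c \<odot>\<^bsub>DM N\<^esub> x) = c \<odot>\<^bsub>U\<^esub> \<pi> x" for c
  proof -
    have "plus_part (\<lambda>f\<in>A. c * x f) = c \<odot>\<^bsub>V\<^esub> plus_part x"
      by (simp add: plus_part_def algebra_simps cong: restrict_cong)
    then have "cls (plus_part (\<lambda>f\<in>A. c * x f)) = c \<odot>\<^bsub>U\<^esub> cls (plus_part x)"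
      using linear_mapsD(3)[OF cls_linear] x plus_part_Dist_plus by simp
    then show ?thesis using x by (simp add: pi_eq[OF x] pi_eq[OF Dist_closed(3)[OF x]] us)
  qed
qed

lemma pi_closed: "x \<in> Dist G N \<Longrightarrow> \<pi> x \<in> carrier U"
  using linear_mapsD(1)[OF pi_linear] by simp

lemma pi_cls: "x \<in> Dist_plus G N \<Longrightarrow> \<pi> x = cls x"
proof -
  assume x: "x \<in> Dist_plus G N"
  then have "plus_part x = x"
    using Dist_ext[of x N] by (intro Dist_eqI) (auto simp: plus_part_def Dist_plus_iff)
  then show ?thesis using x pi_eq[of x N]
    by (simp add: Dist_plus_iff vspace_simps[OF U_vspace] k_algebraD[OF U_alg] vspace_add_simps[OF U_vspace] cls_closed)
qed

lemma pi_unit: "\<pi> (\<lambda>f\<in>A. f \<one>\<^bsub>G\<^esub>) = \<one>\<^bsub>U\<^esub>"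
proof -
  have "plus_part (\<lambda>f\<in>A. f \<one>\<^bsub>G\<^esub>) = \<zero>\<^bsub>V\<^esub>" by (simp add: plus_part_def cong: restrict_cong)
  then have "cls (plus_part (\<lambda>f\<in>A. f \<one>\<^bsub>G\<^esub>)) = \<zero>\<^bsub>U\<^esub>"
    using linear_map_zero[OF cls_linear VM_vspace U_vspace] by simp
  then show ?thesis
    by (simp add: pi_eq[OF unit_Dist] vspace_simps[OF U_vspace] k_algebraD[OF U_alg] vspace_add_simps[OF U_vspace])
qed

lemma conv_decomposition:
  assumes x: "x \<in> Dist G i" and y: "y \<in> Dist G j" and f: "f \<in> A"
  shows "(x \<otimes>\<^bsub>D\<^esub> y) f = x (\<lambda>x\<in>X. 1) * y (\<lambda>x\<in>X. 1) * f \<one>\<^bsub>G\<^esub> + x (\<lambda>x\<in>X. 1) * plus_part y f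
    + y (\<lambda>x\<in>X. 1) * plus_part x f + (plus_part x \<otimes>\<^bsub>D\<^esub> plus_part y) f"
proof -
  let ?e = "\<lambda>f\<in>A. f \<one>\<^bsub>G\<^esub>" and ?c = "x (\<lambda>x\<in>X. 1)" and ?d = "y (\<lambda>x\<in>X. 1)"
  have px: "plus_part x \<in> Dist G i" and py: "plus_part y \<in> Dist G j"
    using plus_part_Dist_plus[OF x] plus_part_Dist_plus[OF y] by (simp_all add: Dist_plus_iff)
  note l = DistD(1)[OF x] DistD(1)[OF y] DistD(1)[OF px] DistD(1)[OF py] DistD(1)[OF unit_Dist[of i]]
  have sx: "x = (\<lambda>f\<in>A. (\<lambda>f\<in>A. ?c * ?e f) f + plus_part x f)"
    using Dist_ext[OF x] by (intro Dist_eqI) (auto simp: plus_part_def)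
  have sy: "y = (\<lambda>f\<in>A. (\<lambda>f\<in>A. ?d * ?e f) f + plus_part y f)"
    using Dist_ext[OF y] by (intro Dist_eqI) (auto simp: plus_part_def)
  have ce: "(\<lambda>f\<in>A. c * ?e f) \<in> linear_maps C base_field" for c
    using DistD(1)[OF Dist_closed(3)[OF unit_Dist]] .
  have "(x \<otimes>\<^bsub>D\<^esub> y) f = ?c * y f + (plus_part x \<otimes>\<^bsub>D\<^esub> y) f"
    using conv_bilinear(1)[OF ce[of ?c] l(3) l(2)] conv_bilinear(3)[OF l(5,5,2), of ?c] conv_unit(1)[OF y] sx f
    by simp
  also have "(plus_part x \<otimes>\<^bsub>D\<^esub> y) f = ?d * plus_part x f + (plus_part x \<otimes>\<^bsub>D\<^esub> plus_part y) f"
    using conv_bilinear(2)[OF ce[of ?d] l(4) l(3)] conv_bilinear(4)[OF l(5,5,3), of ?d] conv_unit(2)[OF px] sy f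
    by simp
  finally show ?thesis using f by (simp add: plus_part_def algebra_simps)
qed

lemma smult_swap: "z \<in> carrier U \<Longrightarrow> a \<odot>\<^bsub>U\<^esub> (b \<odot>\<^bsub>U\<^esub> z) = b \<odot>\<^bsub>U\<^esub> (a \<odot>\<^bsub>U\<^esub> z)"
  using vspace_simps(4)[OF U_vspace, of z a b] vspace_simps(4)[OF U_vspace, of z b a] by (simp add: mult.commute)

text \<open>As the unit is sent to one, the relations extend from distributions that vanish at the
  constants to all distributions.\<close>

lemma pi_mult:
  assumes x: "x \<in> Dist G i" and y: "y \<in> Dist G j" and ij: "i + j \<le> N"
  shows "\<pi> x \<otimes>\<^bsub>U\<^esub> \<pi> y = \<pi> (x \<otimes>\<^bsub>D\<^esub> y)"
proof -
  interpret U: abelian_group U by (rule k_algebraD(4)[OF U_alg])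
  let ?c = "x (\<lambda>x\<in>X. 1)" and ?d = "y (\<lambda>x\<in>X. 1)"
  have px: "plus_part x \<in> Dist_plus G i" and py: "plus_part y \<in> Dist_plus G j"
    using plus_part_Dist_plus[OF x] plus_part_Dist_plus[OF y] by simp_all
  note c = rel_carriers(1)[OF px py ij]
  have xy: "x \<otimes>\<^bsub>D\<^esub> y \<in> Dist G N" using conv_Dist[OF x y] Dist_mono[OF ij] by auto
  have one: "(x \<otimes>\<^bsub>D\<^esub> y) (\<lambda>x\<in>X. 1) = ?c * ?d" by (rule conv_one_value[OF DistD(1)[OF x] DistD(1)[OF y]])
  have pl: "plus_part (x \<otimes>\<^bsub>D\<^esub> y)
      = (?c \<odot>\<^bsub>V\<^esub> plus_part y \<oplus>\<^bsub>V\<^esub> ?d \<odot>\<^bsub>V\<^esub> plus_part x) \<oplus>\<^bsub>V\<^esub> (plus_part x \<otimes>\<^bsub>D\<^esub> plus_part y)"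
    using conv_decomposition[OF x y] unfolding plus_part_def[of "x \<otimes>\<^bsub>D\<^esub> y"] one
    by (auto intro!: restrict_ext)
  note cl = linear_mapsD[OF cls_linear]
  have vV: "a \<odot>\<^bsub>V\<^esub> v \<in> Dist_plus G N" if "v \<in> Dist_plus G N" for a v
    using vspace_simps(1)[OF VM_vspace, of v N a] that by (simp del: Dist_plus_module_simps(2-4))
  have vV2: "v \<oplus>\<^bsub>V\<^esub> w \<in> Dist_plus G N" if "v \<in> Dist_plus G N" "w \<in> Dist_plus G N" for v w
    using vspace_add_simps(1)[OF VM_vspace, of v N w] that by (simp del: Dist_plus_module_simps(2-4))
  have cl3: "cls (plus_part (x \<otimes>\<^bsub>D\<^esub> y)) = (?c \<odot>\<^bsub>U\<^esub> cls (plus_part y) \<oplus>\<^bsub>U\<^esub> ?d \<odot>\<^bsub>U\<^esub> cls (plus_part x))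
      \<oplus>\<^bsub>U\<^esub> (cls (plus_part x) \<otimes>\<^bsub>U\<^esub> cls (plus_part y))"
    unfolding pl cls_mult[OF px py ij] using c
    by (simp add: cl vV vV2 del: Dist_plus_module_simps(2-4))
  have closed: "cls (plus_part x) \<in> carrier U" "cls (plus_part y) \<in> carrier U" "\<one>\<^bsub>U\<^esub> \<in> carrier U"
    using c cls_closed k_algebraD(8)[OF U_alg] by auto
  show ?thesis
    unfolding pi_eq[OF x] pi_eq[OF y] pi_eq[OF xy] one cl3
    using closed vspace_simps(1)[OF U_vspace] k_algebraD(5-7,9,10,12,13)[OF U_alg]
    by (simp add: vspace_simps(3,4)[OF U_vspace] smult_swap U.a_ac)
qed

lemma bracket_plus_part:
  assumes x: "x \<in> Dist G i" and y: "y \<in> Dist G j"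
  shows "bracket x y = bracket (plus_part x) (plus_part y)"
  unfolding bracket_def by (rule restrict_ext) (simp add: conv_decomposition[OF x y] conv_decomposition[OF y x])

lemma pi_bracket:
  assumes x: "x \<in> Dist G i" and y: "y \<in> Dist G j" and ij: "i \<le> N" "j \<le> N" "i + j \<le> Suc N"
  shows "(\<pi> x \<otimes>\<^bsub>U\<^esub> \<pi> y) \<ominus>\<^bsub>U\<^esub> (\<pi> y \<otimes>\<^bsub>U\<^esub> \<pi> x) = \<pi> (bracket x y)"
proof -
  interpret U: abelian_group U by (rule k_algebraD(4)[OF U_alg])
  let ?c = "x (\<lambda>x\<in>X. 1)" and ?d = "y (\<lambda>x\<in>X. 1)"
  have px: "plus_part x \<in> Dist_plus G i" and py: "plus_part y \<in> Dist_plus G j"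
    using plus_part_Dist_plus[OF x] plus_part_Dist_plus[OF y] by simp_all
  note c = rel_carriers(2)[OF px py ij]
  have closed: "cls (plus_part x) \<in> carrier U" "cls (plus_part y) \<in> carrier U" "\<one>\<^bsub>U\<^esub> \<in> carrier U"
    using c cls_closed k_algebraD(8)[OF U_alg] by auto
  let ?R = "((?c * ?d) \<odot>\<^bsub>U\<^esub> \<one>\<^bsub>U\<^esub>) \<oplus>\<^bsub>U\<^esub> (?c \<odot>\<^bsub>U\<^esub> cls (plus_part y) \<oplus>\<^bsub>U\<^esub> ?d \<odot>\<^bsub>U\<^esub> cls (plus_part x))"
  have e1: "\<pi> x \<otimes>\<^bsub>U\<^esub> \<pi> y = (cls (plus_part x) \<otimes>\<^bsub>U\<^esub> cls (plus_part y)) \<oplus>\<^bsub>U\<^esub> ?R"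
    unfolding pi_eq[OF x] pi_eq[OF y]
    using closed vspace_simps(1)[OF U_vspace] k_algebraD(5-7,9,10,12,13)[OF U_alg]
    by (simp add: vspace_simps(3,4)[OF U_vspace] smult_swap U.a_ac)
  have e2: "\<pi> y \<otimes>\<^bsub>U\<^esub> \<pi> x = (cls (plus_part y) \<otimes>\<^bsub>U\<^esub> cls (plus_part x)) \<oplus>\<^bsub>U\<^esub> ?R"
    unfolding pi_eq[OF x] pi_eq[OF y]
    using closed vspace_simps(1)[OF U_vspace] k_algebraD(5-7,9,10,12,13)[OF U_alg]
    by (simp add: vspace_simps(3,4)[OF U_vspace] smult_swap U.a_ac)
  have cancel: "(a \<oplus>\<^bsub>U\<^esub> r) \<ominus>\<^bsub>U\<^esub> (b \<oplus>\<^bsub>U\<^esub> r) = a \<ominus>\<^bsub>U\<^esub> b"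
    if "a \<in> carrier U" "b \<in> carrier U" "r \<in> carrier U" for a b r
    using that by (simp add: a_minus_def U.minus_add U.a_assoc U.r_neg1 U.r_neg2 U.a_lcomm[of r]  U.r_neg)
  have R: "?R \<in> carrier U" using closed vspace_simps(1)[OF U_vspace] by simp
  have "(\<pi> x \<otimes>\<^bsub>U\<^esub> \<pi> y) \<ominus>\<^bsub>U\<^esub> (\<pi> y \<otimes>\<^bsub>U\<^esub> \<pi> x) = cls (bracket (plus_part x) (plus_part y))"
    unfolding e1 e2 cls_bracket[OF px py ij, symmetric]
    using closed R k_algebraD(7)[OF U_alg] by (intro cancel) auto
  then show ?thesis using c by (simp add: bracket_plus_part[OF x y] pi_cls)
qed

end

subsection \<open>Comultiplication, counit and antipode\<close>

lemma opposite_simps [simp]: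
  "carrier (opposite_algebra B) = carrier B" "a \<otimes>\<^bsub>opposite_algebra B\<^esub> b = b \<otimes>\<^bsub>B\<^esub> a"
  "\<one>\<^bsub>opposite_algebra B\<^esub> = \<one>\<^bsub>B\<^esub>" "\<zero>\<^bsub>opposite_algebra B\<^esub> = \<zero>\<^bsub>B\<^esub>"
  "a \<oplus>\<^bsub>opposite_algebra B\<^esub> b = a \<oplus>\<^bsub>B\<^esub> b" "c \<odot>\<^bsub>opposite_algebra B\<^esub> a = c \<odot>\<^bsub>B\<^esub> a"
  by (simp_all add: opposite_algebra_def)

lemma opposite_minus:
  assumes "k_algebra B" "a \<in> carrier B" "b \<in> carrier B"
  shows "a \<ominus>\<^bsub>opposite_algebra B\<^esub> b = a \<ominus>\<^bsub>B\<^esub> b"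
  using assms vspace_minus[OF k_algebraD(2)[OF assms(1)]]
    vspace_minus[OF k_algebraD(2)[OF k_algebra_opposite[OF assms(1)]]]
  by (simp add: a_minus_def)

context higher_enveloping
begin

abbreviation "UU \<equiv> U \<otimes>\<^sub>k U"
abbreviation "DD \<equiv> DM N \<otimes>\<^sub>k DM N"
abbreviation "\<pi>\<pi> \<equiv> tensor_map U U \<pi> \<pi>"

lemma UU_alg: "k_algebra UU"
  by (rule k_algebra_tensor[OF U_alg U_alg])

lemmas UU_vspace = k_algebraD(2)[OF UU_alg]
lemmas pipi = tensor_map_linear[OF DM_vspace DM_vspace U_vspace U_vspace pi_linear pi_linear]
lemmas DD_vspace = tensor_vspace[OF DM_vspace DM_vspace]
lemmas pure_U = pure_simps(1)[OF U_vspace U_vspace]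

text \<open>Keeps track of a preimage of \<open>z\<close> among the tensors of distributions by means
  of its values on pairs of functions. A tensor of distributions is determined by these values, so
  that a realization of the values \<open>\<mu>(f g)\<close> has to be the comultiplication of
  \<open>\<mu>\<close>.\<close>

definition realizes :: "(('g \<Rightarrow> 'k) \<Rightarrow> ('g \<Rightarrow> 'k) \<Rightarrow> 'k) \<Rightarrow> _ \<Rightarrow> bool" where
  "realizes E z \<longleftrightarrow> (\<exists>W\<in>carrier DD. z = \<pi>\<pi> W \<and> (\<forall>f\<in>A. \<forall>g\<in>A. tensor_value W f g = E f g))"

lemma realizesI:
  "W \<in> carrier DD \<Longrightarrow> (\<And>f g. f \<in> A \<Longrightarrow> g \<in> A \<Longrightarrow> tensor_value W f g = E f g) \<Longrightarrow> realizes E (\<pi>\<pi> W)"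
  unfolding realizes_def by blast

lemma realizes_cong:
  "realizes E z \<Longrightarrow> (\<And>f g. f \<in> A \<Longrightarrow> g \<in> A \<Longrightarrow> E' f g = E f g) \<Longrightarrow> realizes E' z"
  unfolding realizes_def by fastforce

lemma realizes_zero: "realizes (\<lambda>f g. 0) \<zero>\<^bsub>UU\<^esub>"
  using realizesI[of "\<zero>\<^bsub>DD\<^esub>" "\<lambda>f g. 0"] linear_map_zero[OF pipi(1) DD_vspace UU_vspace]
    linear_map_zero[OF tensor_value_linear DD_vspace vspace_base_field] vspace_add_simps(2)[OF DD_vspace]
  by simp

lemma realizes_add: "realizes E z \<Longrightarrow> realizes E' z' \<Longrightarrow> realizes (\<lambda>f g. E f g + E' f g) (z \<oplus>\<^bsub>UU\<^esub> z')"
proof -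
  assume "realizes E z" "realizes E' z'"
  then obtain W W' where W: "W \<in> carrier DD" "z = \<pi>\<pi> W" "\<forall>f\<in>A. \<forall>g\<in>A. tensor_value W f g = E f g"
    "W' \<in> carrier DD" "z' = \<pi>\<pi> W'" "\<forall>f\<in>A. \<forall>g\<in>A. tensor_value W' f g = E' f g"
    unfolding realizes_def by blast
  have "realizes (\<lambda>f g. E f g + E' f g) (\<pi>\<pi> (W \<oplus>\<^bsub>DD\<^esub> W'))"
    using W linear_mapsD(2)[OF tensor_value_linear W(1,4)] vspace_add_simps(1)[OF DD_vspace W(1,4)]
    by (intro realizesI) simp_all
  then show ?thesis using W linear_mapsD(2)[OF pipi(1)] by simp
qed

lemma realizes_minus: "realizes E z \<Longrightarrow> realizes E' z' \<Longrightarrow> realizes (\<lambda>f g. E f g - E' f g) (z \<ominus>\<^bsub>UU\<^esub> z')"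
proof -
  assume "realizes E z" "realizes E' z'"
  then obtain W W' where W: "W \<in> carrier DD" "z = \<pi>\<pi> W" "\<forall>f\<in>A. \<forall>g\<in>A. tensor_value W f g = E f g"
    "W' \<in> carrier DD" "z' = \<pi>\<pi> W'" "\<forall>f\<in>A. \<forall>g\<in>A. tensor_value W' f g = E' f g"
    unfolding realizes_def by blast
  have "realizes (\<lambda>f g. E f g - E' f g) (\<pi>\<pi> (W \<ominus>\<^bsub>DD\<^esub> W'))"
    using W linear_map_minus[OF tensor_value_linear DD_vspace vspace_base_field W(1,4)]
      vspace_add_simps(6)[OF DD_vspace W(1,4)]
    by (intro realizesI) simp_all
  then show ?thesis using W linear_map_minus[OF pipi(1) DD_vspace UU_vspace] by simp
qed

lemma realizes_pure:
  "x \<in> Dist G N \<Longrightarrow> y \<in> Dist G N \<Longrightarrow> realizes (\<lambda>f g. x f * y g) (pure U U (\<pi> x) (\<pi> y))"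
  using realizesI[of "pure (DM N) (DM N) x y" "\<lambda>f g. x f * y g"]
  by (simp add: tensor_value_pure pipi(2) pure_simps(1)[OF DM_vspace DM_vspace])

lemma realizes_comult:
  assumes "\<mu> \<in> Dist G N" "realizes E z" "\<And>f g. f \<in> A \<Longrightarrow> g \<in> A \<Longrightarrow> E f g = \<mu> (\<lambda>x\<in>X. f x * g x)"
  shows "z = \<pi>\<pi> (Dist_comult G N \<mu>)"
proof -
  obtain W where W: "W \<in> carrier DD" "z = \<pi>\<pi> W" "\<forall>f\<in>A. \<forall>g\<in>A. tensor_value W f g = E f g"
    using assms(2) unfolding realizes_def by blast
  have "Dist_comult G N \<mu> = W" using W assms(3) by (intro Dist_comult_eqI) auto
  then show ?thesis using W by simp
qed

text \<open>Reduces products and commutators of two comultiplications to single components.\<close>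

lemma realizes_bilinear:
  assumes b: "bilinear UU UU UU b"
    and L: "set L \<subseteq> Dist G N \<times> Dist G N" and M: "set M \<subseteq> Dist G N \<times> Dist G N"
    and E: "\<And>x x' y y'. (x, x') \<in> set L \<Longrightarrow> (y, y') \<in> set M \<Longrightarrow>
      realizes (E (x, x') (y, y')) (b (pure U U (\<pi> x) (\<pi> x')) (pure U U (\<pi> y) (\<pi> y')))"
  shows "realizes (\<lambda>f g. \<Sum>l\<leftarrow>L. \<Sum>m\<leftarrow>M. E l m f g)
    (b (\<pi>\<pi> (tensor_sum (DM N) (DM N) L)) (\<pi>\<pi> (tensor_sum (DM N) (DM N) M)))"
proof -
  have pz: "\<pi>\<pi> \<zero>\<^bsub>DD\<^esub> = \<zero>\<^bsub>UU\<^esub>" by (rule linear_map_zero[OF pipi(1) DD_vspace UU_vspace])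
  have cons: "\<pi>\<pi> (tensor_sum (DM N) (DM N) ((x, y) # K)) = pure U U (\<pi> x) (\<pi> y) \<oplus>\<^bsub>UU\<^esub> \<pi>\<pi> (tensor_sum (DM N) (DM N) K)"
    "\<pi>\<pi> (tensor_sum (DM N) (DM N) K) \<in> carrier UU"
    if "x \<in> Dist G N" "y \<in> Dist G N" "set K \<subseteq> Dist G N \<times> Dist G N" for x y K
    using that linear_mapsD(1,2)[OF pipi(1)] tensor_sum_closed[OF DM_vspace DM_vspace, of K]
      pure_simps(1)[OF DM_vspace DM_vspace, of x N y]
    by (simp_all add: pipi(2))
  have nil: "\<pi>\<pi> (tensor_sum (DM N) (DM N) K) \<in> carrier UU" if "set K \<subseteq> Dist G N \<times> Dist G N" for K
    using that linear_mapsD(1)[OF pipi(1)] tensor_sum_closed[OF DM_vspace DM_vspace, of K] by simp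
  note bl = linear_mapsD(2)[OF bilinear_linear(1)[OF b]] linear_mapsD(2)[OF bilinear_linear(2)[OF b]]
  note bz = linear_map_zero[OF bilinear_linear(1)[OF b] UU_vspace UU_vspace]
    linear_map_zero[OF bilinear_linear(2)[OF b] UU_vspace UU_vspace]
  have inner: "realizes (\<lambda>f g. \<Sum>m\<leftarrow>M'. E (x, x') m f g)
      (b (pure U U (\<pi> x) (\<pi> x')) (\<pi>\<pi> (tensor_sum (DM N) (DM N) M')))"
    if x: "(x, x') \<in> set L" and "set M' \<subseteq> set M" for x x' M'
    using that(2)
  proof (induction M')
    case Nil
    have "pure U U (\<pi> x) (\<pi> x') \<in> carrier UU" using x L by (auto intro!: pure_U pi_closed)
    then show ?case by (simp add: pz bz(2) realizes_zero)
  next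
    case (Cons yy M')
    obtain y y' where yy: "yy = (y, y')" by (cases yy)
    have y: "(y, y') \<in> set M" "y \<in> Dist G N" "y' \<in> Dist G N" "set M' \<subseteq> Dist G N \<times> Dist G N"
      using Cons.prems M yy by auto
    have px: "pure U U (\<pi> x) (\<pi> x') \<in> carrier UU" using x L by (auto intro!: pure_U pi_closed)
    have py: "pure U U (\<pi> y) (\<pi> y') \<in> carrier UU" using y by (auto intro!: pure_U pi_closed)
    show ?case
      unfolding yy cons(1)[OF y(2-4)] bl(2)[OF px py nil[OF y(4)]]
      using realizes_add[OF E[OF x y(1)] Cons.IH] Cons.prems by simp
  qed
  have "realizes (\<lambda>f g. \<Sum>l\<leftarrow>L'. \<Sum>m\<leftarrow>M. E l m f g)
      (b (\<pi>\<pi> (tensor_sum (DM N) (DM N) L')) (\<pi>\<pi> (tensor_sum (DM N) (DM N) M)))"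
    if "set L' \<subseteq> set L" for L'
    using that
  proof (induction L')
    case Nil
    show ?case using nil[OF M] by (simp add: pz bz(1) realizes_zero)
  next
    case (Cons xx L')
    obtain x x' where xx: "xx = (x, x')" by (cases xx)
    have x: "(x, x') \<in> set L" "x \<in> Dist G N" "x' \<in> Dist G N" "set L' \<subseteq> Dist G N \<times> Dist G N"
      using Cons.prems L xx by auto
    have px: "pure U U (\<pi> x) (\<pi> x') \<in> carrier UU" using x by (auto intro!: pure_U pi_closed)
    show ?case
      unfolding xx cons(1)[OF x(2-4)] bl(1)[OF nil[OF M] px nil[OF x(4)]]
      using realizes_add[OF inner[OF x(1) order.refl] Cons.IH] Cons.prems by simp
  qed
  then show ?thesis by simp
qed

lemma Dist_mono': "x \<in> Dist G i \<Longrightarrow> i \<le> j \<Longrightarrow> x \<in> Dist G j"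
  using Dist_mono by blast

lemma Dist_0_conv:
  assumes x: "x \<in> Dist G 0" and y: "y \<in> Dist G 0"
  shows "x \<otimes>\<^bsub>D\<^esub> y = y \<otimes>\<^bsub>D\<^esub> x"
proof (rule Dist_eqI[OF conv_ext conv_ext])
  have z: "plus_part w = (\<lambda>f\<in>A. 0)" if "w \<in> Dist G 0" for w
    using plus_part_Dist_plus[OF that] by (rule Dist_plus_0)
  fix f assume "f \<in> A"
  then show "(x \<otimes>\<^bsub>D\<^esub> y) f = (y \<otimes>\<^bsub>D\<^esub> x) f"
    by (simp add: conv_decomposition[OF x y] conv_decomposition[OF y x] z[OF x] z[OF y] mult.commute)
qed

text \<open>The orders of the components in each slot of the tensor product add up to at most
  \<open>N\<close>, so that these components can be multiplied as distributions.\<close>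

lemma comult_mult:
  assumes x: "x \<in> Dist G i" and y: "y \<in> Dist G j" and ij: "i + j \<le> N"
  shows "\<pi>\<pi> (Dist_comult G N x) \<otimes>\<^bsub>UU\<^esub> \<pi>\<pi> (Dist_comult G N y) = \<pi>\<pi> (Dist_comult G N (x \<otimes>\<^bsub>D\<^esub> y))"
proof -
  obtain L where L: "comult_rep i x L" by (rule comult_rep_exists[OF x])
  obtain M where M: "comult_rep j y M" by (rule comult_rep_exists[OF y])
  have i: "i \<le> N" and j: "j \<le> N" using ij by auto
  note DL = Dist_comult_rep[OF L i] and DM = Dist_comult_rep[OF M j]
  have "realizes (\<lambda>f g. \<Sum>l\<leftarrow>L. \<Sum>m\<leftarrow>M. (fst l \<otimes>\<^bsub>D\<^esub> fst m) f * (snd l \<otimes>\<^bsub>D\<^esub> snd m) g)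
      (\<pi>\<pi> (tensor_sum (DM N) (DM N) L) \<otimes>\<^bsub>UU\<^esub> \<pi>\<pi> (tensor_sum (DM N) (DM N) M))"
  proof (rule realizes_bilinear[OF algebra_mult_bilinear[OF UU_alg] DL(2) DM(2)])
    fix x' x'' y' y'' assume "(x', x'') \<in> set L" "(y', y'') \<in> set M"
    then obtain a a' b b' where a: "a + a' \<le> i" "x' \<in> Dist G a" "x'' \<in> Dist G a'"
      and b: "b + b' \<le> j" "y' \<in> Dist G b" "y'' \<in> Dist G b'"
      using comult_repD(1)[OF L] comult_repD(1)[OF M] by meson
    have "x' \<otimes>\<^bsub>D\<^esub> y' \<in> Dist G N" "x'' \<otimes>\<^bsub>D\<^esub> y'' \<in> Dist G N"
      using Dist_mono'[OF conv_Dist[OF a(2) b(2)]] Dist_mono'[OF conv_Dist[OF a(3) b(3)]] a b ij by auto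
    moreover have "pure U U (\<pi> x') (\<pi> x'') \<otimes>\<^bsub>UU\<^esub> pure U U (\<pi> y') (\<pi> y'')
        = pure U U (\<pi> (x' \<otimes>\<^bsub>D\<^esub> y')) (\<pi> (x'' \<otimes>\<^bsub>D\<^esub> y''))"
      using a b ij Dist_mono'[OF a(2), of N] Dist_mono'[OF a(3), of N] Dist_mono'[OF b(2), of N] Dist_mono'[OF b(3), of N]
      by (simp add: tensor_mult_pure[OF U_alg U_alg] pi_closed pi_mult[OF a(2) b(2)] pi_mult[OF a(3) b(3)])
    ultimately show "realizes (\<lambda>f g. (fst (x', x'') \<otimes>\<^bsub>D\<^esub> fst (y', y'')) f * (snd (x', x'') \<otimes>\<^bsub>D\<^esub> snd (y', y'')) g)
        (pure U U (\<pi> x') (\<pi> x'') \<otimes>\<^bsub>UU\<^esub> pure U U (\<pi> y') (\<pi> y''))"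
      using realizes_pure by simp
  qed
  then show ?thesis
    using conv_comult[OF x y L M] Dist_mono'[OF conv_Dist[OF x y] ij]
    by (intro realizes_comult) (simp_all add: DL(1) DM(1) split_def)
qed

text \<open>If the orders add up to \<open>N + 1\<close>, then the components in each slot can still
  be multiplied as distributions unless their orders already add up to \<open>N + 1\<close>. In this
  case the other slot contains only scalars, which commute, and the commutator relation
  applies.\<close>

lemma comult_bracket:
  assumes x: "x \<in> Dist G i" and y: "y \<in> Dist G j" and ij: "i \<le> N" "j \<le> N" "i + j \<le> Suc N"
  shows "(\<pi>\<pi> (Dist_comult G N x) \<otimes>\<^bsub>UU\<^esub> \<pi>\<pi> (Dist_comult G N y))
    \<ominus>\<^bsub>UU\<^esub> (\<pi>\<pi> (Dist_comult G N y) \<otimes>\<^bsub>UU\<^esub> \<pi>\<pi> (Dist_comult G N x)) = \<pi>\<pi> (Dist_comult G N (bracket x y))"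
proof -
  obtain L where L: "comult_rep i x L" by (rule comult_rep_exists[OF x])
  obtain M where M: "comult_rep j y M" by (rule comult_rep_exists[OF y])
  note DL = Dist_comult_rep[OF L ij(1)] and DM = Dist_comult_rep[OF M ij(2)]
  let ?E = "\<lambda>l m f g. (fst l \<otimes>\<^bsub>D\<^esub> fst m) f * (snd l \<otimes>\<^bsub>D\<^esub> snd m) g
    - (fst m \<otimes>\<^bsub>D\<^esub> fst l) f * (snd m \<otimes>\<^bsub>D\<^esub> snd l) g"
  have bil: "bilinear UU UU UU (\<lambda>z w. (z \<otimes>\<^bsub>UU\<^esub> w) \<ominus>\<^bsub>UU\<^esub> (w \<otimes>\<^bsub>UU\<^esub> z))"
    using bilinear_minus[OF UU_vspace algebra_mult_bilinear[OF UU_alg]]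
      bilinear_linear[OF algebra_mult_bilinear[OF UU_alg]] bilinearI[of UU "\<lambda>z w. w \<otimes>\<^bsub>UU\<^esub> z" UU UU] by blast
  have "realizes (\<lambda>f g. \<Sum>l\<leftarrow>L. \<Sum>m\<leftarrow>M. ?E l m f g)
      ((\<pi>\<pi> (tensor_sum (DM N) (DM N) L) \<otimes>\<^bsub>UU\<^esub> \<pi>\<pi> (tensor_sum (DM N) (DM N) M))
      \<ominus>\<^bsub>UU\<^esub> (\<pi>\<pi> (tensor_sum (DM N) (DM N) M) \<otimes>\<^bsub>UU\<^esub> \<pi>\<pi> (tensor_sum (DM N) (DM N) L)))"
  proof (rule realizes_bilinear[OF bil DL(2) DM(2)])
    fix x' x'' y' y'' assume "(x', x'') \<in> set L" "(y', y'') \<in> set M"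
    then obtain a a' b b' where a: "a + a' \<le> i" "x' \<in> Dist G a" "x'' \<in> Dist G a'"
      and b: "b + b' \<le> j" "y' \<in> Dist G b" "y'' \<in> Dist G b'"
      using comult_repD(1)[OF L] comult_repD(1)[OF M] by meson
    have le: "a \<le> N" "a' \<le> N" "b \<le> N" "b' \<le> N" using a(1) b(1) ij by auto
    note DN = Dist_mono'[OF a(2) le(1)] Dist_mono'[OF a(3) le(2)] Dist_mono'[OF b(2) le(3)] Dist_mono'[OF b(3) le(4)]
    note piN = pi_closed[OF DN(1)] pi_closed[OF DN(2)] pi_closed[OF DN(3)] pi_closed[OF DN(4)]
    note mU = k_algebraD(7)[OF U_alg]
    have z: "(pure U U (\<pi> x') (\<pi> x'') \<otimes>\<^bsub>UU\<^esub> pure U U (\<pi> y') (\<pi> y''))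
        \<ominus>\<^bsub>UU\<^esub> (pure U U (\<pi> y') (\<pi> y'') \<otimes>\<^bsub>UU\<^esub> pure U U (\<pi> x') (\<pi> x''))
      = pure U U (\<pi> x' \<otimes>\<^bsub>U\<^esub> \<pi> y') (\<pi> x'' \<otimes>\<^bsub>U\<^esub> \<pi> y'') \<ominus>\<^bsub>UU\<^esub> pure U U (\<pi> y' \<otimes>\<^bsub>U\<^esub> \<pi> x') (\<pi> y'' \<otimes>\<^bsub>U\<^esub> \<pi> x'')"
      using piN by (simp add: tensor_mult_pure[OF U_alg U_alg])
    (* a slot whose orders add up to N + 1 leaves order 0 for the other one *)
    consider (both) "a + b \<le> N" "a' + b' \<le> N" | (left) "a' = 0" "b' = 0" "a + b \<le> Suc N"
      | (right) "a = 0" "b = 0" "a' + b' \<le> Suc N"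
      using a(1) b(1) ij by linarith
    then have "realizes (?E (x', x'') (y', y''))
        (pure U U (\<pi> x' \<otimes>\<^bsub>U\<^esub> \<pi> y') (\<pi> x'' \<otimes>\<^bsub>U\<^esub> \<pi> y'') \<ominus>\<^bsub>UU\<^esub> pure U U (\<pi> y' \<otimes>\<^bsub>U\<^esub> \<pi> x') (\<pi> y'' \<otimes>\<^bsub>U\<^esub> \<pi> x''))"
    proof cases
      case both
      then have both': "b + a \<le> N" "b' + a' \<le> N" by simp_all
      show ?thesis
        unfolding pi_mult[OF a(2) b(2) both(1)] pi_mult[OF a(3) b(3) both(2)]
          pi_mult[OF b(2) a(2) both'(1)] pi_mult[OF b(3) a(3) both'(2)] fst_conv snd_conv
        by (intro realizes_minus realizes_pure
            Dist_mono'[OF conv_Dist[OF a(2) b(2)] both(1)] Dist_mono'[OF conv_Dist[OF a(3) b(3)] both(2)]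
            Dist_mono'[OF conv_Dist[OF b(2) a(2)] both'(1)] Dist_mono'[OF conv_Dist[OF b(3) a(3)] both'(2)])
    next
      case left
      have x0: "x'' \<in> Dist G 0" and y0: "y'' \<in> Dist G 0" using a b left by simp_all
      have c: "x'' \<otimes>\<^bsub>D\<^esub> y'' \<in> Dist G N" using conv_Dist[OF x0 y0] Dist_mono'[of _ 0 N] by simp
      have br: "bracket x' y' \<in> Dist G N"
        using bracket_Dist[OF a(2) b(2)] left by (auto elim: Dist_mono')
      have "pure U U (\<pi> x' \<otimes>\<^bsub>U\<^esub> \<pi> y') (\<pi> x'' \<otimes>\<^bsub>U\<^esub> \<pi> y'') \<ominus>\<^bsub>UU\<^esub> pure U U (\<pi> y' \<otimes>\<^bsub>U\<^esub> \<pi> x') (\<pi> y'' \<otimes>\<^bsub>U\<^esub> \<pi> x'')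
          = pure U U (\<pi> (bracket x' y')) (\<pi> (x'' \<otimes>\<^bsub>D\<^esub> y''))"
        using pi_mult[OF x0 y0] pi_mult[OF y0 x0] Dist_0_conv[OF x0 y0] piN mU pi_closed[OF c]
          linear_map_minus[OF bilinear_linear(1)[OF pure_bilinear[OF U_vspace U_vspace] pi_closed[OF c]] U_vspace UU_vspace]
        by (simp add: pi_bracket[OF a(2) b(2) le(1,3) left(3), symmetric])
      moreover have "realizes (\<lambda>f g. bracket x' y' f * (x'' \<otimes>\<^bsub>D\<^esub> y'') g) (pure U U (\<pi> (bracket x' y')) (\<pi> (x'' \<otimes>\<^bsub>D\<^esub> y'')))"
        by (rule realizes_pure[OF br c])
      ultimately show ?thesis
        using Dist_0_conv[OF x0 y0]
        by (auto elim!: realizes_cong simp: bracket_def algebra_simps)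
    next
      case right
      have x0: "x' \<in> Dist G 0" and y0: "y' \<in> Dist G 0" using a b right by simp_all
      have c: "x' \<otimes>\<^bsub>D\<^esub> y' \<in> Dist G N" using conv_Dist[OF x0 y0] Dist_mono'[of _ 0 N] by simp
      have br: "bracket x'' y'' \<in> Dist G N"
        using bracket_Dist[OF a(3) b(3)] right by (auto elim: Dist_mono')
      have "pure U U (\<pi> x' \<otimes>\<^bsub>U\<^esub> \<pi> y') (\<pi> x'' \<otimes>\<^bsub>U\<^esub> \<pi> y'') \<ominus>\<^bsub>UU\<^esub> pure U U (\<pi> y' \<otimes>\<^bsub>U\<^esub> \<pi> x') (\<pi> y'' \<otimes>\<^bsub>U\<^esub> \<pi> x'')
          = pure U U (\<pi> (x' \<otimes>\<^bsub>D\<^esub> y')) (\<pi> (bracket x'' y''))"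
        using pi_mult[OF x0 y0] pi_mult[OF y0 x0] Dist_0_conv[OF x0 y0] piN mU pi_closed[OF c]
          linear_map_minus[OF bilinear_linear(2)[OF pure_bilinear[OF U_vspace U_vspace] pi_closed[OF c]] U_vspace UU_vspace]
        by (simp add: pi_bracket[OF a(3) b(3) le(2,4) right(3), symmetric])
      moreover have "realizes (\<lambda>f g. (x' \<otimes>\<^bsub>D\<^esub> y') f * bracket x'' y'' g) (pure U U (\<pi> (x' \<otimes>\<^bsub>D\<^esub> y')) (\<pi> (bracket x'' y'')))"
        by (rule realizes_pure[OF c br])
      ultimately show ?thesis
        using Dist_0_conv[OF x0 y0]
        by (auto elim!: realizes_cong simp: bracket_def algebra_simps)
    qed
    then show "realizes (?E (x', x'') (y', y'')) ((pure U U (\<pi> x') (\<pi> x'') \<otimes>\<^bsub>UU\<^esub> pure U U (\<pi> y') (\<pi> y''))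
        \<ominus>\<^bsub>UU\<^esub> (pure U U (\<pi> y') (\<pi> y'') \<otimes>\<^bsub>UU\<^esub> pure U U (\<pi> x') (\<pi> x'')))"
      unfolding z .
  qed
  moreover have "bracket x y \<in> Dist G N" using bracket_Dist[OF x y] ij by (auto elim: Dist_mono')
  moreover have "(\<Sum>l\<leftarrow>L. \<Sum>m\<leftarrow>M. ?E l m f g) = bracket x y (\<lambda>x\<in>X. f x * g x)" if "f \<in> A" "g \<in> A" for f g
    using that conv_comult[OF x y L M that] conv_comult[OF y x M L that]
    by (simp add: bracket_def sum_list_subtractf split_def sum_list_swap[of _ L M])
  ultimately show ?thesis unfolding DL(1) DM(1) by (intro realizes_comult)
qed

end

lemma tensor_map_compose:
  assumes "vspace M" "vspace N" "vspace M'" "vspace N'" "vspace M''" "vspace N''"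
    and f: "f \<in> linear_maps M M'" and g: "g \<in> linear_maps N N'"
    and f': "f' \<in> linear_maps M' M''" and g': "g' \<in> linear_maps N' N''"
    and h: "h \<in> linear_maps M M''" and k: "k \<in> linear_maps N N''"
    and fh: "\<And>x. x \<in> carrier M \<Longrightarrow> f' (f x) = h x" and gk: "\<And>y. y \<in> carrier N \<Longrightarrow> g' (g y) = k y"
    and Z: "Z \<in> carrier (M \<otimes>\<^sub>k N)"
  shows "tensor_map M'' N'' f' g' (tensor_map M' N' f g Z) = tensor_map M'' N'' h k Z"
proof -
  note t1 = tensor_map_linear[OF assms(1-4) f g] and t2 = tensor_map_linear[OF assms(3-6) f' g']
    and t3 = tensor_map_linear[OF assms(1,2,5,6) h k]
  have p: "tensor_map M'' N'' f' g' (tensor_map M' N' f g (pure M N x y)) = tensor_map M'' N'' h k (pure M N x y)"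
    if "x \<in> carrier M" "y \<in> carrier N" for x y
    using that linear_mapsD(1)[OF f] linear_mapsD(1)[OF g] by (simp add: t1(2) t2(2) t3(2) fh gk)
  show ?thesis
    by (rule tensor_ext[OF assms(1,2) tensor_vspace[OF assms(5,6)] linear_map_comp[OF t1(1) t2(1)] t3(1) p Z])
qed

lemma tensor_ext3:
  assumes M: "vspace M" and N: "vspace N" and K: "vspace K" and L: "vspace L"
    and f: "f \<in> linear_maps ((M \<otimes>\<^sub>k N) \<otimes>\<^sub>k K) L" and g: "g \<in> linear_maps ((M \<otimes>\<^sub>k N) \<otimes>\<^sub>k K) L"
    and eq: "\<And>x y z. x \<in> carrier M \<Longrightarrow> y \<in> carrier N \<Longrightarrow> z \<in> carrier K \<Longrightarrow>
      f (pure (M \<otimes>\<^sub>k N) K (pure M N x y) z) = g (pure (M \<otimes>\<^sub>k N) K (pure M N x y) z)"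
    and W: "W \<in> carrier ((M \<otimes>\<^sub>k N) \<otimes>\<^sub>k K)"
  shows "f W = g W"
proof -
  note MN = tensor_vspace[OF M N]
  have p: "f (pure (M \<otimes>\<^sub>k N) K w z) = g (pure (M \<otimes>\<^sub>k N) K w z)"
    if w: "w \<in> carrier (M \<otimes>\<^sub>k N)" and z: "z \<in> carrier K" for w z
  proof -
    note pl = bilinear_linear(1)[OF pure_bilinear[OF MN K] z]
    show ?thesis
      by (rule tensor_ext[OF M N L linear_map_comp[OF pl f] linear_map_comp[OF pl g] eq[OF _ _ z] w])
  qed
  show ?thesis by (rule tensor_ext[OF MN K L f g p W])
qed

lemma tensor_assoc_natural:
  assumes M: "vspace M" and M': "vspace M'" and f: "f \<in> linear_maps M M'"
    and W: "W \<in> carrier ((M \<otimes>\<^sub>k M) \<otimes>\<^sub>k M)"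
  shows "tensor_assoc M' M' M' (tensor_map (M' \<otimes>\<^sub>k M') M' (tensor_map M' M' f f) f W)
    = tensor_map M' (M' \<otimes>\<^sub>k M') f (tensor_map M' M' f f) (tensor_assoc M M M W)"
proof -
  note MM = tensor_vspace[OF M M] and MM' = tensor_vspace[OF M' M']
  note ff = tensor_map_linear[OF M M M' M' f f]
  note t1 = tensor_map_linear[OF MM M MM' M' ff(1) f] and t2 = tensor_map_linear[OF M MM M' MM' f ff(1)]
  note a = tensor_assoc_linear[OF M M M] and a' = tensor_assoc_linear[OF M' M' M']
  have p: "tensor_assoc M' M' M' (tensor_map (M' \<otimes>\<^sub>k M') M' (tensor_map M' M' f f) f (pure (M \<otimes>\<^sub>k M) M (pure M M x y) z))
      = tensor_map M' (M' \<otimes>\<^sub>k M') f (tensor_map M' M' f f) (tensor_assoc M M M (pure (M \<otimes>\<^sub>k M) M (pure M M x y) z))"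
    if "x \<in> carrier M" "y \<in> carrier M" "z \<in> carrier M" for x y z
    using that linear_mapsD(1)[OF f] pure_simps(1)[OF M M]
    by (simp add: t1(2) t2(2) ff(2) a(2) a'(2))
  show ?thesis
    by (rule tensor_ext3[OF M M M tensor_vspace[OF M' MM'] linear_map_comp[OF t1(1) a'(1)] linear_map_comp[OF a(1) t2(1)] p W])
qed

context higher_enveloping
begin

lemma VM_linear: "f \<in> linear_maps (DM k) B \<Longrightarrow> f \<in> linear_maps (VM k) B"
  by (auto simp: linear_maps_def Dist_plus_iff)

lemma Dist_plus_D: "x \<in> Dist_plus G k \<Longrightarrow> x \<in> Dist G k"
  by (simp add: Dist_plus_iff)

definition comult_U where
  "comult_U = quotient_lift (tensor_algebra_lift UU (\<lambda>x. \<pi>\<pi> (Dist_comult G N x)))"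

definition counit_U where
  "counit_U = quotient_lift (tensor_algebra_lift base_field (\<lambda>x. x (\<lambda>x\<in>X. 1)))"

definition antipode_U where
  "antipode_U = quotient_lift (tensor_algebra_lift (opposite_algebra U) (\<lambda>x. cls (Dist_antipode G x)))"

lemma delta_linear: "(\<lambda>x. \<pi>\<pi> (Dist_comult G N x)) \<in> linear_maps (DM N) UU"
  using linear_map_comp[OF Dist_comult_linear pipi(1)] .

lemma comult_U_hom: "comult_U \<in> algebra_homs U UU"
  and comult_U_cls: "x \<in> Dist_plus G N \<Longrightarrow> comult_U (cls x) = \<pi>\<pi> (Dist_comult G N x)"
proof -
  note L = U_lift[OF UU_alg VM_linear[OF delta_linear]]
  show "comult_U \<in> algebra_homs U UU"
    unfolding comult_U_def
    by (rule L(1)) (rule comult_mult comult_bracket; (rule Dist_plus_D)?; assumption)+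
  show "comult_U (cls x) = \<pi>\<pi> (Dist_comult G N x)" if "x \<in> Dist_plus G N"
    unfolding comult_U_def
    by (rule L(2)[OF _ _ that]) (rule comult_mult comult_bracket; (rule Dist_plus_D)?; assumption)+
qed

lemma counit_linear: "(\<lambda>x. x (\<lambda>x\<in>X. 1)) \<in> linear_maps (DM k) base_field"
  by (rule DM_evaluation) simp

lemma counit_U_hom: "counit_U \<in> algebra_homs U base_field"
  and counit_U_cls: "x \<in> Dist_plus G N \<Longrightarrow> counit_U (cls x) = 0"
proof -
  have br: "bracket x y (\<lambda>x\<in>X. 1) = 0" if "x \<in> Dist_plus G i" "y \<in> Dist_plus G j" for x y i j
    using bracket_Dist_plus[OF that] by (simp add: Dist_plus_iff)
  have cv: "(x \<otimes>\<^bsub>D\<^esub> y) (\<lambda>x\<in>X. 1) = 0" if "x \<in> Dist_plus G i" "y \<in> Dist_plus G j" for x y i j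
    using conv_Dist_plus[OF that] by (simp add: Dist_plus_iff)
  note L = U_lift[OF k_algebra_base_field VM_linear[OF counit_linear]]
  show "counit_U \<in> algebra_homs U base_field"
    unfolding counit_U_def by (rule L(1)) (simp_all add: cv br, simp_all add: Dist_plus_iff)
  show "counit_U (cls x) = 0" if "x \<in> Dist_plus G N"
    unfolding counit_U_def using that
    by (subst L(2)) (simp_all add: cv br, simp_all add: Dist_plus_iff)
qed

lemma antipode_linear: "Dist_antipode G \<in> linear_maps (DM k) (DM k)"
  by (rule linear_mapsI) (auto simp: antipode_Dist, auto simp: antipode_eq intro!: restrict_ext)

lemma antipode_bracket:
  assumes x: "x \<in> Dist G i" and y: "y \<in> Dist G j"
  shows "Dist_antipode G (bracket x y) = bracket (Dist_antipode G y) (Dist_antipode G x)"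
proof (rule Dist_eqI)
  fix f assume f: "f \<in> A"
  have "Dist_antipode G (bracket x y) f = Dist_antipode G (x \<otimes>\<^bsub>D\<^esub> y) f - Dist_antipode G (y \<otimes>\<^bsub>D\<^esub> x) f"
    using f by (simp add: antipode_eq bracket_def)
  then show "Dist_antipode G (bracket x y) f = bracket (Dist_antipode G y) (Dist_antipode G x) f"
    using f by (simp add: antipode_conv[OF x y] antipode_conv[OF y x] bracket_def)
qed (simp_all add: antipode_eq bracket_def)

lemma antipode_U_hom: "antipode_U \<in> algebra_homs U (opposite_algebra U)"
  and antipode_U_cls: "x \<in> Dist_plus G N \<Longrightarrow> antipode_U (cls x) = cls (Dist_antipode G x)"
proof -
  have "Dist_antipode G \<in> linear_maps V V"
    using antipode_linear[of N] antipode_Dist_plus[of _ N] by (auto simp: linear_maps_def Dist_plus_iff)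
  from linear_map_comp[OF this cls_linear]
  have lin: "(\<lambda>x. cls (Dist_antipode G x)) \<in> linear_maps V (opposite_algebra U)"
    by (simp add: linear_maps_def)
  have 1: "cls (Dist_antipode G x) \<otimes>\<^bsub>opposite_algebra U\<^esub> cls (Dist_antipode G y) = cls (Dist_antipode G (x \<otimes>\<^bsub>D\<^esub> y))"
    if "x \<in> Dist_plus G i" "y \<in> Dist_plus G j" "i + j \<le> N" for x y i j
    using cls_mult[OF antipode_Dist_plus[OF that(2)] antipode_Dist_plus[OF that(1)]] that antipode_conv[of x i y j]
    by (simp add: Dist_plus_iff add.commute)
  have 2: "(cls (Dist_antipode G x) \<otimes>\<^bsub>opposite_algebra U\<^esub> cls (Dist_antipode G y)) \<ominus>\<^bsub>opposite_algebra U\<^esub>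
      (cls (Dist_antipode G y) \<otimes>\<^bsub>opposite_algebra U\<^esub> cls (Dist_antipode G x)) = cls (Dist_antipode G (bracket x y))"
    if "x \<in> Dist_plus G i" "y \<in> Dist_plus G j" "i \<le> N" "j \<le> N" "i + j \<le> Suc N" for x y i j
  proof -
    have c: "cls (Dist_antipode G x) \<in> carrier U" "cls (Dist_antipode G y) \<in> carrier U"
      using antipode_Dist_plus[OF that(1)] antipode_Dist_plus[OF that(2)] that(3,4)
      by (auto intro!: cls_closed elim: Dist_plus_mono)
    show ?thesis
      using cls_bracket[OF antipode_Dist_plus[OF that(2)] antipode_Dist_plus[OF that(1)] that(4,3)] that(5)
        antipode_bracket[of x i y j] that(1,2) c
      by (simp add: opposite_minus[OF U_alg] k_algebraD(7)[OF U_alg] add.commute Dist_plus_iff)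
  qed
  note L = U_lift[OF k_algebra_opposite[OF U_alg] lin]
  show "antipode_U \<in> algebra_homs U (opposite_algebra U)"
    unfolding antipode_U_def by (rule L(1)) (rule 1 2; assumption)+
  show "antipode_U (cls x) = cls (Dist_antipode G x)" if "x \<in> Dist_plus G N"
    unfolding antipode_U_def by (rule L(2)[OF _ _ that]) (rule 1 2; assumption)+
qed

lemma antipode_U_linear: "antipode_U \<in> linear_maps U U"
  using algebra_homsD(1)[OF antipode_U_hom] by (simp add: linear_maps_def)

lemma antipode_U_mult:
  "u \<in> carrier U \<Longrightarrow> v \<in> carrier U \<Longrightarrow> antipode_U (u \<otimes>\<^bsub>U\<^esub> v) = antipode_U v \<otimes>\<^bsub>U\<^esub> antipode_U u"
  "antipode_U \<one>\<^bsub>U\<^esub> = \<one>\<^bsub>U\<^esub>"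
  using algebra_homsD(2,3)[OF antipode_U_hom] by simp_all

text \<open>Every distribution is the sum of a multiple of the unit and a distribution that vanishes
  at the constants.\<close>

lemma linear_on_pi:
  assumes B: "vspace B" and F: "F \<in> linear_maps U B" and phi: "\<phi> \<in> linear_maps (DM N) B"
    and one: "F \<one>\<^bsub>U\<^esub> = \<phi> (\<lambda>f\<in>A. f \<one>\<^bsub>G\<^esub>)" and cls: "\<And>x. x \<in> Dist_plus G N \<Longrightarrow> F (cls x) = \<phi> x"
    and x: "x \<in> Dist G N"
  shows "F (\<pi> x) = \<phi> x"
proof -
  let ?c = "x (\<lambda>x\<in>X. 1)" and ?e = "\<lambda>f\<in>A. f \<one>\<^bsub>G\<^esub>"
  have px: "plus_part x \<in> Dist_plus G N" by (rule plus_part_Dist_plus[OF x])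
  have sx: "x = (?c \<odot>\<^bsub>DM N\<^esub> ?e) \<oplus>\<^bsub>DM N\<^esub> plus_part x"
    using Dist_ext[OF x] by (intro Dist_eqI) (auto simp: plus_part_def)
  have e: "?e \<in> carrier (DM N)" "plus_part x \<in> carrier (DM N)"
    using unit_Dist px by (simp_all add: Dist_plus_iff)
  have "F (\<pi> x) = ?c \<odot>\<^bsub>B\<^esub> \<phi> ?e \<oplus>\<^bsub>B\<^esub> \<phi> (plus_part x)"
    unfolding pi_eq[OF x]
    using linear_mapsD[OF F] cls_closed[OF px] k_algebraD(8)[OF U_alg] vspace_simps(1)[OF U_vspace]
    by (simp add: one cls[OF px])
  also have "\<dots> = \<phi> ((?c \<odot>\<^bsub>DM N\<^esub> ?e) \<oplus>\<^bsub>DM N\<^esub> plus_part x)"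
    using linear_mapsD(2,3)[OF phi] e vspace_simps(1)[OF DM_vspace e(1)] by metis
  finally show ?thesis using sx by simp
qed

lemma comult_U_pi: "x \<in> Dist G N \<Longrightarrow> comult_U (\<pi> x) = \<pi>\<pi> (Dist_comult G N x)"
proof (rule linear_on_pi[OF UU_vspace algebra_homsD(1)[OF comult_U_hom] delta_linear])
  show "comult_U \<one>\<^bsub>U\<^esub> = \<pi>\<pi> (Dist_comult G N (\<lambda>f\<in>A. f \<one>\<^bsub>G\<^esub>))"
    using unit_Dist[of N] by (simp add: algebra_homsD(3)[OF comult_U_hom] Dist_comult_unit pipi(2) pi_unit tensor_one[OF U_alg U_alg])
qed (auto simp: comult_U_cls)

lemma counit_U_pi: "x \<in> Dist G N \<Longrightarrow> counit_U (\<pi> x) = x (\<lambda>x\<in>X. 1)"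
  by (rule linear_on_pi[OF vspace_base_field algebra_homsD(1)[OF counit_U_hom] counit_linear])
    (auto simp: counit_U_cls algebra_homsD(3)[OF counit_U_hom] Dist_plus_iff)

lemma antipode_U_pi: "x \<in> Dist G N \<Longrightarrow> antipode_U (\<pi> x) = \<pi> (Dist_antipode G x)"
proof (rule linear_on_pi[OF U_vspace antipode_U_linear linear_map_comp[OF antipode_linear pi_linear]])
  have "Dist_antipode G (\<lambda>f\<in>A. f \<one>\<^bsub>G\<^esub>) = (\<lambda>f\<in>A. f \<one>\<^bsub>G\<^esub>)"
    by (auto simp: antipode_eq inversion_def A_inv intro!: restrict_ext)
  then show "antipode_U \<one>\<^bsub>U\<^esub> = \<pi> (Dist_antipode G (\<lambda>f\<in>A. f \<one>\<^bsub>G\<^esub>))" by (simp add: antipode_U_mult pi_unit)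
qed (auto simp: antipode_U_cls pi_cls antipode_Dist_plus)

subsection \<open>The axioms of a Hopf algebra\<close>

text \<open>Both sides are algebra homomorphisms. On classes, the identity is the image of the
  coassociativity for distributions, because the associativity isomorphism is natural.\<close>

lemma coassoc_U:
  assumes u: "u \<in> carrier U"
  shows "tensor_assoc U U U (tensor_map UU U comult_U id (comult_U u)) = tensor_map U UU id comult_U (comult_U u)"
proof (rule U_hom_eq[OF k_algebra_tensor[OF U_alg UU_alg] _ _ _ u])
  note h1 = tensor_map_algebra_hom[OF U_alg U_alg UU_alg U_alg comult_U_hom id_algebra_hom]
    and h2 = tensor_map_algebra_hom[OF U_alg U_alg U_alg UU_alg id_algebra_hom comult_U_hom]
  show "(\<lambda>u. tensor_assoc U U U (tensor_map UU U comult_U id (comult_U u))) \<in> algebra_homs U (U \<otimes>\<^sub>k UU)"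
    using algebra_hom_comp[OF algebra_hom_comp[OF comult_U_hom h1] tensor_assoc_algebra_hom[OF U_alg U_alg U_alg]] .
  show "(\<lambda>u. tensor_map U UU id comult_U (comult_U u)) \<in> algebra_homs U (U \<otimes>\<^sub>k UU)"
    using algebra_hom_comp[OF comult_U_hom h2] .
  fix x assume x: "x \<in> Dist_plus G N"
  then have xD: "x \<in> Dist G N" by (simp add: Dist_plus_iff)
  let ?d = "Dist_comult G N"
  have d: "?d x \<in> carrier DD" by (rule Dist_comult_spec[OF xD])
  note DN = DM_vspace[of N] and dl = Dist_comult_linear[of N]
  note cl = algebra_homsD(1)[OF comult_U_hom]
  note i = linear_map_id(2)
  note t1 = tensor_map_linear[OF DN DN DD_vspace DN dl i]
    and t2 = tensor_map_linear[OF DN DN DN DD_vspace i dl]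
  have "tensor_map UU U comult_U id (\<pi>\<pi> (?d x)) = tensor_map UU U (\<lambda>x. \<pi>\<pi> (?d x)) \<pi> (?d x)"
    by (rule tensor_map_compose[OF DN DN U_vspace U_vspace UU_vspace U_vspace pi_linear pi_linear cl i
          delta_linear pi_linear _ _ d]) (simp_all add: comult_U_pi)
  also have "\<dots> = tensor_map UU U \<pi>\<pi> \<pi> (tensor_map DD (DM N) ?d id (?d x))"
    by (rule tensor_map_compose[OF DN DN DD_vspace DN UU_vspace U_vspace dl i pipi(1) pi_linear
          delta_linear pi_linear _ _ d, symmetric]) simp_all
  finally have "tensor_assoc U U U (tensor_map UU U comult_U id (\<pi>\<pi> (?d x)))
      = tensor_map U UU \<pi> \<pi>\<pi> (tensor_assoc (DM N) (DM N) (DM N) (tensor_map DD (DM N) ?d id (?d x)))"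
    using tensor_assoc_natural[OF DN U_vspace pi_linear linear_mapsD(1)[OF t1(1) d]] by simp
  also have "tensor_assoc (DM N) (DM N) (DM N) (tensor_map DD (DM N) ?d id (?d x)) = tensor_map (DM N) DD id ?d (?d x)"
    by (rule Dist_comult_coassoc[OF xD])
  also have "tensor_map U UU \<pi> \<pi>\<pi> (tensor_map (DM N) DD id ?d (?d x)) = tensor_map U UU \<pi> (\<lambda>x. \<pi>\<pi> (?d x)) (?d x)"
    by (rule tensor_map_compose[OF DN DN DN DD_vspace U_vspace UU_vspace i dl pi_linear pipi(1)
          pi_linear delta_linear _ _ d]) simp_all
  also have "\<dots> = tensor_map U UU id comult_U (\<pi>\<pi> (?d x))"
    by (rule tensor_map_compose[OF DN DN U_vspace U_vspace U_vspace UU_vspace pi_linear pi_linear i cl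
          pi_linear delta_linear _ _ d, symmetric]) (simp_all add: comult_U_pi)
  finally show "tensor_assoc U U U (tensor_map UU U comult_U id (comult_U (cls x)))
      = tensor_map U UU id comult_U (comult_U (cls x))"
    unfolding comult_U_cls[OF x] .
qed

lemma counit_bilinear:
  "bilinear U U U (\<lambda>a b. counit_U a \<odot>\<^bsub>U\<^esub> b)" "bilinear U U U (\<lambda>a b. counit_U b \<odot>\<^bsub>U\<^esub> a)"
proof -
  note cl = algebra_homsD(1)[OF counit_U_hom]
  show 1: "bilinear U U U (\<lambda>a b. counit_U a \<odot>\<^bsub>U\<^esub> b)"
    using bilinear_compose[OF smult_bilinear[OF U_vspace] cl linear_map_id(1) linear_map_id(1)] .
  show "bilinear U U U (\<lambda>a b. counit_U b \<odot>\<^bsub>U\<^esub> a)"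
    by (rule bilinearI) (use bilinear_linear[OF 1] in auto)
qed

text \<open>Both sides are algebra homomorphisms. On a class, contraction with the counit amounts to
  inserting the constant function 1 into one argument of the comultiplication of a
  distribution.\<close>

lemma counit_axioms:
  assumes u: "u \<in> carrier U"
  shows "tensor_lift U (\<lambda>a b. counit_U a \<odot>\<^bsub>U\<^esub> b) (comult_U u) = u"
    and "tensor_lift U (\<lambda>a b. counit_U b \<odot>\<^bsub>U\<^esub> a) (comult_U u) = u"
proof -
  note e = algebra_homsD[OF counit_U_hom] and el = linear_mapsD[OF algebra_homsD(1)[OF counit_U_hom]]
  note tl1 = tensor_lift_linear[OF U_vspace U_vspace U_vspace counit_bilinear(1)]
    and tp1 = tensor_lift_pure[OF U_vspace U_vspace U_vspace counit_bilinear(1)]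
    and tl2 = tensor_lift_linear[OF U_vspace U_vspace U_vspace counit_bilinear(2)]
    and tp2 = tensor_lift_pure[OF U_vspace U_vspace U_vspace counit_bilinear(2)]
  note simps = k_algebraD[OF U_alg] vspace_simps(1,4,5)[OF U_vspace] e
  have h1: "tensor_lift U (\<lambda>a b. counit_U a \<odot>\<^bsub>U\<^esub> b) \<in> algebra_homs UU U"
    by (rule tensor_algebra_homI[OF U_alg U_alg U_alg tl1]) (simp_all add: tp1 simps smult_swap)
  have h2: "tensor_lift U (\<lambda>a b. counit_U b \<odot>\<^bsub>U\<^esub> a) \<in> algebra_homs UU U"
    by (rule tensor_algebra_homI[OF U_alg U_alg U_alg tl2]) (simp_all add: tp2 simps smult_swap)
  note DN = DM_vspace[of N]
  let ?d = "Dist_comult G N" and ?o = "\<lambda>x\<in>X. 1 :: 'k"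
  have oA: "?o \<in> A" by simp
  have b1: "bilinear (DM N) (DM N) (DM N) (\<lambda>a b. a ?o \<odot>\<^bsub>DM N\<^esub> b)"
    using bilinear_compose[OF smult_bilinear[OF DN] counit_linear linear_map_id(1) linear_map_id(1)] .
  have b2: "bilinear (DM N) (DM N) (DM N) (\<lambda>a b. b ?o \<odot>\<^bsub>DM N\<^esub> a)"
    by (rule bilinearI) (use bilinear_linear[OF b1] in auto)
  note dl1 = tensor_lift_linear[OF DN DN DN b1] and dp1 = tensor_lift_pure[OF DN DN DN b1]
    and dl2 = tensor_lift_linear[OF DN DN DN b2] and dp2 = tensor_lift_pure[OF DN DN DN b2]
  have "tensor_lift U (\<lambda>a b. counit_U a \<odot>\<^bsub>U\<^esub> b) (comult_U (cls x)) = cls x \<and>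
      tensor_lift U (\<lambda>a b. counit_U b \<odot>\<^bsub>U\<^esub> a) (comult_U (cls x)) = cls x" if x: "x \<in> Dist_plus G N" for x
  proof -
    have xD: "x \<in> Dist G N" using x by (simp add: Dist_plus_iff)
    have d: "?d x \<in> carrier DD" by (rule Dist_comult_spec[OF xD])
    have v1: "tensor_lift (DM N) (\<lambda>a b. a ?o \<odot>\<^bsub>DM N\<^esub> b) (?d x) = x"
    proof (rule Dist_eqI[OF _ Dist_ext[OF xD]])
      show "tensor_lift (DM N) (\<lambda>a b. a ?o \<odot>\<^bsub>DM N\<^esub> b) (?d x) \<in> extensional A"
        using linear_mapsD(1)[OF dl1 d] Dist_ext by auto
      fix g assume g: "g \<in> A"
      have "tensor_lift (DM N) (\<lambda>a b. a ?o \<odot>\<^bsub>DM N\<^esub> b) (?d x) g = tensor_value (?d x) ?o g"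
        by (rule tensor_ext[OF DN DN vspace_base_field linear_map_comp[OF dl1 DM_evaluation[OF g]] tensor_value_linear[OF oA g] _ d])
          (use g in \<open>subst dp1, simp, simp, simp add: tensor_value_pure\<close>)
      then show "tensor_lift (DM N) (\<lambda>a b. a ?o \<odot>\<^bsub>DM N\<^esub> b) (?d x) g = x g"
        using g by (simp add: Dist_comult_spec[OF xD] A_restrict cong: restrict_cong)
    qed
    have v2: "tensor_lift (DM N) (\<lambda>a b. b ?o \<odot>\<^bsub>DM N\<^esub> a) (?d x) = x"
    proof (rule Dist_eqI[OF _ Dist_ext[OF xD]])
      show "tensor_lift (DM N) (\<lambda>a b. b ?o \<odot>\<^bsub>DM N\<^esub> a) (?d x) \<in> extensional A"
        using linear_mapsD(1)[OF dl2 d] Dist_ext by auto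
      fix g assume g: "g \<in> A"
      have "tensor_lift (DM N) (\<lambda>a b. b ?o \<odot>\<^bsub>DM N\<^esub> a) (?d x) g = tensor_value (?d x) g ?o"
        by (rule tensor_ext[OF DN DN vspace_base_field linear_map_comp[OF dl2 DM_evaluation[OF g]] tensor_value_linear[OF g oA] _ d])
          (use g in \<open>subst dp2, simp, simp, simp add: tensor_value_pure mult.commute\<close>)
      then show "tensor_lift (DM N) (\<lambda>a b. b ?o \<odot>\<^bsub>DM N\<^esub> a) (?d x) g = x g"
        using g by (simp add: Dist_comult_spec[OF xD] A_restrict cong: restrict_cong)
    qed
    have "tensor_lift U (\<lambda>a b. counit_U a \<odot>\<^bsub>U\<^esub> b) (\<pi>\<pi> (?d x)) = \<pi> (tensor_lift (DM N) (\<lambda>a b. a ?o \<odot>\<^bsub>DM N\<^esub> b) (?d x))"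
      by (rule tensor_ext[OF DN DN U_vspace linear_map_comp[OF pipi(1) tl1] linear_map_comp[OF dl1 pi_linear] _ d])
        (simp add: pipi(2) tp1 pi_closed counit_U_pi dp1 linear_mapsD(3)[OF pi_linear] del: Dist_module_simps(2-4))
    moreover have "tensor_lift U (\<lambda>a b. counit_U b \<odot>\<^bsub>U\<^esub> a) (\<pi>\<pi> (?d x)) = \<pi> (tensor_lift (DM N) (\<lambda>a b. b ?o \<odot>\<^bsub>DM N\<^esub> a) (?d x))"
      by (rule tensor_ext[OF DN DN U_vspace linear_map_comp[OF pipi(1) tl2] linear_map_comp[OF dl2 pi_linear] _ d])
        (simp add: pipi(2) tp2 pi_closed counit_U_pi dp2 linear_mapsD(3)[OF pi_linear] del: Dist_module_simps(2-4))
    ultimately show ?thesis using pi_cls[OF x] by (simp only: comult_U_cls[OF x] v1 v2 simp_thms)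
  qed
  then show "tensor_lift U (\<lambda>a b. counit_U a \<odot>\<^bsub>U\<^esub> b) (comult_U u) = u"
    "tensor_lift U (\<lambda>a b. counit_U b \<odot>\<^bsub>U\<^esub> a) (comult_U u) = u"
    using U_hom_eq[OF U_alg algebra_hom_comp[OF comult_U_hom h1] id_algebra_hom _ u]
      U_hom_eq[OF U_alg algebra_hom_comp[OF comult_U_hom h2] id_algebra_hom _ u] by simp_all
qed

abbreviation "antipode_left \<equiv> tensor_lift U (\<lambda>a b. antipode_U a \<otimes>\<^bsub>U\<^esub> b)"
abbreviation "antipode_right \<equiv> tensor_lift U (\<lambda>a b. a \<otimes>\<^bsub>U\<^esub> antipode_U b)"

lemma antipode_bilinear:
  "bilinear U U U (\<lambda>a b. antipode_U a \<otimes>\<^bsub>U\<^esub> b)" "bilinear U U U (\<lambda>a b. a \<otimes>\<^bsub>U\<^esub> antipode_U b)"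
  using bilinear_compose[OF algebra_mult_bilinear[OF U_alg] antipode_U_linear linear_map_id(1) linear_map_id(1)]
    bilinear_compose[OF algebra_mult_bilinear[OF U_alg] linear_map_id(1) antipode_U_linear linear_map_id(1)] .

lemmas antipode_lift_linear = antipode_bilinear[THEN tensor_lift_linear[OF U_vspace U_vspace U_vspace]]
lemmas antipode_lift_pure = antipode_bilinear[THEN tensor_lift_pure[OF U_vspace U_vspace U_vspace]]

lemmas UU_mult_linear = bilinear_linear[OF algebra_mult_bilinear[OF UU_alg]]
lemmas U_mult_linear = bilinear_linear[OF algebra_mult_bilinear[OF U_alg]]

text \<open>The antipode reverses products, so that a scalar value of a convolution can be pulled out
  of a product: \<open>S(a c) b d = S c (S a b) d\<close> and
  \<open>a c S(b d) = a (c S d) S b\<close>.\<close>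

lemma antipode_left_mult:
  assumes Z: "Z \<in> carrier UU" and W: "W \<in> carrier UU" and c: "antipode_left Z = c \<odot>\<^bsub>U\<^esub> \<one>\<^bsub>U\<^esub>"
  shows "antipode_left (Z \<otimes>\<^bsub>UU\<^esub> W) = c \<odot>\<^bsub>U\<^esub> antipode_left W"
proof -
  note S = linear_mapsD(1)[OF antipode_U_linear] and u = k_algebraD[OF U_alg]
  have "antipode_left (Z \<otimes>\<^bsub>UU\<^esub> pure U U a b) = c \<odot>\<^bsub>U\<^esub> antipode_left (pure U U a b)"
    if a: "a \<in> carrier U" and b: "b \<in> carrier U" for a b
  proof -
    have l: "(\<lambda>Z. (antipode_U a \<otimes>\<^bsub>U\<^esub> antipode_left Z) \<otimes>\<^bsub>U\<^esub> b) \<in> linear_maps UU U"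
      using linear_map_comp[OF linear_map_comp[OF antipode_lift_linear(1) U_mult_linear(2)[OF S[OF a]]] U_mult_linear(1)[OF b]] .
    have "antipode_left (Z \<otimes>\<^bsub>UU\<^esub> pure U U a b) = (antipode_U a \<otimes>\<^bsub>U\<^esub> antipode_left Z) \<otimes>\<^bsub>U\<^esub> b"
      by (rule tensor_ext[OF U_vspace U_vspace U_vspace
            linear_map_comp[OF UU_mult_linear(1)[OF pure_U[OF a b]] antipode_lift_linear(1)] l _ Z])
        (simp add: a b tensor_mult_pure[OF U_alg U_alg] antipode_lift_pure(1) u S antipode_U_mult)
    then show ?thesis using a b by (simp add: c antipode_lift_pure(1) u S vspace_simps(1)[OF U_vspace])
  qed
  then show ?thesis
    by (rule tensor_ext[OF U_vspace U_vspace U_vspace linear_map_comp[OF UU_mult_linear(2)[OF Z] antipode_lift_linear(1)]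
          linear_map_smult[OF U_vspace antipode_lift_linear(1)] _ W])
qed

lemma antipode_right_mult:
  assumes Z: "Z \<in> carrier UU" and W: "W \<in> carrier UU" and c: "antipode_right W = c \<odot>\<^bsub>U\<^esub> \<one>\<^bsub>U\<^esub>"
  shows "antipode_right (Z \<otimes>\<^bsub>UU\<^esub> W) = c \<odot>\<^bsub>U\<^esub> antipode_right Z"
proof -
  note S = linear_mapsD(1)[OF antipode_U_linear] and u = k_algebraD[OF U_alg]
  have "antipode_right (pure U U a b \<otimes>\<^bsub>UU\<^esub> W) = c \<odot>\<^bsub>U\<^esub> antipode_right (pure U U a b)"
    if a: "a \<in> carrier U" and b: "b \<in> carrier U" for a b
  proof -
    have l: "(\<lambda>W. (a \<otimes>\<^bsub>U\<^esub> antipode_right W) \<otimes>\<^bsub>U\<^esub> antipode_U b) \<in> linear_maps UU U"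
      using linear_map_comp[OF linear_map_comp[OF antipode_lift_linear(2) U_mult_linear(2)[OF a]] U_mult_linear(1)[OF S[OF b]]] .
    have "antipode_right (pure U U a b \<otimes>\<^bsub>UU\<^esub> W) = (a \<otimes>\<^bsub>U\<^esub> antipode_right W) \<otimes>\<^bsub>U\<^esub> antipode_U b"
      by (rule tensor_ext[OF U_vspace U_vspace U_vspace
            linear_map_comp[OF UU_mult_linear(2)[OF pure_U[OF a b]] antipode_lift_linear(2)] l _ W])
        (simp add: a b tensor_mult_pure[OF U_alg U_alg] antipode_lift_pure(2) u S antipode_U_mult)
    then show ?thesis using a b by (simp add: c antipode_lift_pure(2) u S vspace_simps(1)[OF U_vspace])
  qed
  then show ?thesis
    by (rule tensor_ext[OF U_vspace U_vspace U_vspace linear_map_comp[OF UU_mult_linear(1)[OF W] antipode_lift_linear(2)]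
          linear_map_smult[OF U_vspace antipode_lift_linear(2)] _ Z])
qed

text \<open>Transfers the antipode axioms from distributions: the products in a convolution of the
  antipode stay within order \<open>N\<close> for each component of a comultiplication.\<close>

lemma linear_on_tensor_sum:
  assumes B: "B \<in> linear_maps UU U"
    and L: "\<And>x y. (x, y) \<in> set L \<Longrightarrow> x \<in> Dist G N \<and> y \<in> Dist G N \<and> \<beta> x y \<in> Dist G N \<and> B (pure U U (\<pi> x) (\<pi> y)) = \<pi> (\<beta> x y)"
  shows "(\<lambda>f\<in>A. \<Sum>(x, y)\<leftarrow>L. \<beta> x y f) \<in> Dist G N \<and>
    B (\<pi>\<pi> (tensor_sum (DM N) (DM N) L)) = \<pi> (\<lambda>f\<in>A. \<Sum>(x, y)\<leftarrow>L. \<beta> x y f)"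
  using L
proof (induction L)
  case Nil
  have "\<zero>\<^bsub>DM N\<^esub> = (\<lambda>f\<in>A. 0)" by simp
  then have "\<pi> (\<lambda>f\<in>A. 0) = \<zero>\<^bsub>U\<^esub>" using linear_map_zero[OF pi_linear DM_vspace U_vspace] by metis
  then show ?case
    using linear_map_zero[OF pipi(1) DD_vspace UU_vspace] linear_map_zero[OF B UU_vspace U_vspace] Dist_closed(1) by simp
next
  case (Cons l L)
  obtain x y where l: "l = (x, y)" by (cases l)
  let ?s = "\<lambda>f\<in>A. \<Sum>(x, y)\<leftarrow>L. \<beta> x y f"
  have IH: "?s \<in> Dist G N" "B (\<pi>\<pi> (tensor_sum (DM N) (DM N) L)) = \<pi> ?s"
    using Cons.IH[OF Cons.prems] by auto
  have xy: "x \<in> Dist G N" "y \<in> Dist G N" "\<beta> x y \<in> Dist G N" "B (pure U U (\<pi> x) (\<pi> y)) = \<pi> (\<beta> x y)"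
    using Cons.prems[of x y] by (auto simp: l)
  have ts: "tensor_sum (DM N) (DM N) L \<in> carrier DD"
    using Cons.prems by (intro tensor_sum_closed[OF DM_vspace DM_vspace]) auto
  have p: "pure (DM N) (DM N) x y \<in> carrier DD" using pure_simps(1)[OF DM_vspace DM_vspace] xy by simp
  have s: "(\<lambda>f\<in>A. \<Sum>(x, y)\<leftarrow>l # L. \<beta> x y f) = \<beta> x y \<oplus>\<^bsub>DM N\<^esub> ?s"
    by (simp add: l fun_eq_iff restrict_def)
  have "B (\<pi>\<pi> (tensor_sum (DM N) (DM N) (l # L))) = \<pi> (\<beta> x y) \<oplus>\<^bsub>U\<^esub> \<pi> ?s"
    using linear_mapsD(2)[OF pipi(1) p ts] linear_mapsD(1)[OF pipi(1) ts] linear_mapsD(2)[OF B] pipi(2)[of x y]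
      pure_U[OF pi_closed[OF xy(1)] pi_closed[OF xy(2)]] xy IH by (simp add: l)
  also have "\<dots> = \<pi> (\<beta> x y \<oplus>\<^bsub>DM N\<^esub> ?s)"
    using linear_mapsD(2)[OF pi_linear, of "\<beta> x y" ?s] xy IH(1) by simp
  finally show ?case unfolding s using Dist_closed(2)[OF xy(3) IH(1)] by simp
qed

lemma antipode_axioms_cls:
  assumes x: "x \<in> Dist_plus G N"
  shows "antipode_left (comult_U (cls x)) = \<zero>\<^bsub>U\<^esub>" "antipode_right (comult_U (cls x)) = \<zero>\<^bsub>U\<^esub>"
proof -
  have xD: "x \<in> Dist G N" and x1: "x (\<lambda>x\<in>X. 1) = 0" using x by (simp_all add: Dist_plus_iff)
  obtain L where L: "comult_rep N x L" using comult_rep_exists[OF xD] .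
  let ?S = "Dist_antipode G"
  have "\<zero>\<^bsub>DM N\<^esub> = (\<lambda>f\<in>A. 0)" by simp
  then have z: "\<pi> (\<lambda>f\<in>A. 0) = \<zero>\<^bsub>U\<^esub>" using linear_map_zero[OF pi_linear DM_vspace U_vspace] by metis
  have l: "a \<in> Dist G N \<and> b \<in> Dist G N \<and> ?S a \<otimes>\<^bsub>D\<^esub> b \<in> Dist G N \<and>
      antipode_left (pure U U (\<pi> a) (\<pi> b)) = \<pi> (?S a \<otimes>\<^bsub>D\<^esub> b) \<and> a \<otimes>\<^bsub>D\<^esub> ?S b \<in> Dist G N \<and>
      antipode_right (pure U U (\<pi> a) (\<pi> b)) = \<pi> (a \<otimes>\<^bsub>D\<^esub> ?S b)" if ab: "(a, b) \<in> set L" for a b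
  proof -
    obtain i j where ij: "i + j \<le> N" "a \<in> Dist G i" "b \<in> Dist G j" using comult_repD(1)[OF L ab] by auto
    have ab': "a \<in> Dist G N" "b \<in> Dist G N" using comult_rep_mem[OF L ab] by auto
    show ?thesis
      using ab' ij conv_Dist[OF antipode_Dist[OF ij(2)] ij(3), THEN Dist_mono'[OF _ ij(1)]]
        conv_Dist[OF ij(2) antipode_Dist[OF ij(3)], THEN Dist_mono'[OF _ ij(1)]]
        pi_mult[OF antipode_Dist[OF ij(2)] ij(3,1)] pi_mult[OF ij(2) antipode_Dist[OF ij(3)] ij(1)]
      by (simp add: antipode_lift_pure pi_closed antipode_U_pi del: Dist_algebra_simps)
  qed
  note s = comult_U_cls[OF x] Dist_comult_rep(1)[OF L le_refl]
  have "(\<lambda>f\<in>A. \<Sum>(a, b)\<leftarrow>L. (?S a \<otimes>\<^bsub>D\<^esub> b) f) = (\<lambda>f\<in>A. 0)"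
    using antipode_convolution(1)[OF xD L] x1 by (intro restrict_ext) simp
  then show "antipode_left (comult_U (cls x)) = \<zero>\<^bsub>U\<^esub>"
    using linear_on_tensor_sum[OF antipode_lift_linear(1), of L "\<lambda>a b. ?S a \<otimes>\<^bsub>D\<^esub> b"] l unfolding s by (metis z)
  have "(\<lambda>f\<in>A. \<Sum>(a, b)\<leftarrow>L. (a \<otimes>\<^bsub>D\<^esub> ?S b) f) = (\<lambda>f\<in>A. 0)"
    using antipode_convolution(2)[OF xD L] x1 by (intro restrict_ext) simp
  then show "antipode_right (comult_U (cls x)) = \<zero>\<^bsub>U\<^esub>"
    using linear_on_tensor_sum[OF antipode_lift_linear(2), of L "\<lambda>a b. a \<otimes>\<^bsub>D\<^esub> ?S b"] l unfolding s by (metis z)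
qed

text \<open>The convolutions are not multiplicative, so that a comparison on generators does not
  suffice; but the scalar values that the axioms assert propagate along products with a
  class.\<close>

lemma antipode_axioms:
  assumes "u \<in> carrier U"
  shows "antipode_left (comult_U u) = counit_U u \<odot>\<^bsub>U\<^esub> \<one>\<^bsub>U\<^esub> \<and>
    antipode_right (comult_U u) = counit_U u \<odot>\<^bsub>U\<^esub> \<one>\<^bsub>U\<^esub>"
proof -
  note u = k_algebraD[OF U_alg] and v = vspace_simps[OF U_vspace]
    and e = algebra_homsD[OF counit_U_hom] and el = linear_mapsD[OF algebra_homsD(1)[OF counit_U_hom]]
    and d = algebra_homsD[OF comult_U_hom] and dl = linear_mapsD[OF algebra_homsD(1)[OF comult_U_hom]]
    and al = linear_mapsD[OF antipode_lift_linear(1)] and ar = linear_mapsD[OF antipode_lift_linear(2)]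
  show ?thesis using assms
  proof (induction rule: U_induct)
    case one
    show ?case by (simp add: d(3) e(3) tensor_one[OF U_alg U_alg] antipode_lift_pure u(8,9) antipode_U_mult v)
  next
    case (cls x z)
    have c: "cls x \<in> carrier U" by (rule cls_closed[OF cls(1)])
    have z0: "0 \<odot>\<^bsub>U\<^esub> y = \<zero>\<^bsub>U\<^esub>" if "y \<in> carrier U" for y using v(6) that by simp
    have zs: "a \<odot>\<^bsub>U\<^esub> \<zero>\<^bsub>U\<^esub> = \<zero>\<^bsub>U\<^esub>" for a using v(7) by simp
    note a0 = antipode_axioms_cls[OF cls(1)]
    have 1: "antipode_left (comult_U (cls x) \<otimes>\<^bsub>UU\<^esub> comult_U z) = 0 \<odot>\<^bsub>U\<^esub> antipode_left (comult_U z)"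
      by (rule antipode_left_mult) (simp_all add: dl c cls(2) a0 z0 u)
    have 2: "antipode_right (comult_U (cls x) \<otimes>\<^bsub>UU\<^esub> comult_U z) = counit_U z \<odot>\<^bsub>U\<^esub> antipode_right (comult_U (cls x))"
      by (rule antipode_right_mult) (simp_all add: dl c cls)
    show ?case using 1 2 cls(2) c
      by (simp add: d(2) e(2) counit_U_cls[OF cls(1)] a0 zs z0 u al dl)
  next
    case (smult c z)
    then show ?case by (simp add: dl al ar el v(4) u)
  next
    case (add y z)
    then show ?case by (simp add: dl al ar el v(2) u)
  qed
qed

end

subsection \<open>The Hopf algebra record\<close>

text \<open>Tensor products and their maps depend only on the module fields of a record. Identities
  for the algebra therefore carry over to the Hopf algebra, whose record extends that of the
  algebra.\<close>

lemma truncate_simps [simp]: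
  "carrier (module.truncate M) = carrier M" "monoid.mult (module.truncate M) = monoid.mult M"
  "\<one>\<^bsub>module.truncate M\<^esub> = \<one>\<^bsub>M\<^esub>" "\<zero>\<^bsub>module.truncate M\<^esub> = \<zero>\<^bsub>M\<^esub>"
  "ring.add (module.truncate M) = ring.add M" "module.smult (module.truncate M) = module.smult M"
  by (simp_all add: module.truncate_def)

lemma k_algebra_truncate:
  assumes "k_algebra (module.truncate M)"
  shows "k_algebra M"
proof (intro k_algebraI)
  note a = k_algebraD[OF assms, simplified]
  interpret A: module base_field "module.truncate M" using k_algebraD(2)[OF assms] .
  interpret O: abelian_group M
  proof (intro abelian_groupI)
    fix x assume "x \<in> carrier M"
    then show "\<exists>y\<in>carrier M. y \<oplus>\<^bsub>M\<^esub> x = \<zero>\<^bsub>M\<^esub>"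
      using A.l_neg[of x] A.a_inv_closed[of x] by (intro bexI[of _ "\<ominus>\<^bsub>module.truncate M\<^esub> x"]) simp_all
  qed (use A.a_ac A.a_closed A.zero_closed A.l_zero in auto)
  show "vspace M"
    using A.smult_l_distr A.smult_r_distr A.smult_assoc1 A.smult_one A.smult_closed
    by (intro moduleI A.is_cring O.abelian_group_axioms) simp_all
  show "Group.monoid M" by (intro monoidI) (simp_all add: a)
qed (simp_all add: k_algebraD[OF assms, simplified])

lemma DirProd_truncate: "module.truncate M \<times>\<times> module.truncate N = M \<times>\<times> N"
  by (simp add: DirProd_def)

lemma bilinear_submodule_truncate:
  "bilinear_submodule R (module.truncate M) (module.truncate N) = bilinear_submodule R M N"
  by (simp add: bilinear_submodule_def bilinear_relators_def DirProd_truncate)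

lemma tensor_product_truncate:
  "tensor_product R (module.truncate M) (module.truncate N) = tensor_product R M N"
  by (simp add: tensor_product_def bilinear_submodule_truncate DirProd_truncate)

lemma pure_truncate: "pure_tensor R (module.truncate M) (module.truncate N) = pure_tensor R M N"
  by (simp add: fun_eq_iff pure_tensor_def bilinear_submodule_truncate DirProd_truncate)

lemma tensor_lift_truncate: "tensor_lift (module.truncate L) b = tensor_lift L b"
  by (simp add: tensor_lift_def linear_extension_def[abs_def] finsum_def finprod_def)

lemma truncate_module [simp]: "module.truncate (M :: ('k, 'a) module) = M"
  by (simp add: module.truncate_def)

context higher_enveloping
begin

abbreviation "H \<equiv> U_hopf p G m"

lemma U_hopf_simps:
  "module.truncate H = U" "comult H = comult_U" "counit H = counit_U" "antipode H = antipode_U"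
  by (simp_all add: U_hopf_def Let_def module.defs hopf.defs comult_U_def counit_U_def antipode_U_def)

lemma U_hopf_fields:
  "carrier H = carrier U" "monoid.mult H = monoid.mult U" "\<one>\<^bsub>H\<^esub> = \<one>\<^bsub>U\<^esub>" "\<zero>\<^bsub>H\<^esub> = \<zero>\<^bsub>U\<^esub>"
  "ring.add H = ring.add U" "module.smult H = module.smult U"
  using truncate_simps[of H] unfolding U_hopf_simps by auto

lemma U_hopf_tensor:
  "tensor_product base_field H H = UU" "tensor_product base_field UU H = UU \<otimes>\<^sub>k U" "tensor_product base_field H UU = U \<otimes>\<^sub>k UU"
  "pure H H = pure U U" "pure UU H = pure UU U" "pure H UU = pure U UU" "tensor_lift H b = tensor_lift U b"
  using tensor_product_truncate[of base_field H H] tensor_product_truncate[of base_field UU H]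
    tensor_product_truncate[of base_field H UU] pure_truncate[of base_field H H] pure_truncate[of base_field UU H]
    pure_truncate[of base_field H UU] tensor_lift_truncate[of H b]
  unfolding U_hopf_simps truncate_module by simp_all

lemma U_hopf_maps:
  "tensor_map UU H f g = tensor_map UU U f g" "tensor_map H UU f' g' = tensor_map U UU f' g'"
  "tensor_map H H f'' g'' = tensor_map U U f'' g''" "tensor_assoc H H H = tensor_assoc U U U"
  by (simp_all add: tensor_map_def tensor_assoc_def U_hopf_tensor)

theorem U_hopf_algebra: "hopf_algebra H"
proof -
  have lm: "linear_maps H B = linear_maps U B" "linear_maps B H = linear_maps B U" for B :: "('k, 'b) module"
    unfolding linear_maps_def by (simp_all add: U_hopf_fields)
  have lm2: "linear_maps H H = linear_maps U U"
    unfolding linear_maps_def by (simp_all add: U_hopf_fields)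
  have ah: "algebra_homs H B = algebra_homs U B" for B :: "('k, 'b) module"
    unfolding algebra_homs_def ring_hom_def by (simp add: U_hopf_fields lm)
  show ?thesis
    unfolding hopf_algebra_def
    using k_algebra_truncate[of H] U_alg coassoc_U counit_axioms antipode_axioms comult_U_hom counit_U_hom antipode_U_linear
    by (simp add: U_hopf_simps U_hopf_tensor U_hopf_maps U_hopf_fields lm2 ah)
qed

end

section \<open>Forms over the prime field and the Frobenius comorphism\<close>

lemma add_power_CHAR_power:
  fixes x y :: "'k::field"
  assumes "CHAR('k) > 0"
  shows "(x + y) ^ (CHAR('k) ^ s) = x ^ (CHAR('k) ^ s) + y ^ (CHAR('k) ^ s)"
  using freshmans_dream'[OF prime_CHAR_semidom[OF assms] refl] .

text \<open>The power map is additive and fixes \<open>1\<close> and \<open>-1\<close>.\<close>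

lemma prime_field_power_CHAR_power:
  fixes c :: "'k::field"
  assumes p: "CHAR('k) > 0" and c: "c \<in> carrier prime_field"
  shows "c ^ (CHAR('k) ^ s) = c"
proof -
  let ?q = "CHAR('k) ^ s"
  have q: "?q > 0" using p by simp
  have neg: "(- 1 :: 'k) ^ ?q = - 1"
    using add_power_CHAR_power[OF p, of 1 "-1" s] zero_power[OF q, where 'a = 'k]
    by (simp add: eq_neg_iff_add_eq_0 add.commute)
  have "(of_int n :: 'k) ^ ?q = of_int n" for n
  proof (induction n rule: int_induct[of _ 0])
    case (step2 i)
    have "(of_int (i - 1) :: 'k) = of_int i + (- 1)" by simp
    then show ?case using step2 by (simp only: add_power_CHAR_power[OF p] neg)
  qed (use q in \<open>simp_all add: add_power_CHAR_power[OF p]\<close>)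
  then show ?thesis using c by (auto simp: prime_field_def)
qed

locale frobenius_form = affine_group G for G :: "('g, 'k::field) alg_group" +
  fixes FpG :: "('g \<Rightarrow> 'k) set" and p s :: nat
  assumes form: "prime_field_form G FpG" and char: "CHAR('k) = p" and p_pos: "p > 0"
begin

abbreviation "q \<equiv> p ^ s"
abbreviation "\<phi> \<equiv> frobenius_comorphism p G FpG s"
abbreviation "FR \<equiv> form_ring G FpG"
abbreviation "Fp \<equiv> prime_field :: ('k, 'k) module"

lemma q_pos: "q > 0" using p_pos by simp

lemma frobenius_add: "(x + y :: 'k) ^ q = x ^ q + y ^ q"
  using add_power_CHAR_power[of x y s] char p_pos by simp

lemma frobenius_fix: "c \<in> carrier Fp \<Longrightarrow> c ^ q = c"
  using prime_field_power_CHAR_power[of c s] char p_pos by simp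

lemma frobenius_sum_list: "(\<Sum>l\<leftarrow>L. f l :: 'k) ^ q = (\<Sum>l\<leftarrow>L. f l ^ q)"
  using q_pos by (induction L) (simp_all add: frobenius_add)

lemma form_ring_simps [simp]:
  "carrier FR = FpG" "f \<oplus>\<^bsub>FR\<^esub> g = (\<lambda>x\<in>X. f x + g x)" "c \<odot>\<^bsub>FR\<^esub> f = (\<lambda>x\<in>X. c * f x)"
  by (simp_all add: form_ring_def function_algebra_def)

lemma form_A: "f \<in> FpG \<Longrightarrow> f \<in> A"
  and form_bij: "bij_betw (base_change_map G) (carrier (tensor_product Fp FR base_field)) A"
  and form_one: "f \<in> FpG \<Longrightarrow> f \<one>\<^bsub>G\<^esub> \<in> carrier Fp"
  and form_inversion: "f \<in> FpG \<Longrightarrow> inversion f \<in> FpG"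
  using form by (auto simp: prime_field_form_def inversion_def)

lemma form_comult:
  assumes "f \<in> FpG"
  obtains Z where "Z \<in> carrier (tensor_product Fp FR FR)"
    "\<And>x y. x \<in> X \<Longrightarrow> y \<in> X \<Longrightarrow> tensor_value Z x y = f (x \<otimes>\<^bsub>G\<^esub> y)"
  using form assms unfolding prime_field_form_def by blast

lemma form_closed:
  "(\<lambda>x\<in>X. 1) \<in> FpG" "f \<in> FpG \<Longrightarrow> g \<in> FpG \<Longrightarrow> (\<lambda>x\<in>X. f x + g x) \<in> FpG"
  "f \<in> FpG \<Longrightarrow> g \<in> FpG \<Longrightarrow> (\<lambda>x\<in>X. f x * g x) \<in> FpG"
  "c \<in> carrier Fp \<Longrightarrow> f \<in> FpG \<Longrightarrow> (\<lambda>x\<in>X. c * f x) \<in> FpG"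
proof -
  have s: "subring FpG C" using form by (simp add: prime_field_form_def)
  show 1: "(\<lambda>x\<in>X. 1) \<in> FpG" using subringE(3)[OF s] by simp
  show add: "(\<lambda>x\<in>X. f x + g x) \<in> FpG" if "f \<in> FpG" "g \<in> FpG" for f g
    using subringE(7)[OF s that] by simp
  show mult: "(\<lambda>x\<in>X. f x * g x) \<in> FpG" if "f \<in> FpG" "g \<in> FpG" for f g
    using subringE(6)[OF s that] by simp
  have zero: "(\<lambda>x\<in>X. 0) \<in> FpG" using subringE(2)[OF s] by simp
  have neg: "(\<lambda>x\<in>X. - f x) \<in> FpG" if "f \<in> FpG" for f
  proof -
    have "\<ominus>\<^bsub>C\<^esub> f = (\<lambda>x\<in>X. - f x)"
      using vspace_minus[OF C_vspace, of f] form_A[OF that] by simp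
    then show ?thesis using subringE(5)[OF s that] by simp
  qed
  show "(\<lambda>x\<in>X. c * f x) \<in> FpG" if c: "c \<in> carrier Fp" and f: "f \<in> FpG" for c f
  proof -
    have n: "(\<lambda>x\<in>X. of_nat n * f x) \<in> FpG" for n
    proof (induction n)
      case (Suc n)
      show ?case using add[OF f Suc] by (simp add: algebra_simps cong: restrict_cong)
    qed (simp add: zero)
    obtain i :: int where i: "c = of_int i" using c by (auto simp: prime_field_def)
    show ?thesis
    proof (cases "i \<ge> 0")
      case True
      then show ?thesis using n[of "nat i"] by (simp add: i of_nat_nat)
    next
      case False
      then have "c = - of_nat (nat (- i))" by (simp add: i)
      then show ?thesis using neg[OF n[of "nat (- i)"]] by (simp cong: restrict_cong)
    qed
  qed
qed

sublocale base_change: tensor Fp FR base_field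
  by (intro tensor.intro scalars_prime_field tensor_axioms.intro)
    (auto simp: scalar_closed_def form_closed)

sublocale form_square: tensor Fp FR FR
  by (intro tensor.intro scalars_prime_field tensor_axioms.intro)
    (auto simp: scalar_closed_def form_closed)

lemma A_power [simp]: "f \<in> A \<Longrightarrow> (\<lambda>x\<in>X. f x ^ n) \<in> A"
proof (induction n)
  case (Suc n)
  show ?case using A_closed(3)[OF Suc.prems Suc.IH[OF Suc.prems]] by (simp cong: restrict_cong)
qed simp

lemma C_power: "f [^]\<^bsub>C\<^esub> (n :: nat) = (\<lambda>x\<in>X. f x ^ n)"
  by (induction n) (simp_all add: nat_pow_def mult.commute cong: restrict_cong)

lemma base_change_bilinear: "bilinear_over Fp FR base_field C (\<lambda>f a. a \<odot>\<^bsub>C\<^esub> f)"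
  by (intro bilinear_overI)
    (auto simp: form_A algebra_simps prime_field_def base_field_def intro!: restrict_ext)

text \<open>The power map fixes the prime field, so that
  \<open>f \<otimes> a \<mapsto> a f\<^sup>q\<close> is well defined on tensor products over the
  prime field.\<close>

lemma frobenius_bilinear: "bilinear_over Fp FR base_field C (\<lambda>f a. a \<odot>\<^bsub>C\<^esub> (f [^]\<^bsub>C\<^esub> q))"
  by (intro bilinear_overI)
    (auto simp: form_A algebra_simps base_field_def C_power frobenius_add frobenius_fix power_mult_distrib intro!: restrict_ext)

lemmas base_change_simps = base_change.tensor_lift_simps[OF C_vspace base_change_bilinear]
lemmas frobenius_lift_simps = base_change.tensor_lift_simps[OF C_vspace frobenius_bilinear]

text \<open>An expansion of a function in functions that are defined over the prime field. The
  Frobenius comorphism can be computed with any such expansion, because base change is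
  bijective.\<close>

definition form_rep :: "('g \<Rightarrow> 'k) \<Rightarrow> (('g \<Rightarrow> 'k) \<times> 'k) list \<Rightarrow> bool" where
  "form_rep h L \<longleftrightarrow> fst ` set L \<subseteq> FpG \<and> h = (\<lambda>x\<in>X. \<Sum>(f, a)\<leftarrow>L. a * f x)"

lemma tensor_of_list:
  assumes "fst ` set L \<subseteq> FpG"
  shows "\<exists>z\<in>carrier (tensor_product Fp FR base_field). base_change_map G z = (\<lambda>x\<in>X. \<Sum>(f, a)\<leftarrow>L. a * f x) \<and>
    tensor_lift C (\<lambda>f a. a \<odot>\<^bsub>C\<^esub> (f [^]\<^bsub>C\<^esub> q)) z = (\<lambda>x\<in>X. \<Sum>(f, a)\<leftarrow>L. a * f x ^ q)"
  using assms
proof (induction L)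
  case Nil
  show ?case
    using base_change_simps(5) frobenius_lift_simps(5) abelian_monoid.zero_closed[OF abelian_group.axioms(1)[OF module.axioms(2)[OF base_change.T_module]]]
    by (intro bexI[of _ "\<zero>\<^bsub>tensor_product Fp FR base_field\<^esub>"]) (simp_all add: base_change_map_def)
next
  case (Cons l L)
  obtain f a where l: "l = (f, a)" by (cases l)
  let ?T = "tensor_product Fp FR base_field" and ?p = "pure_tensor Fp FR base_field f a"
  obtain z where z: "z \<in> carrier ?T" "base_change_map G z = (\<lambda>x\<in>X. \<Sum>(f, a)\<leftarrow>L. a * f x)"
    "tensor_lift C (\<lambda>f a. a \<odot>\<^bsub>C\<^esub> (f [^]\<^bsub>C\<^esub> q)) z = (\<lambda>x\<in>X. \<Sum>(f, a)\<leftarrow>L. a * f x ^ q)"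
    using Cons by auto
  have p: "?p \<in> carrier ?T" and f: "f \<in> FpG" using Cons.prems base_change.pure_closed[of f a] by (auto simp: l)
  have "?p \<oplus>\<^bsub>?T\<^esub> z \<in> carrier ?T" using p z(1) by (rule abelian_monoid.a_closed[OF abelian_group.axioms(1)[OF module.axioms(2)[OF base_change.T_module]]])
  then show ?case
    using z f p base_change_simps(2)[OF p z(1)] base_change_simps(3)[of f a]
      frobenius_lift_simps(2)[OF p z(1)] frobenius_lift_simps(3)[of f a]
    by (intro bexI[of _ "?p \<oplus>\<^bsub>?T\<^esub> z"]) (simp_all add: base_change_map_def l C_power cong: restrict_cong)
qed

lemma frobenius_form_rep:
  assumes "form_rep h L"
  shows "\<phi> h = (\<lambda>x\<in>X. \<Sum>(f, a)\<leftarrow>L. a * f x ^ q)"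
proof -
  obtain z where z: "z \<in> carrier (tensor_product Fp FR base_field)" "base_change_map G z = h"
    "tensor_lift C (\<lambda>f a. a \<odot>\<^bsub>C\<^esub> (f [^]\<^bsub>C\<^esub> q)) z = (\<lambda>x\<in>X. \<Sum>(f, a)\<leftarrow>L. a * f x ^ q)"
    using tensor_of_list[of L] assms by (auto simp: form_rep_def)
  have "inv_into (carrier (tensor_product Fp FR base_field)) (base_change_map G) h = z"
    using inv_into_f_f[OF bij_betw_imp_inj_on[OF form_bij] z(1)] z(2) by simp
  then show ?thesis using z(3) by (simp only: frobenius_comorphism_def)
qed

lemma form_rep_exists:
  assumes "h \<in> A" obtains L where "form_rep h L"
proof -
  obtain z where z: "z \<in> carrier (tensor_product Fp FR base_field)" "base_change_map G z = h"
    using assms form_bij unfolding bij_betw_def by (metis (no_types, lifting) imageE)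
  from z(1) have "\<exists>L. form_rep (base_change_map G z) L"
  proof (induction rule: base_change.tensor_induct)
    case zero
    show ?case using base_change_simps(5) by (intro exI[of _ "[]"]) (simp add: form_rep_def base_change_map_def)
  next
    case (pure f a)
    then show ?case using base_change_simps(3)[of f a]
      by (intro exI[of _ "[(f, a)]"]) (simp add: form_rep_def base_change_map_def)
  next
    case (add u v)
    then obtain L L' where "form_rep (base_change_map G u) L" "form_rep (base_change_map G v) L'" by blast
    then show ?case using base_change_simps(2)[OF add(1,2)]
      by (intro exI[of _ "L @ L'"]) (auto simp: form_rep_def base_change_map_def intro!: restrict_ext)
  qed
  then show ?thesis using that z(2) by auto
qed

lemma form_rep_mem: "form_rep h L \<Longrightarrow> (f, a) \<in> set L \<Longrightarrow> f \<in> FpG"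
  by (auto simp: form_rep_def)

lemma phi_A [simp]:
  assumes "h \<in> A" shows "\<phi> h \<in> A"
proof -
  obtain L where L: "form_rep h L" using form_rep_exists[OF assms] .
  have "(\<lambda>x\<in>X. \<Sum>(f, a)\<leftarrow>K. a * f x ^ q) \<in> A" if "set K \<subseteq> set L" for K
    using that
  proof (induction K)
    case (Cons k K)
    obtain f a where k: "k = (f, a)" by (cases k)
    then have "f \<in> A" using Cons.prems form_rep_mem[OF L] form_A by auto
    then show ?case using A_closed(2)[OF A_closed(4)[OF A_power[of f q], of a] Cons.IH] Cons.prems
      by (simp add: k cong: restrict_cong)
  qed simp
  then show ?thesis by (simp only: frobenius_form_rep[OF L] subset_refl)
qed

lemma phi_form:
  assumes f: "f \<in> FpG" shows "\<phi> f = (\<lambda>x\<in>X. f x ^ q)"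
proof -
  have "form_rep f [(f, 1)]" using f A_restrict[OF form_A[OF f]] by (simp add: form_rep_def)
  then show ?thesis by (simp add: frobenius_form_rep)
qed

lemma phi_add:
  assumes "h \<in> A" "h' \<in> A"
  shows "\<phi> (\<lambda>x\<in>X. h x + h' x) = (\<lambda>x\<in>X. \<phi> h x + \<phi> h' x)"
proof -
  obtain L L' where L: "form_rep h L" and L': "form_rep h' L'" using form_rep_exists assms by metis
  have "form_rep (\<lambda>x\<in>X. h x + h' x) (L @ L')"
    using L L' by (auto simp: form_rep_def intro!: restrict_ext)
  then show ?thesis using L L' by (simp add: frobenius_form_rep cong: restrict_cong)
qed

lemma phi_smult:
  assumes "h \<in> A"
  shows "\<phi> (\<lambda>x\<in>X. c * h x) = (\<lambda>x\<in>X. c * \<phi> h x)"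
proof -
  obtain L where L: "form_rep h L" using form_rep_exists assms by metis
  have "form_rep (\<lambda>x\<in>X. c * h x) (map (\<lambda>(f, a). (f, c * a)) L)"
    using L by (auto simp: form_rep_def o_def split_def sum_list_const_mult mult.assoc intro!: restrict_ext)
  then show ?thesis using L
    by (simp add: frobenius_form_rep o_def split_def sum_list_const_mult mult.assoc cong: restrict_cong)
qed

lemma phi_linear: "\<phi> \<in> linear_maps C C"
  by (rule linear_mapsI) (simp_all add: phi_add phi_smult)

lemma phi_one: "\<phi> (\<lambda>x\<in>X. 1) = (\<lambda>x\<in>X. 1)"
  by (simp add: phi_form form_closed cong: restrict_cong)

lemma phi_mult:
  assumes "h \<in> A" "h' \<in> A"
  shows "\<phi> (\<lambda>x\<in>X. h x * h' x) = (\<lambda>x\<in>X. \<phi> h x * \<phi> h' x)"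
proof -
  obtain L L' where L: "form_rep h L" and L': "form_rep h' L'" using form_rep_exists assms by metis
  let ?P = "map (\<lambda>((f, a), (f', a')). (\<lambda>x\<in>X. f x * f' x, a * a')) (List.product L L')"
  have s: "(\<Sum>(f, a)\<leftarrow>?P. a * f x ^ n) = (\<Sum>(f, a)\<leftarrow>L. a * f x ^ n) * (\<Sum>(f, a)\<leftarrow>L'. a * f x ^ n)"
    if "x \<in> X" for x n
    using that unfolding sum_list_product[symmetric]
    by (auto simp: o_def split_def power_mult_distrib mult_ac intro!: arg_cong[of _ _ sum_list] map_cong)
  have "form_rep (\<lambda>x\<in>X. h x * h' x) ?P"
    unfolding form_rep_def
  proof
    show "fst ` set ?P \<subseteq> FpG" using form_rep_mem[OF L] form_rep_mem[OF L'] form_closed(3) by auto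
    show "(\<lambda>x\<in>X. h x * h' x) = (\<lambda>x\<in>X. \<Sum>(f, a)\<leftarrow>?P. a * f x)"
      using s[of _ 1] L L' by (simp add: form_rep_def cong: restrict_cong)
  qed
  then show ?thesis using L L' s[of _ q] by (simp add: frobenius_form_rep cong: restrict_cong)
qed

lemma phi_unit_value:
  assumes "h \<in> A" shows "\<phi> h \<one>\<^bsub>G\<^esub> = h \<one>\<^bsub>G\<^esub>"
proof -
  obtain L where L: "form_rep h L" using form_rep_exists assms by metis
  have "(\<Sum>(f, a)\<leftarrow>L. a * f \<one>\<^bsub>G\<^esub> ^ q) = (\<Sum>(f, a)\<leftarrow>L. a * f \<one>\<^bsub>G\<^esub>)"
    using form_rep_mem[OF L] by (auto simp: frobenius_fix form_one intro!: arg_cong[of _ _ sum_list] map_cong)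
  moreover have "h \<one>\<^bsub>G\<^esub> = (\<Sum>(f, a)\<leftarrow>L. a * f \<one>\<^bsub>G\<^esub>)" using L unfolding form_rep_def by simp
  ultimately show ?thesis by (simp add: frobenius_form_rep[OF L])
qed

lemma J_power: "f \<in> J (Suc 0) \<Longrightarrow> (\<lambda>x\<in>X. f x ^ n) \<in> J n"
proof (induction n)
  case (Suc n)
  show ?case using J_mult[OF Suc.prems Suc.IH[OF Suc.prems]] by (simp cong: restrict_cong)
qed simp

text \<open>A function defined over the prime field has its value at the identity in the prime field,
  which the power map fixes; hence \<open>f\<^sup>q - f(1) = (f - f(1))\<^sup>q\<close>, and
  functions that vanish at the identity are sent to functions that vanish there to order
  \<open>q\<close>.\<close>

lemma phi_J_1:
  assumes h: "h \<in> J (Suc 0)"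
  shows "\<phi> h \<in> J q"
proof -
  have hA: "h \<in> A" and h1: "h \<one>\<^bsub>G\<^esub> = 0" using h by (simp_all add: J_1_iff)
  obtain L where L: "form_rep h L" using form_rep_exists hA by metis
  have K: "(\<lambda>x\<in>X. (\<Sum>(f, a)\<leftarrow>K. a * f x ^ q) - (\<Sum>(f, a)\<leftarrow>K. a * f \<one>\<^bsub>G\<^esub> ^ q)) \<in> J q"
    if "set K \<subseteq> set L" for K
    using that
  proof (induction K)
    case Nil
    show ?case using J_closed(2) by simp
  next
    case (Cons k K)
    obtain f a where k: "k = (f, a)" by (cases k)
    then have f: "f \<in> A" using Cons.prems form_rep_mem[OF L] form_A by auto
    have "(\<lambda>x\<in>X. (f x - f \<one>\<^bsub>G\<^esub>) ^ q) = (\<lambda>x\<in>X. f x ^ q - f \<one>\<^bsub>G\<^esub> ^ q)"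
    proof (rule restrict_ext)
      fix x
      show "(f x - f \<one>\<^bsub>G\<^esub>) ^ q = f x ^ q - f \<one>\<^bsub>G\<^esub> ^ q"
        using frobenius_add[of "f x - f \<one>\<^bsub>G\<^esub>" "f \<one>\<^bsub>G\<^esub>"] by simp
    qed
    then have "(\<lambda>x\<in>X. f x ^ q - f \<one>\<^bsub>G\<^esub> ^ q) \<in> J q"
      using J_power[OF dev_in_J[OF f], of q] by (simp cong: restrict_cong)
    from J_closed(3)[OF J_smult[OF this, of a] Cons.IH] Cons.prems show ?case
      by (simp add: k algebra_simps cong: restrict_cong)
  qed
  have "(\<Sum>(f, a)\<leftarrow>L. a * f \<one>\<^bsub>G\<^esub> ^ q) = 0"
    using phi_unit_value[OF hA] h1 by (simp add: frobenius_form_rep[OF L])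
  then show ?thesis using K[of L] by (simp add: frobenius_form_rep[OF L])
qed

lemma phi_J: "h \<in> J n \<Longrightarrow> \<phi> h \<in> J (n * q)"
proof (induction n arbitrary: h)
  case (Suc n)
  from Suc.prems show ?case
  proof (induction rule: J_Suc_induct)
    case (mult a b)
    have "\<phi> (\<lambda>x\<in>X. a x * b x) = (\<lambda>x\<in>X. \<phi> a x * \<phi> b x)" using mult J_A by (intro phi_mult)
    moreover have "\<phi> b \<in> J q" using mult by (intro phi_J_1) (simp add: J_1_iff)
    ultimately show ?case using J_mult[OF Suc.IH[OF mult(1)], of "\<phi> b" q] by (simp add: add.commute)
  next
    case (add f g)
    then show ?case using phi_add[OF J_A[OF add(1)] J_A[OF add(2)]] J_closed(3)[OF add(3,4)] by simp
  qed
qed simp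

lemma form_comult_list:
  assumes "f \<in> FpG"
  obtains L where "set L \<subseteq> FpG \<times> FpG" "\<And>x y. x \<in> X \<Longrightarrow> y \<in> X \<Longrightarrow> f (x \<otimes>\<^bsub>G\<^esub> y) = (\<Sum>(a, b)\<leftarrow>L. a x * b y)"
proof -
  obtain Z where Z: "Z \<in> carrier (tensor_product Fp FR FR)"
    and f: "\<And>x y. x \<in> X \<Longrightarrow> y \<in> X \<Longrightarrow> tensor_value Z x y = f (x \<otimes>\<^bsub>G\<^esub> y)" by (rule form_comult[OF assms]) blast
  have b: "bilinear_over Fp FR FR base_field (\<lambda>a b. a x * b y)" if "x \<in> X" "y \<in> X" for x y
    using that by (intro bilinear_overI) (simp_all add: algebra_simps)
  note tl = form_square.tensor_lift_simps[OF vspace_base_field b]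
  from Z have "\<exists>L. set L \<subseteq> FpG \<times> FpG \<and> (\<forall>x\<in>X. \<forall>y\<in>X. tensor_value Z x y = (\<Sum>(a, b)\<leftarrow>L. a x * b y))"
  proof (induction rule: form_square.tensor_induct)
    case zero
    show ?case using tl(5) by (intro exI[of _ "[]"]) (simp add: tensor_value_def)
  next
    case (pure a b)
    then show ?case using tl(3)[of _ _ a b] by (intro exI[of _ "[(a, b)]"]) (simp add: tensor_value_def)
  next
    case (add u v)
    then obtain L L' where "set L \<subseteq> FpG \<times> FpG" "\<forall>x\<in>X. \<forall>y\<in>X. tensor_value u x y = (\<Sum>(a, b)\<leftarrow>L. a x * b y)"
      "set L' \<subseteq> FpG \<times> FpG" "\<forall>x\<in>X. \<forall>y\<in>X. tensor_value v x y = (\<Sum>(a, b)\<leftarrow>L'. a x * b y)" by blast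
    then show ?case using tl(2)[OF _ _ add(1,2)] by (intro exI[of _ "L @ L'"]) (simp add: tensor_value_def)
  qed
  then obtain L where L: "set L \<subseteq> FpG \<times> FpG" "\<forall>x\<in>X. \<forall>y\<in>X. tensor_value Z x y = (\<Sum>(a, b)\<leftarrow>L. a x * b y)"
    by blast
  show ?thesis by (rule that[OF L(1)]) (use L(2) f in auto)
qed

text \<open>The group law is defined over the prime field and the power map is additive and
  multiplicative.\<close>

lemma phi_comult:
  assumes "h \<in> A"
  obtains L where "rep (\<lambda>u v. h (u \<otimes>\<^bsub>G\<^esub> v)) L"
    "rep (\<lambda>u v. \<phi> h (u \<otimes>\<^bsub>G\<^esub> v)) (map (\<lambda>(a, b). (\<phi> a, \<phi> b)) L)"
proof -
  obtain K where K: "form_rep h K" using form_rep_exists[OF assms] .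
  have ex: "\<exists>L. rep (\<lambda>u v. \<Sum>(f, a)\<leftarrow>K. a * f (u \<otimes>\<^bsub>G\<^esub> v)) L \<and>
      rep (\<lambda>u v. \<Sum>(f, a)\<leftarrow>K. a * f (u \<otimes>\<^bsub>G\<^esub> v) ^ q) (map (\<lambda>(a, b). (\<phi> a, \<phi> b)) L)"
    if "fst ` set K \<subseteq> FpG" for K :: "(('g \<Rightarrow> 'k) \<times> 'k) list"
    using that
  proof (induction K)
    case Nil
    show ?case by (intro exI[of _ "[]"]) (simp add: rep_def)
  next
    case (Cons k K)
    obtain f c where k: "k = (f, c)" by (cases k)
    then have f: "f \<in> FpG" using Cons.prems by simp
    obtain L where L: "rep (\<lambda>u v. \<Sum>(f, a)\<leftarrow>K. a * f (u \<otimes>\<^bsub>G\<^esub> v)) L"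
      "rep (\<lambda>u v. \<Sum>(f, a)\<leftarrow>K. a * f (u \<otimes>\<^bsub>G\<^esub> v) ^ q) (map (\<lambda>(a, b). (\<phi> a, \<phi> b)) L)"
      using Cons by auto
    obtain M where M: "set M \<subseteq> FpG \<times> FpG" "\<And>x y. x \<in> X \<Longrightarrow> y \<in> X \<Longrightarrow> f (x \<otimes>\<^bsub>G\<^esub> y) = (\<Sum>(a, b)\<leftarrow>M. a x * b y)"
      by (rule form_comult_list[OF f]) blast
    have r1: "rep (\<lambda>u v. f (u \<otimes>\<^bsub>G\<^esub> v)) M" using M form_A by (auto simp: rep_def)
    have r2: "rep (\<lambda>u v. f (u \<otimes>\<^bsub>G\<^esub> v) ^ q) (map (\<lambda>(a, b). (\<phi> a, \<phi> b)) M)"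
      unfolding rep_def
    proof (intro conjI ballI)
      show "set (map (\<lambda>(a, b). (\<phi> a, \<phi> b)) M) \<subseteq> A \<times> A" using M(1) form_A by auto
      fix u v assume uv: "u \<in> X" "v \<in> X"
      show "f (u \<otimes>\<^bsub>G\<^esub> v) ^ q = (\<Sum>(a, b)\<leftarrow>map (\<lambda>(a, b). (\<phi> a, \<phi> b)) M. a u * b v)"
        unfolding M(2)[OF uv] frobenius_sum_list using M(1) uv
        by (auto simp: o_def split_def phi_form power_mult_distrib intro!: arg_cong[of _ _ sum_list] map_cong)
    qed
    have m: "map (\<lambda>(a, b). (\<phi> a, \<phi> b)) (map (\<lambda>(a, b). (\<lambda>x\<in>X. c * a x, b)) M)
        = map (\<lambda>(a, b). (\<lambda>x\<in>X. c * a x, b)) (map (\<lambda>(a, b). (\<phi> a, \<phi> b)) M)"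
      using M(1) form_A by (auto simp: phi_smult)
    show ?case
      using rep_add[OF rep_smult[OF r1, of c] L(1)] rep_add[OF rep_smult[OF r2, of c] L(2)]
      unfolding m[symmetric] map_append[symmetric] by (auto simp: k)
  qed
  have "fst ` set K \<subseteq> FpG" using K by (simp add: form_rep_def)
  from ex[OF this] obtain L where L: "rep (\<lambda>u v. \<Sum>(f, a)\<leftarrow>K. a * f (u \<otimes>\<^bsub>G\<^esub> v)) L"
      "rep (\<lambda>u v. \<Sum>(f, a)\<leftarrow>K. a * f (u \<otimes>\<^bsub>G\<^esub> v) ^ q) (map (\<lambda>(a, b). (\<phi> a, \<phi> b)) L)"
    by blast
  show ?thesis
  proof
    have h: "h x = (\<Sum>(f, a)\<leftarrow>K. a * f x)" "\<phi> h x = (\<Sum>(f, a)\<leftarrow>K. a * f x ^ q)" if "x \<in> X" for x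
      using K that by (simp add: form_rep_def, simp add: frobenius_form_rep[OF K])
    show "rep (\<lambda>u v. h (u \<otimes>\<^bsub>G\<^esub> v)) L" by (rule rep_cong[OF L(1)]) (simp add: h)
    show "rep (\<lambda>u v. \<phi> h (u \<otimes>\<^bsub>G\<^esub> v)) (map (\<lambda>(a, b). (\<phi> a, \<phi> b)) L)" by (rule rep_cong[OF L(2)]) (simp add: h)
  qed
qed

lemma phi_inversion:
  assumes "h \<in> A" shows "\<phi> (inversion h) = inversion (\<phi> h)"
proof -
  obtain L where L: "form_rep h L" using form_rep_exists[OF assms] .
  let ?L = "map (\<lambda>(f, a). (inversion f, a)) L"
  have s: "(\<Sum>(f, a)\<leftarrow>?L. a * f x ^ n) = (\<Sum>(f, a)\<leftarrow>L. a * f (inv\<^bsub>G\<^esub> x) ^ n)" if "x \<in> X" for x n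
    using that by (simp add: o_def split_def inversion_def)
  have h: "h y = (\<Sum>(f, a)\<leftarrow>L. a * f y)" "\<phi> h y = (\<Sum>(f, a)\<leftarrow>L. a * f y ^ q)" if "y \<in> X" for y
    using L that by (simp add: form_rep_def, simp add: frobenius_form_rep[OF L])
  have r: "form_rep (inversion h) ?L"
    unfolding form_rep_def
  proof
    show "fst ` set ?L \<subseteq> FpG" using form_rep_mem[OF L] form_inversion by auto
    show "inversion h = (\<lambda>x\<in>X. \<Sum>(f, a)\<leftarrow>?L. a * f x)"
      unfolding inversion_def[of h] using s[of _ 1] by (intro restrict_ext) (simp only: h inv_closed power_one_right)
  qed
  show ?thesis
    unfolding frobenius_form_rep[OF r] inversion_def[of "\<phi> h"]
    by (intro restrict_ext) (simp only: s h inv_closed)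
qed

subsection \<open>The map on distributions\<close>

abbreviation "\<Xi> \<equiv> Xi p G FpG s"

lemma Xi_apply: "\<Xi> \<mu> = (\<lambda>f\<in>A. \<mu> (\<phi> f))"
  by (simp add: Xi_def)

lemma Xi_linear_functional:
  assumes "\<mu> \<in> linear_maps C base_field" shows "\<Xi> \<mu> \<in> linear_maps C base_field"
  using linear_map_comp[OF phi_linear assms] by (auto simp: linear_maps_def Xi_apply)

text \<open>The transpose of a map that sends \<open>J (Suc j)\<close> into
  \<open>J (Suc j * q)\<close>.\<close>

lemma Xi_Dist:
  assumes mu: "\<mu> \<in> Dist G k" and k: "Suc k \<le> Suc j * q"
  shows "\<Xi> \<mu> \<in> Dist G j"
  unfolding Dist_iff
proof (intro conjI ballI)
  show "\<Xi> \<mu> \<in> linear_maps C base_field" using Xi_linear_functional DistD(1)[OF mu] .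
  show "\<Xi> \<mu> \<in> extensional A" by (simp add: Xi_apply)
  fix f assume "f \<in> J (Suc j)"
  then have "\<phi> f \<in> J (Suc k)" "f \<in> A" using phi_J[of f "Suc j"] J_antimono[OF k] J_A by auto
  then show "\<Xi> \<mu> f = 0" using DistD(3)[OF mu] by (simp add: Xi_apply)
qed

lemma Xi_Dist_div: "\<mu> \<in> Dist G i \<Longrightarrow> \<Xi> \<mu> \<in> Dist G (i div q)"
proof (rule Xi_Dist)
  have "i < q + i div q * q" using mod_less_divisor[OF q_pos, of i] div_mult_mod_eq[of i q] by linarith
  then show "Suc i \<le> Suc (i div q) * q" by (simp only: mult_Suc Suc_le_eq)
qed

lemma Xi_one_value: "\<Xi> \<mu> (\<lambda>x\<in>X. 1) = \<mu> (\<lambda>x\<in>X. 1)"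
  by (simp add: Xi_apply phi_one)

lemma Xi_unit: "\<Xi> (\<lambda>f\<in>A. f \<one>\<^bsub>G\<^esub>) = (\<lambda>f\<in>A. f \<one>\<^bsub>G\<^esub>)"
  by (simp add: Xi_apply phi_unit_value cong: restrict_cong)

lemma Xi_conv:
  assumes x: "x \<in> Dist G i" and y: "y \<in> Dist G j"
  shows "\<Xi> (x \<otimes>\<^bsub>D\<^esub> y) = \<Xi> x \<otimes>\<^bsub>D\<^esub> \<Xi> y"
proof (rule Dist_eqI)
  show "\<Xi> x \<otimes>\<^bsub>D\<^esub> \<Xi> y \<in> extensional A" by (rule conv_ext)
  fix f assume f: "f \<in> A"
  note lx = DistD(1)[OF x] and ly = DistD(1)[OF y]
  obtain L where L: "rep (\<lambda>u v. f (u \<otimes>\<^bsub>G\<^esub> v)) L"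
    "rep (\<lambda>u v. \<phi> f (u \<otimes>\<^bsub>G\<^esub> v)) (map (\<lambda>(a, b). (\<phi> a, \<phi> b)) L)" using phi_comult[OF f] .
  have "(\<Xi> x \<otimes>\<^bsub>D\<^esub> \<Xi> y) f = (\<Sum>(a, b)\<leftarrow>L. x (\<phi> a) * y (\<phi> b))"
    unfolding conv_apply[OF f L(1) Xi_linear_functional[OF lx] Xi_linear_functional[OF ly]]
    using rep_mem[OF L(1)] by (auto simp: Xi_apply intro!: arg_cong[of _ _ sum_list] map_cong)
  also have "\<dots> = (x \<otimes>\<^bsub>D\<^esub> y) (\<phi> f)"
    using conv_apply[OF phi_A[OF f] L(2) lx ly] by (simp add: o_def split_def)
  finally show "\<Xi> (x \<otimes>\<^bsub>D\<^esub> y) f = (\<Xi> x \<otimes>\<^bsub>D\<^esub> \<Xi> y) f" using f by (simp add: Xi_apply)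
qed (simp add: Xi_apply)

lemma Xi_antipode: "\<Xi> (Dist_antipode G x) = Dist_antipode G (\<Xi> x)"
  by (simp add: Xi_apply antipode_eq phi_inversion cong: restrict_cong)

lemma Xi_linear:
  assumes "Suc k \<le> Suc j * q" shows "\<Xi> \<in> linear_maps (DM k) (DM j)"
  by (rule linear_mapsI) (simp_all add: Xi_Dist[OF _ assms], simp_all add: Xi_apply cong: restrict_cong)

lemma Xi_comult:
  assumes mu: "\<mu> \<in> Dist G k" and k: "Suc k \<le> Suc j * q"
  shows "Dist_comult G j (\<Xi> \<mu>) = tensor_map (DM j) (DM j) \<Xi> \<Xi> (Dist_comult G k \<mu>)"
proof (rule Dist_comult_eqI)
  note l = Xi_linear[OF k] and d = Dist_comult_spec[OF mu]
  note t = tensor_map_linear[OF DM_vspace DM_vspace DM_vspace DM_vspace l l]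
  show "tensor_map (DM j) (DM j) \<Xi> \<Xi> (Dist_comult G k \<mu>) \<in> carrier (DM j \<otimes>\<^sub>k DM j)"
    by (rule linear_mapsD(1)[OF t(1) d(1)])
  fix f g assume fg: "f \<in> A" "g \<in> A"
  have "tensor_value (tensor_map (DM j) (DM j) \<Xi> \<Xi> (Dist_comult G k \<mu>)) f g
      = tensor_value (Dist_comult G k \<mu>) (\<phi> f) (\<phi> g)"
    by (rule tensor_ext[OF DM_vspace DM_vspace vspace_base_field linear_map_comp[OF t(1) tensor_value_linear[OF fg]]
          tensor_value_linear[OF phi_A phi_A] _ d(1)])
      (use fg in \<open>simp_all add: t(2) tensor_value_pure Xi_Dist[OF _ k]\<close>, simp add: Xi_apply)
  then show "tensor_value (tensor_map (DM j) (DM j) \<Xi> \<Xi> (Dist_comult G k \<mu>)) f g = \<Xi> \<mu> (\<lambda>x\<in>X. f x * g x)"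
    using fg d(2)[of "\<phi> f" "\<phi> g"] by (simp add: Xi_apply phi_mult)
qed

end

section \<open>The induced homomorphism\<close>

lemma opposite_algebra_hom:
  "f \<in> algebra_homs B B' \<Longrightarrow> f \<in> algebra_homs (opposite_algebra B) (opposite_algebra B')"
  using algebra_homsD[of f B B'] by (intro algebra_homsI) (simp_all add: linear_maps_def)

locale frobenius_levels = frobenius_form G FpG p s
  for G :: "('g, 'k::field) alg_group" and FpG p s +
  fixes r :: nat
begin

sublocale src: higher_enveloping G p "int r" by unfold_locales (rule p_pos)
sublocale tgt: higher_enveloping G p "int r - int s" by unfold_locales (rule p_pos)

text \<open>An equality for \<open>s \<le> r + 1\<close>. For larger \<open>s\<close> the target
  contains only distributions of order 0, and the bound says that
  \<open>p\<^sup>r\<^sup>+\<^sup>1 \<le> p\<^sup>s\<close>.\<close>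

lemma top_order_bound: "Suc src.N \<le> Suc tgt.N * q"
proof (cases "s \<le> Suc r")
  case True
  have "nat (int r - int s + 1) + s = nat (int r + 1)" using True by simp
  then have "Suc tgt.N * q = p ^ nat (int r + 1)" unfolding tgt.power_eq[symmetric] by (simp add: power_add[symmetric])
  then show ?thesis using src.power_eq by simp
next
  case False
  then have "p ^ nat (int r + 1) \<le> p ^ s" using p_pos by (intro power_increasing) auto
  then show ?thesis using src.power_eq by (simp add: order_trans)
qed

text \<open>Since \<open>i div q + j div q\<close> is at most \<open>(i + j) div q\<close>, dividing
  the orders by \<open>q\<close> turns the order conditions of the relations for \<open>r\<close>
  into those for \<open>r - s\<close>.\<close>

lemma order_div:
  "i \<le> src.N \<Longrightarrow> i div q \<le> tgt.N"
  "i + j \<le> src.N \<Longrightarrow> i div q + j div q \<le> tgt.N"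
  "i + j \<le> Suc src.N \<Longrightarrow> i div q + j div q \<le> Suc tgt.N"
proof -
  have d: "(i div q + j div q) * q \<le> i + j" for i j
    using add_mono[OF div_times_less_eq_dividend[of i q] div_times_less_eq_dividend[of j q]] by (simp add: distrib_right)
  have 2: "i div q + j div q \<le> tgt.N" if "i + j \<le> src.N" for i j
  proof -
    have "(i div q + j div q) * q < Suc tgt.N * q" using d[of i j] top_order_bound that by linarith
    then show ?thesis by (metis less_Suc_eq_le mult_less_cancel2)
  qed
  show "i \<le> src.N \<Longrightarrow> i div q \<le> tgt.N" using 2[of i 0] by simp
  show "i + j \<le> src.N \<Longrightarrow> i div q + j div q \<le> tgt.N" by (rule 2)
  assume "i + j \<le> Suc src.N"
  then have "(i div q + j div q) * q \<le> Suc tgt.N * q" using d[of i j] top_order_bound by linarith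
  then show "i div q + j div q \<le> Suc tgt.N" using q_pos by (metis mult_le_cancel2)
qed

lemma Xi_Dist_plus_div: "x \<in> Dist_plus G i \<Longrightarrow> \<Xi> x \<in> Dist_plus G (i div q)"
  by (simp add: Dist_plus_iff Xi_Dist_div Xi_one_value)

lemma Xi_Dist_plus_top: "x \<in> Dist_plus G src.N \<Longrightarrow> \<Xi> x \<in> Dist_plus G tgt.N"
  using Xi_Dist[OF _ top_order_bound] by (simp add: Dist_plus_iff Xi_one_value)

lemma Xi_bracket:
  assumes x: "x \<in> Dist G i" and y: "y \<in> Dist G j"
  shows "\<Xi> (src.bracket x y) = src.bracket (\<Xi> x) (\<Xi> y)"
proof (rule Dist_eqI)
  fix f assume f: "f \<in> A"
  have "(\<Xi> x \<otimes>\<^bsub>D\<^esub> \<Xi> y) f = (x \<otimes>\<^bsub>D\<^esub> y) (\<phi> f)" "(\<Xi> y \<otimes>\<^bsub>D\<^esub> \<Xi> x) f = (y \<otimes>\<^bsub>D\<^esub> x) (\<phi> f)"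
    unfolding Xi_conv[OF x y, symmetric] Xi_conv[OF y x, symmetric] using f by (simp_all add: Xi_apply)
  then show "\<Xi> (src.bracket x y) f = src.bracket (\<Xi> x) (\<Xi> y) f"
    using f by (simp only: src.bracket_def Xi_apply[of "restrict _ _"] restrict_apply' phi_A)
qed (simp_all add: Xi_apply src.bracket_def)

definition Upsilon where
  "Upsilon = quotient_lift (tensor_algebra_lift tgt.U (\<lambda>x. tgt.cls (\<Xi> x)))"

lemma Upsilon_hom: "Upsilon \<in> algebra_homs src.U tgt.U"
  and Upsilon_cls: "x \<in> Dist_plus G src.N \<Longrightarrow> Upsilon (src.cls x) = tgt.cls (\<Xi> x)"
proof -
  have lin: "\<Xi> \<in> linear_maps src.V tgt.V"
    using src.VM_linear[OF Xi_linear[OF top_order_bound]] Xi_Dist_plus_top by (auto simp: linear_maps_def)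
  have 1: "tgt.cls (\<Xi> x) \<otimes>\<^bsub>tgt.U\<^esub> tgt.cls (\<Xi> y) = tgt.cls (\<Xi> (x \<otimes>\<^bsub>D\<^esub> y))"
    if "x \<in> Dist_plus G i" "y \<in> Dist_plus G j" "i + j \<le> src.N" for x y i j
    using tgt.cls_mult[OF Xi_Dist_plus_div[OF that(1)] Xi_Dist_plus_div[OF that(2)] order_div(2)[OF that(3)]]
      Xi_conv[OF src.Dist_plus_D[OF that(1)] src.Dist_plus_D[OF that(2)]] by simp
  have 2: "(tgt.cls (\<Xi> x) \<otimes>\<^bsub>tgt.U\<^esub> tgt.cls (\<Xi> y)) \<ominus>\<^bsub>tgt.U\<^esub> (tgt.cls (\<Xi> y) \<otimes>\<^bsub>tgt.U\<^esub> tgt.cls (\<Xi> x))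
      = tgt.cls (\<Xi> (src.bracket x y))"
    if "x \<in> Dist_plus G i" "y \<in> Dist_plus G j" "i \<le> src.N" "j \<le> src.N" "i + j \<le> Suc src.N" for x y i j
    using tgt.cls_bracket[OF Xi_Dist_plus_div[OF that(1)] Xi_Dist_plus_div[OF that(2)]
        order_div(1)[OF that(3)] order_div(1)[OF that(4)] order_div(3)[OF that(5)]]
      Xi_bracket[OF src.Dist_plus_D[OF that(1)] src.Dist_plus_D[OF that(2)]] by simp
  note L = src.U_lift[OF tgt.U_alg linear_map_comp[OF lin tgt.cls_linear]]
  show "Upsilon \<in> algebra_homs src.U tgt.U"
    unfolding Upsilon_def by (rule L(1)) (rule 1 2; assumption)+
  show "Upsilon (src.cls x) = tgt.cls (\<Xi> x)" if "x \<in> Dist_plus G src.N"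
    unfolding Upsilon_def by (rule L(2)[OF _ _ that]) (rule 1 2; assumption)+
qed

lemmas Upsilon_linear = algebra_homsD(1)[OF Upsilon_hom]

lemma Upsilon_pi: "x \<in> Dist G src.N \<Longrightarrow> Upsilon (src.\<pi> x) = tgt.\<pi> (\<Xi> x)"
proof (rule src.linear_on_pi[OF tgt.U_vspace Upsilon_linear linear_map_comp[OF Xi_linear[OF top_order_bound] tgt.pi_linear]])
  show "Upsilon \<one>\<^bsub>src.U\<^esub> = tgt.\<pi> (\<Xi> (\<lambda>f\<in>A. f \<one>\<^bsub>G\<^esub>))"
    by (simp add: algebra_homsD(3)[OF Upsilon_hom] Xi_unit tgt.pi_unit)
qed (simp_all add: Upsilon_cls tgt.pi_cls Xi_Dist_plus_top)

text \<open>On classes this is the compatibility of \<open>\<Xi>\<close> with the comultiplication of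
  distributions; both sides are the image of the comultiplication of a distribution under
  \<open>\<pi> \<circ> \<Xi>\<close> in each slot.\<close>

lemma Upsilon_comult:
  assumes u: "u \<in> carrier src.U"
  shows "tgt.comult_U (Upsilon u) = tensor_map tgt.U tgt.U Upsilon Upsilon (src.comult_U u)"
proof (rule src.U_hom_eq[OF tgt.UU_alg algebra_hom_comp[OF Upsilon_hom tgt.comult_U_hom]
      algebra_hom_comp[OF src.comult_U_hom tensor_map_algebra_hom[OF src.U_alg src.U_alg tgt.U_alg tgt.U_alg Upsilon_hom Upsilon_hom]] _ u])
  fix x assume x: "x \<in> Dist_plus G src.N"
  note xD = src.Dist_plus_D[OF x] and Xl = Xi_linear[OF top_order_bound]
  note d = Dist_comult_spec(1)[OF xD]
  have "tgt.comult_U (Upsilon (src.cls x)) = tgt.\<pi>\<pi> (tensor_map (DM tgt.N) (DM tgt.N) \<Xi> \<Xi> (Dist_comult G src.N x))"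
    by (simp only: Upsilon_cls[OF x] tgt.comult_U_cls[OF Xi_Dist_plus_top[OF x]] Xi_comult[OF xD top_order_bound])
  also have "\<dots> = tensor_map tgt.U tgt.U (\<lambda>x. tgt.\<pi> (\<Xi> x)) (\<lambda>x. tgt.\<pi> (\<Xi> x)) (Dist_comult G src.N x)"
    by (rule tensor_map_compose[OF DM_vspace DM_vspace DM_vspace DM_vspace tgt.U_vspace tgt.U_vspace Xl Xl
          tgt.pi_linear tgt.pi_linear linear_map_comp[OF Xl tgt.pi_linear] linear_map_comp[OF Xl tgt.pi_linear] _ _ d]) (rule refl)+
  also have "\<dots> = tensor_map tgt.U tgt.U Upsilon Upsilon (src.\<pi>\<pi> (Dist_comult G src.N x))"
    by (rule tensor_map_compose[OF DM_vspace DM_vspace src.U_vspace src.U_vspace tgt.U_vspace tgt.U_vspace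
          src.pi_linear src.pi_linear Upsilon_linear Upsilon_linear
          linear_map_comp[OF Xl tgt.pi_linear] linear_map_comp[OF Xl tgt.pi_linear] _ _ d, symmetric])
      (simp_all add: Upsilon_pi)
  finally show "tgt.comult_U (Upsilon (src.cls x)) = tensor_map tgt.U tgt.U Upsilon Upsilon (src.comult_U (src.cls x))"
    by (simp only: src.comult_U_cls[OF x])
qed

lemma Upsilon_counit: "u \<in> carrier src.U \<Longrightarrow> tgt.counit_U (Upsilon u) = src.counit_U u"
  by (rule src.U_hom_eq[OF k_algebra_base_field algebra_hom_comp[OF Upsilon_hom tgt.counit_U_hom] src.counit_U_hom])
    (simp_all add: Upsilon_cls src.counit_U_cls tgt.counit_U_cls Xi_Dist_plus_top)

lemma Upsilon_antipode: "u \<in> carrier src.U \<Longrightarrow> tgt.antipode_U (Upsilon u) = Upsilon (src.antipode_U u)"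
  by (rule src.U_hom_eq[OF k_algebra_opposite[OF tgt.U_alg] algebra_hom_comp[OF Upsilon_hom tgt.antipode_U_hom]
        algebra_hom_comp[OF src.antipode_U_hom opposite_algebra_hom[OF Upsilon_hom]]])
    (simp_all add: Upsilon_cls src.antipode_U_cls tgt.antipode_U_cls Xi_Dist_plus_top antipode_Dist_plus Xi_antipode)

lemma Upsilon_hopf_hom: "hopf_algebra_hom src.H tgt.H Upsilon"
proof -
  have "algebra_homs src.H tgt.H = algebra_homs src.U tgt.U"
    unfolding algebra_homs_def ring_hom_def linear_maps_def by (simp add: src.U_hopf_fields tgt.U_hopf_fields)
  then show ?thesis
    unfolding hopf_algebra_hom_def
    by (simp add: src.U_hopf_algebra tgt.U_hopf_algebra Upsilon_hom src.U_hopf_fields src.U_hopf_simps tgt.U_hopf_simps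
        tgt.U_hopf_maps Upsilon_comult Upsilon_counit Upsilon_antipode)
qed

lemma Upsilon_induced: "induced_by \<Xi> p G (int r) (int r - int s) Upsilon"
  by (simp add: induced_by_def Upsilon_hom Upsilon_cls)

lemma Upsilon_unique:
  assumes "induced_by \<Xi> p G (int r) (int r - int s) f" "u \<in> carrier src.U"
  shows "f u = Upsilon u"
proof (rule src.U_hom_eq[OF tgt.U_alg _ Upsilon_hom _ assms(2)])
  show "f \<in> algebra_homs src.U tgt.U" using assms(1) by (simp only: induced_by_def)
  show "f (src.cls x) = Upsilon (src.cls x)" if "x \<in> Dist_plus G src.N" for x
    using assms(1) that Upsilon_cls[OF that] by (simp only: induced_by_def)
qed

end

theorem proposition4p1p1:
  fixes G :: "('g, 'k::alg_closed_field) alg_group"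
    and FpG :: "('g \<Rightarrow> 'k) set"
    and p r s :: nat
  assumes "CHAR('k) = p" and "p > 0"
    and "reductive_group G"
    and "prime_field_form G FpG"
  shows "Xi p G FpG s ` Dist_plus G (top_order p (int r))
           \<subseteq> Dist_plus G (top_order p (int r - int s)) \<and>
         (\<exists>\<Upsilon>. induced_by (Xi p G FpG s) p G (int r) (int r - int s) \<Upsilon> \<and>
              hopf_algebra_hom (U_hopf p G (int r)) (U_hopf p G (int r - int s)) \<Upsilon> \<and>
              (\<forall>\<Upsilon>'. induced_by (Xi p G FpG s) p G (int r) (int r - int s) \<Upsilon>' \<longrightarrow>
                    (\<forall>u\<in>carrier (U_algebra p G (int r)). \<Upsilon>' u = \<Upsilon> u)))"
proof -
  interpret frobenius_levels G FpG p s r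
    using assms by unfold_locales (simp_all add: reductive_group_def)
  show ?thesis
  proof (intro conjI exI allI impI ballI)
    show "Xi p G FpG s ` Dist_plus G src.N \<subseteq> Dist_plus G tgt.N"
      by (intro image_subsetI) (rule Xi_Dist_plus_top)
    show "induced_by (Xi p G FpG s) p G (int r) (int r - int s) Upsilon" by (rule Upsilon_induced)
    show "hopf_algebra_hom src.H tgt.H Upsilon" by (rule Upsilon_hopf_hom)
    show "f u = Upsilon u"
      if "induced_by (Xi p G FpG s) p G (int r) (int r - int s) f" "u \<in> carrier src.U" for f u
      using that by (rule Upsilon_unique)
  qed
qed

end
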